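(* Fix $\delta\in(0,1]$ and assume $\eta(\varepsilon)\to0$ as $\varepsilon\to0$. Let $u_\varepsilon$ be the weak solution of the $\varepsilon$-problem with coefficient $b_{\varepsilon,\delta}$ and $v_\varepsilon=b_{\varepsilon,\delta}u_\varepsilon$. Then, as $\varepsilon\to0$, $v_\varepsilon\to v_0$ strongly in $L^2(\Omega_T)$ and $\nabla v_\varepsilon\rightharpoonup\nabla v_0$ weakly in $L^2(\Omega_T)$, where $v_0$ is the unique weak solution of $$\mathcal M_{\mathcal Y}(b^{-1})\,\partial_tv_0-\Delta v_0=f\text{ in }\Omega_T,\quad\partial_\nu v_0=0\text{ on }\partial\Omega\times(0,T),\quad v_0(\cdot,0)=\frac{\bar u}{\mathcal M_{\mathcal Y}(b^{-1})}\text{ in }\Omega;$$ in particular $v_0$ does not depend on $\delta$.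
   Context: Let $n\ge2$, $\Omega\subset\mathbb R^n$ a smooth bounded open set, $T>0$, $\Omega_T=\Omega\times(0,T)$. Let $\mathcal Y=(-1/2,1/2)^n$, $\Xi_\varepsilon=\{\xi\in\mathbb Z^n:\varepsilon(\xi+\mathcal Y)\subset\Omega\}$, $B\subset\subset\mathcal Y$ a connected regular open set, $\eta=\eta(\varepsilon)\in(0,1]$, $\Omega^1_\varepsilon=\bigcup_{\xi\in\Xi_\varepsilon}\varepsilon(\xi+\eta B)$, $\Omega^2_\varepsilon=\Omega\setminus\overline{\Omega^1_\varepsilon}$ (assumed smooth). Let $b$ be a Carathéodory function in $L^\infty(\Omega\times\mathcal Y)$, $\mathcal Y$-periodic in the second variable, with $b\ge C>0$; $b_\varepsilon(x)=b(x,x/\varepsilon)$; $b_{\varepsilon,\delta}=\delta b_\varepsilon$ on $\Omega^1_\varepsilon$, $b_{\varepsilon,\delta}=b_\varepsilon$ on $\Omega^2_\varepsilon$; $\mathcal M_{\mathcal Y}(b^{-1})(x)=\int_{\mathcal Y}b(x,y)^{-1}dy$. Let $f\in L^2(\Omega_T)$, $\bar u\in L^2(\Omega)$. The $\varepsilon$-problem: $\partial_tu-\Delta(b_{\varepsilon,\delta}u)=f$ in $\Omega_T$, $\partial_\nu(b_{\varepsilon,\delta}u)=0$ on $\partial\Omega\times(0,T)$, $u(\cdot,0)=\bar u$; a weak solution is $u\in H^1(t_0,T;L^2(\Omega))\cap C([0,T];L^2(\Omega))$ for all $t_0>0$ with $b_{\varepsilon,\delta}u\in L^2(0,T;H^1(\Omega))$,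 $\int_{\Omega_T}[\partial_tu\varphi+\nabla(b_{\varepsilon,\delta}u)\cdot\nabla\varphi]=\int_{\Omega_T}f\varphi$ for all $\varphi\in L^2(0,T;H^1(\Omega))$ supported away from $t=0$, and $u(0)=\bar u$ in $L^2$. *)

theory Defs
  imports "HOL-Analysis.Analysis"
begin

text \<open>k times continuously (Frechet) differentiable real-valued functions on a set S
  (intended for open S), and C-infinity functions.\<close>
fun Ck_on :: "nat \<Rightarrow> 'a::real_normed_vector set \<Rightarrow> ('a \<Rightarrow> real) \<Rightarrow> bool" where
  "Ck_on 0 S f = continuous_on S f"
| "Ck_on (Suc k) S f =
     ((\<forall>x\<in>S. f differentiable (at x)) \<and>
      (\<forall>v. Ck_on k S (\<lambda>x. frechet_derivative f (at x) v)))"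

definition smooth_fun :: "'a::real_normed_vector set \<Rightarrow> ('a \<Rightarrow> real) \<Rightarrow> bool" where
  "smooth_fun S f \<longleftrightarrow> (\<forall>k. Ck_on k S f)"

definition smooth_domain :: "'a::euclidean_space set \<Rightarrow> bool" where
  "smooth_domain S \<longleftrightarrow> open S \<and> bounded S \<and>
    (\<forall>p\<in>frontier S. \<exists>r>0. \<exists>\<psi>. smooth_fun (ball p r) \<psi> \<and>
        (\<forall>x\<in>ball p r. x \<in> S \<longleftrightarrow> \<psi> x < 0) \<and>
        (\<forall>x\<in>ball p r. \<psi> x = 0 \<longrightarrow> frechet_derivative \<psi> (at x) \<noteq> (\<lambda>_. 0)))"

definition L2 :: "'a::euclidean_space set \<Rightarrow> ('a \<Rightarrow> real) \<Rightarrow> bool" where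
  "L2 A f \<longleftrightarrow> set_borel_measurable lebesgue A f \<and>
              set_integrable lebesgue A (\<lambda>z. (f z)^2)"

definition L2v :: "'a::euclidean_space set \<Rightarrow> ('a \<Rightarrow> 'b::euclidean_space) \<Rightarrow> bool" where
  "L2v A G \<longleftrightarrow> set_borel_measurable lebesgue A G \<and>
               set_integrable lebesgue A (\<lambda>z. (norm (G z))^2)"

definition test_fun :: "'a::euclidean_space set \<Rightarrow> ('a \<Rightarrow> real) \<Rightarrow> bool" where
  "test_fun U \<phi> \<longleftrightarrow> smooth_fun UNIV \<phi> \<and> compact (closure {z. \<phi> z \<noteq> 0}) \<and>
                    closure {z. \<phi> z \<noteq> 0} \<subseteq> U"

definition dx :: "'n::finite \<Rightarrow> ((real^'n) \<times> real \<Rightarrow> real) \<Rightarrow> (real^'n) \<times> real \<Rightarrow> real" where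
  "dx i \<phi> z = frechet_derivative \<phi> (at z) (axis i 1, 0)"

definition dt :: "((real^'n::finite) \<times> real \<Rightarrow> real) \<Rightarrow> (real^'n) \<times> real \<Rightarrow> real" where
  "dt \<phi> z = frechet_derivative \<phi> (at z) (0, 1)"

abbreviation OmT :: "(real^'n::finite) set \<Rightarrow> real \<Rightarrow> ((real^'n) \<times> real) set" where
  "OmT \<Omega> T \<equiv> \<Omega> \<times> {0<..<T}"

text \<open>G is the (L^2) weak spatial gradient of v on Omega_T, i.e. v in L^2(0,T;H^1(Omega))
  has spatial gradient G (together with L2 of v).\<close>
definition spatial_grad :: "(real^'n::finite) set \<Rightarrow> real \<Rightarrow> ((real^'n) \<times> real \<Rightarrow> real)
    \<Rightarrow> ((real^'n) \<times> real \<Rightarrow> real^'n) \<Rightarrow> bool" where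
  "spatial_grad \<Omega> T v G \<longleftrightarrow> L2 (OmT \<Omega> T) v \<and> L2v (OmT \<Omega> T) G \<and>
     (\<forall>\<phi> i. test_fun (OmT \<Omega> T) \<phi> \<longrightarrow>
        set_lebesgue_integral lebesgue (OmT \<Omega> T) (\<lambda>z. v z * dx i \<phi> z) =
        - set_lebesgue_integral lebesgue (OmT \<Omega> T) (\<lambda>z. (G z $ i) * \<phi> z))"

text \<open>w is the weak time derivative of u on Omega_T, with u, w in L^2(Omega x (t0,T))
  for all t0 > 0 (i.e. u in H^1(t0,T;L^2(Omega)) for all t0>0).\<close>
definition time_deriv_loc :: "(real^'n::finite) set \<Rightarrow> real \<Rightarrow> ((real^'n) \<times> real \<Rightarrow> real)
    \<Rightarrow> ((real^'n) \<times> real \<Rightarrow> real) \<Rightarrow> bool" where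
  "time_deriv_loc \<Omega> T u w \<longleftrightarrow>
     (\<forall>t0. 0 < t0 \<and> t0 < T \<longrightarrow> L2 (\<Omega> \<times> {t0<..<T}) u \<and> L2 (\<Omega> \<times> {t0<..<T}) w) \<and>
     (\<forall>\<phi>. test_fun (OmT \<Omega> T) \<phi> \<longrightarrow>
        set_lebesgue_integral lebesgue (OmT \<Omega> T) (\<lambda>z. u z * dt \<phi> z) =
        - set_lebesgue_integral lebesgue (OmT \<Omega> T) (\<lambda>z. w z * \<phi> z))"

definition C0L2 :: "(real^'n::finite) set \<Rightarrow> real \<Rightarrow> ((real^'n) \<times> real \<Rightarrow> real) \<Rightarrow> bool" where
  "C0L2 \<Omega> T u \<longleftrightarrow> (\<forall>t\<in>{0..T}. L2 \<Omega> (\<lambda>x. u (x, t))) \<and>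
     (\<forall>t\<in>{0..T}. ((\<lambda>s. set_lebesgue_integral lebesgue \<Omega> (\<lambda>x. (u (x, s) - u (x, t))^2))
                    \<longlongrightarrow> 0) (at t within {0..T}))"

text \<open>Weak solution of  m d_t u - Delta(a u) = f  in Omega_T,
  d_nu (a u) = 0 on the lateral boundary, u(.,0) = u0.\<close>
definition weak_sol :: "(real^'n::finite) set \<Rightarrow> real \<Rightarrow> (real^'n \<Rightarrow> real) \<Rightarrow> (real^'n \<Rightarrow> real)
    \<Rightarrow> ((real^'n) \<times> real \<Rightarrow> real) \<Rightarrow> (real^'n \<Rightarrow> real) \<Rightarrow> ((real^'n) \<times> real \<Rightarrow> real) \<Rightarrow> bool" where
  "weak_sol \<Omega> T m a f u0 u \<longleftrightarrow>
     (\<exists>w G. time_deriv_loc \<Omega> T u w \<and> C0L2 \<Omega> T u \<and>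
        (AE x in lebesgue. x \<in> \<Omega> \<longrightarrow> u (x, 0) = u0 x) \<and>
        spatial_grad \<Omega> T (\<lambda>z. a (fst z) * u z) G \<and>
        (\<forall>\<phi> G\<phi> t0. spatial_grad \<Omega> T \<phi> G\<phi> \<and> 0 < t0 \<and>
              (\<forall>z\<in>OmT \<Omega> T. snd z < t0 \<longrightarrow> \<phi> z = 0) \<longrightarrow>
           set_lebesgue_integral lebesgue (OmT \<Omega> T)
              (\<lambda>z. m (fst z) * w z * \<phi> z + G z \<bullet> G\<phi> z) =
           set_lebesgue_integral lebesgue (OmT \<Omega> T) (\<lambda>z. f z * \<phi> z)))"

definition Ycell :: "(real^'n::finite) set" where
  "Ycell = {y. \<forall>i. - 1/2 < y $ i \<and> y $ i < 1/2}"

definition int_vec :: "real^'n::finite \<Rightarrow> bool" where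
  "int_vec \<xi> \<longleftrightarrow> (\<forall>i. \<xi> $ i \<in> \<int>)"

definition Xi :: "(real^'n::finite) set \<Rightarrow> real \<Rightarrow> (real^'n) set" where
  "Xi \<Omega> \<epsilon> = {\<xi>. int_vec \<xi> \<and> (\<lambda>y. \<epsilon> *\<^sub>R (\<xi> + y)) ` Ycell \<subseteq> \<Omega>}"

definition Omega1 :: "(real^'n::finite) set \<Rightarrow> (real^'n) set \<Rightarrow> real \<Rightarrow> real \<Rightarrow> (real^'n) set" where
  "Omega1 \<Omega> B \<eta> \<epsilon> = (\<Union>\<xi>\<in>Xi \<Omega> \<epsilon>. (\<lambda>y. \<epsilon> *\<^sub>R (\<xi> + \<eta> *\<^sub>R y)) ` B)"

definition Omega2 :: "(real^'n::finite) set \<Rightarrow> (real^'n) set \<Rightarrow> real \<Rightarrow> real \<Rightarrow> (real^'n) set" where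
  "Omega2 \<Omega> B \<eta> \<epsilon> = \<Omega> - closure (Omega1 \<Omega> B \<eta> \<epsilon>)"

definition b_eps :: "(real^'n::finite \<Rightarrow> real^'n \<Rightarrow> real) \<Rightarrow> real \<Rightarrow> real^'n \<Rightarrow> real" where
  "b_eps b \<epsilon> x = b x ((1 / \<epsilon>) *\<^sub>R x)"

definition b_eps_delta :: "(real^'n::finite \<Rightarrow> real^'n \<Rightarrow> real) \<Rightarrow> (real^'n) set \<Rightarrow> (real^'n) set
    \<Rightarrow> real \<Rightarrow> real \<Rightarrow> real \<Rightarrow> real^'n \<Rightarrow> real" where
  "b_eps_delta b \<Omega> B \<eta> \<epsilon> \<delta> x =
     (if x \<in> Omega1 \<Omega> B \<eta> \<epsilon> then \<delta> * b_eps b \<epsilon> x else b_eps b \<epsilon> x)"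

definition MY_inv :: "(real^'n::finite \<Rightarrow> real^'n \<Rightarrow> real) \<Rightarrow> real^'n \<Rightarrow> real" where
  "MY_inv b x = set_lebesgue_integral lebesgue Ycell (\<lambda>y. 1 / b x y)"

definition admissible_coeff :: "(real^'n::finite) set \<Rightarrow> (real^'n \<Rightarrow> real^'n \<Rightarrow> real) \<Rightarrow> bool" where
  "admissible_coeff \<Omega> b \<longleftrightarrow>
     (\<forall>y. set_borel_measurable lebesgue \<Omega> (\<lambda>x. b x y)) \<and>
     (AE x in lebesgue. x \<in> \<Omega> \<longrightarrow> continuous_on UNIV (b x)) \<and>
     (\<exists>M. AE x in lebesgue. x \<in> \<Omega> \<longrightarrow> (\<forall>y. \<bar>b x y\<bar> \<le> M)) \<and>
     (AE x in lebesgue. x \<in> \<Omega> \<longrightarrow> (\<forall>y k. int_vec k \<longrightarrow> b x (y + k) = b x y)) \<and>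
     (\<exists>C>0. AE x in lebesgue. x \<in> \<Omega> \<longrightarrow> (\<forall>y. C \<le> b x y))"

end

(*
  Put beta = 1 / b_eps_delta, so that v = b_eps_delta u solves d_t (beta v) - Laplace v = f. Testing with
  backward time integrals of test functions (Duhamel) and with v itself bounds v, grad v and sqrt(t) d_t (beta v)
  in L^2 uniformly in epsilon. Since beta oscillates periodically, up to the inclusions, whose measure is at most
  eta^n |Omega| and tends to 0, the integral of (beta - M(1/b)) p v tends to 0 uniformly for v bounded in
  L^2(0,T;H^1); no compactness theorem is needed for this, only translation estimates. Mazur's lemma applied to
  the triples (v, grad v, sqrt(t) d_t (beta v)) therefore yields a solution of the limit problem, and comparing
  v with it gives  int beta (v - v0)^2 <= int (M(1/b) - beta) v0 (v - v0) -> 0, which is the strong convergence;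
  the same inequality with equal coefficients gives uniqueness.
*)
theory Submission
  imports Defs
begin

text \<open>The weak formulation admits only test functions vanishing near t = 0, and for a datum in
  L^2 the time derivative is controlled only with the weight sqrt(t). The datum is therefore brought
  in through an identity free of time derivatives: testing with a backward integral cut off near t =
  0 and integrating by parts leaves only \<beta> v, grad v and the datum. Such an identity survives
  weak limits, but it does not by itself show that the limit takes its datum strongly; that needs an
  energy argument near t = 0. The averaging rests on a finite symmetry. On a grid with N^n subcells
  per period, the indicator of one class of subcells sums to 1 over its N^n translates by grid
  nodes, so its deviation from the mean is an average of differences of translates, and a shift of
  size epsilon costs only epsilon times the gradient. On the inclusions 1/b is multiplied by 1 + d
  with d = 1/\<delta> - 1, a bounded factor on a set of vanishing measure, which is why the limit
  does not see \<delta>.\<close>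

abbreviation (input) borelm :: "('a::topological_space => 'b::topological_space) set" where
  "borelm == borel_measurable borel"

abbreviation (input) ind :: "'a set => 'a => real" where
  "ind == indicator"

abbreviation (input) limseq (infixr "~~>" 60) where
  "X ~~> L == X \<longlonglongrightarrow> L"

abbreviation (input) sint :: "'a::euclidean_space set => ('a => 'b) => 'b::{banach,second_countable_topology}" where
  "sint == set_lebesgue_integral lebesgue"

lemmas integrable_add = Bochner_Integration.integrable_add
lemmas integrable_bound = Bochner_Integration.integrable_bound
lemmas integrable_diff = Bochner_Integration.integrable_diff
lemmas integral_add = Bochner_Integration.integral_add
lemmas integral_cong = Bochner_Integration.integral_cong
lemmas integral_diff = Bochner_Integration.integral_diff
lemmas integral_minus = Bochner_Integration.integral_minus
lemmas integral_sum = Bochner_Integration.integral_sum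

subsection \<open>Smooth functions\<close>

lemma Ck_on_SucD: "Ck_on (Suc k) UNIV f ==> Ck_on k UNIV f"
proof (induction k arbitrary: f)
 case 0
 then show ?case by (auto intro!: continuous_at_imp_continuous_on differentiable_imp_continuous_within)
next
 case (Suc k)
 show ?case unfolding Ck_on.simps(2)
 proof (intro conjI allI)
  show "\<forall>x\<in>UNIV. f differentiable at x" using Suc.prems by simp
  fix v
  have "Ck_on (Suc k) UNIV (%x. frechet_derivative f (at x) v)" using Suc.prems unfolding Ck_on.simps(2)[of "Suc k"] by blast
  from Suc.IH[OF this] show "Ck_on k UNIV (%x. frechet_derivative f (at x) v)" .
 qed
qed

text \<open>\<open>frechet_derivative\<close> is a choice operator; by uniqueness any derivative
  that can be exhibited may stand in for it.\<close>

lemma Ck_on_SucI: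
 assumes "!!x. (f has_derivative f' x) (at x)" "!!v. Ck_on k UNIV (%x. f' x v)"
 shows "Ck_on (Suc k) UNIV f"
proof -
 have "frechet_derivative f (at x) = f' x" for x using frechet_derivative_at[OF assms(1)] by simp
 then show ?thesis using assms unfolding Ck_on.simps(2) by (auto simp: differentiable_def)
qed

lemma Ck_on_Suc_has_derivative:
 "Ck_on (Suc k) UNIV f ==> (f has_derivative frechet_derivative f (at x)) (at x)" using frechet_derivative_works unfolding Ck_on.simps(2) by blast

lemma Ck_on_Suc_deriv:
 "Ck_on (Suc k) UNIV f ==> Ck_on k UNIV (%x. frechet_derivative f (at x) v)" unfolding Ck_on.simps(2) by blast

lemmas Ck_on_SucD2 = Ck_on_Suc_has_derivative Ck_on_Suc_deriv

lemma Ck_on_const: "Ck_on k UNIV (%x. c)"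
proof (induction k arbitrary: c)
 case (Suc k)
 show ?case by (rule Ck_on_SucI[where f' = "%_ _. 0"]) (use Suc in auto)
qed auto

lemma Ck_on_linear: "bounded_linear f ==> Ck_on k UNIV f"
proof (induction k)
 case 0
 then show ?case by (auto intro: linear_continuous_on)
next
 case (Suc k)
 show ?case by (rule Ck_on_SucI[where f' = "%_. f"])
   (use Suc in \<open>auto intro: bounded_linear_imp_has_derivative Ck_on_const\<close>)
qed

lemma Ck_on_add: "Ck_on k UNIV f ==> Ck_on k UNIV g ==> Ck_on k UNIV (%x. f x + g x)"
proof (induction k arbitrary: f g)
 case 0
 then show ?case by (auto intro: continuous_on_add)
next
 case (Suc k)
 show ?case by (intro Ck_on_SucI[where f' = "%x v. frechet_derivative f (at x) v + frechet_derivative g (at x) v"]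
    has_derivative_add Suc.IH Ck_on_Suc_has_derivative[OF Suc.prems(1)] Ck_on_Suc_has_derivative[OF Suc.prems(2)]
    Ck_on_Suc_deriv[OF Suc.prems(1)] Ck_on_Suc_deriv[OF Suc.prems(2)])
qed

lemma Ck_on_mult: "Ck_on k UNIV f ==> Ck_on k UNIV g ==> Ck_on k UNIV (%x. f x * g x)"
proof (induction k arbitrary: f g)
 case 0
 then show ?case by (auto intro: continuous_on_mult)
next
 case (Suc k)
 note f = Ck_on_SucD2[OF Suc.prems(1)] and g = Ck_on_SucD2[OF Suc.prems(2)]
 show ?case
 proof (rule Ck_on_SucI[where f' = "%x v. f x * frechet_derivative g (at x) v + frechet_derivative f (at x) v * g x"])
  show "((%x. f x * g x) has_derivative (%v. f x * frechet_derivative g (at x) v + frechet_derivative f (at x) v * g x)) (at x)" for x by (intro has_derivative_mult f(1) g(1))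
  show "Ck_on k UNIV (%x. f x * frechet_derivative g (at x) v + frechet_derivative f (at x) v * g x)" for v by (intro Ck_on_add Suc.IH f(2) g(2) Ck_on_SucD[OF Suc.prems(1)] Ck_on_SucD[OF Suc.prems(2)])
 qed
qed

lemma Ck_on_affine:
 assumes "bounded_linear L"
 shows "Ck_on k UNIV f ==> Ck_on k UNIV (%x. f (L x + c))"
proof (induction k arbitrary: f)
 case 0
 have "continuous_on UNIV L" using assms by (rule linear_continuous_on)
 with 0 show ?case by (auto intro!: continuous_on_compose2[of UNIV f] continuous_intros)
next
 case (Suc k)
 note f = Ck_on_SucD2[OF Suc.prems(1)]
 show ?case
 proof (rule Ck_on_SucI[where f' = "%x v. frechet_derivative f (at (L x + c)) (L v)"])
  fix x
  have 1: "((%x. L x + c) has_derivative L) (at x)" using bounded_linear_imp_has_derivative[OF assms] by (auto intro!: derivative_eq_intros)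
  have "(f has_derivative frechet_derivative f (at (L x + c))) (at (L x + c))" using f(1) by blast
  from has_derivative_compose[OF 1 this]
  show "((%x. f (L x + c)) has_derivative (%v. frechet_derivative f (at (L x + c)) (L v))) (at x)" .
 next
  fix v show "Ck_on k UNIV (%x. frechet_derivative f (at (L x + c)) (L v))" using f(2) by (intro Suc.IH) blast
 qed
qed

section \<open>A flat exponential and smooth bumps\<close>

definition flat_exp :: "nat => real => real" where
 "flat_exp k s = (if s > 0 then exp (-1/s) / s ^ k else 0)"

text \<open>With u = 1/s the limit from the right is that of u^k / e^u at infinity; from the left
  the function is zero.\<close>

lemma flat_exp_tendsto_0: "(flat_exp k \<longlongrightarrow> 0) (at 0)"
proof -
 have "((%u::real. u ^ k / exp u) \<longlongrightarrow> 0) at_top" by (rule tendsto_power_div_exp_0)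
 then have "((%s. (inverse s) ^ k / exp (inverse s)) \<longlongrightarrow> 0) (at_right (0::real))" by (rule filterlim_compose[OF _ filterlim_inverse_at_top_right])
 then have "(flat_exp k \<longlongrightarrow> 0) (at_right 0)" by (rule Lim_transform_eventually)
   (auto simp: eventually_at_filter flat_exp_def field_simps exp_minus power_inverse)
 moreover have "(flat_exp k \<longlongrightarrow> 0) (at_left 0)" by (rule Lim_transform_eventually[OF tendsto_const])
   (auto simp: eventually_at_filter flat_exp_def)
 ultimately show ?thesis using filterlim_split_at by blast
qed

text \<open>The span of the family over all k is closed under differentiation, so smoothness follows
  by induction on the order with the exponent left free. At s = 0 the difference quotient is the
  next member of the family, which tends to 0.\<close>

lemma flat_exp_has_derivative:
 "(flat_exp k has_field_derivative (flat_exp (k+2) s - real k * flat_exp (k+1) s)) (at s)"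
proof (cases s "0::real" rule: linorder_cases)
 case less
 have "((%_. 0) has_field_derivative 0) (at s)" by simp
 moreover have "flat_exp (k+2) s - real k * flat_exp (k+1) s = 0" using less by (simp add: flat_exp_def)
 moreover have ev: "eventually (%x. flat_exp k x = 0) (nhds s)" by (rule eventually_mono[OF eventually_nhds_in_open[of "{..<0}"]]) (use less in \<open>auto simp: flat_exp_def\<close>)
 ultimately show ?thesis using DERIV_cong_ev[OF refl ev refl, of 0] by simp
next
 case equal
 have "((%y. (flat_exp k y - flat_exp k 0) / (y - 0)) \<longlongrightarrow> 0) (at 0)" by (rule Lim_transform_eventually[OF flat_exp_tendsto_0[of "Suc k"]])
   (auto simp: eventually_at_filter flat_exp_def)
 then show ?thesis using equal by (simp add: has_field_derivative_iff flat_exp_def)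
next
 case greater
 have ev: "eventually (%x. flat_exp k x = exp (-1/x) / x^k) (nhds s)" by (rule eventually_mono[OF eventually_nhds_in_open[of "{0<..}"]]) (use greater in \<open>auto simp: flat_exp_def\<close>)
 have "((%x. exp (-1/x) / x^k) has_field_derivative
   (exp (-1/s) * (1/s^2) * s^k - exp (-1/s) * (real k * s^(k-1))) / (s^k * s^k)) (at s)" using greater by (auto intro!: derivative_eq_intros simp: power2_eq_square)
 moreover have "(exp (-1/s) * (1/s^2) * s^k - exp (-1/s) * (real k * s^(k-1))) / (s^k * s^k)
   = flat_exp (k+2) s - real k * flat_exp (k+1) s" using greater by (cases k) (auto simp: flat_exp_def field_simps power2_eq_square)
 ultimately show ?thesis using DERIV_cong_ev[OF refl ev refl] by simp
qed

lemma Ck_on_flat_exp: "smooth_fun UNIV p ==> Ck_on k UNIV (%x. flat_exp j (p x))"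
proof (induction k arbitrary: j)
 case 0
 have "continuous_on UNIV (flat_exp j)" using flat_exp_has_derivative by (meson DERIV_isCont continuous_at_imp_continuous_on)
 moreover have "continuous_on UNIV p" using 0 unfolding smooth_fun_def by (metis Ck_on.simps(1))
 ultimately show ?case by (auto intro: continuous_on_compose2)
next
 case (Suc k)
 note p = Suc.prems[unfolded smooth_fun_def, rule_format, of "Suc k", THEN Ck_on_Suc_has_derivative]
  Suc.prems[unfolded smooth_fun_def, rule_format, of "Suc k", THEN Ck_on_Suc_deriv]
 show ?case
 proof (rule Ck_on_SucI[where f' = "%x v. (flat_exp (j+2) (p x) + (- real j) * flat_exp (j+1) (p x)) * frechet_derivative p (at x) v"])
  fix x
  have "(p has_derivative frechet_derivative p (at x)) (at x)" using p(1) by blast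
  from DERIV_compose_FDERIV[OF flat_exp_has_derivative this]
  show "((%x. flat_exp j (p x)) has_derivative (%v. (flat_exp (j+2) (p x) + (- real j) * flat_exp (j+1) (p x)) * frechet_derivative p (at x) v)) (at x)" by (simp add: mult.commute)
 next
  fix v
  have "Ck_on k UNIV (%x. frechet_derivative p (at x) v)" using p(2) by blast
  then show "Ck_on k UNIV (%x. (flat_exp (j+2) (p x) + (- real j) * flat_exp (j+1) (p x)) * frechet_derivative p (at x) v)" using Suc by (intro Ck_on_mult Ck_on_add Ck_on_const)
 qed
qed

lemma smooth_funD: "smooth_fun UNIV f ==> (f has_derivative frechet_derivative f (at x)) (at x)" unfolding smooth_fun_def by (metis Ck_on_Suc_has_derivative)
lemma smooth_fun_deriv: "smooth_fun UNIV f ==> smooth_fun UNIV (%x. frechet_derivative f (at x) v)" unfolding smooth_fun_def by (metis Ck_on_Suc_deriv)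
lemma smooth_fun_continuous: "smooth_fun UNIV f ==> continuous_on UNIV f" unfolding smooth_fun_def by (metis Ck_on.simps(1))
lemma smooth_fun_const: "smooth_fun UNIV (%x. c)" by (simp add: smooth_fun_def Ck_on_const)
lemma smooth_fun_add: "smooth_fun UNIV f ==> smooth_fun UNIV g ==> smooth_fun UNIV (%x. f x + g x)" by (simp add: smooth_fun_def Ck_on_add)
lemma smooth_fun_mult: "smooth_fun UNIV f ==> smooth_fun UNIV g ==> smooth_fun UNIV (%x. f x * g x)" by (simp add: smooth_fun_def Ck_on_mult)
lemma smooth_fun_diff: "smooth_fun UNIV f ==> smooth_fun UNIV g ==> smooth_fun UNIV (%x. f x - g x)" using smooth_fun_add[of f "%x. (-1) * g x"] smooth_fun_mult[OF smooth_fun_const[of "-1"], of g] by simp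
lemma smooth_fun_affine: "bounded_linear L ==> smooth_fun UNIV f ==> smooth_fun UNIV (%x. f (L x + c))" by (simp add: smooth_fun_def Ck_on_affine)
lemma smooth_fun_prod: "(!!i. i \<in> I ==> smooth_fun UNIV (f i)) ==> smooth_fun UNIV (%x. \<Prod>i\<in>I. f i x)" by (induction I rule: infinite_finite_induct) (auto intro: smooth_fun_const smooth_fun_mult)
lemma smooth_fun_power: "smooth_fun UNIV f ==> smooth_fun UNIV (%x. f x ^ m)" by (induction m) (auto intro: smooth_fun_const smooth_fun_mult)

lemma smooth_fun_inner_self: "smooth_fun UNIV (%x::'a::real_inner. x \<bullet> x)" unfolding smooth_fun_def
proof
 fix k show "Ck_on k UNIV (%x::'a. x \<bullet> x)"
 proof (cases k)
  case 0
  then show ?thesis by (auto intro!: continuous_intros)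
 next
  case (Suc j)
  show ?thesis unfolding Suc by (rule Ck_on_SucI[where f' = "%x v. 2 * (x \<bullet> v)"])
    (auto intro!: derivative_eq_intros Ck_on_linear bounded_linear_const_mult bounded_linear_inner_right simp: inner_commute)
 qed
qed

definition bump :: "'a::euclidean_space => real => 'a => real" where
 "bump c r x = flat_exp 0 (r^2 - (x - c) \<bullet> (x - c))"

lemma smooth_fun_bump: "smooth_fun UNIV (bump c r)"
proof -
 have "smooth_fun UNIV (%x. r^2 - (x + (-c)) \<bullet> (x + (-c)))" by (intro smooth_fun_diff smooth_fun_const smooth_fun_affine[OF bounded_linear_ident smooth_fun_inner_self])
 then show ?thesis unfolding smooth_fun_def bump_def using Ck_on_flat_exp[of "%x. r^2 - (x - c) \<bullet> (x - c)"] by (simp add: smooth_fun_def)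
qed

lemma bump_pos_iff: "r > 0 ==> bump c r x > 0 \<longleftrightarrow> x \<in> ball c r" using abs_le_square_iff[of r "norm (x - c)"] by (simp add: bump_def flat_exp_def dist_norm norm_minus_commute power2_norm_eq_inner[symmetric]) (auto simp: not_le[symmetric])
lemma bump_nonneg: "0 <= bump c r x" by (simp add: bump_def flat_exp_def)
lemma bump_less_1: "bump c r x < 1" by (simp add: bump_def flat_exp_def)

subsection \<open>Test functions\<close>

lemma test_funI:
 assumes "smooth_fun UNIV \<phi>" "compact K" "K \<subseteq> U" "!!z. z \<notin> K ==> \<phi> z = 0"
 shows "test_fun U \<phi>"
proof -
 have "closure {z. \<phi> z ~= 0} \<subseteq> K" using assms by (intro closure_minimal) (auto simp: compact_imp_closed)
 moreover from this have "compact (closure {z. \<phi> z ~= 0})" using assms(2) compact_Int_closed[of K "closure {z. \<phi> z ~= 0}"] by (simp add: Int_absorb1)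
 ultimately show ?thesis using assms unfolding test_fun_def by auto
qed

text \<open>The derivative vanishes off the closed support because \<open>\<phi>\<close> is
  identically zero on its open complement.\<close>

lemma test_funE:
 assumes "test_fun U \<phi>"
 obtains K where "smooth_fun UNIV \<phi>" "compact K" "K \<subseteq> U" "!!z. z \<notin> K ==> \<phi> z = 0"
  "!!z v. z \<notin> K ==> frechet_derivative \<phi> (at z) v = 0"
proof -
 let ?K = "closure {z. \<phi> z ~= 0}"
 have 0: "\<phi> z = 0" if "z \<notin> ?K" for z using that closure_subset[of "{z. \<phi> z ~= 0}"] by auto
 have 1: "frechet_derivative \<phi> (at z) v = 0" if "z \<notin> ?K" for z v
 proof -
  have "(\<phi> has_derivative (%_. 0)) (at z)"
  proof (rule has_derivative_transform_within_open)
   show "((%_. 0) has_derivative (%_. 0)) (at z)" by simp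
   show "open (- ?K)" by (rule open_Compl[OF closed_closure])
   show "z \<in> - ?K" using that by simp
   show "0 = \<phi> y" if "y \<in> - ?K" for y using 0[of y] ComplD[OF that] by metis
  qed
  from frechet_derivative_at[OF this, symmetric] show ?thesis by simp
 qed
 have a: "smooth_fun UNIV \<phi>" "compact ?K" "?K \<subseteq> U" using assms unfolding test_fun_def by blast+
 show thesis by (rule that[OF a 0 1])
qed

lemma test_fun_support: "test_fun U \<phi> ==> \<exists>K. compact K & K \<subseteq> U & (\<forall>z. z \<notin> K --> \<phi> z = 0)" by (erule test_funE) auto
lemma test_fun_smooth: "test_fun U \<phi> ==> smooth_fun UNIV \<phi>" by (simp add: test_fun_def)
lemma test_fun_mono: "test_fun U \<phi> ==> U \<subseteq> V ==> test_fun V \<phi>" by (auto simp: test_fun_def)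
lemma test_fun_outside: "test_fun U \<phi> ==> z \<notin> U ==> \<phi> z = 0" by (erule test_funE) blast
lemma test_fun_deriv_outside: "test_fun U \<phi> ==> z \<notin> U ==> frechet_derivative \<phi> (at z) v = 0" by (erule test_funE) blast

lemma test_fun_deriv: "test_fun U \<phi> ==> test_fun U (%x. frechet_derivative \<phi> (at x) v)" by (erule test_funE, rule test_funI[OF smooth_fun_deriv]) auto

lemma test_fun_mult: "test_fun U \<phi> ==> smooth_fun UNIV \<psi> ==> test_fun U (%x. \<psi> x * \<phi> x)" by (erule test_funE, rule test_funI[OF smooth_fun_mult]) auto

lemma test_fun_zero: "test_fun U (%x. 0)" by (rule test_funI[of _ "{}"]) (auto intro: smooth_fun_const)

lemma test_fun_add: assumes "test_fun U \<phi>" "test_fun U \<psi>" shows "test_fun U (%x. \<phi> x + \<psi> x)"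
proof -
 obtain K where "smooth_fun UNIV \<phi>" "compact K" "K \<subseteq> U" "!!z. z \<notin> K ==> \<phi> z = 0" using assms(1) test_fun_support[OF assms(1)] test_fun_smooth by blast
 moreover obtain L where "smooth_fun UNIV \<psi>" "compact L" "L \<subseteq> U" "!!z. z \<notin> L ==> \<psi> z = 0" using assms(2) test_fun_support[OF assms(2)] test_fun_smooth by blast
 ultimately show ?thesis by (intro test_funI[of _ "K \<union> L"] smooth_fun_add) auto
qed

lemma test_fun_bounded: assumes "test_fun U \<phi>" obtains M where "M > 0" "!!z. \<bar>\<phi> z\<bar> <= M"
proof -
 obtain K where K: "smooth_fun UNIV \<phi>" "compact K" "!!z. z \<notin> K ==> \<phi> z = 0" using assms test_fun_support[OF assms] test_fun_smooth by blast
 have "compact (\<phi> ` K)" by (rule compact_continuous_image) (use continuous_on_subset[OF smooth_fun_continuous[OF K(1)]] K(2) in simp_all)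
 then obtain M where "!!z. z \<in> K ==> \<bar>\<phi> z\<bar> <= M" using compact_imp_bounded bounded_iff by (metis imageI real_norm_def)
 then have "\<bar>\<phi> z\<bar> <= \<bar>M\<bar> + 1" for z using K(3)[of z] by (cases "z \<in> K") force+
 then show thesis using that[of "\<bar>M\<bar> + 1"] by auto
qed

lemma test_fun_shift:
 assumes "test_fun W \<phi>" "!!z. z \<in> W ==> z + c \<in> U"
 shows "test_fun U (%z. \<phi> (z - c))"
proof -
 obtain K where K: "smooth_fun UNIV \<phi>" "compact K" "K \<subseteq> W" "!!z. z \<notin> K ==> \<phi> z = 0" using assms(1) test_fun_support[OF assms(1)] test_fun_smooth by blast
 show ?thesis
 proof (rule test_funI[of _ "(%z. c + z) ` K"])
  show "smooth_fun UNIV (%z. \<phi> (z - c))" using smooth_fun_affine[OF bounded_linear_ident K(1), of "-c"] by simp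
  show "compact ((%z. c + z) ` K)" using K(2) by (rule compact_translation)
  show "(%z. c + z) ` K \<subseteq> U" using K(3) assms(2) by (auto simp: add.commute)
  show "\<phi> (z - c) = 0" if "z \<notin> (%z. c + z) ` K" for z using that K(4)[of "z - c"] by (metis add.commute diff_add_cancel imageI)
 qed
qed

lemma frechet_derivative_shift:
 assumes "smooth_fun UNIV \<phi>"
 shows "frechet_derivative (%z. \<phi> (z - c)) (at z) v = frechet_derivative \<phi> (at (z - c)) v"
proof -
 have "((%z. z - c) has_derivative (%v. v)) (at z)" by (auto intro!: derivative_eq_intros)
 from has_derivative_compose[OF this smooth_funD[OF assms]]
 show ?thesis using frechet_derivative_at by metis
qed

lemma frechet_derivative_mult_smooth:
 assumes "smooth_fun UNIV \<phi>" "smooth_fun UNIV \<psi>"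
 shows "frechet_derivative (%z. \<psi> z * \<phi> z) (at z) v
   = \<psi> z * frechet_derivative \<phi> (at z) v + frechet_derivative \<psi> (at z) v * \<phi> z" using frechet_derivative_at[OF has_derivative_mult[OF smooth_funD[OF assms(2)] smooth_funD[OF assms(1)]]]
 by metis

subsection \<open>Square integrable Borel functions\<close>

text \<open>Borel measurability on the whole space, instead of Lebesgue measurability on a subset,
  keeps compositions with continuous maps, sections and Fubini free of completions.\<close>

definition sq :: "('a::euclidean_space => 'b::euclidean_space) => bool" where
 "sq f \<longleftrightarrow> f \<in> borelm & integrable lborel (%x. (norm (f x))^2)"

text \<open>The squared L^2 norm; the triangle inequality appears in its squared form with factors
  2.\<close>

definition N2 :: "('a::euclidean_space => 'b::euclidean_space) => real" where
 "N2 f = (LBINT x. (norm (f x))^2)"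

lemma sq_measurable[measurable_dest]: "sq f ==> f \<in> borelm" by (simp add: sq_def)
lemma sq_integrable: "sq f ==> integrable lborel (%x. (norm (f x))^2)" by (simp add: sq_def)
lemma N2_nonneg[simp]: "0 <= N2 f" by (simp add: N2_def)

lemma sq_bound:
 assumes "sq g" "f \<in> borelm" "AE x in lborel. norm (f x) <= norm (g x)"
 shows "sq f" unfolding sq_def
proof
 show "integrable lborel (%x. (norm (f x))^2)"
 proof (rule integrable_bound[OF sq_integrable[OF assms(1)]])
  show "(%x. (norm (f x))^2) \<in> borel_measurable lborel" using assms(2) by measurable
  show "AE x in lborel. norm ((norm (f x))^2) <= norm ((norm (g x))^2)" using assms(3) by eventually_elim (auto intro: power_mono)
 qed
qed (fact assms)

lemma N2_mono:
 assumes "sq g" "f \<in> borelm" "AE x in lborel. norm (f x) <= norm (g x)"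
 shows "N2 f <= N2 g" unfolding N2_def using assms(3) by (intro integral_mono_AE sq_integrable[OF assms(1)] sq_integrable[OF sq_bound[OF assms]])
   (auto elim!: eventually_mono intro: power_mono)

lemma norm_add_square_le: "(norm (a + b :: 'a::real_inner))^2 <= 2 * (norm a)^2 + 2 * (norm b)^2"
proof -
 have "(norm (a + b))^2 <= (norm a + norm b)^2" by (intro power_mono norm_triangle_ineq) auto
 also have "... <= 2 * (norm a)^2 + 2 * (norm b)^2" using sum_squares_bound[of "norm a" "norm b"] by (simp add: power2_sum)
 finally show ?thesis .
qed

lemma sq_zero[simp]: "sq (%x. 0)" by (simp add: sq_def)
lemma N2_zero[simp]: "N2 (%x. 0) = 0" by (simp add: N2_def)

lemma sq_add: assumes "sq f" "sq g" shows "sq (%x. f x + g x)" unfolding sq_def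
proof
 show [measurable]: "(%x. f x + g x) \<in> borelm" using assms[THEN sq_measurable] by measurable
 show "integrable lborel (%x. (norm (f x + g x))^2)" by (rule integrable_bound[where f = "%x. 2 * (norm (f x))^2 + 2 * (norm (g x))^2"])
   (use assms[THEN sq_integrable] norm_add_square_le in \<open>auto\<close>)
qed

lemma N2_add_le: assumes "sq f" "sq g" shows "N2 (%x. f x + g x) <= 2 * N2 f + 2 * N2 g"
proof -
 have "N2 (%x. f x + g x) <= (LBINT x. 2 * (norm (f x))^2 + 2 * (norm (g x))^2)" unfolding N2_def by (intro integral_mono) (use assms[THEN sq_integrable] sq_integrable[OF sq_add[OF assms]] norm_add_square_le in auto)
 then show ?thesis using assms[THEN sq_integrable] by (simp add: N2_def)
qed

lemma sq_scaleR: assumes "sq f" shows "sq (%x. c *\<^sub>R f x)" using assms by (auto simp: sq_def power_mult_distrib)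
lemma N2_scaleR: "N2 (%x. c *\<^sub>R f x) = c^2 * N2 f" by (simp add: N2_def power_mult_distrib)
lemma sq_minus: "sq f ==> sq (%x. - f x)" using sq_scaleR[of f "-1"] by simp
lemma N2_minus: "N2 (%x. - f x) = N2 f" by (simp add: N2_def)
lemma N2_minus_commute: "N2 (%x. f x - g x) = N2 (%x. g x - f x)" by (simp add: N2_def norm_minus_commute)
lemma sq_diff: "sq f ==> sq g ==> sq (%x. f x - g x)" using sq_add[of f "%x. - g x"] sq_minus[of g] by simp
lemma N2_diff_le: "sq f ==> sq g ==> N2 (%x. f x - g x) <= 2 * N2 f + 2 * N2 g" using N2_add_le[of f "%x. - g x"] sq_minus[of g] by (simp add: N2_minus)
lemma N2_triangle: assumes "sq f" "sq g" "sq h"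
 shows "N2 (%x. f x - h x) <= 2 * N2 (%x. f x - g x) + 2 * N2 (%x. g x - h x)" using N2_add_le[OF sq_diff[OF assms(1,2)] sq_diff[OF assms(2,3)]] by simp

lemma sq_sum: "(!!i. i \<in> I ==> sq (f i)) ==> sq (%x. \<Sum>i\<in>I. f i x)" by (induction I rule: infinite_finite_induct) (auto intro: sq_add)

lemma sq_scale_bounded:
 assumes f: "sq f" and g: "g \<in> borelm" "!!x. \<bar>g x\<bar> <= C"
 shows "sq (%x. g x *\<^sub>R f x)" "N2 (%x. g x *\<^sub>R f x) <= C^2 * N2 f"
proof -
 have "0 <= C" using g(2)[of undefined] by simp
 have m: "(%x. g x *\<^sub>R f x) \<in> borelm" using f[THEN sq_measurable] g(1) by measurable
 have b: "AE x in lborel. norm (g x *\<^sub>R f x) <= norm (C *\<^sub>R f x)" using g(2) \<open>0 <= C\<close> by (auto intro!: AE_I2 mult_right_mono)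
 show "sq (%x. g x *\<^sub>R f x)" by (rule sq_bound[OF sq_scaleR[OF f] m b])
 show "N2 (%x. g x *\<^sub>R f x) <= C^2 * N2 f" using N2_mono[OF sq_scaleR[OF f] m b] by (simp add: N2_scaleR)
qed

lemmas sq_mult_bounded = sq_scale_bounded(1)[where 'b=real, simplified]
lemmas N2_mult_bounded = sq_scale_bounded(2)[where 'b=real, simplified]

lemma sq_norm: "sq f ==> sq (%x. norm (f x))" by (auto simp: sq_def)
lemma N2_norm: "N2 (%x. norm (f x)) = N2 f" by (simp add: N2_def)

lemma N2_cong_AE: "AE x in lborel. f x = g x ==> sq f ==> g \<in> borelm ==> N2 f = N2 g" unfolding N2_def by (intro integral_cong_AE) (auto elim: eventually_mono dest: sq_measurable)

lemma N2_eq_0_iff: "sq f ==> N2 f = 0 \<longleftrightarrow> (AE x in lborel. f x = 0)" unfolding N2_def by (subst integral_nonneg_eq_0_iff_AE) (auto simp: sq_integrable)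

lemma sq_integrable_norm_mult:
 assumes "sq f" "sq g" shows "integrable lborel (%x. norm (f x) * norm (g x))"
proof (rule integrable_bound[where f = "%x. (norm (f x))^2 + (norm (g x))^2"])
 show "integrable lborel (%x. (norm (f x))^2 + (norm (g x))^2)" using assms by (simp add: sq_integrable)
 show "(%x. norm (f x) * norm (g x)) \<in> borel_measurable lborel" using assms[THEN sq_measurable] by measurable
 have "a * b <= a^2 + b^2" if "a \<ge> 0" "b \<ge> 0" for a b :: real using sum_squares_bound[of a b] that mult_nonneg_nonneg[of a b] by linarith
 then show "AE x in lborel. norm (norm (f x) * norm (g x)) <= norm ((norm (f x))^2 + (norm (g x))^2)" by (auto simp: abs_mult)
qed

lemma sq_integrable_inner: assumes "sq f" "sq g" shows "integrable lborel (%x. f x \<bullet> g x)"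
proof (rule integrable_bound[OF sq_integrable_norm_mult[OF assms]])
 show "(%x. f x \<bullet> g x) \<in> borel_measurable lborel" using assms[THEN sq_measurable] by measurable
qed (auto simp: Cauchy_Schwarz_ineq2)

lemma sq_integrable_scaleR: assumes "sq f" "sq g" shows "integrable lborel (%x. f x *\<^sub>R g x)"
proof (rule integrable_bound[OF sq_integrable_norm_mult[OF assms]])
 show "(%x. f x *\<^sub>R g x) \<in> borel_measurable lborel" using assms[THEN sq_measurable] by measurable
qed auto

lemma sq_integrable_mult: "sq (f::_ => real) ==> sq g ==> integrable lborel (%x. f x * g x)" using sq_integrable_inner[of f g] by (simp add: inner_real_def)

lemma Cauchy_Schwarz_norm_mult:
 assumes f: "sq f" and g: "sq g"
 shows "(LBINT x. norm (f x) * norm (g x)) <= sqrt (N2 f) * sqrt (N2 g)"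
proof -
 have [measurable]: "f \<in> borelm" "g \<in> borelm" using f g by (auto simp: sq_measurable)
 let ?I = "\<integral>x. norm (f x) * norm (g x) \<partial>lborel"
 have 0: "?I \<ge> 0" by simp
 have "(\<integral>\<^sup>+x. ennreal (norm (f x)) * ennreal (norm (g x)) \<partial>lborel)^2 <=
   (\<integral>\<^sup>+x. ennreal (norm (f x)) ^ 2 \<partial>lborel) * (\<integral>\<^sup>+x. ennreal (norm (g x)) ^ 2 \<partial>lborel)" by (rule Cauchy_Schwarz_nn_integral) measurable
 also have "(\<integral>\<^sup>+x. ennreal (norm (f x)) ^ 2 \<partial>lborel) = ennreal (N2 f)" unfolding N2_def by (subst nn_integral_eq_integral[symmetric]) (auto simp: f sq_integrable ennreal_power)
 also have "(\<integral>\<^sup>+x. ennreal (norm (g x)) ^ 2 \<partial>lborel) = ennreal (N2 g)" unfolding N2_def by (subst nn_integral_eq_integral[symmetric]) (auto simp: g sq_integrable ennreal_power)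
 also have "(\<integral>\<^sup>+x. ennreal (norm (f x)) * ennreal (norm (g x)) \<partial>lborel) = ennreal ?I" by (subst nn_integral_eq_integral[symmetric]) (auto simp: f g sq_integrable_norm_mult ennreal_mult)
 finally have "ennreal (?I^2) <= ennreal (N2 f * N2 g)" using 0 by (simp add: ennreal_power ennreal_mult)
 then have "?I^2 <= N2 f * N2 g" by (subst (asm) ennreal_le_iff) auto
 then have "?I <= sqrt (N2 f * N2 g)" by (rule real_le_rsqrt)
 then show ?thesis by (simp add: real_sqrt_mult)
qed

lemma Cauchy_Schwarz_inner:
 assumes "sq f" "sq g"
 shows "\<bar>\<integral>x. f x \<bullet> g x \<partial>lborel\<bar> <= sqrt (N2 f) * sqrt (N2 g)"
proof -
 have "\<bar>\<integral>x. f x \<bullet> g x \<partial>lborel\<bar> <= (LBINT x. \<bar>f x \<bullet> g x\<bar>)" using integral_norm_bound[of lborel "%x. f x \<bullet> g x"] by simp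
 also have "... <= (LBINT x. norm (f x) * norm (g x))" by (rule integral_mono)
   (use assms in \<open>auto simp: Cauchy_Schwarz_ineq2 sq_integrable_norm_mult sq_integrable_inner\<close>)
 finally have "\<bar>\<integral>x. f x \<bullet> g x \<partial>lborel\<bar> <= (LBINT x. norm (f x) * norm (g x))" .
 with Cauchy_Schwarz_norm_mult[OF assms] show ?thesis by linarith
qed

lemma Cauchy_Schwarz_mult:
 "sq (f::_ => real) ==> sq g ==> \<bar>\<integral>x. f x * g x \<partial>lborel\<bar> <= sqrt (N2 f) * sqrt (N2 g)" using Cauchy_Schwarz_inner[of f g] by (simp add: inner_real_def)

lemma inner_integral_LIMSEQ:
 assumes "!!n. sq (f n)" "sq h" "sq g" "(%n. N2 (%x. f n x - h x)) ~~> 0"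
 shows "(%n. \<integral>x. f n x \<bullet> g x \<partial>lborel) ~~> (LBINT x. h x \<bullet> g x)"
proof (rule LIM_zero_cancel, rule tendsto_rabs_zero_cancel, rule tendsto_sandwich[OF _ _ tendsto_const])
 show "\<forall>\<^sub>F n in sequentially. \<bar>(LBINT x. f n x \<bullet> g x) - (LBINT x. h x \<bullet> g x)\<bar> <= sqrt (N2 (%x. f n x - h x)) * sqrt (N2 g)" using Cauchy_Schwarz_inner[OF sq_diff[OF assms(1,2)] assms(3)] assms by (auto simp: inner_diff_left sq_integrable_inner)
 show "(%n. sqrt (N2 (%x. f n x - h x)) * sqrt (N2 g)) ~~> 0" using tendsto_mult_right[OF tendsto_real_sqrt[OF assms(4)], of "sqrt (N2 g)"] by simp
qed auto

lemma mult_integral_LIMSEQ: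
 fixes f :: "nat => 'a::euclidean_space => real"
 assumes "!!n. sq (f n)" "sq h" "sq g" "(%n. N2 (%x. f n x - h x)) ~~> 0"
 shows "(%n. \<integral>x. f n x * g x \<partial>lborel) ~~> (LBINT x. h x * g x)" using inner_integral_LIMSEQ[OF assms] by (simp add: inner_real_def)

lemma N2_dominated_LIMSEQ:
 assumes "sq w" "!!n. f n \<in> borelm" "g \<in> borelm"
  "AE x in lborel. (%n. f n x) ~~> g x"
  "!!n. AE x in lborel. norm (f n x - g x) <= norm (w x)"
 shows "(%n. N2 (%x. f n x - g x)) ~~> 0"
proof -
 have "(%n. N2 (%x. f n x - g x)) ~~> (\<integral>x. 0 \<partial>(lborel :: 'a measure))" unfolding N2_def
 proof (rule integral_dominated_convergence[where w = "%x. (norm (w x))^2"])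
  show "AE x in lborel. (%n. (norm (f n x - g x))^2) ~~> 0" using assms(4)
  proof eventually_elim
   case (elim x)
   then have "(%n. (norm (f n x - g x))^2) ~~> (norm (g x - g x))^2" by (intro tendsto_intros)
   then show ?case by simp
  qed
  show "AE x in lborel. norm ((norm (f n x - g x))^2) <= (norm (w x))^2" for n using assms(5)[of n] by eventually_elim (auto intro: power_mono)
 qed (use assms in \<open>auto simp: sq_integrable\<close>)
 then show ?thesis by simp
qed

subsection \<open>Density of test functions\<close>

lemma indicator_square: "(norm (ind A x))^2 = ind A x" by (auto simp: indicator_def)

lemma sq_indicator: "A \<in> sets borel ==> emeasure lborel A < \<infinity> ==> sq (ind A)" unfolding sq_def indicator_square by (auto intro!: integrable_real_indicator)

lemma N2_indicator: "A \<in> sets borel ==> N2 (ind A) = measure lborel A" unfolding N2_def indicator_square by simp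

lemma sq_indicator_scale:
 assumes "sq u" "A \<in> sets borel" shows "sq (%x. ind A x *\<^sub>R u x)" "N2 (%x. ind A x *\<^sub>R u x) <= N2 u"
proof -
 have "ind A \<in> borelm" using assms(2) by simp
 from sq_scale_bounded[OF assms(1) this, of 1]
 show "sq (%x. ind A x *\<^sub>R u x)" "N2 (%x. ind A x *\<^sub>R u x) <= N2 u" by (auto simp: indicator_def)
qed

lemmas sq_indicator_mult = sq_indicator_scale(1)[where 'b=real, simplified]
lemmas N2_indicator_mult = sq_indicator_scale(2)[where 'b=real, simplified]

lemma test_fun_sq: assumes "test_fun U \<phi>" shows "sq \<phi>"
proof -
 obtain M where M: "M > 0" "!!z. \<bar>\<phi> z\<bar> <= M" using test_fun_bounded[OF assms] by blast
 obtain K where K: "compact K" "!!z. z \<notin> K ==> \<phi> z = 0" using test_fun_support[OF assms] by blast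
 have m: "\<phi> \<in> borelm" using smooth_fun_continuous[OF test_fun_smooth[OF assms]] by (rule borel_measurable_continuous_onI)
 have [simp]: "K \<in> sets borel" using K(1) by (simp add: borel_compact)
 have "sq (ind K)" by (rule sq_indicator) (use K(1) emeasure_compact_finite in auto)
 from sq_scaleR[OF this, of M] have i: "sq (%x. M * ind K x)" by simp
 show ?thesis by (rule sq_bound[OF i m]) (use M K in \<open>auto simp: indicator_def\<close>)
qed

definition test_dense :: "'a::euclidean_space set => ('a => real) => bool" where
 "test_dense W u \<longleftrightarrow> (\<forall>e>0. \<exists>\<phi>. test_fun W \<phi> & N2 (%x. \<phi> x - indicator W x * u x) < e)"

text \<open>Cover K by finitely many balls inside V and let \<psi> be the product of the factors 1 -
  \<open>bump\<close>. Then \<psi> lies strictly between 0 and 1 on the union V' of the open balls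
  and equals 1 off it, so 1 - \<psi>^m tends to the indicator of V'. The supports stay in the union
  of the closed balls, which still lies in V.\<close>

lemma smooth_indicator_approx:
 fixes K :: "'a::euclidean_space set"
 assumes "compact K" "open V" "K \<subseteq> V"
 obtains V' \<phi> where "open V'" "K \<subseteq> V'" "V' \<subseteq> V" "bounded V'"
  "!!m::nat. test_fun V (\<phi> m)" "!!m x. 0 <= \<phi> m x & \<phi> m x <= 1"
  "!!m x. x \<notin> V' ==> \<phi> m x = 0" "!!x. x \<in> V' ==> (%m. \<phi> m x) ~~> 1"
proof -
 have "\<exists>r>0. cball x r \<subseteq> V" if "x \<in> K" for x using assms that open_contains_cball by blast
 then obtain r where r: "!!x. x \<in> K ==> r x > 0 & cball x (r x) \<subseteq> V" by metis
 have "K \<subseteq> (\<Union>x\<in>K. ball x (r x))" using r by auto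
 then obtain C where C: "C \<subseteq> K" "finite C" "K \<subseteq> (\<Union>x\<in>C. ball x (r x))" using compactE_image[OF assms(1), of K "%x. ball x (r x)"] by auto
 define V' where "V' = (\<Union>x\<in>C. ball x (r x))"
 define \<psi> where "\<psi> x = (\<Prod>c\<in>C. 1 - bump c (r c) x)" for x
 have f01: "0 < 1 - bump c (r c) x" "1 - bump c (r c) x <= 1" for c x using bump_less_1[of c "r c" x] bump_nonneg[of c "r c" x] by auto
 have p0: "0 < \<psi> x" for x unfolding \<psi>_def by (rule prod_pos) (use f01 in auto)
 have p1: "\<psi> x <= 1" for x unfolding \<psi>_def by (rule prod_le_1) (use f01 in \<open>auto intro: less_imp_le\<close>)
 have p2: "\<psi> x = 1" if "x \<notin> V'" for x unfolding \<psi>_def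
 proof (rule prod.neutral, rule ballI)
  fix c assume "c \<in> C"
  with that C r have "\<not> bump c (r c) x > 0" by (subst bump_pos_iff) (auto simp: V'_def)
  with bump_nonneg[of c "r c" x] show "1 - bump c (r c) x = 1" by simp
 qed
 have p3: "\<psi> x < 1" if "x \<in> V'" for x
 proof -
  from that obtain c where c: "c \<in> C" "x \<in> ball c (r c)" by (auto simp: V'_def)
  have "\<psi> x = (1 - bump c (r c) x) * (\<Prod>d\<in>C-{c}. 1 - bump d (r d) x)" unfolding \<psi>_def using c C by (subst prod.remove) auto
  also have "... <= (1 - bump c (r c) x) * 1" by (rule mult_left_mono[OF prod_le_1]) (use f01 in \<open>auto intro: less_imp_le\<close>)
  also have "... < 1" using bump_pos_iff[of "r c" c x] c C r by auto
  finally show ?thesis .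
 qed
 define K' where "K' = (\<Union>x\<in>C. cball x (r x))"
 have "smooth_fun UNIV (%x. 1 - \<psi> x ^ m)" for m unfolding \<psi>_def by (intro smooth_fun_diff smooth_fun_const smooth_fun_power smooth_fun_prod smooth_fun_bump)
 moreover have "compact K'" unfolding K'_def using C by (intro compact_UN) auto
 moreover have "K' \<subseteq> V" using C r unfolding K'_def by blast
 moreover have VK: "V' \<subseteq> K'" by (auto simp: V'_def K'_def)
 ultimately have t: "test_fun V (%x. 1 - \<psi> x ^ m)" for m by (intro test_funI[of _ K']) (auto simp: p2 subsetD[OF VK] dest: contra_subsetD[OF VK])
 show thesis
 proof (rule that[of V' "%m x. 1 - \<psi> x ^ m"])
  show "open V'" by (auto simp: V'_def)
  show "K \<subseteq> V'" using C by (simp add: V'_def)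
  show "V' \<subseteq> V" "bounded V'" using VK \<open>K' \<subseteq> V\<close> \<open>compact K'\<close> compact_imp_bounded bounded_subset by blast+
  show "0 <= 1 - \<psi> x ^ m & 1 - \<psi> x ^ m <= 1" for m x using p0[of x] p1[of x] by (auto intro: power_le_one less_imp_le)
  show "1 - \<psi> x ^ m = 0" if "x \<notin> V'" for m x using p2[OF that] by simp
  show "(%m. 1 - \<psi> x ^ m) ~~> 1" if "x \<in> V'" for x
  proof -
   have "(%m. 1 - \<psi> x ^ m) ~~> 1 - 0" by (intro tendsto_intros LIMSEQ_power_zero) (use p0[of x] p3[OF that] in auto)
   then show ?thesis by simp
  qed
 qed (fact t)
qed

text \<open>Regularity of Lebesgue measure gives a compact T inside A \<inter> W and an open set
  around T, both with small excess. An open V between T and that set differs from A \<inter> W by a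
  set of small measure, and its indicator is a limit of test functions.\<close>

lemma test_dense_indicator:
 fixes W :: "'a::euclidean_space set"
 assumes "open W" "A \<in> sets borel" "bounded A"
 shows "test_dense W (indicator A)" unfolding test_dense_def
proof (intro allI impI)
 fix e :: real assume "e > 0"
 \<comment> \<open>The triangle inequalities below add up to an error of less than 10
   \<open>d\<close>.\<close>
 define d where "d = e / 16"
 have "d > 0" using \<open>e > 0\<close> by (simp add: d_def)
 define B where "B = A \<inter> W"
 have B: "B \<in> sets borel" "bounded B" "B \<in> sets lebesgue" using assms bounded_subset[OF assms(3), of B] by (auto simp: B_def)
 obtain T where T: "closed T" "T \<subseteq> B" "emeasure lebesgue (B - T) < ennreal d" using sets_lebesgue_inner_closed[OF B(3) \<open>d > 0\<close>] by metis
 have "compact T" using T(1) bounded_subset[OF B(2) T(2)] compact_eq_bounded_closed by blast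
 obtain U0 where U0: "open U0" "T \<subseteq> U0" "emeasure lborel (U0 - T) < d" using outer_regular_lborel[of T d] T \<open>d > 0\<close> by auto
 obtain V \<phi> where V: "open V" "T \<subseteq> V" "V \<subseteq> U0 \<inter> W" "bounded V"
  and \<phi>: "!!m::nat. test_fun (U0 \<inter> W) (\<phi> m)" "!!m x. 0 <= \<phi> m x & \<phi> m x <= 1"
  "!!m x. x \<notin> V ==> \<phi> m x = 0" "!!x. x \<in> V ==> (%m. \<phi> m x) ~~> 1" using smooth_indicator_approx[OF \<open>compact T\<close>, of "U0 \<inter> W"] U0 T assms(1) by (auto simp: B_def)
 have sV: "sq (ind V)" by (rule sq_indicator) (use V emeasure_bounded_finite in auto)
 have sB: "sq (ind B)" by (rule sq_indicator) (use B emeasure_bounded_finite in auto)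
 have "(%m. N2 (%x. \<phi> m x - ind V x)) ~~> 0"
 proof (rule N2_dominated_LIMSEQ[OF sV])
  show "\<phi> m \<in> borelm" for m using test_fun_sq[OF \<phi>(1)] by (rule sq_measurable)
  show "ind V \<in> borelm" using sV by (rule sq_measurable)
  show "AE x in lborel. (%n. \<phi> n x) ~~> ind V x"
  proof (rule AE_I2)
   fix x show "(%n. \<phi> n x) ~~> ind V x" using \<phi>(3,4) by (cases "x \<in> V") auto
  qed
  show "AE x in lborel. norm (\<phi> n x - ind V x) <= norm (ind V x)" for n
  proof (rule AE_I2)
   fix x show "norm (\<phi> n x - ind V x) <= norm (ind V x)" using \<phi>(2)[of n x] \<phi>(3)[of x n] by (cases "x \<in> V") auto
  qed
 qed
 from order_tendstoD(2)[OF this \<open>d > 0\<close>] obtain m where m: "N2 (%x. \<phi> m x - ind V x) < d" by (auto simp: eventually_sequentially)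
 have VT: "V - T \<in> sets borel" "emeasure lborel (V - T) < d" using V T U0 by (auto intro!: le_less_trans[OF emeasure_mono U0(3)])
 have BT: "B - T \<in> sets borel" "emeasure lborel (B - T) < d" using T B by auto
 have mV: "measure lborel (V - T) <= d" "measure lborel (B - T) <= d" unfolding measure_def using VT(2) BT(2) \<open>d > 0\<close> by (auto intro!: enn2real_leI dest: less_imp_le)
 have "N2 (%x. ind V x - ind B x) <= 2 * N2 (ind (V - T)) + 2 * N2 (ind (B - T))"
 proof -
  have s: "sq (ind (V - T))" "sq (ind (B - T))" by (rule sq_indicator; use VT BT in \<open>auto intro: less_trans\<close>)+
  \<comment> \<open>T is contained in both sets, so its contribution cancels.\<close>
  have "(%x. ind V x - ind B x) = (%x. ind (V - T) x - ind (B - T) x)" using T V by (auto simp: indicator_def fun_eq_iff)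
  with N2_diff_le[OF s] show ?thesis by simp
 qed
 then have "N2 (%x. ind V x - ind B x) <= 4 * d" using mV by (simp add: N2_indicator VT BT)
 with N2_triangle[OF test_fun_sq[OF \<phi>(1)] sV sB, of m] m have "N2 (%x. \<phi> m x - ind B x) < 10 * d" by linarith
 then show "\<exists>\<phi>. test_fun W \<phi> & N2 (%x. \<phi> x - indicator W x * indicator A x) < e" by (intro exI[of _ "\<phi> m"] conjI test_fun_mono[OF \<phi>(1)[of m]])
   (use \<open>e > 0\<close> in \<open>auto simp: d_def B_def indicator_inter_arith mult.commute\<close>)
qed

lemma test_dense_limit:
 assumes "open W" "!!n. sq (u n)" "sq v" "!!n::nat. test_dense W (u n)" "(%n. N2 (%x. u n x - v x)) ~~> 0"
 shows "test_dense W v" unfolding test_dense_def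
proof (intro allI impI)
 fix e :: real assume "e > 0"
 have W: "W \<in> sets borel" using assms(1) by auto
 from order_tendstoD(2)[OF assms(5), of "e/8"] \<open>e > 0\<close> obtain n where n: "N2 (%x. u n x - v x) < e/8" by (auto simp: eventually_sequentially)
 from assms(4)[of n] \<open>e > 0\<close> obtain \<phi> where \<phi>: "test_fun W \<phi>" "N2 (%x. \<phi> x - indicator W x * u n x) < e/8" unfolding test_dense_def by (meson divide_pos_pos zero_less_numeral)
 have s: "sq (%x. indicator W x * u n x)" "sq (%x. indicator W x * v x)" using assms W by (auto intro: sq_indicator_mult)
 have "N2 (%x. indicator W x * u n x - indicator W x * v x) <= N2 (%x. u n x - v x)" by (rule N2_mono[OF sq_diff[OF assms(2,3)]]) (use assms(2,3) W in \<open>auto simp: indicator_def sq_measurable\<close>)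
 with N2_triangle[OF test_fun_sq[OF \<phi>(1)] s] n \<phi>(2) have "N2 (%x. \<phi> x - indicator W x * v x) < e" using \<open>e > 0\<close> by linarith
 with \<phi> show "\<exists>\<phi>. test_fun W \<phi> & N2 (%x. \<phi> x - indicator W x * v x) < e" by blast
qed

lemma test_dense_add:
 assumes "open W" "sq u" "sq v" "test_dense W u" "test_dense W v"
 shows "test_dense W (%x. u x + v x)" unfolding test_dense_def
proof (intro allI impI)
 fix e :: real assume "e > 0"
 have W: "W \<in> sets borel" using assms(1) by auto
 obtain \<phi> where \<phi>: "test_fun W \<phi>" "N2 (%x. \<phi> x - indicator W x * u x) < e/4" using assms(4) \<open>e > 0\<close> unfolding test_dense_def by (meson divide_pos_pos zero_less_numeral)
 obtain \<psi> where \<psi>: "test_fun W \<psi>" "N2 (%x. \<psi> x - indicator W x * v x) < e/4" using assms(5) \<open>e > 0\<close> unfolding test_dense_def by (meson divide_pos_pos zero_less_numeral)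
 have s: "sq (%x. indicator W x * u x)" "sq (%x. indicator W x * v x)" using assms W by (auto intro: sq_indicator_mult)
 have "N2 (%x. (\<phi> x + \<psi> x) - indicator W x * (u x + v x)) < e" using N2_add_le[OF sq_diff[OF test_fun_sq[OF \<phi>(1)] s(1)] sq_diff[OF test_fun_sq[OF \<psi>(1)] s(2)]] \<phi>(2) \<psi>(2) by (simp add: algebra_simps)
 with test_fun_add[OF \<phi>(1) \<psi>(1)] show "\<exists>\<phi>. test_fun W \<phi> & N2 (%x. \<phi> x - indicator W x * (u x + v x)) < e" by blast
qed

lemma test_dense_scale:
 assumes "test_dense W u"
 shows "test_dense W (%x. c * u x)" unfolding test_dense_def
proof (intro allI impI)
 fix e :: real assume "e > 0"
 define d where "d = e / (c^2 + 1)"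
 have p: "c^2 + 1 > 0" using zero_le_power2[of c] by linarith
 have "d > 0" using \<open>e > 0\<close> p by (simp add: d_def)
 then obtain \<phi> where \<phi>: "test_fun W \<phi>" "N2 (%x. \<phi> x - indicator W x * u x) < d" using assms unfolding test_dense_def by blast
 have "(%x. c * \<phi> x - indicator W x * (c * u x)) = (%x. c *\<^sub>R (\<phi> x - indicator W x * u x))" by (auto simp: algebra_simps)
 then have "N2 (%x. c * \<phi> x - indicator W x * (c * u x)) = c^2 * N2 (%x. \<phi> x - indicator W x * u x)" by (simp only: N2_scaleR)
 also have "... <= c^2 * d" using \<phi>(2) by (intro mult_left_mono) auto
 also have "... < (c^2 + 1) * d" using \<open>d > 0\<close> by (simp add: algebra_simps)
 also have "... = e" using p by (simp add: d_def)
 finally show "\<exists>\<phi>. test_fun W \<phi> & N2 (%x. \<phi> x - indicator W x * (c * u x)) < e" using test_fun_mult[OF \<phi>(1) smooth_fun_const[of c]] by blast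
qed

lemma sq_truncate:
 assumes "sq u" shows "sq (%x. indicator (ball 0 R) x * u x)" "!!x. \<bar>indicator (ball 0 R) x * u x\<bar> <= \<bar>u x :: real\<bar>" by (rule sq_indicator_mult[OF assms]) (auto simp: indicator_def)

text \<open>Induction over nonnegative Borel functions. The indicators met on the way may have
  infinite measure, which the cutoff to a ball repairs. Square integrability is a premise inside the
  induction because each constituent inherits it from the function that dominates it.\<close>

lemma test_dense_nonneg:
 fixes u :: "'a::euclidean_space => real"
 assumes W: "open W" and u: "u \<in> borelm" "!!x. 0 <= u x"
 shows "sq u --> (\<forall>R. test_dense W (%x. indicator (ball 0 R) x * u x))" using u
proof (induction u rule: borel_measurable_induct_real)
 case (set A)
 show ?case
 proof (intro impI allI)
  fix R
  have "test_dense W (indicator (ball 0 R \<inter> A))" by (rule test_dense_indicator[OF W]) (use set in \<open>auto intro: bounded_subset[OF bounded_ball]\<close>)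
  then show "test_dense W (%x. indicator (ball 0 R) x * ind A x)" by (simp add: indicator_inter_arith[symmetric] fun_eq_iff[symmetric])
 qed
next
 case (mult u c)
 show ?case
 proof (intro impI allI)
  fix R assume s: "sq (%x. c * u x)"
  show "test_dense W (%x. indicator (ball 0 R) x * (c * u x))"
  proof (cases "c = 0")
   case True
   then show ?thesis using test_fun_zero[of W] by (auto simp: test_dense_def intro!: exI[of _ "%x. 0"])
  next
   case False
   with sq_scaleR[OF s, of "1/c"] have "sq u" by simp
   with mult have "test_dense W (%x. c * (indicator (ball 0 R) x * u x))" by (intro test_dense_scale) auto
   then show ?thesis by (simp add: algebra_simps)
  qed
 qed
next
 case (add u v)
 show ?case
 proof (intro impI allI)
  fix R assume s: "sq (%x. v x + u x)"
  have "sq u" "sq v" by (rule sq_bound[OF s]; use add in auto)+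
  with add have "test_dense W (%x. indicator (ball 0 R) x * v x + indicator (ball 0 R) x * u x)" by (intro test_dense_add[OF W] sq_truncate) auto
  then show "test_dense W (%x. indicator (ball 0 R) x * (v x + u x))" by (simp add: algebra_simps)
 qed
next
 case (seq U)
 show ?case
 proof (intro impI allI)
  fix R assume s: "sq u"
  have le: "U i x <= u x" for i x using seq.hyps(3) seq.hyps(4)[of x] by (intro incseq_le) (auto simp: incseq_def le_fun_def)
have sU: "sq (U i)" for i
  proof (rule sq_bound[OF s])
   show "U i \<in> borelm" using seq.hyps(1)[of i] by simp
   show "AE x in lborel. norm (U i x) <= norm (u x)"
   proof (rule AE_I2)
    fix x show "norm (U i x) <= norm (u x)" using le[of i x] seq.hyps(2)[of i x] by simp
   qed
  qed
  have um: "u \<in> borelm" using s by (rule sq_measurable)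
  have "(%n. N2 (%x. indicator (ball 0 R) x * U n x - indicator (ball 0 R) x * u x)) ~~> 0"
  proof (rule N2_dominated_LIMSEQ[OF s])
   show "AE x in lborel. (%n. ind (ball 0 R) x * U n x) ~~> ind (ball 0 R) x * u x" using seq.hyps(4) by (auto intro!: tendsto_intros)
   show "AE x in lborel. norm (ind (ball 0 R) x * U n x - ind (ball 0 R) x * u x) <= norm (u x)" for n
   proof (rule AE_I2)
    fix x show "norm (ind (ball 0 R) x * U n x - ind (ball 0 R) x * u x) <= norm (u x)" using le[of n x] seq.hyps(2)[of n x] by (cases "x \<in> ball 0 R") simp_all
   qed
  qed (simp_all add: sq_truncate(1)[OF s, THEN sq_measurable] sq_truncate(1)[OF sU, THEN sq_measurable])
  moreover have "test_dense W (%x. indicator (ball 0 R) x * U n x)" for n using seq.IH[of n] sU[of n] by simp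
  ultimately show "test_dense W (%x. indicator (ball 0 R) x * u x)" using test_dense_limit[OF W, of "%n x. indicator (ball 0 R) x * U n x"] sq_truncate(1)[OF s] sq_truncate(1)[OF sU] by simp
 qed
qed

text \<open>Dominated convergence removes the truncation to balls; splitting into positive and
  negative part removes the sign condition.\<close>

lemma test_dense:
 fixes u :: "'a::euclidean_space => real"
 assumes W: "open W" and u: "sq u"
 shows "test_dense W u"
proof -
 have *: "test_dense W v" if v: "sq v" "!!x. 0 <= v x" for v :: "'a => real"
 proof (rule test_dense_limit[OF W, of "%n x. indicator (ball 0 (real n)) x * v x"])
  show "test_dense W (%x. indicator (ball 0 (real n)) x * v x)" for n using test_dense_nonneg[OF W sq_measurable[OF v(1)] v(2)] v by blast
  show "(%n. N2 (%x. indicator (ball 0 (real n)) x * v x - v x)) ~~> 0"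
  proof (rule N2_dominated_LIMSEQ[OF v(1)])
   show "AE x in lborel. (%n. indicator (ball 0 (real n)) x * v x) ~~> v x"
   proof (rule AE_I2)
    fix x :: 'a
    obtain k where "norm x < real k" using reals_Archimedean2 by blast
    then have "eventually (%n. indicator (ball 0 (real n)) x * v x = v x) sequentially" by (auto simp: eventually_sequentially indicator_def intro!: exI[of _ k])
    then show "(%n. indicator (ball 0 (real n)) x * v x) ~~> v x" by (rule tendsto_eventually)
   qed
  qed (use v sq_truncate(1)[THEN sq_measurable] in \<open>auto simp: indicator_def sq_measurable\<close>)
 qed (use v sq_truncate in auto)
 have s: "sq (%x. max 0 (u x))" "sq (%x. max 0 (- u x))" by (rule sq_bound[OF u]; use sq_measurable[OF u] in auto)+
 have "test_dense W (%x. max 0 (u x) + (-1) * max 0 (- u x))" by (rule test_dense_add[OF W s(1) _ * test_dense_scale[OF *]]) (use s sq_scaleR[OF s(2), of "-1"] in auto)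
 moreover have "(%x. max 0 (u x) + (-1) * max 0 (- u x)) = u" by (auto simp: max_def)
 ultimately show ?thesis by simp
qed

lemma test_fun_approx_seq:
 fixes u :: "'a::euclidean_space => real"
 assumes "open W" "sq u"
 obtains \<phi> where "!!n::nat. test_fun W (\<phi> n)" "(%n. N2 (%x. \<phi> n x - indicator W x * u x)) ~~> 0"
proof -
 have "\<exists>\<phi>. test_fun W \<phi> & N2 (%x. \<phi> x - indicator W x * u x) < inverse (real (Suc n))" for n using test_dense[OF assms] unfolding test_dense_def by simp
 then obtain \<phi> where \<phi>: "!!n. test_fun W (\<phi> n) & N2 (%x. \<phi> n x - indicator W x * u x) < inverse (real (Suc n))" by metis
 have "(%n. N2 (%x. \<phi> n x - indicator W x * u x)) ~~> 0" by (rule tendsto_sandwich[OF _ _ tendsto_const LIMSEQ_inverse_real_of_nat]) (use \<phi> in \<open>auto intro!: always_eventually less_imp_le\<close>)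
 with \<phi> that show thesis by blast
qed

text \<open>Approximating k itself on W by test functions turns the hypothesis into a vanishing
  integral of k^2 over W.\<close>

lemma fundamental_lemma:
 fixes k :: "'a::euclidean_space => real"
 assumes "open W" "sq k" "!!\<phi>. test_fun W \<phi> ==> (LBINT z. k z * \<phi> z) = 0"
 shows "AE z in lborel. z \<in> W --> k z = 0"
proof -
 obtain \<phi> where \<phi>: "!!n::nat. test_fun W (\<phi> n)" "(%n. N2 (%x. \<phi> n x - indicator W x * k x)) ~~> 0" using test_fun_approx_seq[OF assms(1,2)] by blast
 have s: "sq (%x. indicator W x * k x)" using assms by (auto intro: sq_indicator_mult)
 have "(%n. \<integral>z. \<phi> n z * k z \<partial>lborel) ~~> (LBINT z. (indicator W z * k z) * k z)" by (rule mult_integral_LIMSEQ[OF test_fun_sq[OF \<phi>(1)] s assms(2) \<phi>(2)])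
 moreover have "(LBINT z. \<phi> n z * k z) = 0" for n using assms(3)[OF \<phi>(1)[of n]] by (simp add: mult.commute)
 ultimately have "(LBINT z. (indicator W z * k z) * k z) = 0" by (simp add: LIMSEQ_const_iff)
 moreover have "(%z. (indicator W z * k z) * k z) = (%z. (norm (indicator W z * k z))^2)" by (auto simp: indicator_def power2_eq_square)
 ultimately have "N2 (%z. indicator W z * k z) = 0" by (simp add: N2_def)
 with s have "AE z in lborel. indicator W z * k z = 0" by (simp add: N2_eq_0_iff)
 then show ?thesis by eventually_elim (auto simp: indicator_def)
qed

subsection \<open>Completeness and weak compactness\<close>

lemma nn_integral_norm_square: "sq f ==> (\<integral>\<^sup>+x. ennreal ((norm (f x))^2) \<partial>lborel) = ennreal (N2 f)" unfolding N2_def by (rule nn_integral_eq_integral) (auto simp: sq_integrable)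

lemma sqI_nn_integral:
 assumes "h \<in> borelm" "(\<integral>\<^sup>+x. ennreal ((norm (h x))^2) \<partial>lborel) <= ennreal e" "0 <= e"
 shows "sq h" "N2 h <= e"
proof -
 have m: "(%x. (norm (h x))^2) \<in> borel_measurable lborel" using assms(1) by measurable
 have "(\<integral>\<^sup>+x. ennreal ((norm (h x))^2) \<partial>lborel) < \<infinity>" using assms(2) by (simp add: order.strict_trans1)
 then show s: "sq h" unfolding sq_def using assms(1) by (auto intro!: integrableI_nonneg[OF m])
 show "N2 h <= e" using assms(2,3) unfolding nn_integral_norm_square[OF s] by simp
qed

lemma sq_Fatou:
 assumes "!!n. sq (h n)" "!!n::nat. N2 (h n) <= e" "k \<in> borelm"
  "AE x in lborel. (%n. h n x) ~~> k x"
 shows "sq k" "N2 k <= e"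
proof -
 have e: "0 <= e" using assms(2)[of 0] N2_nonneg[of "h 0"] by linarith
 have [measurable]: "!!n. h n \<in> borelm" using assms(1) by (rule sq_measurable)
 have "(\<integral>\<^sup>+x. ennreal ((norm (k x))^2) \<partial>lborel) = (\<integral>\<^sup>+x. liminf (%n. ennreal ((norm (h n x))^2)) \<partial>lborel)"
 proof (rule nn_integral_cong_AE)
  show "AE x in lborel. ennreal ((norm (k x))^2) = liminf (%n. ennreal ((norm (h n x))^2))" using assms(4)
  proof eventually_elim
   case (elim x)
   then have "(%n. ennreal ((norm (h n x))^2)) ~~> ennreal ((norm (k x))^2)" by (intro tendsto_intros tendsto_ennrealI)
   from lim_imp_Liminf[OF trivial_limit_sequentially this] show ?case by simp
  qed
 qed
 also have "... <= liminf (%n. \<integral>\<^sup>+x. ennreal ((norm (h n x))^2) \<partial>lborel)" by (rule nn_integral_liminf) measurable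
 also have "... = liminf (%n. ennreal (N2 (h n)))" by (simp add: nn_integral_norm_square assms(1))
 also have "... <= liminf (%n::nat. ennreal e)" by (rule Liminf_mono) (use assms(2) e in \<open>auto intro!: always_eventually ennreal_leI\<close>)
 also have "... = ennreal e" by (simp add: Liminf_const)
 finally show "sq k" "N2 k <= e" using sqI_nn_integral[OF assms(3) _ e] by auto
qed

text \<open>Riesz-Fischer: a fast subsequence converges almost everywhere, Fatou shows that its
  limit is approached in norm, and the Cauchy property carries this to the whole sequence.\<close>

lemma sq_complete:
 fixes f :: "nat => 'a::euclidean_space => 'b::euclidean_space"
 assumes sq: "!!n. sq (f n)"
  and Cau: "!!e. e > 0 ==> \<exists>K. \<forall>k\<ge>K. \<forall>j\<ge>k. N2 (%x. f k x - f j x) <= e"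
 obtains g where "sq g" "(%n. N2 (%x. f n x - g x)) ~~> 0"
proof -
 have [measurable]: "!!n. f n \<in> borelm" using sq by (rule sq_measurable)
 have "\<exists>K. \<forall>k\<ge>K. \<forall>j\<ge>k. N2 (%x. f k x - f j x) <= (1/4)^i" for i :: nat by (rule Cau) simp
 then obtain K where K: "!!i k j. K i <= k ==> k <= j ==> N2 (%x. f k x - f j x) <= (1/4)^i" by metis
 \<comment> \<open>Partial sums of the thresholds plus n give an index sequence that is monotone,
   unbounded and past each threshold.\<close>
 define r where "r n = (\<Sum>i\<le>n. K i) + n" for n
 have r1: "K n <= r n" for n unfolding r_def using member_le_sum[of n "{..n}" K] by simp
 have r2: "r n <= r (Suc n)" for n by (simp add: r_def)
 have r3: "n <= r n" for n by (simp add: r_def)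
 have r_mono: "r m <= r n" if "m <= n" for m n using lift_Suc_mono_le[of r, OF r2 that] .
 define g where "g n x = norm (f (r (Suc n)) x - f (r n) x)" for n x
 have [measurable]: "!!n. g n \<in> borelm" unfolding g_def by measurable
 have gN: "(\<integral>\<^sup>+x. ennreal ((g n x)^2) \<partial>lborel) <= ennreal ((1/4)^n)" for n
 proof -
  have "(\<integral>\<^sup>+x. ennreal ((g n x)^2) \<partial>lborel) = ennreal (N2 (%x. f (r n) x - f (r (Suc n)) x))" unfolding g_def using nn_integral_norm_square[OF sq_diff[OF sq sq], of "r n" "r (Suc n)"] by (simp add: norm_minus_commute)
  also have "... <= ennreal ((1/4)^n)" by (intro ennreal_leI K r1 r2)
  finally show ?thesis .
 qed
 have "(\<integral>\<^sup>+x. (\<Sum>n. ennreal (2^n * (g n x)^2)) \<partial>lborel) = (\<Sum>n. \<integral>\<^sup>+x. ennreal (2^n * (g n x)^2) \<partial>lborel)" by (rule nn_integral_suminf) measurable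
 also have "... <= (\<Sum>n. ennreal ((1/2)^n))"
 proof (intro suminf_le summableI)
  fix n
  have "(\<integral>\<^sup>+x. ennreal (2^n * (g n x)^2) \<partial>lborel) = ennreal (2^n) * (\<integral>\<^sup>+x. ennreal ((g n x)^2) \<partial>lborel)" by (simp add: ennreal_mult nn_integral_cmult)
  also have "... <= ennreal (2^n) * ennreal ((1/4)^n)" by (intro mult_left_mono gN) simp
  also have "... = ennreal ((1/2)^n)" by (simp add: ennreal_mult[symmetric] power_mult_distrib[symmetric])
  finally show "(\<integral>\<^sup>+x. ennreal (2^n * (g n x)^2) \<partial>lborel) <= ennreal ((1/2)^n)" .
 qed
 also have "... = ennreal (\<Sum>n. (1/2)^n)" by (rule suminf_ennreal2) auto
 also have "... < \<infinity>" by simp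
 finally have "AE x in lborel. (\<Sum>n. ennreal (2^n * (g n x)^2)) ~= \<infinity>" by (intro nn_integral_PInf_AE) (auto simp: less_top)
 then have ae: "AE x in lborel. convergent (%n. f (r n) x)"
 proof eventually_elim
  case (elim x)
  have s1: "summable (%n. 2^n * (g n x)^2)" using elim by (intro summable_suminf_not_top) (auto simp: top_unique less_top)
  have s2: "summable (%n. (1/2::real)^n)" by (rule summable_geometric) simp
  have "summable (%n. g n x)"
  proof (rule summable_comparison_test'[OF summable_add[OF s1 s2]])
   fix n :: nat
   \<comment> \<open>The weight 2^n in the series above survives increments whose squared norms
     decay like 4^-n, and by completing the square against 2^-n it still dominates the increments
     themselves.\<close>
   have "2 * (g n x * 1) <= 2^n * (g n x)^2 + (1/2)^n"
   proof -
    have "0 <= (2^n * g n x - 1)^2 / 2^n" by simp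
    also have "... = 2^n * (g n x)^2 + (1/2)^n - 2 * g n x" by (simp add: power2_diff power_mult_distrib field_simps power2_eq_square)
    finally show ?thesis by simp
   qed
   moreover have "0 <= g n x" by (simp add: g_def)
   ultimately show "norm (g n x) <= 2^n * (g n x)^2 + (1/2)^n" by simp
  qed
  then have "summable (%n. f (r (Suc n)) x - f (r n) x)" unfolding g_def by (rule summable_norm_cancel)
  then have "convergent (%n. (\<Sum>i<n. f (r (Suc i)) x - f (r i) x) + f (r 0) x)" by (intro convergent_add convergent_const) (simp add: summable_iff_convergent)
  then show ?case by (simp add: sum_lessThan_telescope[of "%n. f (r n) x"])
 qed
 define h where "h x = lim (%n. f (r n) x)" for x
 have [measurable]: "h \<in> borelm" unfolding h_def by (rule borel_measurable_lim_metric) measurable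
 have lim: "AE x in lborel. (%n. f (r n) x) ~~> h x" using ae unfolding h_def by eventually_elim (simp add: convergent_LIMSEQ_iff)
 \<comment> \<open>Fatou in the difference of the terms n and n + m of the subsequence as m
   grows.\<close>
 have est: "sq (%x. f (r n) x - h x) & N2 (%x. f (r n) x - h x) <= (1/4)^n" for n
 proof -
  have "AE x in lborel. (%m. f (r n) x - f (r (n + m)) x) ~~> f (r n) x - h x" using lim
  proof eventually_elim
   case (elim x)
   from LIMSEQ_ignore_initial_segment[OF this, of n]
   show ?case by (intro tendsto_intros) (simp add: add.commute)
  qed
  from sq_Fatou[OF _ _ _ this, of "(1/4)^n"] show ?thesis using sq_diff[OF sq sq] K[OF r1 r_mono] by auto
 qed
 have sh: "sq h" using sq_diff[OF sq[of "r 0"] conjunct1[OF est[of 0]]] by simp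
 have "(%n. N2 (%x. f n x - h x)) ~~> 0"
 proof (rule LIMSEQ_I)
  fix e :: real assume "e > 0"
  obtain n where n: "(1/4::real)^n < e/8" using real_arch_pow_inv[of "e/8" "1/4"] \<open>e > 0\<close> by auto
  obtain K' where K': "!!k j. K' <= k ==> k <= j ==> N2 (%x. f k x - f j x) <= e/8" using Cau[of "e/8"] \<open>e > 0\<close> by auto
  have "norm (N2 (%x. f k x - h x) - 0) < e" if "k \<ge> K'" for k
  proof -
   define j where "j = max k n"
   have "N2 (%x. f k x - f (r j) x) <= e/8" using r3[of j] by (intro K' that) (simp add: j_def)
   moreover have "N2 (%x. f (r j) x - h x) <= (1/4)^j" using est by blast
   moreover have "(1/4::real)^j <= (1/4)^n" by (rule power_decreasing) (auto simp: j_def)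
   ultimately have "N2 (%x. f k x - h x) < e" using N2_triangle[OF sq[of k] sq[of "r j"] sh] n \<open>e > 0\<close> by linarith
   then show ?thesis by simp
  qed
  then show "\<exists>no. \<forall>n\<ge>no. norm (N2 (%x. f n x - h x) - 0) < e" by blast
 qed
 with sh that show thesis by blast
qed

section \<open>Convex combinations and Mazur's lemma\<close>

lemma N2_parallelogram:
 assumes "sq f" "sq g"
 shows "N2 (%x. f x - g x) = 2 * N2 f + 2 * N2 g - 4 * N2 (%x. (1/2) *\<^sub>R (f x + g x))"
proof -
 have p: "(norm (a - b))^2 = 2 * (norm a)^2 + 2 * (norm b)^2 - 4 * (norm ((1/2) *\<^sub>R (a + b)))^2" for a b :: 'b unfolding power2_norm_eq_inner by (simp add: inner_diff_left inner_diff_right inner_add_left inner_add_right inner_commute field_simps)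
 show ?thesis unfolding N2_def p using assms sq_integrable[OF sq_scaleR[OF sq_add[OF assms], of "1/2"]] by (simp add: sq_integrable)
qed

text \<open>Keeping the weights on the tail from k on is what lets convex combinations retain the
  limit of a real sequence as k grows; the bound m makes the sums finite.\<close>

definition convex_weights :: "nat => (nat => real) => nat => bool" where
 "convex_weights k c m \<longleftrightarrow> (\<forall>i. 0 <= c i) & (\<forall>i. c i ~= 0 --> k <= i & i < m) & (\<Sum>i<m. c i) = 1"

lemma convex_weights_sum:
 fixes f :: "nat => 'b::real_vector"
 assumes "convex_weights k c m" "m <= M"
 shows "(\<Sum>i<M. c i *\<^sub>R f i) = (\<Sum>i<m. c i *\<^sub>R f i)"
proof (rule sum.mono_neutral_right)
 show "\<forall>i\<in>{..<M} - {..<m}. c i *\<^sub>R f i = 0"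
 proof
  fix i assume "i \<in> {..<M} - {..<m}"
  then have "c i = 0" using assms(1) by (auto simp: convex_weights_def)
  then show "c i *\<^sub>R f i = 0" by simp
 qed
qed (use assms in auto)

lemma convex_weights_mono: "convex_weights k c m ==> m <= M ==> l <= k ==> convex_weights l c M" using convex_weights_sum[of k c m M "%_. 1::real"] by (force simp: convex_weights_def)

lemma convex_weights_mid:
 assumes "convex_weights k c m" "convex_weights k c' m"
 shows "convex_weights k (%i. (c i + c' i) / 2) m"
proof -
 have "(\<Sum>i<m. (c i + c' i) / 2) = 1" using assms by (simp add: convex_weights_def sum_divide_distrib[symmetric] sum.distrib)
 then show ?thesis using assms unfolding convex_weights_def by (auto; metis add.right_neutral div_0)
qed

lemma convex_weights_LIMSEQ:
 fixes a :: "nat => real"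
 assumes "a ~~> l" "!!k. convex_weights k (c k) (m k)"
 shows "(%k. \<Sum>i<m k. c k i * a i) ~~> l"
proof (rule LIMSEQ_I)
 fix e :: real assume "e > 0"
 with assms(1) obtain K where K: "!!i. i \<ge> K ==> \<bar>a i - l\<bar> < e/2" using LIMSEQ_D[of a l "e/2"] by auto
 have "norm ((\<Sum>i<m k. c k i * a i) - l) < e" if "k \<ge> K" for k
 proof -
  have w: "!!i. 0 <= c k i" "!!i. c k i ~= 0 ==> k <= i" "(\<Sum>i<m k. c k i) = 1" using assms(2)[of k] by (auto simp: convex_weights_def)
  have "(\<Sum>i<m k. c k i * a i) - l = (\<Sum>i<m k. c k i * (a i - l))" using w(3) by (simp add: algebra_simps sum_subtractf sum_distrib_left[symmetric])
  also have "norm ... <= (\<Sum>i<m k. c k i * (e/2))"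
  proof (rule sum_norm_le)
   fix i show "norm (c k i * (a i - l)) <= c k i * (e / 2)" using w(1)[of i] w(2)[of i] K[of i] that by (cases "c k i = 0") (auto simp: abs_mult intro!: mult_left_mono less_imp_le)
  qed
  also have "... = e/2" using w(3) by (simp add: sum_distrib_right[symmetric] sum_divide_distrib[symmetric])
  also have "... < e" using \<open>e > 0\<close> by simp
  finally show ?thesis .
 qed
 then show "\<exists>no. \<forall>n\<ge>no. norm ((\<Sum>i<m n. c n i * a i) - l) < e" by blast
qed

text \<open>Minimization takes the place of weak compactness: \<open>d k\<close> is the infimum of
  the squared norm over convex combinations of the tail from k. It increases and is bounded, and
  near minimizers of the tails form a Cauchy sequence by the parallelogram law, because midpoints
  are again admissible.\<close>

lemma Mazur:
 fixes x :: "nat => 'a::euclidean_space => 'b::euclidean_space"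
 assumes sq: "!!n. sq (x n)" and bd: "!!n. N2 (x n) <= C"
 obtains c m y where "!!k. convex_weights k (c k) (m k)" "sq y"
  "(%k. N2 (%z. (\<Sum>i<m k. c k i *\<^sub>R x i z) - y z)) ~~> 0"
proof -
 define comb where "comb c m z = (\<Sum>i<m. c i *\<^sub>R x i z)" for c :: "nat => real" and m z
 have sc: "sq (comb c m)" for c m
 proof -
  have "sq (%z. \<Sum>i<m. c i *\<^sub>R x i z)" by (intro sq_sum sq_scaleR sq)
  then show ?thesis by (simp add: comb_def[abs_def])
 qed
 define S where "S k = {N2 (comb c m) | c m. convex_weights k c m}" for k
 have bb: "bdd_below (S k)" for k by (rule bdd_belowI[of _ 0]) (auto simp: S_def)
 have unit: "convex_weights k (%i. if i = k then 1 else 0) (Suc k)" for k by (auto simp: convex_weights_def)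
 have Sk: "N2 (x k) \<in> S k" for k
 proof -
  have "comb (%i. if i = k then 1 else 0) (Suc k) z = x k z" for z
  proof -
   have "comb (%i. if i = k then 1 else 0) (Suc k) z = (\<Sum>i<Suc k. if i = k then x i z else 0)" unfolding comb_def by (rule sum.cong) auto
   then show ?thesis by simp
  qed
  then have "comb (%i. if i = k then 1 else 0) (Suc k) = x k" by (rule ext)
  moreover have "N2 (comb (%i. if i = k then 1 else 0) (Suc k)) \<in> S k" unfolding S_def mem_Collect_eq by (rule exI, rule exI, rule conjI, rule refl, rule unit)
  ultimately show ?thesis by (simp only:)
 qed
 define d where "d k = Inf (S k)" for k
 have dC: "d k <= C" for k unfolding d_def using cInf_lower[OF Sk bb] bd order_trans by blast
 have Smono: "S l \<subseteq> S k" if "k <= l" for k l unfolding S_def using convex_weights_mono[OF _ order_refl that] by blast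
 have ne: "S l ~= {}" for l using Sk by blast
 have d_mono: "d k <= d l" if "k <= l" for k l unfolding d_def by (rule cInf_superset_mono[OF ne bb Smono[OF that]])
 have "convergent d"
 proof (rule Bseq_mono_convergent)
  show "Bseq d"
  proof (rule BseqI')
   fix n
   have "0 <= d n" unfolding d_def by (rule cInf_greatest[OF ne]) (auto simp: S_def)
   then show "norm (d n) <= \<bar>C\<bar>" using dC[of n] by simp
  qed
 qed (use d_mono in blast)
 then have "Cauchy d" by (rule convergent_Cauchy)
 have "\<exists>c m. convex_weights k c m & N2 (comb c m) < d k + inverse (real (Suc k))" for k
 proof -
  have "Inf (S k) < d k + inverse (real (Suc k))" by (simp add: d_def)
  then obtain s where "s \<in> S k" "s < d k + inverse (real (Suc k))" using cInf_lessD[of "S k"] Sk by blast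
  then show ?thesis by (auto simp: S_def)
 qed
 then obtain c m where cm: "!!k. convex_weights k (c k) (m k)" "!!k. N2 (comb (c k) (m k)) < d k + inverse (real (Suc k))" by metis
 define y where "y k = comb (c k) (m k)" for k
 \<comment> \<open>The midpoint of \<open>y k\<close> and \<open>y j\<close> combines the tail from
   k, so its squared norm is at least \<open>d k\<close>. The parallelogram law then leaves only the
   growth of d and the two slacks of the near minimizers.\<close>
 have diff: "N2 (%z. y k z - y j z) <= 2 * (d j - d k) + 4 * inverse (real (Suc k))" if "k <= j" for k j
 proof -
  define M where "M = max (m k) (m j)"
  have w: "convex_weights k (c k) M" "convex_weights k (c j) M" using convex_weights_mono[OF cm(1)[of k], of M k] convex_weights_mono[OF cm(1)[of j], of M k] that by (auto simp: M_def)
  define e where "e i = (c k i + c j i) / 2" for i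
  have "comb e M z = (1/2) *\<^sub>R (y k z + y j z)" for z
  proof -
   have "y k z = comb (c k) M z" "y j z = comb (c j) M z" unfolding y_def comb_def by (rule convex_weights_sum[symmetric, OF cm(1)]; simp add: M_def)+
   then show ?thesis unfolding comb_def e_def by (simp add: scaleR_sum_right sum.distrib[symmetric] scaleR_add_left[symmetric] flip: scaleR_add_left)
  qed
  moreover have "convex_weights k e M" unfolding e_def by (rule convex_weights_mid[OF w])
  then have "d k <= N2 (comb e M)" unfolding d_def by (intro cInf_lower bb) (auto simp: S_def)
  ultimately have "d k <= N2 (%z. (1/2) *\<^sub>R (y k z + y j z))" by (metis (no_types, lifting) ext)
  moreover have "inverse (real (Suc j)) <= inverse (real (Suc k))" using that by (simp add: le_imp_inverse_le)
  ultimately show ?thesis using N2_parallelogram[of "y k" "y j"] cm(2)[of k] cm(2)[of j] sc unfolding y_def by smt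
 qed
 have "\<exists>K. \<forall>k\<ge>K. \<forall>j\<ge>k. N2 (%z. y k z - y j z) <= e" if "e > 0" for e
 proof -
  obtain K1 where K1: "!!k j. k \<ge> K1 ==> j \<ge> K1 ==> dist (d j) (d k) < e/4" using CauchyD[OF \<open>Cauchy d\<close>, of "e/4"] \<open>e > 0\<close> by (auto simp: dist_norm)
  obtain K2 where K2: "inverse (real (Suc K2)) < e/8" using reals_Archimedean[of "e/8"] \<open>e > 0\<close> by auto
  have "N2 (%z. y k z - y j z) <= e" if "k \<ge> max K1 K2" "j \<ge> k" for k j
  proof -
   have gen: "a <= e" if "a <= 2*p + 4*q" "p < e/4" "q <= r" "r < e/8" for a p q r using that by linarith
   have p: "d j - d k < e/4" using K1[of k j] that unfolding dist_real_def by linarith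
   have q: "inverse (real (Suc k)) <= inverse (real (Suc K2))" using that by (simp add: le_imp_inverse_le)
   show ?thesis by (rule gen[OF diff[OF that(2)] p q K2])
  qed
  then show ?thesis by blast
 qed
 moreover have "sq (y n)" for n unfolding y_def by (rule sc)
 ultimately obtain g where "sq g" "(%n. N2 (%x. y n x - g x)) ~~> 0" using sq_complete[of y] by blast
 then show thesis using that[OF cm(1), of g] by (simp add: y_def comb_def)
qed

subsection \<open>Translations and weak derivatives\<close>

lemma integral_shift:
 fixes f :: "'a::euclidean_space => 'b::{banach,second_countable_topology}"
 assumes "f \<in> borelm"
 shows "(LBINT z. f (z + c)) = (LBINT z. f z)" using integral_distr[of "(+) c" lborel borel f] assms by (simp add: lborel_distr_plus add.commute)

lemma integrable_shift:
 fixes f :: "'a::euclidean_space => 'b::{banach,second_countable_topology}"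
 assumes "integrable lborel f" shows "integrable lborel (%z. f (z + c))" using integrable_distr[of "(+) c" lborel borel f] assms by (simp add: lborel_distr_plus add.commute)

lemma AE_shift:
 fixes c :: "'a::euclidean_space"
 assumes "AE z in lborel. P z" shows "AE z in lborel. P (z + c)"
proof -
 have "AE z in distr lborel borel ((+) c). P z" using assms by (simp only: lborel_distr_plus)
 from AE_distrD[OF _ this] show ?thesis by (simp add: add.commute)
qed

lemma sq_shift: assumes "sq f" shows "sq (%z. f (z + c))"
proof -
 have [measurable]: "f \<in> borelm" using assms by (rule sq_measurable)
 show ?thesis unfolding sq_def using integrable_shift[OF sq_integrable[OF assms]] by simp
qed

lemma N2_shift: assumes "sq f" shows "N2 (%z. f (z + c)) = N2 f"
proof -
 have [measurable]: "f \<in> borelm" using assms by (rule sq_measurable)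
 show ?thesis unfolding N2_def by (rule integral_shift) measurable
qed

lemma borel_eq_prod: "(borel :: ('a::euclidean_space \<times> 'b::euclidean_space) measure) = borel \<Otimes>\<^sub>M borel" by (simp add: borel_prod)

section \<open>Integrals over a parameter\<close>

locale param_avg =
 fixes F :: "'a::euclidean_space => real => 'b::euclidean_space" and S :: "real set" and h C :: real
 assumes F_meas[measurable]: "case_prod F \<in> borel_measurable (borel \<Otimes>\<^sub>M borel)"
  and S_meas[measurable]: "S \<in> sets borel" and S_emeasure: "emeasure lborel S = ennreal h" and h_nonneg: "0 <= h"
  and F_sq: "!!r. r \<in> S ==> sq (%z. F z r)" and F_N2: "!!r. r \<in> S ==> N2 (%z. F z r) <= C"
  and C_nonneg: "0 <= C"
begin

text \<open>Line integrals of derivatives, backward time integrals and moving averages in time are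
  all instances. Where a section is not integrable the value is 0 by convention, which happens only
  on a null set.\<close>

definition avg :: "'a => 'b" where "avg z = (LBINT r. indicator S r *\<^sub>R F z r)"

lemma F_meas'[measurable]: "(%x. F (fst x) (snd x)) \<in> borel_measurable (borel \<Otimes>\<^sub>M borel)" using F_meas by (simp add: case_prod_beta')

lemma avg_measurable[measurable]: "avg \<in> borelm"
proof -
 have "(%z. \<integral>r. indicator S r *\<^sub>R F z r \<partial>lborel) \<in> borel_measurable (lborel :: 'a measure)" by (rule lborel.borel_measurable_lebesgue_integral) measurable
 then show ?thesis by (simp add: avg_def[abs_def])
qed

definition E where "E z = (\<integral>\<^sup>+r. indicator S r * ennreal ((norm (F z r))^2) \<partial>lborel)"

lemma E_measurable[measurable]: "E \<in> borelm"
proof -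
 have "(%z. \<integral>\<^sup>+r. indicator S r * ennreal ((norm (F z r))^2) \<partial>lborel) \<in> borel_measurable (lborel :: 'a measure)" by (rule lborel.borel_measurable_nn_integral) measurable
 then show ?thesis by (simp add: E_def[abs_def])
qed

lemma E_total: "(\<integral>\<^sup>+z. E z \<partial>lborel) <= ennreal (h * C)"
proof -
 have "(\<integral>\<^sup>+z. E z \<partial>lborel) = (\<integral>\<^sup>+r. (\<integral>\<^sup>+z. indicator S r * ennreal ((norm (F z r))^2) \<partial>lborel) \<partial>lborel)" unfolding E_def by (rule lborel_pair.Fubini'[symmetric]) measurable
 also have "... <= (\<integral>\<^sup>+r. ennreal C * indicator S r \<partial>lborel)"
 proof (rule nn_integral_mono)
  fix r
  show "(\<integral>\<^sup>+z. indicator S r * ennreal ((norm (F z r))^2) \<partial>lborel) <= ennreal C * indicator S r" using F_sq[of r] F_N2[of r] nn_integral_norm_square[of "%z. F z r"] by (cases "r \<in> S") (auto intro!: ennreal_leI)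
 qed
 also have "... = ennreal C * ennreal h" by (simp add: nn_integral_cmult_indicator S_emeasure)
 finally show ?thesis using C_nonneg h_nonneg by (simp add: ennreal_mult[symmetric] mult.commute)
qed

lemma CS_slice: "(\<integral>\<^sup>+r. indicator S r * ennreal (norm (F z r)) \<partial>lborel)^2 <= ennreal h * E z"
proof -
 have "(\<integral>\<^sup>+r. indicator S r * (indicator S r * ennreal (norm (F z r))) \<partial>lborel)^2
  <= (\<integral>\<^sup>+r. (indicator S r)^2 \<partial>lborel) * (\<integral>\<^sup>+r. (indicator S r * ennreal (norm (F z r)))^2 \<partial>lborel)" by (rule Cauchy_Schwarz_nn_integral) measurable
 moreover have "(%r. indicator S r * (indicator S r * ennreal (norm (F z r)))) = (%r. indicator S r * ennreal (norm (F z r)))"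
  "(%r. (indicator S r)^2 :: ennreal) = indicator S"
  "(%r. (indicator S r * ennreal (norm (F z r)))^2) = (%r. indicator S r * ennreal ((norm (F z r))^2))" by (auto simp: indicator_def ennreal_power)
 ultimately show ?thesis by (simp add: E_def S_emeasure)
qed

text \<open>A section that is not integrable has integral 0, so the bound holds at every point and
  not only almost everywhere.\<close>

lemma norm_avg_le: "ennreal (norm (avg z)) <= (\<integral>\<^sup>+r. indicator S r * ennreal (norm (F z r)) \<partial>lborel)"
proof (cases "integrable lborel (%r. indicator S r *\<^sub>R F z r)")
 case True
 have "ennreal (norm (avg z)) <= (\<integral>\<^sup>+r. ennreal (norm (indicator S r *\<^sub>R F z r)) \<partial>lborel)" unfolding avg_def by (rule integral_norm_bound_ennreal[OF True])
 then show ?thesis by (simp add: ennreal_mult ennreal_indicator)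
qed (simp add: avg_def not_integrable_integral_eq)

lemma avg_square_le: "ennreal ((norm (avg z))^2) <= ennreal h * E z"
proof -
 have "ennreal ((norm (avg z))^2) = (ennreal (norm (avg z)))^2" by (simp add: ennreal_power)
 also have "... <= (\<integral>\<^sup>+r. indicator S r * ennreal (norm (F z r)) \<partial>lborel)^2" by (rule power_mono[OF norm_avg_le]) simp
 also note CS_slice
 finally show ?thesis .
qed

lemma sq_avg: "sq avg" and N2_avg: "N2 avg <= h^2 * C"
proof -
 have "(\<integral>\<^sup>+z. ennreal ((norm (avg z))^2) \<partial>lborel) <= (\<integral>\<^sup>+z. ennreal h * E z \<partial>lborel)" by (rule nn_integral_mono) (rule avg_square_le)
 also have "... = ennreal h * (\<integral>\<^sup>+z. E z \<partial>lborel)" by (rule nn_integral_cmult) measurable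
 also have "... <= ennreal h * ennreal (h * C)" by (rule mult_left_mono[OF E_total]) simp
 also have "... = ennreal (h^2 * C)" using h_nonneg C_nonneg by (simp add: ennreal_mult[symmetric] power2_eq_square mult.assoc)
 finally show "sq avg" "N2 avg <= h^2 * C" using sqI_nn_integral[OF avg_measurable] C_nonneg by auto
qed

lemma AE_integrable: "AE z in lborel. integrable lborel (%r. indicator S r *\<^sub>R F z r)"
proof -
 have "(\<integral>\<^sup>+z. E z \<partial>lborel) ~= \<infinity>" using E_total by (auto simp: top_unique)
 then have "AE z in lborel. E z ~= \<infinity>" by (intro nn_integral_PInf_AE) auto
 then show ?thesis
 proof eventually_elim
  case (elim z)
  then have "ennreal h * E z < \<infinity>" by (auto simp: ennreal_mult_less_top less_top)
  then have "(\<integral>\<^sup>+r. indicator S r * ennreal (norm (F z r)) \<partial>lborel)^2 < \<infinity>" using CS_slice[of z] by (rule le_less_trans[rotated])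
  then have "(\<integral>\<^sup>+r. indicator S r * ennreal (norm (F z r)) \<partial>lborel) < \<infinity>" by (auto simp: power2_eq_square ennreal_mult_less_top)
  moreover have "(%r. F z r) \<in> borelm" by measurable
  ultimately show ?case by (intro integrableI_bounded) (auto simp: ennreal_mult ennreal_indicator)
 qed
qed

text \<open>Fubini; the double integral converges absolutely by Cauchy-Schwarz in z for each r and
  the finite measure of S.\<close>

lemma inner_avg:
 assumes "sq \<phi>"
 shows "(LBINT z. avg z \<bullet> \<phi> z) = (LBINT r. indicator S r * (LBINT z. F z r \<bullet> \<phi> z))"
proof -
 have [measurable]: "\<phi> \<in> borelm" using assms by (rule sq_measurable)
 define H where "H z r = indicator S r * (F z r \<bullet> \<phi> z)" for z r
 have [measurable]: "case_prod H \<in> borel_measurable (lborel \<Otimes>\<^sub>M lborel)" unfolding H_def by measurable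
 have "(\<integral>\<^sup>+x. ennreal (norm (case_prod H x)) \<partial>(lborel \<Otimes>\<^sub>M lborel)) = (\<integral>\<^sup>+r. (\<integral>\<^sup>+z. ennreal (norm (H z r)) \<partial>lborel) \<partial>lborel)" by (subst lborel_pair.nn_integral_snd[symmetric]) (auto simp: case_prod_beta')
 also have "... <= (\<integral>\<^sup>+r. ennreal (sqrt C * sqrt (N2 \<phi>)) * indicator S r \<partial>lborel)"
 proof (rule nn_integral_mono)
  fix r
  show "(\<integral>\<^sup>+z. ennreal (norm (H z r)) \<partial>lborel) <= ennreal (sqrt C * sqrt (N2 \<phi>)) * indicator S r"
  proof (cases "r \<in> S")
   case True
   have "(\<integral>\<^sup>+z. ennreal (norm (H z r)) \<partial>lborel) <= (\<integral>\<^sup>+z. ennreal (norm (F z r) * norm (\<phi> z)) \<partial>lborel)" by (rule nn_integral_mono) (auto simp: H_def True intro!: ennreal_leI Cauchy_Schwarz_ineq2)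
   also have "... = ennreal (LBINT z. norm (F z r) * norm (\<phi> z))" by (rule nn_integral_eq_integral[OF sq_integrable_norm_mult[OF F_sq[OF True] assms]]) simp
   also have "... <= ennreal (sqrt C * sqrt (N2 \<phi>))"
   proof (rule ennreal_leI)
    have "(LBINT z. norm (F z r) * norm (\<phi> z)) <= sqrt (N2 (%z. F z r)) * sqrt (N2 \<phi>)" by (rule Cauchy_Schwarz_norm_mult[OF F_sq[OF True] assms])
    also have "... <= sqrt C * sqrt (N2 \<phi>)" using F_N2[OF True] by (intro mult_right_mono) auto
    finally show "(LBINT z. norm (F z r) * norm (\<phi> z)) <= sqrt C * sqrt (N2 \<phi>)" .
   qed
   finally show ?thesis using True by simp
  qed (simp add: H_def)
 qed
 also have "... = ennreal (sqrt C * sqrt (N2 \<phi>)) * ennreal h" by (simp add: nn_integral_cmult_indicator S_emeasure)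
 also have "... < \<infinity>" by (simp add: ennreal_mult[symmetric] C_nonneg h_nonneg)
 finally have int: "integrable (lborel \<Otimes>\<^sub>M lborel) (case_prod H)" by (intro integrableI_bounded) auto
 have "(LBINT z. avg z \<bullet> \<phi> z) = (LBINT z. (LBINT r. H z r))"
 proof (rule integral_cong_AE)
  show "(%z. avg z \<bullet> \<phi> z) \<in> borel_measurable lborel" by measurable
  show "(%z. \<integral>r. H z r \<partial>lborel) \<in> borel_measurable lborel" by (rule lborel.borel_measurable_lebesgue_integral) (simp add: \<open>case_prod H \<in> _\<close>)
  show "AE z in lborel. avg z \<bullet> \<phi> z = (LBINT r. H z r)" using AE_integrable
  proof eventually_elim
   case (elim z)
   from integral_inner_left[OF this, of "\<phi> z"] show ?case by (simp add: avg_def H_def)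
  qed
 qed
 also have "... = (LBINT r. (LBINT z. H z r))" by (rule lborel_pair.Fubini_integral[OF int, symmetric])
 finally show ?thesis by (simp add: H_def)
qed

end

section \<open>Weak directional derivatives and translations\<close>

definition wder :: "'a::euclidean_space set => 'a => ('a => real) => ('a => real) => bool" where
 "wder U d v g \<longleftrightarrow> (\<forall>\<phi>. test_fun U \<phi> -->
   (LBINT z. v z * frechet_derivative \<phi> (at z) d) = - (LBINT z. g z * \<phi> z))"

lemma smooth_fun_line_integral:
 assumes "smooth_fun UNIV \<phi>" "0 <= h"
 shows "(LBINT r. indicator {0..h} r * frechet_derivative \<phi> (at (z - r *\<^sub>R d)) d) = \<phi> z - \<phi> (z - h *\<^sub>R d)"
proof -
 have "((%r. - \<phi> (z - r *\<^sub>R d)) has_real_derivative frechet_derivative \<phi> (at (z - r *\<^sub>R d)) d) (at r)" for r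
 proof -
  have 1: "((%r. z - r *\<^sub>R d) has_derivative (%s. - (s *\<^sub>R d))) (at r)" by (auto intro!: derivative_eq_intros)
  have "((%r. \<phi> (z - r *\<^sub>R d)) has_derivative (%s. frechet_derivative \<phi> (at (z - r *\<^sub>R d)) (- (s *\<^sub>R d)))) (at r)" by (rule has_derivative_compose[OF 1 smooth_funD[OF assms(1)]])
  then have 2: "((%r. - \<phi> (z - r *\<^sub>R d)) has_derivative (%s. - frechet_derivative \<phi> (at (z - r *\<^sub>R d)) (- (s *\<^sub>R d)))) (at r)" by (rule has_derivative_minus)
  have L: "linear (frechet_derivative \<phi> (at (z - r *\<^sub>R d)))" using smooth_funD[OF assms(1)] has_derivative_linear by blast
  have "(%s. - frechet_derivative \<phi> (at (z - r *\<^sub>R d)) (- (s *\<^sub>R d))) = (*) (frechet_derivative \<phi> (at (z - r *\<^sub>R d)) d)" by (simp add: linear_neg[OF L] linear_scale[OF L] mult.commute fun_eq_iff)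
  with 2 show ?thesis by (simp add: has_field_derivative_def)
 qed
 moreover have "isCont (%r. frechet_derivative \<phi> (at (z - r *\<^sub>R d)) d) r" for r
 proof -
  have "continuous_on UNIV (%x. frechet_derivative \<phi> (at x) d)" by (rule smooth_fun_continuous[OF smooth_fun_deriv[OF assms(1)]])
  then have "continuous_on UNIV (%r. frechet_derivative \<phi> (at (z - r *\<^sub>R d)) d)" by (rule continuous_on_compose2) (auto intro!: continuous_intros)
  then show ?thesis by (simp add: continuous_on_eq_continuous_at)
 qed
 ultimately have "(LBINT r. frechet_derivative \<phi> (at (z - r *\<^sub>R d)) d * indicator {0..h} r) = - \<phi> (z - h *\<^sub>R d) - - \<phi> (z - 0 *\<^sub>R d)" by (intro integral_FTC_Icc_real assms(2)) auto
 then show ?thesis by (simp add: mult.commute)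
qed

text \<open>For smooth functions this is the fundamental theorem along the segment. Tested against
  \<phi>, the translation moves onto \<phi>, where that theorem applies, and the weak derivative
  moves the result back to g; \<open>WU\<close> keeps the shifted supports inside U.\<close>

lemma wder_translation:
 fixes v g :: "'a::euclidean_space => real"
 assumes v: "sq v" and g: "sq g" and wd: "wder U d v g" and W: "open W" and h: "0 <= h"
  and WU: "!!z r. z \<in> W ==> 0 <= r ==> r <= h ==> z + r *\<^sub>R d \<in> U"
 shows "AE z in lborel. z \<in> W --> v (z + h *\<^sub>R d) - v z = (LBINT r. indicator {0..h} r * g (z + r *\<^sub>R d))"
  and "sq (%z. \<integral>r. indicator {0..h} r * g (z + r *\<^sub>R d) \<partial>lborel)"
proof -
 have [measurable]: "v \<in> borelm" "g \<in> borelm" using v g by (auto simp: sq_measurable)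
 interpret J: param_avg "%z r. g (z + r *\<^sub>R d)" "{0..h}" h "N2 g"
 proof
  show "(%(z, r). g (z + r *\<^sub>R d)) \<in> borel_measurable (borel \<Otimes>\<^sub>M borel)" by measurable
 qed (use h in \<open>auto simp: sq_shift[OF g] N2_shift[OF g]\<close>)
 define J where "J z = (LBINT r. indicator {0..h} r * g (z + r *\<^sub>R d))" for z
 have Javg: "J.avg = J" unfolding J_def J.avg_def by simp
 show "sq (%z. \<integral>r. indicator {0..h} r * g (z + r *\<^sub>R d) \<partial>lborel)" using J.sq_avg unfolding Javg by (simp add: J_def[abs_def])
 have sJ: "sq J" using J.sq_avg unfolding Javg .
 have sv: "sq (%z. v (z + h *\<^sub>R d))" by (rule sq_shift[OF v])
 have key: "(LBINT z. (v (z + h *\<^sub>R d) - v z - J z) * \<phi> z) = 0" if t: "test_fun W \<phi>" for \<phi>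
 proof -
  have s\<phi>: "sq \<phi>" by (rule test_fun_sq[OF t])
  have [measurable]: "\<phi> \<in> borelm" using s\<phi> by (rule sq_measurable)
  let ?D = "%z. frechet_derivative \<phi> (at z) d"
  have sD: "sq ?D" by (rule test_fun_sq[OF test_fun_deriv[OF t]])
  have [measurable]: "?D \<in> borelm" using sD by (rule sq_measurable)
  interpret K: param_avg "%z r. ?D (z - r *\<^sub>R d)" "{0..h}" h "N2 ?D"
  proof
   show "(%(z, r). ?D (z - r *\<^sub>R d)) \<in> borel_measurable (borel \<Otimes>\<^sub>M borel)" by measurable
   show "sq (%z. ?D (z - r *\<^sub>R d))" for r using sq_shift[OF sD, of "- (r *\<^sub>R d)"] by simp
   show "N2 (%z. ?D (z - r *\<^sub>R d)) <= N2 ?D" for r using N2_shift[OF sD, of "- (r *\<^sub>R d)"] by simp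
  qed (use h in auto)
  have Kavg: "K.avg z = \<phi> z - \<phi> (z - h *\<^sub>R d)" for z unfolding K.avg_def using smooth_fun_line_integral[OF test_fun_smooth[OF t] h] by simp
  have s\<phi>h: "sq (%z. \<phi> (z - h *\<^sub>R d))" using sq_shift[OF s\<phi>, of "- (h *\<^sub>R d)"] by simp
  have "(LBINT z. (v (z + h *\<^sub>R d) - v z) * \<phi> z) = (LBINT z. v (z + h *\<^sub>R d) * \<phi> z) - (LBINT z. v z * \<phi> z)" by (simp add: algebra_simps sq_integrable_mult sv v s\<phi>)
  also have "(LBINT z. v (z + h *\<^sub>R d) * \<phi> z) = (LBINT z. v z * \<phi> (z - h *\<^sub>R d))" using integral_shift[of "%z. v z * \<phi> (z - h *\<^sub>R d)" "h *\<^sub>R d"] by simp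
  also have "... - (LBINT z. v z * \<phi> z) = - (LBINT z. K.avg z \<bullet> v z)" by (simp add: Kavg algebra_simps sq_integrable_mult v s\<phi> s\<phi>h)
  also have "(LBINT z. K.avg z \<bullet> v z) = (LBINT r. indicator {0..h} r * (LBINT z. ?D (z - r *\<^sub>R d) \<bullet> v z))" by (rule K.inner_avg[OF v])
  also have "... = (LBINT r. indicator {0..h} r * - (LBINT z. g (z + r *\<^sub>R d) \<bullet> \<phi> z))"
  proof (rule integral_cong[OF refl])
   fix r :: real
   show "indicator {0..h} r * (LBINT z. ?D (z - r *\<^sub>R d) \<bullet> v z) = indicator {0..h} r * - (LBINT z. g (z + r *\<^sub>R d) \<bullet> \<phi> z)"
   proof (cases "r \<in> {0..h}")
    case True
    have "test_fun U (%z. \<phi> (z - r *\<^sub>R d))" by (rule test_fun_shift[OF t]) (use WU True in auto)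
    then have "(LBINT z. v z * frechet_derivative (%z. \<phi> (z - r *\<^sub>R d)) (at z) d) = - (LBINT z. g z * \<phi> (z - r *\<^sub>R d))" using wd unfolding wder_def by blast
    moreover have "(LBINT z. g z * \<phi> (z - r *\<^sub>R d)) = (LBINT z. g (z + r *\<^sub>R d) * \<phi> z)" using integral_shift[of "%z. g z * \<phi> (z - r *\<^sub>R d)" "r *\<^sub>R d"] by simp
    ultimately show ?thesis by (simp add: frechet_derivative_shift[OF test_fun_smooth[OF t]] mult.commute)
   qed simp
  qed
  also have "... = - (LBINT r. indicator {0..h} r * (LBINT z. g (z + r *\<^sub>R d) \<bullet> \<phi> z))" by simp
  also have "(LBINT r. indicator {0..h} r * (LBINT z. g (z + r *\<^sub>R d) \<bullet> \<phi> z)) = (LBINT z. J z * \<phi> z)" using J.inner_avg[OF s\<phi>] unfolding Javg by simp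
  finally have "(LBINT z. (v (z + h *\<^sub>R d) - v z) * \<phi> z) = (LBINT z. J z * \<phi> z)" by simp
  moreover have "(LBINT z. (v (z + h *\<^sub>R d) - v z - J z) * \<phi> z) = (LBINT z. (v (z + h *\<^sub>R d) - v z) * \<phi> z) - (LBINT z. J z * \<phi> z)" by (subst integral_diff[symmetric])
    (auto intro!: sq_integrable_mult sq_diff sv v s\<phi> sJ simp: algebra_simps)
  ultimately show ?thesis by simp
 qed
 have "AE z in lborel. z \<in> W --> v (z + h *\<^sub>R d) - v z - J z = 0" by (rule fundamental_lemma[OF W sq_diff[OF sq_diff[OF sv v] sJ]]) (rule key)
 then show "AE z in lborel. z \<in> W --> v (z + h *\<^sub>R d) - v z = (LBINT r. indicator {0..h} r * g (z + r *\<^sub>R d))"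
  by eventually_elim (simp add: J_def)
qed

subsection \<open>Functions on the space-time cylinder\<close>

lemma sq_prod:
 fixes f :: "'a::euclidean_space => real" and g :: "'b::euclidean_space => real"
 assumes "sq f" "sq g"
 shows "sq (%z. f (fst z) * g (snd z))" "N2 (%z. f (fst z) * g (snd z)) = N2 f * N2 g"
proof -
 have [measurable]: "f \<in> borelm" "g \<in> borelm" using assms by (auto simp: sq_measurable)
 have m: "(%z. f (fst z) * g (snd z)) \<in> borelm" unfolding borel_eq_prod by measurable
 have "(\<integral>\<^sup>+z. ennreal ((norm (f (fst z) * g (snd z)))^2) \<partial>lborel) = (\<integral>\<^sup>+x. \<integral>\<^sup>+y. ennreal ((norm (f x))^2) * ennreal ((norm (g y))^2) \<partial>lborel \<partial>lborel)" unfolding lborel_prod[symmetric] by (subst lborel.nn_integral_fst[symmetric]) (auto simp: ennreal_mult[symmetric] power_mult_distrib)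
 also have "... = ennreal (N2 f) * ennreal (N2 g)" by (simp add: nn_integral_cmult nn_integral_multc nn_integral_norm_square[OF assms(1), simplified] nn_integral_norm_square[OF assms(2), simplified])
 also have "... = ennreal (N2 f * N2 g)" by (simp add: ennreal_mult)
 finally have eq: "(\<integral>\<^sup>+z. ennreal ((norm (f (fst z) * g (snd z)))^2) \<partial>lborel) = ennreal (N2 f * N2 g)" .
 show s: "sq (%z. f (fst z) * g (snd z))" by (rule sqI_nn_integral(1)[OF m eq_refl[OF eq]]) simp
 show "N2 (%z. f (fst z) * g (snd z)) = N2 f * N2 g" using eq unfolding nn_integral_norm_square[OF s] by (simp add: ennreal_inj)
qed

text \<open>The integrand is symmetric in t and s, so the triangles s > t and s < t contribute
  equally, and the diagonal is null. This is the source of the positivity of backward time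
  integrals.\<close>

lemma triangle_integral:
 fixes g :: "real => 'b::euclidean_space"
 assumes g: "integrable lborel g"
 shows "(LBINT t. g t \<bullet> (LBINT s. indicator {t<..} s *\<^sub>R g s)) = (norm (LBINT t. g t))^2 / 2"
proof -
 have [measurable]: "g \<in> borelm" using g by auto
 have I: "integrable (lborel \<Otimes>\<^sub>M lborel) (%(t, s). norm (g t) * norm (g s))"
 proof (rule lborel_pair.Fubini_integrable)
  show "integrable lborel (%x. \<integral>y. norm (case (x, y) of (t, s) => norm (g t) * norm (g s)) \<partial>lborel)" using g by (simp add: abs_mult)
  show "AE x in lborel. integrable lborel (%y. case (x, y) of (t, s) => norm (g t) * norm (g s))" using g by simp
 qed measurable
 have int: "integrable (lborel \<Otimes>\<^sub>M lborel) (%(t, s). c t s * (g t \<bullet> g s))"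
  if [measurable]: "case_prod c \<in> borel_measurable (borel \<Otimes>\<^sub>M borel)" and c: "!!t s. \<bar>c t s\<bar> <= 1" for c :: "real => real => real"
 proof (rule integrable_bound[OF I])
  show "(%(t, s). c t s * (g t \<bullet> g s)) \<in> borel_measurable (lborel \<Otimes>\<^sub>M lborel)"
   by measurable
  show "AE x in lborel \<Otimes>\<^sub>M lborel. norm (case x of (t, s) => c t s * (g t \<bullet> g s)) <= norm (case x of (t, s) => norm (g t) * norm (g s))"
  proof (rule AE_I2)
   fix x :: "real \<times> real"
   obtain t s where x: "x = (t, s)" by fastforce
   have "\<bar>c t s\<bar> * \<bar>g t \<bullet> g s\<bar> <= 1 * (norm (g t) * norm (g s))" by (intro mult_mono c Cauchy_Schwarz_ineq2) auto
   then show "norm (case x of (t, s) => c t s * (g t \<bullet> g s)) <= norm (case x of (t, s) => norm (g t) * norm (g s))" by (simp add: abs_mult x)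
  qed
 qed
 have ig: "integrable lborel (%s. indicator A s *\<^sub>R g s)" if "A \<in> sets borel" for A using that g by (intro integrable_mult_indicator) auto
 define I1 where "I1 = (LBINT t. (LBINT s. indicator {t<..} s * (g t \<bullet> g s)))"
 define I2 where "I2 = (LBINT t. (LBINT s. indicator {..<t} s * (g t \<bullet> g s)))"
 have m1: "(%(t::real, s). ind {t<..} s) \<in> borel_measurable (borel \<Otimes>\<^sub>M borel)"
  "(%(t::real, s). ind {..<t} s) \<in> borel_measurable (borel \<Otimes>\<^sub>M borel)" unfolding indicator_def of_bool_def case_prod_beta' greaterThan_iff lessThan_iff by measurable
 have i1: "integrable (lborel \<Otimes>\<^sub>M lborel) (%(t, s). indicator {t<..} s * (g t \<bullet> g s))" by (rule int) (use m1 in \<open>auto simp: indicator_def\<close>)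
 have i2: "integrable (lborel \<Otimes>\<^sub>M lborel) (%(t, s). indicator {..<t} s * (g t \<bullet> g s))" by (rule int) (use m1 in \<open>auto simp: indicator_def\<close>)
 have "I1 = (LBINT s. (LBINT t. indicator {t<..} s * (g t \<bullet> g s)))" unfolding I1_def by (rule lborel_pair.Fubini_integral[OF i1, symmetric])
 also have "... = I2" unfolding I2_def by (intro integral_cong refl) (auto simp: indicator_def inner_commute)
 finally have eq: "I1 = I2" .
 have "I1 + I2 = (LBINT t. (LBINT s. indicator {t<..} s * (g t \<bullet> g s)) + (LBINT s. indicator {..<t} s * (g t \<bullet> g s)))" unfolding I1_def I2_def by (rule integral_add[symmetric]; rule lborel_pair.integrable_fst) (use i1 i2 in auto)
 also have "... = (LBINT t. g t \<bullet> (LBINT s. g s))"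
 proof (rule integral_cong[OF refl])
  fix t
  have a: "integrable lborel (%s. indicator A s * (g t \<bullet> g s))" if "A \<in> sets borel" for A using integrable_inner_right[OF ig[OF that], of "g t"] by simp
  have "(LBINT s. indicator {t<..} s * (g t \<bullet> g s)) + (LBINT s. indicator {..<t} s * (g t \<bullet> g s))
   = (LBINT s. indicator {t<..} s * (g t \<bullet> g s) + indicator {..<t} s * (g t \<bullet> g s))" by (rule integral_add[symmetric]) (auto intro: a)
  also have "... = (LBINT s. g t \<bullet> g s)"
  proof (rule integral_cong_AE)
   have "AE s in lborel. s ~= t" by (rule AE_lborel_singleton)
   then show "AE s in lborel. indicator {t<..} s * (g t \<bullet> g s) + indicator {..<t} s * (g t \<bullet> g s) = g t \<bullet> g s"
    by eventually_elim (auto simp: indicator_def)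
  qed auto
  also have "... = g t \<bullet> (LBINT s. g s)" by (rule integral_inner_right) (use g in auto)
  finally show "(LBINT s. indicator {t<..} s * (g t \<bullet> g s)) + (LBINT s. indicator {..<t} s * (g t \<bullet> g s)) = g t \<bullet> (LBINT s. g s)" .
 qed
 also have "... = (LBINT s. g s) \<bullet> (LBINT s. g s)" by (rule integral_inner_left) (use g in auto)
 finally have "2 * I1 = (norm (LBINT t. g t))^2" using eq by (simp add: power2_norm_eq_inner)
 moreover have "I1 = (LBINT t. g t \<bullet> (LBINT s. indicator {t<..} s *\<^sub>R g s))" unfolding I1_def
 proof (rule integral_cong[OF refl])
  fix t
  show "(LBINT s. indicator {t<..} s * (g t \<bullet> g s)) = g t \<bullet> (LBINT s. indicator {t<..} s *\<^sub>R g s)" using integral_inner_right[OF ig[of "{t<..}"], of "g t"] by simp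
 qed
 ultimately show ?thesis by simp
qed

section \<open>Weak spatial gradients on the cylinder\<close>

locale cylinder =
 fixes \<Omega> :: "(real^'n::finite) set" and T :: real
 assumes \<Omega>_open: "open \<Omega>" and \<Omega>_bounded: "bounded \<Omega>" and T_pos: "T > 0"
begin

abbreviation D where "D \<equiv> OmT \<Omega> T"

lemma D_open: "open D" using \<Omega>_open by (intro open_Times) auto
lemma D_borel[measurable]: "D \<in> sets borel" using D_open by simp
lemma \<Omega>_borel[measurable]: "\<Omega> \<in> sets borel" using \<Omega>_open by simp
lemma D_bounded: "bounded D" using \<Omega>_bounded by (intro bounded_Times) auto
lemma sq_D: "sq (ind D)" by (rule sq_indicator) (use D_bounded emeasure_bounded_finite in auto)
lemma sq_\<Omega>: "sq (ind \<Omega>)" by (rule sq_indicator) (use \<Omega>_bounded emeasure_bounded_finite in auto)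

text \<open>Membership in L^2(0,T;H^1) with gradient G. Both functions are zero off the cylinder so
  that all integrals run over the whole space; weak differentiability is tested only inside.\<close>

definition H1 :: "((real^'n) \<times> real => real) => ((real^'n) \<times> real => real^'n) => bool" where
 "H1 v G \<longleftrightarrow> sq v & sq G & (\<forall>z. z \<notin> D --> v z = 0 & G z = 0) &
   (\<forall>\<phi> i. test_fun D \<phi> --> (LBINT z. v z * dx i \<phi> z) = - (LBINT z. (G z $ i) * \<phi> z))"

definition off :: "((real^'n) \<times> real => 'b::real_normed_vector) => bool" where
 "off v \<longleftrightarrow> (\<forall>z. z \<notin> D --> v z = 0)"

lemma offD: "off v ==> z \<notin> D ==> v z = 0" unfolding off_def by blast
lemma offI: "(!!z. z \<notin> D ==> v z = 0) ==> off v" unfolding off_def by blast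

lemma sq_time_cut:
 assumes "c \<in> borelm" "!!t::real. \<bar>c t\<bar> <= C"
 shows "sq (%t. ind {0<..<T} t * c t)"
proof -
 have "sq (ind {0<..<T})" by (rule sq_indicator) (use T_pos in auto)
 from sq_mult_bounded[OF this assms] show ?thesis by (simp add: mult.commute)
qed

lemma snd_borel[measurable]: "(snd :: (real^'n) \<times> real => real) \<in> borelm" by (rule borel_measurable_continuous_onI) (intro continuous_intros)
lemma fst_borel[measurable]: "(fst :: (real^'n) \<times> real => real^'n) \<in> borelm" by (rule borel_measurable_continuous_onI) (intro continuous_intros)

lemma H1_off: "H1 v G ==> off v" "H1 v G ==> off G" unfolding H1_def off_def by blast+
lemma H1_sq: "H1 v G ==> sq v" "H1 v G ==> sq G" by (auto simp: H1_def)
lemma H1_outside: "H1 v G ==> z \<notin> D ==> v z = 0" "H1 v G ==> z \<notin> D ==> G z = 0" unfolding H1_def by blast+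

lemma sq_component: assumes "sq (G :: _ => real^'n)" shows "sq (%z. G z $ i)"
proof (rule sq_bound[OF assms])
 have [measurable]: "G \<in> borelm" using assms by (rule sq_measurable)
 have "(%z. G z \<bullet> axis i 1) \<in> borelm" by measurable
 then show "(%z. G z $ i) \<in> borelm" by (simp add: inner_axis)
qed (auto simp: component_le_norm_cart)

lemma integrable_on_D:
 fixes v :: "(real^'n) \<times> real => 'b::euclidean_space"
 assumes "sq v" "off v"
 shows "integrable lborel v"
proof -
 have "integrable lborel (%z. ind D z *\<^sub>R v z)" by (rule sq_integrable_scaleR[OF sq_D assms(1)])
 moreover have "(%z. ind D z *\<^sub>R v z) = v" using offD[OF assms(2)] by (auto simp: indicator_def fun_eq_iff)
 ultimately show ?thesis by simp
qed

lemma off_component: "off (G :: _ => real^'n) ==> off (%z. G z $ i)" unfolding off_def by simp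

lemma H1I:
 assumes "sq v" "sq G" "off v" "off G"
  "!!\<phi> i. test_fun D \<phi> ==> (LBINT z. v z * dx i \<phi> z) = - (LBINT z. (G z $ i) * \<phi> z)"
 shows "H1 v G" using assms unfolding H1_def off_def by blast

lemma cut_time_LIMSEQ:
 fixes v p :: "(real^'n) \<times> real => real"
 assumes v: "sq v" "off v" and p: "continuous_on UNIV p"
  and \<kappa>: "!!n::nat. sq (\<kappa> n)" and c: "c \<in> borelm" "!!t::real. \<bar>c t\<bar> <= C"
  and lim: "(%n. N2 (%t. \<kappa> n t - indicator {0<..<T} t * c t)) ~~> 0"
 shows "(%n. \<integral>z. v z * (\<kappa> n (snd z) * p z) \<partial>lborel) ~~> (LBINT z. v z * (c (snd z) * p z))"
proof -
 have [measurable]: "p \<in> borelm" using p by (rule borel_measurable_continuous_onI)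
 have [measurable]: "c \<in> borelm" by (rule c)
 have [measurable]: "!!n. \<kappa> n \<in> borelm" using \<kappa> by (rule sq_measurable)
 have "compact (p ` closure D)" by (rule compact_continuous_image) (use p D_bounded in \<open>auto intro: continuous_on_subset\<close>)
 then obtain M0 where M0: "!!z. z \<in> closure D ==> \<bar>p z\<bar> <= M0" using compact_imp_bounded bounded_iff by (metis imageI real_norm_def)
 define M where "M = \<bar>M0\<bar>"
 have M: "\<bar>p z\<bar> <= M" if "z \<in> D" for z using M0[of z] that closure_subset[of D] by (force simp: M_def)
 define k where "k n t = \<kappa> n t - indicator {0<..<T} t * c t" for n t
 define g where "g z = ind D z * (c (snd z) * p z)" for z
 define f where "f n z = ind D z * (\<kappa> n (snd z) * p z)" for n z
 have s0: "sq (%t. indicator {0<..<T} t * c t)" by (rule sq_time_cut[OF c])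
 have sk: "sq (k n)" for n unfolding k_def by (rule sq_diff[OF \<kappa> s0])
 have bm: "f n \<in> borelm" "g \<in> borelm" for n unfolding f_def g_def borel_eq_prod by (auto simp: borel_eq_prod[symmetric])
 have le: "\<bar>f n z - g z\<bar> <= M * \<bar>ind \<Omega> (fst z) * k n (snd z)\<bar>" for n z
 proof (cases "z \<in> D")
  case True
  then have "f n z - g z = k n (snd z) * p z" by (auto simp: f_def g_def k_def algebra_simps mem_Times_iff)
  moreover have "\<bar>k n (snd z)\<bar> * \<bar>p z\<bar> <= \<bar>k n (snd z)\<bar> * M" by (intro mult_left_mono M True) auto
  ultimately show ?thesis using True by (simp add: abs_mult mem_Times_iff mult.commute)
 qed (auto simp: f_def g_def M_def)
 have b: "sq (%z. f n z - g z) & N2 (%z. f n z - g z) <= M^2 * (N2 (ind \<Omega>) * N2 (k n))" for n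
 proof -
  have s: "sq (%z. M *\<^sub>R (ind \<Omega> (fst z) * k n (snd z)))" by (rule sq_scaleR[OF sq_prod(1)[OF sq_\<Omega> sk]])
  have m: "(%z. f n z - g z) \<in> borelm" using bm by measurable
  have a: "AE z in lborel. norm (f n z - g z) <= norm (M *\<^sub>R (ind \<Omega> (fst z) * k n (snd z)))" using le[of n] by (auto simp: abs_mult M_def)
  show ?thesis using sq_bound[OF s m a] N2_mono[OF s m a] by (simp add: N2_scaleR[where 'b=real, simplified] sq_prod(2)[OF sq_\<Omega> sk])
 qed
 have sg: "sq g"
 proof (rule sq_bound)
  show "sq (%z. (C * M) *\<^sub>R ind D z)" by (rule sq_scaleR[OF sq_D])
  have "C \<ge> 0" using c(2)[of 0] by simp
  then show "AE z in lborel. norm (g z) <= norm ((C * M) *\<^sub>R ind D z)" by (intro AE_I2) (auto simp: g_def indicator_def abs_mult M_def intro!: mult_mono c(2) M[unfolded M_def])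
 qed (rule bm)
 have sf: "sq (f n)" for n using sq_add[OF conjunct1[OF b[of n]] sg] by simp
 have "(%n. N2 (%z. f n z - g z)) ~~> 0"
 proof (rule tendsto_sandwich[OF _ _ tendsto_const])
  show "\<forall>\<^sub>F n in sequentially. N2 (%z. f n z - g z) <= M^2 * (N2 (ind \<Omega>) * N2 (k n))" using b by auto
  have "(%n. M^2 * (N2 (ind \<Omega>) * N2 (k n))) ~~> M^2 * (N2 (ind \<Omega>) * 0)" using lim unfolding k_def by (intro tendsto_intros)
  then show "(%n. M^2 * (N2 (ind \<Omega>) * N2 (k n))) ~~> 0" by simp
 qed auto
 from mult_integral_LIMSEQ[OF sf sg v(1) this]
 have "(%n. \<integral>z. f n z * v z \<partial>lborel) ~~> (LBINT z. g z * v z)" .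
 moreover have "(%z. f n z * v z) = (%z. v z * (\<kappa> n (snd z) * p z))" for n by (rule ext, rename_tac z, case_tac "z \<in> D") (simp_all add: f_def offD[OF v(2)])
 moreover have "(%z. g z * v z) = (%z. v z * (c (snd z) * p z))" by (rule ext, rename_tac z, case_tac "z \<in> D") (simp_all add: g_def offD[OF v(2)])
 ultimately show ?thesis by simp
qed

text \<open>The time factor is approximated in L^2(0,T) by smooth compactly supported ones, and
  spatial derivatives pass through functions of time. This is why cutoffs and shifts in time
  preserve \<open>H1\<close>.\<close>

lemma H1_test:
 assumes H: "H1 v G" and \<psi>: "smooth_fun UNIV \<psi>" and K: "compact K" "K \<subseteq> \<Omega>" "!!z. fst z \<notin> K ==> \<psi> z = 0"
  and c: "c \<in> borelm" "!!t::real. \<bar>c t\<bar> <= C"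
 shows "(LBINT z. v z * (c (snd z) * dx i \<psi> z)) = - (LBINT z. (G z $ i) * (c (snd z) * \<psi> z))"
proof -
 have sq0: "sq (%t. ind {0<..<T} t * c t)" by (rule sq_time_cut[OF c])
 obtain \<kappa> where \<kappa>: "!!n::nat. test_fun {0<..<T} (\<kappa> n)"
  "(%n. N2 (%t. \<kappa> n t - indicator {0<..<T} t * (indicator {0<..<T} t * c t))) ~~> 0" using test_fun_approx_seq[OF _ sq0, of "{0<..<T}"] by auto
 have lim: "(%n. N2 (%t. \<kappa> n t - indicator {0<..<T} t * c t)) ~~> 0"
 proof -
  have "ind {0<..<T} t * (ind {0<..<T} t * c t) = ind {0<..<T} t * c t" for t by (simp add: indicator_def)
  with \<kappa>(2) show ?thesis by simp
 qed
 have eq: "(LBINT z. v z * (\<kappa> n (snd z) * dx i \<psi> z)) = - (LBINT z. (G z $ i) * (\<kappa> n (snd z) * \<psi> z))" for n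
 proof -
  obtain L where L: "compact L" "L \<subseteq> {0<..<T}" "!!t. t \<notin> L ==> \<kappa> n t = 0" using test_fun_support[OF \<kappa>(1)] by blast
  have sm: "smooth_fun UNIV (%z::(real^'n)\<times>real. \<kappa> n (snd z))" using smooth_fun_affine[OF bounded_linear_snd test_fun_smooth[OF \<kappa>(1)], of n 0] by simp
  have t: "test_fun D (%z. \<kappa> n (snd z) * \<psi> z)"
  proof (rule test_funI[of _ "K \<times> L"])
   show "smooth_fun UNIV (%z. \<kappa> n (snd z) * \<psi> z)" by (rule smooth_fun_mult[OF sm \<psi>])
   show "compact (K \<times> L)" using K L by (intro compact_Times)
   show "K \<times> L \<subseteq> D" using K L by auto
   show "\<kappa> n (snd z) * \<psi> z = 0" if "z \<notin> K \<times> L" for z using that K(3)[of z] L(3)[of "snd z"] by (auto simp: mem_Times_iff)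
  qed
  have d0: "frechet_derivative (%z::(real^'n)\<times>real. \<kappa> n (snd z)) (at z) (axis i 1, 0) = 0" for z
  proof -
   have 1: "((%z::(real^'n)\<times>real. snd z) has_derivative snd) (at z)" by (rule bounded_linear_imp_has_derivative[OF bounded_linear_snd])
   have d: "((%z::(real^'n)\<times>real. \<kappa> n (snd z)) has_derivative (%w. frechet_derivative (\<kappa> n) (at (snd z)) (snd w))) (at z)" by (rule has_derivative_compose[OF 1 smooth_funD[OF test_fun_smooth[OF \<kappa>(1)]]])
   have L: "linear (frechet_derivative (\<kappa> n) (at (snd z)))" using smooth_funD[OF test_fun_smooth[OF \<kappa>(1)]] has_derivative_linear by blast
   show ?thesis using frechet_derivative_at[OF d, symmetric] linear_0[OF L] by simp
  qed
  have "dx i (%z. \<kappa> n (snd z) * \<psi> z) z = \<kappa> n (snd z) * dx i \<psi> z" for z unfolding dx_def by (simp add: frechet_derivative_mult_smooth[OF \<psi> sm] d0)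
  moreover have "(LBINT z. v z * dx i (%z. \<kappa> n (snd z) * \<psi> z) z) = - (LBINT z. (G z $ i) * (\<kappa> n (snd z) * \<psi> z))" using H t unfolding H1_def by blast
  ultimately show ?thesis by simp
 qed
 have "(%n. \<integral>z. v z * (\<kappa> n (snd z) * dx i \<psi> z) \<partial>lborel) ~~> (LBINT z. v z * (c (snd z) * dx i \<psi> z))" by (rule cut_time_LIMSEQ[OF H1_sq(1)[OF H] H1_off(1)[OF H] _ test_fun_sq[OF \<kappa>(1)] c lim])
   (auto simp: dx_def[abs_def] intro!: smooth_fun_continuous smooth_fun_deriv \<psi>)
 moreover have "(%n. \<integral>z. (G z $ i) * (\<kappa> n (snd z) * \<psi> z) \<partial>lborel) ~~> (LBINT z. (G z $ i) * (c (snd z) * \<psi> z))" by (rule cut_time_LIMSEQ[OF sq_component[OF H1_sq(2)[OF H]] off_component[OF H1_off(2)[OF H]]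
   smooth_fun_continuous[OF \<psi>] test_fun_sq[OF \<kappa>(1)] c lim])
 then have "(%n. - (LBINT z. (G z $ i) * (\<kappa> n (snd z) * \<psi> z))) ~~> - (LBINT z. (G z $ i) * (c (snd z) * \<psi> z))" by (rule tendsto_minus)
 ultimately show ?thesis unfolding eq by (rule LIMSEQ_unique)
qed

lemma test_fun_space_support:
 assumes "test_fun (\<Omega> \<times> A) \<phi>"
 obtains K where "compact K" "K \<subseteq> \<Omega>" "!!z. fst z \<notin> K ==> \<phi> z = 0"
proof -
 obtain L where L: "compact L" "L \<subseteq> \<Omega> \<times> A" "!!z. z \<notin> L ==> \<phi> z = 0" using test_fun_support[OF assms] by blast
 have c: "compact (fst ` L)" by (rule compact_continuous_image[OF _ L(1)]) (auto intro: continuous_intros)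
 have s: "fst ` L \<subseteq> \<Omega>" using L(2) by auto
 have z: "\<phi> z = 0" if "fst z \<notin> fst ` L" for z using L(3)[of z] that by blast
 show thesis by (rule that[OF c s z])
qed

lemma H1_add: assumes "H1 v G" "H1 v' G'" shows "H1 (%z. v z + v' z) (%z. G z + G' z)"
proof (rule H1I)
 fix \<phi> i assume t: "test_fun D \<phi>"
 have sD: "sq (dx i \<phi>)" using test_fun_sq[OF test_fun_deriv[OF t]] by (simp add: dx_def[abs_def])
 have "(LBINT z. v z * dx i \<phi> z) = - (LBINT z. (G z $ i) * \<phi> z)" "(LBINT z. v' z * dx i \<phi> z) = - (LBINT z. (G' z $ i) * \<phi> z)" using assms t unfolding H1_def by blast+
 then show "(LBINT z. (v z + v' z) * dx i \<phi> z) = - (LBINT z. ((G z + G' z) $ i) * \<phi> z)" using assms[THEN H1_sq(1)] assms[THEN H1_sq(2), THEN sq_component, of i] sD test_fun_sq[OF t] by (simp add: distrib_right sq_integrable_mult)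
next
 show "off (%z. v z + v' z)" "off (%z. G z + G' z)" by (rule offI; simp add: H1_outside[OF assms(1)] H1_outside[OF assms(2)])+
 show "sq (%z. v z + v' z)" "sq (%z. G z + G' z)" by (rule sq_add; use assms H1_sq in blast)+
qed

lemma H1_scale: assumes "H1 v G" shows "H1 (%z. a * v z) (%z. a *\<^sub>R G z)"
proof (rule H1I)
 fix \<phi> i assume t: "test_fun D \<phi>"
 have "(LBINT z. v z * dx i \<phi> z) = - (LBINT z. (G z $ i) * \<phi> z)" using assms t unfolding H1_def by blast
 then show "(LBINT z. a * v z * dx i \<phi> z) = - (LBINT z. ((a *\<^sub>R G z) $ i) * \<phi> z)" by (simp add: mult.assoc)
next
 show "off (%z. a * v z)" "off (%z. a *\<^sub>R G z)" by (rule offI; simp add: H1_outside[OF assms])+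
 show "sq (%z. a * v z)" "sq (%z. a *\<^sub>R G z)" using sq_scaleR[OF H1_sq(1)[OF assms], of a] sq_scaleR[OF H1_sq(2)[OF assms], of a] by simp_all
qed

lemma H1_diff: assumes "H1 v G" "H1 v' G'" shows "H1 (%z. v z - v' z) (%z. G z - G' z)" using H1_add[OF assms(1) H1_scale[OF assms(2), of "-1"]] by simp

lemma H1_cut:
 assumes H: "H1 v G" and c: "c \<in> borelm" "!!t::real. \<bar>c t\<bar> <= C"
 shows "H1 (%z. c (snd z) * v z) (%z. c (snd z) *\<^sub>R G z)"
proof (rule H1I)
 have m: "(%z::(real^'n)\<times>real. c (snd z)) \<in> borelm" using c(1) by measurable
 show "sq (%z. c (snd z) * v z)" by (rule sq_mult_bounded[OF H1_sq(1)[OF H] m c(2)])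
 show "sq (%z. c (snd z) *\<^sub>R G z)" by (rule sq_scale_bounded(1)[OF H1_sq(2)[OF H] m c(2)])
 fix \<phi> i assume t: "test_fun D \<phi>"
 obtain K where "compact K" "K \<subseteq> \<Omega>" "!!z. fst z \<notin> K ==> \<phi> z = 0" using test_fun_space_support[OF t] by blast
 from H1_test[OF H test_fun_smooth[OF t] this c, of i]
 show "(LBINT z. c (snd z) * v z * dx i \<phi> z) = - (LBINT z. ((c (snd z) *\<^sub>R G z) $ i) * \<phi> z)" by (simp add: algebra_simps)
next
 show "off (%z. c (snd z) * v z)" "off (%z. c (snd z) *\<^sub>R G z)" by (rule offI; simp add: H1_outside[OF H])+
qed

section \<open>Time shifts and backward time integrals\<close>

definition sh :: "real => ((real^'n) \<times> real => 'b::real_normed_vector) => (real^'n) \<times> real => 'b" where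
 "sh h v z = ind {0<..<T} (snd z) *\<^sub>R v (z + (0, h))"

lemma ind_snd_borel[measurable]: "A \<in> sets borel ==> (%z::(real^'n)\<times>real. ind A (snd z)) \<in> borelm" by (rule measurable_compose[OF snd_borel borel_measurable_indicator])

lemma sq_sh: assumes "sq v" shows "sq (sh h v)" "N2 (sh h v) <= N2 v"
proof -
 have "(%z::(real^'n)\<times>real. ind {0<..<T} (snd z)) \<in> borelm" by measurable
 from sq_scale_bounded[OF sq_shift[OF assms, of "(0,h)"] this, of 1]
 show "sq (sh h v)" "N2 (sh h v) <= N2 v" unfolding sh_def[abs_def] by (auto simp: N2_shift[OF assms])
qed

lemma off_sh: assumes "off v" shows "off (sh h v)"
proof (rule offI)
 fix z assume "z \<notin> D"
 then show "sh h v z = 0" using offD[OF assms, of "z + (0, h)"] by (cases z) (auto simp: sh_def indicator_def)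
qed

text \<open>Shifting back, the restriction to 0 < t < T becomes an indicator evaluated at t - h, a
  bounded Borel factor in time as allowed by \<open>H1_test\<close>.\<close>

lemma H1_sh:
 assumes H: "H1 v G" shows "H1 (sh h v) (sh h G)"
proof (rule H1I)
 fix \<phi> i assume t: "test_fun D \<phi>"
 obtain K where K: "compact K" "K \<subseteq> \<Omega>" "!!z. fst z \<notin> K ==> \<phi> z = 0" using test_fun_space_support[OF t] by blast
 have [measurable]: "v \<in> borelm" "G \<in> borelm" using H1_sq[OF H] by (auto simp: sq_measurable)
 have [measurable]: "\<phi> \<in> borelm" "dx i \<phi> \<in> borelm" using test_fun_sq[OF t] test_fun_sq[OF test_fun_deriv[OF t]] by (auto simp: dx_def[abs_def] sq_measurable)
 have m: "(%z::(real^'n)\<times>real. ind {0<..<T} (snd z - h)) \<in> borelm" by (rule measurable_compose[of "%z. snd z - h" _ borel, OF _ borel_measurable_indicator]) measurable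
 note [measurable] = m
 have [measurable]: "(%z. G z $ i) \<in> borelm" by (rule sq_measurable[OF sq_component[OF H1_sq(2)[OF H]]])
 have [measurable]: "(%z. \<phi> (z - (0, h))) \<in> borelm" "(%z. dx i \<phi> (z - (0, h))) \<in> borelm"
  by measurable
 have sm: "smooth_fun UNIV (%z. \<phi> (z - (0, h)))" using smooth_fun_affine[OF bounded_linear_ident test_fun_smooth[OF t], of "- (0,h)"] by (simp only: add_uminus_conv_diff)
 have "(LBINT z. sh h v z * dx i \<phi> z) = (LBINT z. v z * (indicator {0<..<T} (snd z - h) * dx i (%z. \<phi> (z - (0, h))) z))"
 proof -
  have "(LBINT z. v z * (indicator {0<..<T} (snd z - h) * dx i \<phi> (z - (0, h)))) = (LBINT z. v (z + (0,h)) * (indicator {0<..<T} (snd (z + (0,h)) - h) * dx i \<phi> (z + (0,h) - (0, h))))" by (rule integral_shift[symmetric]) measurable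
  then show ?thesis unfolding dx_def frechet_derivative_shift[OF test_fun_smooth[OF t]] by (simp add: sh_def algebra_simps)
 qed
 also have "... = - (LBINT z. (G z $ i) * (indicator {0<..<T} (snd z - h) * \<phi> (z - (0, h))))" by (rule H1_test[OF H sm K(1,2), of "%t. indicator {0<..<T} (t - h)" 1])
   (auto intro!: K(3) simp: indicator_def)
 also have "(LBINT z. (G z $ i) * (indicator {0<..<T} (snd z - h) * \<phi> (z - (0, h)))) = (LBINT z. (G (z + (0,h)) $ i) * (indicator {0<..<T} (snd (z + (0,h)) - h) * \<phi> (z + (0,h) - (0, h))))" by (rule integral_shift[symmetric]) measurable
 also have "... = (LBINT z. (sh h G z $ i) * \<phi> z)" by (simp add: sh_def algebra_simps)
 finally show "(LBINT z. sh h v z * dx i \<phi> z) = - (LBINT z. (sh h G z $ i) * \<phi> z)" .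
qed (use off_sh H1_off[OF H] sq_sh H1_sq[OF H] in auto)

text \<open>For v vanishing off the cylinder this is the integral from t to T. Integrating backward
  stays away from t = 0, near which time derivatives need not be integrable.\<close>

definition tint :: "((real^'n) \<times> real => 'b::euclidean_space) => (real^'n) \<times> real => 'b" where
 "tint v z = ind {0<..<T} (snd z) *\<^sub>R (LBINT s. indicator {snd z<..} s *\<^sub>R v (fst z, s))"

text \<open>With s = t + r the backward integral becomes an integral of time shifts over r in (0,
  T), so norm bounds and gradients are inherited from the shifts.\<close>

lemma tint_avg:
 assumes s: "sq v" and o: "off v"
 shows "param_avg (%z r. sh r v z) {0<..<T} T (N2 v)" "param_avg.avg (%z r. sh r v z) {0<..<T} = tint v"
proof -
 have [measurable]: "v \<in> borelm" using s by (rule sq_measurable)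
 have [measurable]: "v \<in> borel_measurable (borel \<Otimes>\<^sub>M borel)" unfolding borel_eq_prod[symmetric] by measurable
 show p: "param_avg (%z r. sh r v z) {0<..<T} T (N2 v)"
 proof
  show "(%(z, r). sh r v z) \<in> borel_measurable (borel \<Otimes>\<^sub>M borel)" unfolding sh_def case_prod_beta' by measurable
 qed (use T_pos sq_sh[OF s] in auto)
 show "param_avg.avg (%z r. sh r v z) {0<..<T} = tint v"
 proof
  fix z :: "(real^'n) \<times> real"
  obtain x t where z: "z = (x, t)" by fastforce
  have vx: "(%s. v (x, s)) \<in> borelm" by measurable
  have "param_avg.avg (%z r. sh r v z) {0<..<T} z = (LBINT r. indicator {0<..<T} t *\<^sub>R (indicator {t<..} (r + t) *\<^sub>R v (x, r + t)))" unfolding param_avg.avg_def[OF p]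
  proof (rule integral_cong[OF refl])
   fix r
   show "indicator {0<..<T} r *\<^sub>R sh r v z = indicator {0<..<T} t *\<^sub>R (indicator {t<..} (r + t) *\<^sub>R v (x, r + t))" using offD[OF o, of "(x, t + r)"] by (cases "(x, t + r) \<in> D") (auto simp: sh_def z indicator_def add.commute)
  qed
  also have "... = (LBINT r. indicator {0<..<T} t *\<^sub>R (indicator {t<..} r *\<^sub>R v (x, r)))" by (rule integral_shift[of "%r. indicator {0<..<T} t *\<^sub>R (indicator {t<..} r *\<^sub>R v (x, r))" t]) (use vx in measurable)
  also have "... = tint v z" by (simp add: tint_def z scaleR_scaleR[symmetric] del: scaleR_scaleR)
  finally show "param_avg.avg (%z r. sh r v z) {0<..<T} z = tint v z" .
 qed
qed

lemma sq_tint: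
 assumes "sq v" "off v"
 shows "sq (tint v)" "N2 (tint v) <= T^2 * N2 v" using param_avg.sq_avg[OF tint_avg(1)[OF assms]] param_avg.N2_avg[OF tint_avg(1)[OF assms]] unfolding tint_avg(2)[OF assms] by auto

lemma off_tint: assumes "off v" shows "off (tint v)"
proof (rule offI)
 fix z assume z: "z \<notin> D"
 show "tint v z = 0"
 proof (cases "snd z \<in> {0<..<T}")
  case True
  with z have "v (fst z, s) = 0" for s by (intro offD[OF assms]) (auto simp: mem_Times_iff)
  then show ?thesis by (simp add: tint_def)
 qed (simp add: tint_def)
qed

lemma H1_tint: assumes H: "H1 v G" shows "H1 (tint v) (tint G)"
proof (rule H1I)
 note v = H1_sq(1)[OF H] H1_off(1)[OF H] and G = H1_sq(2)[OF H] H1_off(2)[OF H]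
 show "sq (tint v)" by (rule sq_tint[OF v])
 show "sq (tint G)" by (rule sq_tint[OF G])
 show "off (tint v)" "off (tint G)" by (rule off_tint v(2) G(2))+
 fix \<phi> i assume t: "test_fun D \<phi>"
 have s: "sq \<phi>" "sq (dx i \<phi>)" using test_fun_sq[OF t] test_fun_sq[OF test_fun_deriv[OF t]] by (auto simp: dx_def[abs_def])
 have sa: "sq (%z. \<phi> z *\<^sub>R axis i (1::real) :: real^'n)" by (rule sq_bound[OF s(1)]) (use sq_measurable[OF s(1)] in auto)
 have "(LBINT z. tint v z * dx i \<phi> z) = (LBINT r. indicator {0<..<T} r * (LBINT z. sh r v z * dx i \<phi> z))" using param_avg.inner_avg[OF tint_avg(1)[OF v] s(2)] unfolding tint_avg(2)[OF v] by simp
 also have "... = (LBINT r. indicator {0<..<T} r * - (LBINT z. sh r G z \<bullet> (\<phi> z *\<^sub>R axis i 1)))"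
 proof -
  have "(LBINT z. sh r v z * dx i \<phi> z) = - (LBINT z. sh r G z \<bullet> (\<phi> z *\<^sub>R axis i 1))" for r using H1_sh[OF H, of r] t unfolding H1_def by (simp add: inner_axis mult.commute)
  then show ?thesis by simp
 qed
 also have "... = - (LBINT r. indicator {0<..<T} r * (LBINT z. sh r G z \<bullet> (\<phi> z *\<^sub>R axis i 1)))" by simp
 also have "(LBINT r. indicator {0<..<T} r * (LBINT z. sh r G z \<bullet> (\<phi> z *\<^sub>R axis i 1))) = (LBINT z. tint G z \<bullet> (\<phi> z *\<^sub>R axis i 1))" using param_avg.inner_avg[OF tint_avg(1)[OF G] sa] unfolding tint_avg(2)[OF G] by simp
 also have "... = (LBINT z. (tint G z $ i) * \<phi> z)" by (simp add: inner_axis mult.commute)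
 finally show "(LBINT z. tint v z * dx i \<phi> z) = - (LBINT z. (tint G z $ i) * \<phi> z)" .
qed

lemma AE_slice_integrable:
 fixes v :: "(real^'n) \<times> real => 'b::euclidean_space"
 assumes "integrable lborel v" shows "AE x in lborel. integrable lborel (%t. v (x, t))" using lborel_pair.AE_integrable_fst'[of v] assms by (simp add: lborel_prod)

lemma integral_slices:
 fixes v :: "(real^'n) \<times> real => 'b::euclidean_space"
 assumes "integrable lborel v" shows "(LBINT z. v z) = (LBINT x. (LBINT t. v (x, t)))"
  and "integrable lborel (%x. \<integral>t. v (x, t) \<partial>lborel)" using lborel_pair.integral_fst'[of v] lborel_pair.integrable_fst'[of v] assms by (simp_all add: lborel_prod)

definition tI :: "((real^'n) \<times> real => 'b::euclidean_space) => real^'n => 'b" where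
 "tI v x = (LBINT t. v (x, t))"

lemma pair_borel[measurable]: "(%t::real. (x::real^'n, t)) \<in> borelm" by (rule borel_measurable_continuous_onI) (intro continuous_intros)

text \<open>Cauchy-Schwarz on each time line, whose relevant part has length T.\<close>

lemma sq_tI:
 fixes v :: "(real^'n) \<times> real => 'b::euclidean_space"
 assumes v: "sq v" "off v"
 shows "sq (tI v)" "N2 (tI v) <= T * N2 v"
proof -
 have [measurable]: "v \<in> borelm" using v by (simp add: sq_measurable)
 have vp: "v \<in> borel_measurable (lborel \<Otimes>\<^sub>M lborel)" unfolding lborel_prod by simp
 have "(%x. \<integral>t. v (x, t) \<partial>lborel) \<in> borel_measurable (lborel :: (real^'n) measure)" by (rule lborel.borel_measurable_lebesgue_integral) (use vp in simp)
 then have m: "tI v \<in> borelm" by (simp add: tI_def[abs_def])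
 define E where "E x = (\<integral>\<^sup>+t. ennreal ((norm (v (x, t)))^2) \<partial>lborel)" for x
 have vs: "(%t. v (x, t)) \<in> borelm" for x by measurable
 have le: "ennreal ((norm (tI v x))^2) <= ennreal T * E x" for x
 proof -
  have "ennreal (norm (tI v x)) <= (\<integral>\<^sup>+t. ennreal (norm (v (x, t))) \<partial>lborel)"
  proof (cases "integrable lborel (%t. v (x, t))")
   case True
   then show ?thesis unfolding tI_def by (rule integral_norm_bound_ennreal)
  qed (simp add: tI_def not_integrable_integral_eq)
  also have "... = (\<integral>\<^sup>+t. indicator {0<..<T} t * ennreal (norm (v (x, t))) \<partial>lborel)" by (rule nn_integral_cong) (use offD[OF v(2)] in \<open>auto simp: indicator_def\<close>)
  finally have "(ennreal (norm (tI v x)))^2 <= (\<integral>\<^sup>+t. indicator {0<..<T} t * ennreal (norm (v (x, t))) \<partial>lborel)^2" by (rule power_mono) simp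
  also have "... <= (\<integral>\<^sup>+t. (indicator {0<..<T} t)^2 \<partial>lborel) * (\<integral>\<^sup>+t. (ennreal (norm (v (x, t))))^2 \<partial>lborel)" by (rule Cauchy_Schwarz_nn_integral) (use vs in measurable)
  also have "(%t. (indicator {0<..<T} t)^2 :: ennreal) = indicator {0<..<T}" by (auto simp: indicator_def)
  finally show ?thesis using T_pos by (simp add: E_def ennreal_power)
 qed
 have "(\<integral>\<^sup>+x. E x \<partial>lborel) = ennreal (N2 v)" unfolding E_def nn_integral_norm_square[OF v(1), symmetric] lborel_prod[symmetric] by (rule lborel.nn_integral_fst) (use vp in measurable)
 moreover have "(\<integral>\<^sup>+x. ennreal ((norm (tI v x))^2) \<partial>lborel) <= (\<integral>\<^sup>+x. ennreal T * E x \<partial>lborel)" by (rule nn_integral_mono) (rule le)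
 moreover have "(\<integral>\<^sup>+x. ennreal T * E x \<partial>lborel) = ennreal T * (\<integral>\<^sup>+x. E x \<partial>lborel)"
 proof (rule nn_integral_cmult)
  have "(%x. \<integral>\<^sup>+t. ennreal ((norm (v (x, t)))^2) \<partial>lborel) \<in> borel_measurable (lborel :: (real^'n) measure)" by (rule lborel.borel_measurable_nn_integral) (use vp in measurable)
  then show "E \<in> borel_measurable lborel" by (simp add: E_def[abs_def])
 qed
 ultimately have "(\<integral>\<^sup>+x. ennreal ((norm (tI v x))^2) \<partial>lborel) <= ennreal (T * N2 v)" using T_pos by (simp add: ennreal_mult)
 from sqI_nn_integral[OF m this] T_pos show "sq (tI v)" "N2 (tI v) <= T * N2 v" by auto
qed

text \<open>\<open>triangle_integral\<close> on almost every time line, followed by Fubini.\<close>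

lemma tint_quadratic:
 assumes G: "sq G" "off G"
 shows "(LBINT z. G z \<bullet> tint G z) = N2 (tI G) / 2"
proof -
 have int: "integrable lborel (%z. G z \<bullet> tint G z)" by (rule sq_integrable_inner[OF G(1) sq_tint(1)[OF G]])
 have "AE x in lborel. (LBINT t. G (x, t) \<bullet> tint G (x, t)) = (norm (tI G x))^2 / 2" using AE_slice_integrable[OF integrable_on_D[OF G]]
 proof eventually_elim
  case (elim x)
  have "(%t. G (x, t) \<bullet> tint G (x, t)) = (%t. G (x, t) \<bullet> (LBINT s. indicator {t<..} s *\<^sub>R G (x, s)))"
  proof
   fix t show "G (x, t) \<bullet> tint G (x, t) = G (x, t) \<bullet> (LBINT s. indicator {t<..} s *\<^sub>R G (x, s))" using offD[OF G(2), of "(x, t)"] by (cases "t \<in> {0<..<T}") (auto simp: tint_def)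
  qed
  then show ?case by (simp only: triangle_integral[OF elim] tI_def)
 qed
 then have "(LBINT x. (LBINT t. G (x, t) \<bullet> tint G (x, t))) = (LBINT x. (norm (tI G x))^2 / 2)" by (intro integral_cong_AE borel_measurable_integrable integral_slices(2)[OF int])
   (use sq_integrable[OF sq_tI(1)[OF G]] in auto)
 then show ?thesis unfolding integral_slices(1)[OF int] by (simp add: N2_def)
qed

lemma tint_inner_nonneg: "sq G ==> off G ==> 0 <= (LBINT z. G z \<bullet> tint G z)" by (simp add: tint_quadratic)

text \<open>Polarization of \<open>tint_quadratic\<close>. This is integration by parts in time,
  with the right-hand side as boundary term.\<close>

lemma tint_polar:
 fixes a b :: "(real^'n) \<times> real => real"
 assumes a: "sq a" "off a" and b: "sq b" "off b"
 shows "(LBINT z. a z * tint b z) + (LBINT z. b z * tint a z) = (LBINT x. tI a x * tI b x)"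
proof -
 have ab: "sq (%z. a z + b z)" "off (%z. a z + b z)" using a b by (auto intro: sq_add simp: off_def)
 note st = sq_tint(1)[OF a] sq_tint(1)[OF b] and sI = sq_tI(1)[OF a] sq_tI(1)[OF b]
 have ae: "AE x in lborel. integrable lborel (%t. a (x, t)) & integrable lborel (%t. b (x, t))" using AE_slice_integrable[OF integrable_on_D[OF a]] AE_slice_integrable[OF integrable_on_D[OF b]] by eventually_elim simp
 \<comment> \<open>Additivity is claimed only almost everywhere because it needs both sections to be
   integrable.\<close>
 have t1: "AE z in lborel. tint (%z. a z + b z) z = tint a z + tint b z" unfolding lborel_prod[symmetric]
 proof (rule lborel_pair.AE_pair_measure)
  have "(%z. tint (%z. a z + b z) z - (tint a z + tint b z)) \<in> borel_measurable (borel :: ((real^'n) \<times> real) measure)" using sq_measurable[OF sq_diff[OF sq_tint(1)[OF ab] sq_add[OF st]]] .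
  then have m: "(%z. tint (%z. a z + b z) z - (tint a z + tint b z)) \<in> borel_measurable (lborel \<Otimes>\<^sub>M lborel)" by (simp add: lborel_prod)
  have "{x \<in> space (lborel \<Otimes>\<^sub>M lborel). tint (%z. a z + b z) x - (tint a x + tint b x) = 0} \<in> sets (lborel \<Otimes>\<^sub>M lborel)" using m by measurable
  then show "{x \<in> space (lborel \<Otimes>\<^sub>M lborel). tint (%z. a z + b z) x = tint a x + tint b x} \<in> sets (lborel \<Otimes>\<^sub>M lborel)" by (simp add: algebra_simps)
  show "AE x in lborel. AE y in lborel. tint (%z. a z + b z) (x, y) = tint a (x, y) + tint b (x, y)" using ae
  proof eventually_elim
   case (elim x)
   have i: "integrable lborel (%s. indicator {y<..} s * c (x, s))" if "integrable lborel (%t. c (x, t))" for c :: "_ => real" and y :: real using integrable_mult_indicator[of "{y<..}" lborel "%t. c (x, t)"] that by simp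
   show ?case using i[of a] i[of b] elim by (auto simp: tint_def distrib_left)
  qed
 qed
 have t2: "AE x in lborel. tI (%z. a z + b z) x = tI a x + tI b x" using ae by eventually_elim (simp add: tI_def)
 have "N2 (tI (%z. a z + b z)) = N2 (%x. tI a x + tI b x)" by (rule N2_cong_AE[OF t2 sq_tI(1)[OF ab] sq_measurable[OF sq_add[OF sI]]])
 also have "... = N2 (tI a) + N2 (tI b) + 2 * (LBINT x. tI a x * tI b x)" using sq_integrable[OF sI(1)] sq_integrable[OF sI(2)] sq_integrable_mult[OF sI] by (simp add: N2_def power2_sum mult.assoc)
 finally have 1: "N2 (tI (%z. a z + b z)) = N2 (tI a) + N2 (tI b) + 2 * (LBINT x. tI a x * tI b x)" .
 have "(LBINT z. (a z + b z) * tint (%z. a z + b z) z) = (LBINT z. (a z + b z) * (tint a z + tint b z))" by (rule integral_cong_AE)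
   (use t1 sq_measurable[OF ab(1)] sq_measurable[OF sq_tint(1)[OF ab]] sq_measurable[OF sq_add[OF st]] in \<open>auto elim: eventually_mono\<close>)
 also have "... = (LBINT z. a z * tint a z) + (LBINT z. a z * tint b z) + (LBINT z. b z * tint a z) + (LBINT z. b z * tint b z)" by (simp add: distrib_left distrib_right sq_integrable_mult a b st)
 finally show ?thesis using 1 tint_quadratic[OF ab] tint_quadratic[OF a] tint_quadratic[OF b] by simp
qed

end

subsection \<open>Representation of functions with a weak time derivative\<close>

lemma AE_lborel_fst:
 assumes "AE x in (lborel :: 'a::euclidean_space measure). P x"
 shows "AE z in (lborel :: ('a \<times> 'b::euclidean_space) measure). P (fst z)"
proof -
 obtain N where N: "{x. \<not> P x} \<subseteq> N" "N \<in> null_sets (lborel :: 'a measure)" using AE_E[OF assms] by (auto simp: null_sets_def)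
 have "N \<times> (UNIV :: 'b set) \<in> null_sets (lborel \<Otimes>\<^sub>M lborel)" using N(2) lborel.emeasure_pair_measure_Times[of N "lborel :: 'a measure" "UNIV :: 'b set"] by (auto simp: null_sets_def)
 then have "N \<times> (UNIV :: 'b set) \<in> null_sets lborel" by (simp add: lborel_prod)
 then show ?thesis by (rule AE_I'[OF _ ]) (use N(1) in auto)
qed

context cylinder
begin

definition late :: "real => ((real^'n) \<times> real => real) => (real^'n) \<times> real => real" where
 "late t0 w z = ind {t0<..} (snd z) * w z"

text \<open>Square integrable after every positive time but possibly not up to t = 0, which is all
  that a time derivative satisfies when the datum is only in L^2.\<close>

definition wloc :: "((real^'n) \<times> real => real) => bool" where
 "wloc w \<longleftrightarrow> w \<in> borelm & off w & (\<forall>t0>0. sq (late t0 w))"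

text \<open>P is the value at the final time T. Integrating down from T rather than up from 0 makes
  sense although w may fail to be integrable at t = 0.\<close>

definition time_rep :: "((real^'n) \<times> real => real) => ((real^'n) \<times> real => real) => (real^'n => real) => bool" where
 "time_rep U w P \<longleftrightarrow> (AE z in lborel. z \<in> D --> U z = P (fst z) - tint w z)"

lemma off_late: "off w ==> off (late t0 w)" by (simp add: off_def late_def)
lemma sq_late: "sq U ==> sq (late t0 U)" unfolding late_def[abs_def] by (rule sq_mult_bounded[where C=1]) (auto simp: indicator_def intro!: ind_snd_borel[unfolded indicator_def])

text \<open>Needed besides \<open>sq_tint\<close> because a time derivative need not be square
  integrable up to t = 0.\<close>

lemma tint_measurable[measurable]:
 fixes w :: "(real^'n) \<times> real => 'b::euclidean_space"
 assumes [measurable]: "w \<in> borelm" shows "tint w \<in> borelm"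
proof -
 have "(%z. \<integral>s. indicator {snd z<..} s *\<^sub>R w (fst z, s) \<partial>lborel) \<in> borel_measurable (lborel :: ((real^'n) \<times> real) measure)"
 proof (rule lborel.borel_measurable_lebesgue_integral)
  have p: "(%p::((real^'n) \<times> real) \<times> real. (fst (fst p), snd p)) \<in> borelm" by (rule borel_measurable_continuous_onI) (intro continuous_intros)
  have w: "(%p::((real^'n) \<times> real) \<times> real. w (fst (fst p), snd p)) \<in> borelm" by (rule measurable_compose[OF p assms])
  have c: "closed {p::((real^'n) \<times> real) \<times> real. snd p <= snd (fst p)}" by (intro closed_Collect_le continuous_intros)
  have i: "(%p::((real^'n) \<times> real) \<times> real. ind (- {p. snd p <= snd (fst p)}) p) \<in> borelm" by (rule borel_measurable_indicator) (use c in auto)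
  have "(%p::((real^'n) \<times> real) \<times> real. ind (- {p. snd p <= snd (fst p)}) p *\<^sub>R w (fst (fst p), snd p)) \<in> borelm" by (rule borel_measurable_scaleR[OF i w])
  moreover have "(%p::((real^'n) \<times> real) \<times> real. ind (- {p. snd p <= snd (fst p)}) p *\<^sub>R w (fst (fst p), snd p))
   = (%(z, s). ind {snd z<..} s *\<^sub>R w (fst z, s))" by (auto simp: fun_eq_iff indicator_def)
  ultimately have "(%(z, s). ind {snd z<..} s *\<^sub>R w (fst z, s)) \<in> borel_measurable (borel \<Otimes>\<^sub>M borel)" by (simp only: borel_prod)
  then show "(%(z, s). ind {snd z<..} s *\<^sub>R w (fst z, s)) \<in> borel_measurable (lborel \<Otimes>\<^sub>M lborel)" by (simp cong: measurable_cong_sets)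
 qed
 then have "(%z. \<integral>s. indicator {snd z<..} s *\<^sub>R w (fst z, s) \<partial>lborel) \<in> borel_measurable (borel :: ((real^'n) \<times> real) measure)" by simp
 then show ?thesis unfolding tint_def[abs_def] by (intro borel_measurable_scaleR ind_snd_borel) auto
qed

lemma tint_late: "t0 <= snd z ==> tint (late t0 w) z = tint w z"
proof -
 assume a: "t0 <= snd z"
 have "(LBINT s. ind {snd z<..} s *\<^sub>R late t0 w (fst z, s)) = (LBINT s. ind {snd z<..} s *\<^sub>R w (fst z, s))" by (rule integral_cong[OF refl]) (use a in \<open>auto simp: indicator_def late_def\<close>)
 then show ?thesis by (simp add: tint_def)
qed

lemma tint_late_early: "0 < snd z ==> snd z < T ==> snd z <= t0 ==> tint (late t0 w) z = tI (late t0 w) (fst z)"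
proof -
 assume a: "0 < snd z" "snd z < T" "snd z <= t0"
 then have "tint (late t0 w) z = (LBINT s. indicator {snd z<..} s *\<^sub>R late t0 w (fst z, s))" by (simp add: tint_def)
 also have "... = tI (late t0 w) (fst z)" unfolding tI_def late_def by (rule integral_cong[OF refl]) (use a in \<open>auto simp: indicator_def\<close>)
 finally show ?thesis .
qed

lemma wloc_slices:
 assumes "wloc w" "0 < t0" shows "AE x in lborel. integrable lborel (%t. late t0 w (x, t))" by (rule AE_slice_integrable[OF integrable_on_D]) (use assms off_late in \<open>auto simp: wloc_def\<close>)

lemma tint_increment:
 assumes i: "integrable lborel (%t. late t0 w (x, t))" and t: "0 < t0" "t0 < t" "0 < h" "t + h < T"
 shows "tint w (x, t) - tint w (x, t + h) = (LBINT r. indicator {0..h} r * late t0 w (x, t + r))"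
proof -
 have ind: "integrable lborel (%s. indicator A s * late t0 w (x, s))" if "A \<in> sets borel" for A using integrable_mult_indicator[of A lborel "%t. late t0 w (x, t)"] that i by simp
 have m: "(%s. late t0 w (x, s)) \<in> borelm" using i by auto
 have "tint w (x, t) = tint (late t0 w) (x, t)" "tint w (x, t + h) = tint (late t0 w) (x, t + h)" using tint_late[of t0 "(x, t)" w] tint_late[of t0 "(x, t + h)" w] t by simp_all
 then have "tint w (x, t) - tint w (x, t + h) = (LBINT s. indicator {t<..} s * late t0 w (x, s)) - (LBINT s. indicator {t + h<..} s * late t0 w (x, s))" using t by (simp add: tint_def)
 also have "... = (LBINT s. indicator {t<..} s * late t0 w (x, s) - indicator {t + h<..} s * late t0 w (x, s))" by (rule integral_diff[symmetric]) (auto intro: ind)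
 also have "... = (LBINT s. indicator {t..t + h} s * late t0 w (x, s))"
 proof (rule integral_cong_AE)
  have "AE s in lborel. s ~= t" by (rule AE_lborel_singleton)
  then show "AE s in lborel. indicator {t<..} s * late t0 w (x, s) - indicator {t + h<..} s * late t0 w (x, s) = indicator {t..t + h} s * late t0 w (x, s)"
   by eventually_elim (use t in \<open>auto simp: indicator_def\<close>)
 qed (use m in auto)
 also have "... = (LBINT r. indicator {t..t + h} (r + t) * late t0 w (x, r + t))" by (rule integral_shift[symmetric]) (use m in auto)
 also have "... = (LBINT r. indicator {0..h} r * late t0 w (x, t + r))" by (rule integral_cong[OF refl]) (auto simp: indicator_def add.commute)
 finally show ?thesis .
qed

text \<open>The sum R of U and the backward integral of w has weak time derivative zero, so by the
  translation formula it does not change under time shifts. P is its average over the times between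
  T/2 and T, where everything is square integrable.\<close>

lemma time_rep_exists:
 assumes U: "sq U" "off U" and w: "wloc w" and wd: "wder D (0, 1) U w"
 obtains P where "sq P" "time_rep U w P"
proof -
 have [measurable]: "U \<in> borelm" "w \<in> borelm" using U w by (auto simp: sq_measurable wloc_def)
 define R where "R z = U z + tint w z" for z
 have [measurable]: "R \<in> borelm" unfolding R_def by measurable
 have step1: "AE z in lborel. z \<in> D & z + (0, h) \<in> D --> R (z + (0, h)) = R z" if h: "0 < h" for h
 proof -
  \<comment> \<open>The translation formula needs square integrability of w, hence a fixed positive
    starting time; countably many starting times exhaust the cylinder.\<close>
  have "AE z in lborel. z \<in> \<Omega> \<times> {t0<..<T - h} --> R (z + (0, h)) = R z" if t0: "0 < t0" for t0
  proof -
   let ?U = "\<Omega> \<times> {t0<..<T}" and ?W = "\<Omega> \<times> {t0<..<T - h}"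
   have "wder ?U (0, 1) (late t0 U) (late t0 w)" unfolding wder_def
   proof (intro allI impI)
    fix \<phi> assume t: "test_fun ?U \<phi>"
    have "test_fun D \<phi>" by (rule test_fun_mono[OF t]) (use t0 in auto)
    then have "(LBINT z. U z * frechet_derivative \<phi> (at z) (0, 1)) = - (LBINT z. w z * \<phi> z)" using wd unfolding wder_def by blast
    moreover have "U z * frechet_derivative \<phi> (at z) (0, 1) = late t0 U z * frechet_derivative \<phi> (at z) (0, 1)" for z using test_fun_deriv_outside[OF t, of z] by (cases "z \<in> ?U") (auto simp: late_def)
    moreover have "w z * \<phi> z = late t0 w z * \<phi> z" for z using test_fun_outside[OF t, of z] by (cases "z \<in> ?U") (auto simp: late_def)
    ultimately show "(LBINT z. late t0 U z * frechet_derivative \<phi> (at z) (0, 1)) = - (LBINT z. late t0 w z * \<phi> z)" by simp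
   qed
   moreover have "open ?W" using \<Omega>_open by (intro open_Times) auto
   moreover have "sq (late t0 w)" using w t0 by (simp add: wloc_def)
   ultimately have "AE z in lborel. z \<in> ?W --> late t0 U (z + h *\<^sub>R (0, 1)) - late t0 U z = (LBINT r. indicator {0..h} r * late t0 w (z + r *\<^sub>R (0, 1)))" using h by (intro wder_translation(1)[OF sq_late[OF U(1)]]) auto
   moreover have "AE z in lborel. integrable lborel (%t. late t0 w (fst z, t))" using AE_lborel_fst[OF wloc_slices[OF w t0]] .
   ultimately show ?thesis
   proof eventually_elim
    case (elim z)
    obtain x t where z: "z = (x, t)" by fastforce
    show ?case
    proof
     assume "z \<in> ?W"
     then have t: "t0 < t" "t + h < T" using z by auto
     have "U (x, t + h) - U (x, t) = (LBINT r. indicator {0..h} r * late t0 w (x, t + r))" using elim(1) \<open>z \<in> ?W\<close> t h by (simp add: z late_def)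
     with tint_increment[of t0 w x t h] elim(2) t t0 h show "R (z + (0, h)) = R z" by (simp add: R_def z)
    qed
   qed
  qed
  then have "AE z in lborel. \<forall>n. z \<in> \<Omega> \<times> {inverse (real (Suc n))<..<T - h} --> R (z + (0, h)) = R z" by (subst AE_all_countable) auto
  then show ?thesis
  proof eventually_elim
   case (elim z)
   show ?case
   proof
    assume z: "z \<in> D & z + (0, h) \<in> D"
    then have "0 < snd z" by auto
    then obtain n where "inverse (real (Suc n)) < snd z" using reals_Archimedean by blast
    with z have "z \<in> \<Omega> \<times> {inverse (real (Suc n))<..<T - h}" by (cases z) auto
    with elim show "R (z + (0, h)) = R z" by blast
   qed
  qed
 qed
 have step2: "AE z in lborel. z \<in> D & z + (0, h) \<in> D --> R (z + (0, h)) = R z" for h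
 proof (cases h "0::real" rule: linorder_cases)
  case less
  then have "AE z in lborel. z \<in> D & z + (0, - h) \<in> D --> R (z + (0, - h)) = R z" by (intro step1) simp
  from AE_shift[OF this, of "(0, h)"] show ?thesis
   by eventually_elim (auto simp: add.assoc)
 next
  case equal
  then show ?thesis by (simp add: zero_prod_def[symmetric])
 qed (rule step1)
 have "AE h in (lborel::real measure). AE z in lborel. z \<in> D & z + (0, h) \<in> D --> R (z + (0, h)) = R z" by (rule AE_I2) (rule step2)
 \<comment> \<open>Fubini for null sets: from every shift and almost every point to almost every
   point and almost every shift, which is what averaging over shifts requires.\<close>
 then have AE: "AE z in lborel. AE h in lborel. z \<in> D & z + (0, h) \<in> D --> R (z + (0, h)) = R z"
 proof (subst lborel_pair.AE_commute)
  have s: "(%p::((real^'n) \<times> real) \<times> real. fst p + (0, snd p)) \<in> borelm" by (rule borel_measurable_continuous_onI) (intro continuous_intros)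
  have f: "(fst :: ((real^'n) \<times> real) \<times> real => _) \<in> borelm" by (rule borel_measurable_continuous_onI) (intro continuous_intros)
  note [measurable] = s f
  have "{p::((real^'n) \<times> real) \<times> real. fst p \<in> D & fst p + (0, snd p) \<in> D --> R (fst p + (0, snd p)) = R (fst p)} \<in> sets borel"
  proof -
   have "{p \<in> space borel. fst p \<in> D & fst p + (0, snd p) \<in> D --> R (fst p + (0, snd p)) = R (fst p)} \<in> sets (borel :: (((real^'n) \<times> real) \<times> real) measure)"
    by measurable
   then show ?thesis by simp
  qed
  then show "{x \<in> space (lborel \<Otimes>\<^sub>M lborel). fst x \<in> D & fst x + (0, snd x) \<in> D --> R (fst x + (0, snd x)) = R (fst x)} \<in> sets (lborel \<Otimes>\<^sub>M lborel)" unfolding lborel_prod by simp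
 qed
 define R1 where "R1 z = late (T/2) U z + ind {T/2<..} (snd z) * tint (late (T/2) w) z" for z
 have sw: "sq (late (T/2) w)" "off (late (T/2) w)" using w T_pos off_late by (auto simp: wloc_def)
 have R1: "sq R1" "off R1"
 proof -
  have "sq (late (T/2) (tint (late (T/2) w)))" by (rule sq_late[OF sq_tint(1)[OF sw]])
  then have "sq (%z. ind {T/2<..} (snd z) * tint (late (T/2) w) z)" by (simp add: late_def[abs_def])
  then show "sq R1" unfolding R1_def[abs_def] by (intro sq_add sq_late U)
  show "off R1" unfolding R1_def[abs_def] using off_late[OF U(2)] off_tint[OF sw(2)] by (auto simp: off_def)
 qed
 have R1_eq: "R1 z = ind {T/2<..} (snd z) * R z" if "z \<in> D" for z unfolding R1_def R_def using tint_late[of "T/2" z w] by (auto simp: late_def indicator_def)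
 \<comment> \<open>The interval from T/2 to T has length T/2, whence the factor.\<close>
 define P where "P x = (2/T) * tI R1 x" for x
 have "sq P" unfolding P_def[abs_def] using sq_scaleR[OF sq_tI(1)[OF R1], of "2/T"] by simp
 moreover have "time_rep U w P" unfolding time_rep_def using AE
 proof eventually_elim
  case (elim z)
  obtain x t where z: "z = (x, t)" by fastforce
  show ?case
  proof
   assume zD: "z \<in> D"
   have [measurable]: "R1 \<in> borelm" using R1 by (simp add: sq_measurable)
   have mR: "(%s. R1 (x, s)) \<in> borelm" by measurable
   have "tI R1 x = (LBINT h. R1 (x, h + t))" unfolding tI_def by (rule integral_shift[symmetric, OF mR])
   also have "... = (LBINT h. R z * indicator {T/2 - t<..<T - t} h)"
   proof (rule integral_cong_AE)
    show "AE h in lborel. R1 (x, h + t) = R z * indicator {T/2 - t<..<T - t} h" using elim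
    proof eventually_elim
     case (elim h)
     show ?case
     proof (cases "z + (0, h) \<in> D")
      case True
      with elim zD have e: "R (z + (0, h)) = R z" by blast
      have "R1 (x, h + t) = ind {T/2<..} (h + t) * R z" using R1_eq[OF True] e by (simp add: z add.commute)
      moreover have "ind {T/2<..} (h + t) = indicator {T/2 - t<..<T - t} h" using True by (auto simp: indicator_def z)
      ultimately show ?thesis by simp
     next
      case False
      then have "R1 (x, h + t) = 0" using offD[OF R1(2), of "z + (0, h)"] by (simp add: z add.commute)
      moreover have "h \<notin> {T/2 - t<..<T - t}"
      proof
       assume "h \<in> {T/2 - t<..<T - t}"
       with False zD show False using T_pos by (auto simp: z)
      qed
      ultimately show ?thesis by simp
     qed
    qed
    show "(%h. R1 (x, h + t)) \<in> borel_measurable lborel" using mR by measurable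
   qed measurable
   also have "... = R z * (T/2)" using T_pos by (simp add: mult.commute)
   finally have "P x = R z" using T_pos by (simp add: P_def field_simps)
   then show "U z = P (fst z) - tint w z" by (simp add: R_def z)
  qed
 qed
 ultimately show thesis by (rule that)
qed

text \<open>The fundamental theorem in time, applied backward from T, where \<open>\<phi>\<close>
  vanishes.\<close>

lemma test_fun_time_integral:
 assumes t: "test_fun D \<phi>"
 shows "tI (%z. frechet_derivative \<phi> (at z) (0, 1)) x = 0"
  and "z \<in> D ==> tint (%z. frechet_derivative \<phi> (at z) (0, 1)) z = - \<phi> z"
proof -
 let ?f = "%z. frechet_derivative \<phi> (at z) (0, 1)"
 have fo: "?f z = 0" if "z \<notin> D" for z using test_fun_deriv_outside[OF t that] .
 have *: "(LBINT s. indicator {a..T} s * ?f (x, s)) = - \<phi> (x, a)" if "a <= T" for a x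
 proof -
  have "(LBINT r. indicator {0..T - a} r * frechet_derivative \<phi> (at ((x, T) - r *\<^sub>R (0, 1))) (0, 1)) = \<phi> (x, T) - \<phi> ((x, T) - (T - a) *\<^sub>R (0, 1))" by (rule smooth_fun_line_integral[OF test_fun_smooth[OF t]]) (use that in simp)
  also have "... = - \<phi> (x, a)" using test_fun_outside[OF t, of "(x, T)"] by simp
  finally have 1: "(LBINT r. indicator {0..T - a} r * ?f (x, T - r)) = - \<phi> (x, a)" by simp
  have "(LBINT r. indicator {0..T - a} r * ?f (x, T - r)) = (LBINT r. indicator {a..T} (T + (-1) * r) * ?f (x, T + (-1) * r))" by (rule integral_cong[OF refl]) (auto simp: indicator_def)
  also have "... = (LBINT s. indicator {a..T} s * ?f (x, s))" using lborel_integral_real_affine[of "-1" "%s. indicator {a..T} s * ?f (x, s)" T] by simp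
  finally show ?thesis using 1 by simp
 qed
 show "tI ?f x = 0"
 proof -
  have "tI ?f x = (LBINT s. indicator {0..T} s * ?f (x, s))" unfolding tI_def by (rule integral_cong[OF refl]) (rename_tac s, case_tac "(x, s) \<in> D", auto simp: indicator_def fo)
  also have "... = - \<phi> (x, 0)" using *[of 0 x] T_pos by simp
  finally show ?thesis using test_fun_outside[OF t, of "(x, 0)"] by simp
 qed
 show "tint ?f z = - \<phi> z" if z: "z \<in> D"
 proof -
  obtain x a where za: "z = (x, a)" by fastforce
  have a: "0 < a" "a < T" using z za by auto
  have [measurable]: "?f \<in> borelm" by (rule sq_measurable[OF test_fun_sq[OF test_fun_deriv[OF t]]])
  have "tint ?f z = (LBINT s. indicator {a<..} s * ?f (x, s))" using a by (simp add: tint_def za)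
  also have "... = (LBINT s. indicator {a..T} s * ?f (x, s))"
  proof (rule integral_cong_AE)
   have "AE s in lborel. s ~= a" by (rule AE_lborel_singleton)
   then show "AE s in lborel. indicator {a<..} s * ?f (x, s) = indicator {a..T} s * ?f (x, s)"
    by eventually_elim (rename_tac s, case_tac "(x, s) \<in> D", auto simp: indicator_def fo)
  qed measurable
  finally show ?thesis using *[of a x] a by (simp add: za)
 qed
qed

lemma integral_fst_mult:
 fixes P :: "real^'n => real"
 assumes P: "sq P" and k: "sq k" "off k"
 shows "(LBINT z. P (fst z) * k z) = (LBINT x. P x * tI k x)" "integrable lborel (%z. P (fst z) * k z)"
proof -
 have s: "sq (%z::(real^'n)\<times>real. P (fst z) * ind {0<..<T} (snd z))" by (rule sq_prod(1)[OF P sq_indicator]) (use T_pos in auto)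
 have e: "P (fst z) * k z = (P (fst z) * ind {0<..<T} (snd z)) * k z" for z using offD[OF k(2), of z] by (cases "z \<in> D") (auto simp: indicator_def)
 show i: "integrable lborel (%z. P (fst z) * k z)" unfolding e by (rule sq_integrable_mult[OF s k(1)])
 show "(LBINT z. P (fst z) * k z) = (LBINT x. P x * tI k x)" unfolding integral_slices(1)[OF i] by (simp add: tI_def)
qed

text \<open>Converse of \<open>time_rep_exists\<close>. The support of \<phi> lies after some
  positive time, so w may be replaced by its late part and \<open>tint_polar\<close> swaps the time
  integrals; P drops out because the time derivative of \<phi> has integral zero on each time
  line.\<close>

lemma time_rep_wder:
 assumes w: "wloc w" and P: "sq P" and rep: "time_rep U w P" and U: "U \<in> borelm"
 shows "wder D (0, 1) U w" unfolding wder_def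
proof (intro allI impI)
 fix \<phi> assume t: "test_fun D \<phi>"
 let ?f = "%z. frechet_derivative \<phi> (at z) (0, 1)"
 obtain K where K: "compact K" "K \<subseteq> D" "!!z. z \<notin> K ==> \<phi> z = 0" "!!z. z \<notin> K ==> ?f z = 0" using t by (elim test_funE) metis
 obtain t0 where t0: "0 < t0" "!!z. z \<in> K ==> t0 < snd z"
 proof (cases "K = {}")
  case False
  have "compact (snd ` K)" by (rule compact_continuous_image[OF _ K(1)]) (intro continuous_intros)
  then obtain m where m: "m \<in> snd ` K" "!!y. y \<in> snd ` K ==> m <= y" using compact_attains_inf[of "snd ` K"] False by blast
  then have "m > 0" using K(2) by auto
  have "m/2 < snd z" if "z \<in> K" for z using m(2)[of "snd z"] that \<open>m > 0\<close> by auto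
  with \<open>m > 0\<close> show thesis by (intro that[of "m/2"]) auto
 qed (use that[of 1] in auto)
 have sf: "sq ?f" "off ?f" using test_fun_sq[OF test_fun_deriv[OF t]] test_fun_deriv_outside[OF t] by (auto simp: off_def)
 have sp: "sq \<phi>" "off \<phi>" using test_fun_sq[OF t] test_fun_outside[OF t] by (auto simp: off_def)
 have sw: "sq (late t0 w)" "off (late t0 w)" using w t0 off_late by (auto simp: wloc_def)
 have [measurable]: "U \<in> borelm" "?f \<in> borelm" "w \<in> borelm" "\<phi> \<in> borelm" "late t0 w \<in> borelm" "P \<in> borelm" using U sf sp w sw P by (auto simp: sq_measurable wloc_def)
 have "(LBINT z. U z * ?f z) = (LBINT z. P (fst z) * ?f z - tint (late t0 w) z * ?f z)"
 proof (rule integral_cong_AE)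
  show "AE z in lborel. U z * ?f z = P (fst z) * ?f z - tint (late t0 w) z * ?f z" using rep unfolding time_rep_def
  proof eventually_elim
   case (elim z)
   show ?case
   proof (cases "z \<in> K")
    case True
    then have "tint (late t0 w) z = tint w z" by (intro tint_late less_imp_le[OF t0(2)])
    with elim True K(2) show ?thesis by (auto simp: left_diff_distrib)
   qed (simp add: K(4))
  qed
  show "(%z. P (fst z) * ?f z - tint (late t0 w) z * ?f z) \<in> borel_measurable lborel" by measurable
 qed measurable
 also have "... = (LBINT z. P (fst z) * ?f z) - (LBINT z. tint (late t0 w) z * ?f z)" by (rule integral_diff[OF integral_fst_mult(2)[OF P sf] sq_integrable_mult[OF sq_tint(1)[OF sw] sf(1)]])
 also have "(LBINT z. P (fst z) * ?f z) = 0" unfolding integral_fst_mult(1)[OF P sf] by (simp add: test_fun_time_integral(1)[OF t])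
 also have "(LBINT z. tint (late t0 w) z * ?f z) = - (LBINT z. late t0 w z * tint ?f z)" using tint_polar[OF sf sw] by (simp add: test_fun_time_integral(1)[OF t] mult.commute)
 also have "(LBINT z. late t0 w z * tint ?f z) = (LBINT z. - (w z * \<phi> z))"
 proof (rule integral_cong[OF refl])
  fix z
  have "late t0 w z * \<phi> z = w z * \<phi> z" using K(3)[of z] t0(2)[of z] by (cases "z \<in> K") (auto simp: late_def)
  then show "late t0 w z * tint ?f z = - (w z * \<phi> z)" using test_fun_time_integral(2)[OF t, of z] offD[OF sw(2), of z] test_fun_outside[OF t, of z] by (cases "z \<in> D") auto
 qed
 finally show "(LBINT z. U z * ?f z) = - (LBINT z. w z * \<phi> z)" by simp
qed

end

subsection \<open>Solutions and energy estimates\<close>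

lemma mult_integral_LIMSEQ2:
 fixes f g :: "nat => 'a::euclidean_space => real"
 assumes f: "!!n. sq (f n)" "sq f0" "(%n. N2 (%x. f n x - f0 x)) ~~> 0"
  and g: "!!n. sq (g n)" "sq g0" "(%n. N2 (%x. g n x - g0 x)) ~~> 0"
 shows "(%n. \<integral>x. f n x * g n x \<partial>lborel) ~~> (LBINT x. f0 x * g0 x)"
proof -
 have 1: "(%n. \<integral>x. f n x * g0 x \<partial>lborel) ~~> (LBINT x. f0 x * g0 x)" by (rule mult_integral_LIMSEQ[OF f(1,2) g(2) f(3)])
 have 2: "(%n. \<integral>x. g n x * f0 x \<partial>lborel) ~~> (LBINT x. g0 x * f0 x)" by (rule mult_integral_LIMSEQ[OF g(1,2) f(2) g(3)])
 have 3: "(%n. \<integral>x. (f n x - f0 x) * (g n x - g0 x) \<partial>lborel) ~~> 0"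
 proof (rule tendsto_rabs_zero_cancel, rule tendsto_sandwich[OF _ _ tendsto_const])
  show "\<forall>\<^sub>F n in sequentially. \<bar>\<integral>x. (f n x - f0 x) * (g n x - g0 x) \<partial>lborel\<bar> <= sqrt (N2 (%x. f n x - f0 x)) * sqrt (N2 (%x. g n x - g0 x))" by (intro always_eventually allI Cauchy_Schwarz_mult sq_diff f g)
  show "(%n. sqrt (N2 (%x. f n x - f0 x)) * sqrt (N2 (%x. g n x - g0 x))) ~~> 0" using tendsto_mult[OF tendsto_real_sqrt[OF f(3)] tendsto_real_sqrt[OF g(3)]] by simp
 qed auto
 have eq: "(LBINT x. f n x * g n x) = (LBINT x. f n x * g0 x) + (LBINT x. g n x * f0 x) + (LBINT x. (f n x - f0 x) * (g n x - g0 x)) - (LBINT x. f0 x * g0 x)" for n by (simp add: algebra_simps sq_integrable_mult f g)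
 have "(%n. \<integral>x. f n x * g n x \<partial>lborel) ~~> (LBINT x. f0 x * g0 x) + (LBINT x. g0 x * f0 x) + 0 - (LBINT x. f0 x * g0 x)" unfolding eq by (intro tendsto_intros 1 2 3)
 then show ?thesis by (simp add: mult.commute)
qed

lemma N2_LIMSEQ:
 assumes "!!n. sq (f n)" "sq f0" "(%n. N2 (%x. f n x - f0 x)) ~~> 0"
 shows "(%n. N2 (f n)) ~~> N2 f0"
proof -
 have 1: "(%n. \<integral>x. f n x \<bullet> f0 x \<partial>lborel) ~~> (LBINT x. f0 x \<bullet> f0 x)" by (rule inner_integral_LIMSEQ[OF assms(1,2,2,3)])
 have p: "(norm a)^2 = (norm (a - b))^2 + 2 * (a \<bullet> b) - b \<bullet> b" for a b :: 'b by (simp add: power2_norm_eq_inner inner_diff_left inner_diff_right inner_commute)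
 have eq: "N2 (f n) = N2 (%x. f n x - f0 x) + 2 * (LBINT x. f n x \<bullet> f0 x) - (LBINT x. f0 x \<bullet> f0 x)" for n
 proof -
  have "N2 (f n) = (LBINT x. (norm (f n x - f0 x))^2 + 2 * (f n x \<bullet> f0 x) - f0 x \<bullet> f0 x)" unfolding N2_def by (rule integral_cong[OF refl p])
  then show ?thesis by (simp add: N2_def sq_integrable[OF sq_diff[OF assms(1,2)]] sq_integrable_inner assms)
 qed
 have "(%n. N2 (f n)) ~~> 0 + 2 * (LBINT x. f0 x \<bullet> f0 x) - (LBINT x. f0 x \<bullet> f0 x)" unfolding eq by (intro tendsto_intros assms 1)
 then show ?thesis by (simp add: N2_def power2_norm_eq_inner)
qed

lemma test_fun_translation:
 assumes t: "test_fun U \<phi>" and h: "0 <= h"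
 shows "N2 (%z. \<phi> z - \<phi> (z - h *\<^sub>R d)) <= h^2 * N2 (%z. frechet_derivative \<phi> (at z) d)"
proof -
 let ?D = "%z. frechet_derivative \<phi> (at z) d"
 have sD: "sq ?D" by (rule test_fun_sq[OF test_fun_deriv[OF t]])
 have [measurable]: "?D \<in> borelm" using sD by (rule sq_measurable)
 interpret K: param_avg "%z r. ?D (z - r *\<^sub>R d)" "{0..h}" h "N2 ?D"
 proof
  show "(%(z, r). ?D (z - r *\<^sub>R d)) \<in> borel_measurable (borel \<Otimes>\<^sub>M borel)" by measurable
  show "sq (%z. ?D (z - r *\<^sub>R d))" for r using sq_shift[OF sD, of "- (r *\<^sub>R d)"] by simp
  show "N2 (%z. ?D (z - r *\<^sub>R d)) <= N2 ?D" for r using N2_shift[OF sD, of "- (r *\<^sub>R d)"] by simp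
 qed (use h in auto)
 have "K.avg = (%z. \<phi> z - \<phi> (z - h *\<^sub>R d))" unfolding K.avg_def using smooth_fun_line_integral[OF test_fun_smooth[OF t] h] by (simp add: fun_eq_iff)
 with K.N2_avg show ?thesis by simp
qed

text \<open>Density of test functions, for which a shift by s costs at most s times the norm of a
  fixed derivative.\<close>

lemma translation_continuous:
 fixes u :: "'a::euclidean_space => real"
 assumes u: "sq u" and e: "e > 0"
 shows "\<exists>\<eta>>0. \<forall>s. 0 <= s & s <= \<eta> --> N2 (%z. u (z - s *\<^sub>R d) - u z) <= e"
proof -
 obtain \<phi> where t: "test_fun UNIV \<phi>" and \<phi>: "N2 (%x. \<phi> x - u x) < e / 16" using test_dense[OF open_UNIV u] e unfolding test_dense_def by (auto dest!: spec[of _ "e/16"])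
 have s\<phi>: "sq \<phi>" by (rule test_fun_sq[OF t])
 define M where "M = N2 (%z. frechet_derivative \<phi> (at z) d)"
 \<comment> \<open>The cap 1 gives s^2 <= s, and the second term then makes s^2 M at most
   e/8.\<close>
 define \<eta> where "\<eta> = min 1 (e / (8 * (M + 1)))"
 have M: "0 <= M" by (simp add: M_def)
 have "\<eta> > 0" using e M by (simp add: \<eta>_def)
 moreover have "N2 (%z. u (z - s *\<^sub>R d) - u z) <= e" if s: "0 <= s" "s <= \<eta>" for s
 proof -
  have us: "sq (%z. u (z - s *\<^sub>R d))" and ps: "sq (%z. \<phi> (z - s *\<^sub>R d))" using sq_shift[OF u, of "- (s *\<^sub>R d)"] sq_shift[OF s\<phi>, of "- (s *\<^sub>R d)"] by simp_all
  have a: "N2 (%z. u (z - s *\<^sub>R d) - \<phi> (z - s *\<^sub>R d)) <= e / 16" using N2_shift[OF sq_diff[OF s\<phi> u], of "- (s *\<^sub>R d)"] \<phi> N2_minus_commute[of "%z. u (z - s *\<^sub>R d)" "%z. \<phi> (z - s *\<^sub>R d)"] by simp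
  have "N2 (%z. \<phi> z - \<phi> (z - s *\<^sub>R d)) <= s^2 * M" unfolding M_def by (rule test_fun_translation[OF t s(1)])
  also have "s^2 * M <= e / 8"
  proof -
   have "s <= 1" using s(2) by (simp add: \<eta>_def)
   with s(1) have "s^2 <= s" by (simp add: power2_eq_square mult_left_le_one_le)
   also have "s <= e / (8 * (M + 1))" using s(2) by (simp add: \<eta>_def)
   finally have "s^2 * M <= e / (8 * (M + 1)) * M" using M by (rule mult_right_mono)
   also have "... <= e / 8" using M e by (simp add: field_simps)
   finally show ?thesis .
  qed
  finally have b: "N2 (%z. \<phi> (z - s *\<^sub>R d) - \<phi> z) <= e / 8" using N2_minus_commute by metis
  have "N2 (%z. u (z - s *\<^sub>R d) - \<phi> z) <= 2 * (e/16) + 2 * (e/8)" using N2_triangle[OF us ps s\<phi>] a b by linarith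
  with N2_triangle[OF us s\<phi> u] \<phi> e show ?thesis by linarith
 qed
 ultimately show ?thesis by blast
qed

definition coef :: "('a::euclidean_space => real) => real => real => bool" where
 "coef \<beta> c C \<longleftrightarrow> 0 < c & \<beta> \<in> borelm & (\<forall>x. c <= \<beta> x & \<beta> x <= C)"

lemma coefD:
 assumes "coef \<beta> c C"
 shows "0 < c" "\<beta> \<in> borelm" "c <= \<beta> x" "\<beta> x <= C" "\<bar>\<beta> x\<bar> <= C" "0 < \<beta> x" "0 < C"
  "\<bar>1 / \<beta> x\<bar> <= 1 / c" "1 / C <= 1 / \<beta> x" "(%x. 1 / \<beta> x) \<in> borelm"
proof -
 show 1: "0 < c" "\<beta> \<in> borelm" "c <= \<beta> x" "\<beta> x <= C" using assms by (auto simp: coef_def)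
 show 2: "0 < \<beta> x" using 1 by linarith
 show "\<bar>\<beta> x\<bar> <= C" "0 < C" using 1 2 by linarith+
 show "\<bar>1 / \<beta> x\<bar> <= 1 / c" using 1 2 by (simp add: frac_le)
 show "1 / C <= 1 / \<beta> x" using 1 2 by (simp add: frac_le)
 show "(%x. 1 / \<beta> x) \<in> borelm" using 1(2) by measurable
qed

context cylinder
begin

lemma sq_fst_mult:
 fixes \<beta> :: "real^'n => real"
 assumes "sq v" "\<beta> \<in> borelm" "!!x. \<bar>\<beta> x\<bar> <= C"
 shows "sq (%z::(real^'n)\<times>real. \<beta> (fst z) * v z)" by (rule sq_mult_bounded[OF assms(1) measurable_compose[OF fst_borel assms(2)]]) (rule assms(3))

lemma late_integral_LIMSEQ:
 assumes h: "integrable lborel h" "off h" and tk: "!!k::nat. 0 < tk k" "tk ~~> 0"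
 shows "(%k. \<integral>z. late (tk k) h z \<partial>lborel) ~~> (LBINT z. h z)"
proof (rule integral_dominated_convergence[where w = "%z. norm (h z)"])
 have [measurable]: "h \<in> borelm" using h by auto
 show "late (tk k) h \<in> borel_measurable lborel" for k unfolding late_def[abs_def] by measurable
 show "AE z in lborel. (%k. late (tk k) h z) ~~> h z"
 proof (rule AE_I2)
  fix z show "(%k. late (tk k) h z) ~~> h z"
  proof (cases "z \<in> D")
   case True
   then have "0 < snd z" by auto
   from order_tendstoD(2)[OF tk(2) this] have "eventually (%k. late (tk k) h z = h z) sequentially"
    by eventually_elim (simp add: late_def)
   then show ?thesis by (rule tendsto_eventually)
  qed (simp add: late_def offD[OF h(2)])
 qed
qed (use h in \<open>auto simp: late_def indicator_def\<close>)

lemma N2_late_LIMSEQ: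
 assumes h: "sq h" "off h" and tk: "!!k::nat. 0 < tk k" "tk ~~> 0"
 shows "(%k. N2 (%z. late (tk k) h z - h z)) ~~> 0"
proof (rule N2_dominated_LIMSEQ[OF h(1)])
 show "AE z in lborel. (%k. late (tk k) h z) ~~> h z"
 proof (rule AE_I2)
  fix z show "(%k. late (tk k) h z) ~~> h z"
  proof (cases "z \<in> D")
   case True
   then have "0 < snd z" by auto
   from order_tendstoD(2)[OF tk(2) this] have "eventually (%k. late (tk k) h z = h z) sequentially"
    by eventually_elim (simp add: late_def)
   then show ?thesis by (rule tendsto_eventually)
  qed (simp add: late_def offD[OF h(2)])
 qed
qed (use h sq_late[OF h(1)] in \<open>auto simp: late_def indicator_def sq_measurable\<close>)

text \<open>The trace at time t of the function represented by \<open>time_rep\<close>, fixed for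
  every t > 0 and not only for almost every t.\<close>

definition Ut :: "((real^'n) \<times> real => real) => (real^'n => real) => real => real^'n => real" where
 "Ut w P t x = P x - tI (late t w) x"

text \<open>Here v solves d_t (\<beta> v) - Laplace v = f, w is the time derivative of \<beta> v, P
  its final value and \<open>ub\<close> its initial value. The datum is required along some sequence
  of times tending to 0 only, because a given weak solution is known to agree with its
  representation at almost every time.\<close>

definition is_sol :: "(real^'n => real) => ((real^'n) \<times> real => real) => (real^'n => real) =>
  ((real^'n) \<times> real => real) => ((real^'n) \<times> real => real^'n) => ((real^'n) \<times> real => real) => (real^'n => real) => bool" where
 "is_sol \<beta> f ub v G w P \<longleftrightarrow> H1 v G & wloc w & sq P & time_rep (%z. \<beta> (fst z) * v z) w P &
   (\<exists>tk. (\<forall>k::nat. 0 < tk k) & tk ~~> 0 & (%k. N2 (%x. Ut w P (tk k) x - ub x)) ~~> 0) &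
   (\<forall>\<phi> G\<phi> t0. H1 \<phi> G\<phi> --> 0 < t0 --> (\<forall>z. snd z < t0 --> \<phi> z = 0) -->
    (LBINT z. w z * \<phi> z) + (LBINT z. G z \<bullet> G\<phi> z) = (LBINT z. f z * \<phi> z))"

lemma wloc_late: "wloc w ==> 0 < t0 ==> sq (late t0 w)" "wloc w ==> off (late t0 w)" using off_late by (auto simp: wloc_def)

lemma sq_Ut: "wloc w ==> sq P ==> 0 < t ==> sq (Ut w P t)" unfolding Ut_def[abs_def] by (intro sq_diff sq_tI wloc_late)

lemma late_mult_swap: "(%z. w z * late t0 \<phi> z) = (%z. late t0 w z * \<phi> z)" by (auto simp: late_def fun_eq_iff)

text \<open>Integration by parts in time. The backward integral of the late part of w equals P - U
  after t0 and is constant in time before t0, so \<open>tint_polar\<close> leaves U and its trace at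
  t0.\<close>

lemma duhamel_identity:
 assumes w: "wloc w" and P: "sq P" and U: "sq U" "off U" and rep: "time_rep U w P" and \<Phi>: "sq \<Phi>" "off \<Phi>" and t0: "0 < t0"
 shows "(LBINT z. late t0 w z * tint \<Phi> z) = (LBINT z. late t0 \<Phi> z * U z) - (LBINT z. Ut w P t0 (fst z) * late t0 \<Phi> z)"
proof -
 let ?L = "late t0 w"
 note L = wloc_late[OF w] note L = L(1)[OF t0] L(2)
 have sA: "sq (tI ?L)" by (rule sq_tI(1)[OF L])
 have l\<Phi>: "sq (late t0 \<Phi>)" "off (late t0 \<Phi>)" using \<Phi> by (auto intro: sq_late off_late)
 have [measurable]: "\<Phi> \<in> borelm" "late t0 \<Phi> \<in> borelm" "P \<in> borelm" "U \<in> borelm" "tint ?L \<in> borelm" "tI ?L \<in> borelm" using \<Phi> l\<Phi> P U sA sq_tint(1)[OF L] by (auto simp: sq_measurable)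
 note i = integral_fst_mult[OF sA \<Phi>] integral_fst_mult(2)[OF sA l\<Phi>] integral_fst_mult(2)[OF P l\<Phi>]
 have "(LBINT z. \<Phi> z * tint ?L z) = (LBINT z. tI ?L (fst z) * \<Phi> z - tI ?L (fst z) * late t0 \<Phi> z + P (fst z) * late t0 \<Phi> z - late t0 \<Phi> z * U z)"
 proof (rule integral_cong_AE)
  show "AE z in lborel. \<Phi> z * tint ?L z = tI ?L (fst z) * \<Phi> z - tI ?L (fst z) * late t0 \<Phi> z + P (fst z) * late t0 \<Phi> z - late t0 \<Phi> z * U z" using rep unfolding time_rep_def
  proof eventually_elim
   case (elim z)
   show ?case
   proof (cases "z \<in> D")
    case True
    show ?thesis
    proof (cases "t0 < snd z")
     case True
     then have "tint ?L z = tint w z" by (intro tint_late) simp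
     moreover have "tint w z = P (fst z) - U z" using elim \<open>z \<in> D\<close> by simp
     ultimately show ?thesis using True by (simp add: late_def right_diff_distrib mult.commute)
    next
     case False
     then have "tint ?L z = tI ?L (fst z)" using \<open>z \<in> D\<close> by (intro tint_late_early) auto
     with False show ?thesis by (simp add: late_def[of t0 \<Phi>])
    qed
   qed (simp add: offD[OF \<Phi>(2)] offD[OF l\<Phi>(2)])
  qed
 qed measurable
 also have "... = (LBINT z. tI ?L (fst z) * \<Phi> z) - (LBINT z. tI ?L (fst z) * late t0 \<Phi> z) + (LBINT z. P (fst z) * late t0 \<Phi> z) - (LBINT z. late t0 \<Phi> z * U z)" by (simp add: i(2-4) sq_integrable_mult[OF l\<Phi>(1) U(1)])
 finally have 1: "(LBINT z. \<Phi> z * tint ?L z) = ..." .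
 have 2: "(LBINT z. Ut w P t0 (fst z) * late t0 \<Phi> z) = (LBINT z. P (fst z) * late t0 \<Phi> z) - (LBINT z. tI ?L (fst z) * late t0 \<Phi> z)" by (simp add: Ut_def left_diff_distrib i(3,4))
 have 3: "(LBINT x. tI ?L x * tI \<Phi> x) = (LBINT z. tI ?L (fst z) * \<Phi> z)" using i(1) by simp
 show ?thesis using tint_polar[OF L \<Phi>] 1 2 3 by linarith
qed

text \<open>The equation is tested with the backward integral of \<Phi>, cut off before a time tk
  that then tends to 0. The result contains the datum but neither the time derivative nor a trace,
  so it passes to weak limits.\<close>

lemma weak_duhamel:
 assumes S: "is_sol \<beta> f ub v G w P" and \<beta>: "coef \<beta> c C" and f: "sq f" and ub: "sq ub" and H: "H1 \<Phi> G\<Phi>"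
 shows "(LBINT z. \<beta> (fst z) * v z * \<Phi> z) + (LBINT z. G z \<bullet> tint G\<Phi> z) = (LBINT z. f z * tint \<Phi> z) + (LBINT x. ub x * tI \<Phi> x)"
proof -
 define U where "U z = \<beta> (fst z) * v z" for z
 have Hv: "H1 v G" and w: "wloc w" and P: "sq P" and rep: "time_rep U w P" using S by (auto simp: is_sol_def U_def[abs_def])
 obtain tk where tk: "!!k::nat. 0 < tk k" "tk ~~> 0" "(%k. N2 (%x. Ut w P (tk k) x - ub x)) ~~> 0" using S unfolding is_sol_def by blast
 have U: "sq U" "off U" unfolding U_def[abs_def] using sq_fst_mult[OF H1_sq(1)[OF Hv] coefD(2,5)[OF \<beta>]] H1_outside(1)[OF Hv] by (auto simp: off_def)
 note \<Phi> = H1_sq(1)[OF H] H1_off(1)[OF H] and G\<Phi> = H1_sq(2)[OF H] H1_off(2)[OF H]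
 note Ht = H1_tint[OF H]
 define J where "J z = ind \<Omega> (fst z) * ind {0<..<T} (snd z)" for z
 have eq: "(LBINT z. late (tk k) \<Phi> z * U z) - (LBINT z. (Ut w P (tk k) (fst z) * ind {0<..<T} (snd z)) * late (tk k) \<Phi> z)
   + (LBINT z. late (tk k) (%z. G z \<bullet> tint G\<Phi> z) z) = (LBINT z. late (tk k) (%z. f z * tint \<Phi> z) z)" for k
 proof -
  have "H1 (%z. ind {tk k<..} (snd z) * tint \<Phi> z) (%z. ind {tk k<..} (snd z) *\<^sub>R tint G\<Phi> z)" by (rule H1_cut[OF Ht, where C=1]) (auto simp: indicator_def)
  moreover have "\<forall>z. snd z < tk k --> ind {tk k<..} (snd z) * tint \<Phi> z = 0" by simp
  ultimately have "(LBINT z. w z * late (tk k) (tint \<Phi>) z) + (LBINT z. G z \<bullet> (ind {tk k<..} (snd z) *\<^sub>R tint G\<Phi> z)) = (LBINT z. f z * (ind {tk k<..} (snd z) * tint \<Phi> z))" using S tk(1)[of k] unfolding is_sol_def late_def by blast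
  moreover have "(LBINT z. Ut w P (tk k) (fst z) * late (tk k) \<Phi> z) = (LBINT z. (Ut w P (tk k) (fst z) * ind {0<..<T} (snd z)) * late (tk k) \<Phi> z)"
  proof (rule integral_cong[OF refl])
   fix z show "Ut w P (tk k) (fst z) * late (tk k) \<Phi> z = (Ut w P (tk k) (fst z) * ind {0<..<T} (snd z)) * late (tk k) \<Phi> z" using offD[OF \<Phi>(2), of z] by (cases "z \<in> D") (auto simp: late_def indicator_def)
  qed
  ultimately show ?thesis unfolding late_mult_swap duhamel_identity[OF w P U rep \<Phi> tk(1)] by (simp add: late_def mult.left_commute)
 qed
 have 1: "(%k. \<integral>z. late (tk k) \<Phi> z * U z \<partial>lborel) ~~> (LBINT z. \<Phi> z * U z)" by (rule mult_integral_LIMSEQ[OF sq_late[OF \<Phi>(1)] \<Phi>(1) U(1) N2_late_LIMSEQ[OF \<Phi> tk(1,2)]])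
 have s01: "sq (ind {0<..<T})" by (rule sq_indicator) (use T_pos in auto)
 have 2: "(%k. \<integral>z. (Ut w P (tk k) (fst z) * ind {0<..<T} (snd z)) * late (tk k) \<Phi> z \<partial>lborel) ~~> (LBINT z. (ub (fst z) * ind {0<..<T} (snd z)) * \<Phi> z)"
 proof (rule mult_integral_LIMSEQ2[OF _ _ _ sq_late[OF \<Phi>(1)] \<Phi>(1) N2_late_LIMSEQ[OF \<Phi> tk(1,2)]])
  show "sq (%z::(real^'n)\<times>real. Ut w P (tk k) (fst z) * ind {0<..<T} (snd z))" for k by (rule sq_prod(1)[OF sq_Ut[OF w P tk(1)] s01])
  show "sq (%z::(real^'n)\<times>real. ub (fst z) * ind {0<..<T} (snd z))" by (rule sq_prod(1)[OF ub s01])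
  have "N2 (%z::(real^'n)\<times>real. Ut w P (tk k) (fst z) * ind {0<..<T} (snd z) - ub (fst z) * ind {0<..<T} (snd z)) = N2 (%x. Ut w P (tk k) x - ub x) * N2 (ind {0<..<T})" for k using sq_prod(2)[OF sq_diff[OF sq_Ut[OF w P tk(1)] ub] s01, of k] by (simp add: left_diff_distrib)
  then show "(%k. N2 (%z::(real^'n)\<times>real. Ut w P (tk k) (fst z) * ind {0<..<T} (snd z) - ub (fst z) * ind {0<..<T} (snd z))) ~~> 0" using tendsto_mult_right[OF tk(3), of "N2 (ind {0<..<T})"] by simp
 qed
 have 3: "(%k. \<integral>z. late (tk k) (%z. G z \<bullet> tint G\<Phi> z) z \<partial>lborel) ~~> (LBINT z. G z \<bullet> tint G\<Phi> z)" by (rule late_integral_LIMSEQ[OF sq_integrable_inner[OF H1_sq(2)[OF Hv] H1_sq(2)[OF Ht]] _ tk(1,2)])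
   (use H1_outside(2)[OF Hv] in \<open>auto simp: off_def\<close>)
 have 4: "(%k. \<integral>z. late (tk k) (%z. f z * tint \<Phi> z) z \<partial>lborel) ~~> (LBINT z. f z * tint \<Phi> z)" by (rule late_integral_LIMSEQ[OF sq_integrable_mult[OF f H1_sq(1)[OF Ht]] _ tk(1,2)])
   (use H1_outside(1)[OF Ht] in \<open>auto simp: off_def\<close>)
 from LIMSEQ_unique[OF tendsto_add[OF tendsto_diff[OF 1 2] 3, unfolded eq] 4]
 have "(LBINT z. \<Phi> z * U z) - (LBINT z. (ub (fst z) * ind {0<..<T} (snd z)) * \<Phi> z) + (LBINT z. G z \<bullet> tint G\<Phi> z) = (LBINT z. f z * tint \<Phi> z)" .
 moreover have "(LBINT z. (ub (fst z) * ind {0<..<T} (snd z)) * \<Phi> z) = (LBINT z. ub (fst z) * \<Phi> z)"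
 proof (rule integral_cong[OF refl])
  fix z show "(ub (fst z) * ind {0<..<T} (snd z)) * \<Phi> z = ub (fst z) * \<Phi> z" using offD[OF \<Phi>(2), of z] by (cases "z \<in> D") (auto simp: indicator_def)
 qed
 ultimately show ?thesis using integral_fst_mult(1)[OF ub \<Phi>] by (simp add: U_def mult.commute)
qed

text \<open>Subtract the two identities of \<open>weak_duhamel\<close> for \<Phi> = v1 - v2: datum
  and source cancel, and the gradient term has a sign by \<open>tint_inner_nonneg\<close>.\<close>

lemma comparison:
 assumes S1: "is_sol \<beta>1 f ub v1 G1 w1 P1" and S2: "is_sol \<beta>2 f ub v2 G2 w2 P2"
  and \<beta>: "coef \<beta>1 c C" "coef \<beta>2 c C" and f: "sq f" and ub: "sq ub"
 shows "(LBINT z. \<beta>1 (fst z) * (v1 z - v2 z)^2) <= (LBINT z. (\<beta>2 (fst z) - \<beta>1 (fst z)) * v2 z * (v1 z - v2 z))"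
proof -
 have H: "H1 v1 G1" "H1 v2 G2" using S1 S2 by (auto simp: is_sol_def)
 define \<Phi> where "\<Phi> z = v1 z - v2 z" for z
 define F where "F z = G1 z - G2 z" for z
 have H\<Phi>: "H1 \<Phi> F" unfolding \<Phi>_def[abs_def] F_def[abs_def] by (rule H1_diff[OF H])
 note V = weak_duhamel[OF S1 \<beta>(1) f ub H\<Phi>] weak_duhamel[OF S2 \<beta>(2) f ub H\<Phi>]
 have sF: "sq (tint F)" by (rule H1_sq(2)[OF H1_tint[OF H\<Phi>]])
 have "0 <= (LBINT z. F z \<bullet> tint F z)" by (rule tint_inner_nonneg[OF H1_sq(2)[OF H\<Phi>] H1_off(2)[OF H\<Phi>]])
 also have "... = (LBINT z. G1 z \<bullet> tint F z) - (LBINT z. G2 z \<bullet> tint F z)" by (simp add: F_def inner_diff_left sq_integrable_inner sF H1_sq(2)[OF H(1)] H1_sq(2)[OF H(2)])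
 finally have le: "(LBINT z. \<beta>1 (fst z) * v1 z * \<Phi> z) <= (LBINT z. \<beta>2 (fst z) * v2 z * \<Phi> z)" using V by linarith
 have i: "integrable lborel (%z. \<beta> (fst z) * v z * \<Phi> z)" if "coef \<beta> c C" "sq v" for \<beta> v by (rule sq_integrable_mult[OF sq_fst_mult[OF that(2) coefD(2,5)[OF that(1)]] H1_sq(1)[OF H\<Phi>]])
 have "(LBINT z. \<beta>1 (fst z) * (v1 z - v2 z)^2) = (LBINT z. \<beta>1 (fst z) * v1 z * \<Phi> z - \<beta>1 (fst z) * v2 z * \<Phi> z)" by (simp add: \<Phi>_def algebra_simps power2_eq_square)
 also have "... = (LBINT z. \<beta>1 (fst z) * v1 z * \<Phi> z) - (LBINT z. \<beta>1 (fst z) * v2 z * \<Phi> z)" by (rule integral_diff) (use i[OF \<beta>(1)] H1_sq(1)[OF H(1)] H1_sq(1)[OF H(2)] in auto)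
 finally have 1: "(LBINT z. \<beta>1 (fst z) * (v1 z - v2 z)^2) = ..." .
 have "(LBINT z. (\<beta>2 (fst z) - \<beta>1 (fst z)) * v2 z * (v1 z - v2 z)) = (LBINT z. \<beta>2 (fst z) * v2 z * \<Phi> z - \<beta>1 (fst z) * v2 z * \<Phi> z)" by (simp add: \<Phi>_def algebra_simps)
 also have "... = (LBINT z. \<beta>2 (fst z) * v2 z * \<Phi> z) - (LBINT z. \<beta>1 (fst z) * v2 z * \<Phi> z)" by (rule integral_diff) (use i[OF \<beta>(1)] i[OF \<beta>(2)] H1_sq(1)[OF H(2)] in auto)
 finally show ?thesis using 1 le by linarith
qed

text \<open>\<open>weak_duhamel\<close> with \<Phi> = v, dropping the nonnegative gradient
  term.\<close>

lemma estimate_v: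
 assumes S: "is_sol \<beta> f ub v G w P" and \<beta>: "coef \<beta> c C" and f: "sq f" and ub: "sq ub"
 shows "sqrt (N2 v) <= (T * sqrt (N2 f) + sqrt T * sqrt (N2 ub)) / c"
proof -
 have H: "H1 v G" using S by (simp add: is_sol_def)
 note v = H1_sq(1)[OF H] H1_off(1)[OF H] and G = H1_sq(2)[OF H] H1_off(2)[OF H]
 note c = coefD(1)[OF \<beta>]
 have "c * N2 v = (LBINT z. c * (v z)^2)" by (simp add: N2_def)
 also have "... <= (LBINT z. \<beta> (fst z) * v z * v z)"
 proof (rule integral_mono)
  show "integrable lborel (%z. c * (v z)^2)" using sq_integrable[OF v(1)] by simp
  show "integrable lborel (%z. \<beta> (fst z) * v z * v z)" by (rule sq_integrable_mult[OF sq_fst_mult[OF v(1) coefD(2,5)[OF \<beta>]] v(1)])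
  show "c * (v z)^2 <= \<beta> (fst z) * v z * v z" for z using mult_right_mono[OF coefD(3)[OF \<beta>, of "fst z"], of "(v z)^2"] by (simp add: power2_eq_square mult.assoc)
 qed
 also have "... <= (LBINT z. f z * tint v z) + (LBINT x. ub x * tI v x)" using weak_duhamel[OF S \<beta> f ub H] tint_inner_nonneg[OF G] by linarith
 also have "... <= sqrt (N2 f) * sqrt (N2 (tint v)) + sqrt (N2 ub) * sqrt (N2 (tI v))" using Cauchy_Schwarz_mult[OF f sq_tint(1)[OF v]] Cauchy_Schwarz_mult[OF ub sq_tI(1)[OF v]] by linarith
 also have "... <= sqrt (N2 f) * (T * sqrt (N2 v)) + sqrt (N2 ub) * (sqrt T * sqrt (N2 v))"
 proof -
  have "sqrt (N2 (tint v)) <= sqrt (T^2 * N2 v)" "sqrt (N2 (tI v)) <= sqrt (T * N2 v)" using sq_tint(2)[OF v] sq_tI(2)[OF v] by simp_all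
  then have "sqrt (N2 (tint v)) <= T * sqrt (N2 v)" "sqrt (N2 (tI v)) <= sqrt T * sqrt (N2 v)" using T_pos by (simp_all add: real_sqrt_mult)
  then show ?thesis by (intro add_mono mult_left_mono) auto
 qed
 finally have le: "c * N2 v <= (T * sqrt (N2 f) + sqrt T * sqrt (N2 ub)) * sqrt (N2 v)" by (simp add: algebra_simps)
 show ?thesis
 proof (cases "N2 v = 0")
  case True
  then show ?thesis using c T_pos by simp
 next
  case False
  then have p: "0 < sqrt (N2 v)" using N2_nonneg[of v] by (simp add: less_le)
  have "(c * sqrt (N2 v)) * sqrt (N2 v) <= (T * sqrt (N2 f) + sqrt T * sqrt (N2 ub)) * sqrt (N2 v)" using le by (simp add: mult.assoc)
  then have "c * sqrt (N2 v) <= T * sqrt (N2 f) + sqrt T * sqrt (N2 ub)" using p by (rule mult_right_le_imp_le)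
  then show ?thesis using c by (simp add: pos_le_divide_eq mult.commute)
 qed
qed

text \<open>The time derivative of U^2/2 is w U, and the weight \<gamma> depends on x only, so it
  commutes with time integrals. With \<gamma> = 1/\<beta> the product \<gamma> U becomes v, an
  admissible test function.\<close>

lemma weighted_chain_rule:
 assumes w: "wloc w" and P: "sq P" and rep: "time_rep U w P" and t0: "0 < t0" and U: "U \<in> borelm"
  and \<gamma>: "\<gamma> \<in> borelm" "!!x. \<bar>\<gamma> x\<bar> <= C"
 shows "(LBINT z. late t0 w z * (\<gamma> (fst z) * U z)) = (LBINT x. \<gamma> x * ((P x)^2 - (Ut w P t0 x)^2) / 2)"
proof -
 let ?L = "late t0 w" and ?A = "tI (late t0 w)"
 note L = wloc_late[OF w] note L = L(1)[OF t0] L(2)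
 have sA: "sq ?A" by (rule sq_tI(1)[OF L])
 define M where "M z = \<gamma> (fst z) * ?L z" for z
 have M: "sq M" "off M" unfolding M_def[abs_def] using sq_fst_mult[OF L(1) \<gamma>] L(2) by (auto simp: off_def)
 have s\<gamma>P: "sq (%x. \<gamma> x * P x)" and s\<gamma>A: "sq (%x. \<gamma> x * ?A x)" by (rule sq_mult_bounded[OF _ \<gamma>]; fact)+
 have [measurable]: "P \<in> borelm" "U \<in> borelm" "?L \<in> borelm" "tint ?L \<in> borelm" "\<gamma> \<in> borelm" "M \<in> borelm" using P U L \<gamma> M sq_tint(1)[OF L] by (auto simp: sq_measurable)
 have "(LBINT z. ?L z * (\<gamma> (fst z) * U z)) = (LBINT z. (\<gamma> (fst z) * P (fst z)) * ?L z - M z * tint ?L z)"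
 proof (rule integral_cong_AE)
  show "AE z in lborel. ?L z * (\<gamma> (fst z) * U z) = (\<gamma> (fst z) * P (fst z)) * ?L z - M z * tint ?L z" using rep unfolding time_rep_def
  proof eventually_elim
   case (elim z)
   show ?case
   proof (cases "z \<in> D & t0 < snd z")
    case True
    then have "tint ?L z = tint w z" by (intro tint_late) simp
    moreover have "tint w z = P (fst z) - U z" using elim True by simp
    ultimately show ?thesis by (simp add: M_def right_diff_distrib mult_ac)
   next
    case False
    then have "?L z = 0" using offD[OF L(2), of z] by (auto simp: late_def)
    then show ?thesis by (simp add: M_def)
   qed
  qed
 qed measurable
 also have "... = (LBINT z. (\<gamma> (fst z) * P (fst z)) * ?L z) - (LBINT z. M z * tint ?L z)" by (rule integral_diff[OF integral_fst_mult(2)[OF s\<gamma>P L] sq_integrable_mult[OF M(1) sq_tint(1)[OF L]]])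
 also have "(LBINT z. (\<gamma> (fst z) * P (fst z)) * ?L z) = (LBINT x. \<gamma> x * P x * ?A x)" by (rule integral_fst_mult(1)[OF s\<gamma>P L])
 also have "(LBINT z. M z * tint ?L z) = (LBINT x. \<gamma> x * ?A x * ?A x) / 2"
 proof -
  have a: "tint M z = \<gamma> (fst z) * tint ?L z" for z
  proof -
   have "(LBINT s. ind {snd z<..} s * (\<gamma> (fst z) * ?L (fst z, s))) = \<gamma> (fst z) * (LBINT s. ind {snd z<..} s * ?L (fst z, s))" unfolding integral_mult_right_zero[symmetric] by (simp add: mult.left_commute)
   then show ?thesis by (simp add: tint_def M_def)
  qed
  have b: "tI M x = \<gamma> x * ?A x" for x by (simp add: tI_def M_def)
  have "(LBINT z. ?L z * tint M z) = (LBINT z. M z * tint ?L z)" unfolding a by (simp add: M_def algebra_simps)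
  then show ?thesis using tint_polar[OF M L] by (simp add: b)
 qed
 also have "(LBINT x. \<gamma> x * P x * ?A x) - (LBINT x. \<gamma> x * ?A x * ?A x) / 2 = (LBINT x. \<gamma> x * P x * ?A x - \<gamma> x * ?A x * ?A x / 2)" by (simp add: sq_integrable_mult[OF s\<gamma>P sA] sq_integrable_mult[OF s\<gamma>A sA])
 also have "... = (LBINT x. \<gamma> x * ((P x)^2 - (Ut w P t0 x)^2) / 2)" by (rule integral_cong[OF refl]) (simp add: Ut_def power2_eq_square field_simps)
 finally show ?thesis .
qed

text \<open>Test with v after the time tk. The final term is nonnegative and dropped, the initial
  one is at most 1/(2c) times the squared norm of the trace, and tk tends to 0.\<close>

lemma estimate_gradient:
 assumes S: "is_sol \<beta> f ub v G w P" and \<beta>: "coef \<beta> c C" and f: "sq f" and ub: "sq ub"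
 shows "N2 G <= sqrt (N2 f) * sqrt (N2 v) + N2 ub / (2 * c)"
proof -
 define U where "U z = \<beta> (fst z) * v z" for z
 have H: "H1 v G" and w: "wloc w" and P: "sq P" and rep: "time_rep U w P" using S by (auto simp: is_sol_def U_def[abs_def])
 obtain tk where tk: "!!k::nat. 0 < tk k" "tk ~~> 0" "(%k. N2 (%x. Ut w P (tk k) x - ub x)) ~~> 0" using S unfolding is_sol_def by blast
 note v = H1_sq(1)[OF H] H1_off(1)[OF H] and G = H1_sq(2)[OF H] H1_off(2)[OF H]
 note c = coefD(1)[OF \<beta>]
 have U: "U \<in> borelm" unfolding U_def[abs_def] using sq_fst_mult[OF v(1) coefD(2,5)[OF \<beta>]] by (rule sq_measurable)
 have \<gamma>U: "1 / \<beta> (fst z) * U z = v z" for z using coefD(6)[OF \<beta>, of "fst z"] by (simp add: U_def)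
 have le: "(LBINT z. late (tk k) (%z. (norm (G z))^2) z) <= (LBINT z. late (tk k) (%z. f z * v z) z) + N2 (Ut w P (tk k)) / (2 * c)" for k
 proof -
  have "H1 (%z. ind {tk k<..} (snd z) * v z) (%z. ind {tk k<..} (snd z) *\<^sub>R G z)" by (rule H1_cut[OF H, where C=1]) (auto simp: indicator_def)
  moreover have "\<forall>z. snd z < tk k --> ind {tk k<..} (snd z) * v z = 0" by simp
  ultimately have e: "(LBINT z. w z * late (tk k) v z) + (LBINT z. G z \<bullet> (ind {tk k<..} (snd z) *\<^sub>R G z)) = (LBINT z. f z * (ind {tk k<..} (snd z) * v z))" using S tk(1)[of k] unfolding is_sol_def late_def by blast
  have "(LBINT z. w z * late (tk k) v z) = (LBINT z. late (tk k) w z * (1 / \<beta> (fst z) * U z))" unfolding late_mult_swap \<gamma>U ..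
  also have "... = (LBINT x. 1 / \<beta> x * ((P x)^2 - (Ut w P (tk k) x)^2) / 2)" by (rule weighted_chain_rule[OF w P rep tk(1) U coefD(10,8)[OF \<beta>]])
  also have "... \<ge> (LBINT x. - ((Ut w P (tk k) x)^2 / (2 * c)))"
  proof (rule integral_mono)
   have "integrable lborel (%x. (Ut w P (tk k) x)^2)" using sq_integrable[OF sq_Ut[OF w P tk(1)], of k] by simp
   then show "integrable lborel (%x. - ((Ut w P (tk k) x)^2 / (2 * c)))" by simp
   have a: "integrable lborel (%x. 1 / \<beta> x * g x * g x)" if "sq g" for g by (rule sq_integrable_mult[OF sq_mult_bounded[OF that coefD(10,8)[OF \<beta>]] that])
   have "integrable lborel (%x. (1 / \<beta> x * P x * P x - 1 / \<beta> x * Ut w P (tk k) x * Ut w P (tk k) x) / 2)" by (intro integrable_diff integrable_divide a P sq_Ut[OF w P tk(1)])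
   then show "integrable lborel (%x. 1 / \<beta> x * ((P x)^2 - (Ut w P (tk k) x)^2) / 2)" by (simp add: power2_eq_square diff_divide_distrib)
   fix x
   have "1 / \<beta> x * (Ut w P (tk k) x)^2 <= 1 / c * (Ut w P (tk k) x)^2" by (intro mult_right_mono order_trans[OF abs_ge_self coefD(8)[OF \<beta>]]) simp
   moreover have "0 <= 1 / \<beta> x * (P x)^2" using coefD(6)[OF \<beta>, of x] by simp
   ultimately show "- ((Ut w P (tk k) x)^2 / (2 * c)) <= 1 / \<beta> x * ((P x)^2 - (Ut w P (tk k) x)^2) / 2" unfolding right_diff_distrib by (simp add: field_simps)
  qed
  finally have "- (N2 (Ut w P (tk k)) / (2 * c)) <= (LBINT z. w z * late (tk k) v z)" by (simp add: N2_def)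
  moreover have "(LBINT z. G z \<bullet> (ind {tk k<..} (snd z) *\<^sub>R G z)) = (LBINT z. late (tk k) (%z. (norm (G z))^2) z)" by (simp add: late_def power2_norm_eq_inner)
  moreover have "(LBINT z. f z * (ind {tk k<..} (snd z) * v z)) = (LBINT z. late (tk k) (%z. f z * v z) z)" by (simp add: late_def mult.left_commute)
  ultimately show ?thesis using e by linarith
 qed
 have 1: "(%k. \<integral>z. late (tk k) (%z. (norm (G z))^2) z \<partial>lborel) ~~> N2 G" unfolding N2_def by (rule late_integral_LIMSEQ[OF sq_integrable[OF G(1)] _ tk(1,2)])
   (use H1_outside(2)[OF H] in \<open>auto simp: off_def\<close>)
 have 2: "(%k. \<integral>z. late (tk k) (%z. f z * v z) z \<partial>lborel) ~~> (LBINT z. f z * v z)" by (rule late_integral_LIMSEQ[OF sq_integrable_mult[OF f v(1)] _ tk(1,2)])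
   (use H1_outside(1)[OF H] in \<open>auto simp: off_def\<close>)
 have "N2 G <= (LBINT z. f z * v z) + N2 ub / (2 * c)" by (rule LIMSEQ_le[OF 1 tendsto_add[OF 2 tendsto_divide[OF N2_LIMSEQ[OF sq_Ut[OF w P tk(1)] ub tk(3)] tendsto_const]]])
   (use le c in auto)
 with Cauchy_Schwarz_mult[OF f v(1)] show ?thesis by linarith
qed

end

subsection \<open>The weighted estimate of the time derivative\<close>

context cylinder
begin

text \<open>The moving average of L over the preceding time span of length h; for L = w it is the
  backward difference quotient of \<beta> v.\<close>

definition back_avg :: "real => ((real^'n) \<times> real => real) => (real^'n) \<times> real => real" where
 "back_avg h L z = (LBINT r. indicator {0..h} r * L (z + (0, r - h))) / h"

text \<open>The averaging error is itself an average of the errors of the shifts by 0 <= s <= h, so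
  it inherits their common bound.\<close>

lemma back_avg:
 assumes L: "sq L" and h: "0 < h"
 shows sq_back_avg: "sq (back_avg h L)"
  and N2_back_avg: "(!!s. 0 <= s ==> s <= h ==> N2 (%z. L (z - s *\<^sub>R (0, 1)) - L z) <= e) ==> N2 (%z. back_avg h L z - L z) <= e"
proof -
 have [measurable]: "L \<in> borelm" using L by (rule sq_measurable)
 have m: "(%p::((real^'n) \<times> real) \<times> real. L (fst p + (0, snd p - h))) \<in> borelm" by (rule measurable_compose[OF _ \<open>L \<in> _\<close>], rule borel_measurable_continuous_onI) (intro continuous_intros)
 have mL: "(%p::((real^'n) \<times> real) \<times> real. L (fst p)) \<in> borelm" by (rule measurable_compose[OF _ \<open>L \<in> _\<close>], rule borel_measurable_continuous_onI) (intro continuous_intros)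
 have d: "(%z. L (z + (0, r - h)) - L z) = (%z. L (z - (h - r) *\<^sub>R (0, 1)) - L z)" for r by (rule ext) (auto simp: algebra_simps prod_eq_iff intro!: arg_cong[where f=L])
 interpret A: param_avg "%z r. L (z + (0, r - h))" "{0..h}" h "N2 L"
 proof
  show "(%(z, r). L (z + (0, r - h))) \<in> borel_measurable (borel \<Otimes>\<^sub>M borel)" using m by (simp add: case_prod_beta' borel_prod)
 qed (use h in \<open>auto simp: sq_shift[OF L] N2_shift[OF L]\<close>)
 have Aavg: "back_avg h L = (%z. (1/h) *\<^sub>R A.avg z)" by (simp add: A.avg_def back_avg_def fun_eq_iff)
 show sb: "sq (back_avg h L)" unfolding Aavg by (rule sq_scaleR[OF A.sq_avg])
 assume e: "!!s. 0 <= s ==> s <= h ==> N2 (%z. L (z - s *\<^sub>R (0, 1)) - L z) <= e"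
 have e0: "0 <= e" using e[of 0] h order_trans[OF N2_nonneg] by fastforce
 interpret B: param_avg "%z r. L (z + (0, r - h)) - L z" "{0..h}" h e
 proof
  show "(%(z, r). L (z + (0, r - h)) - L z) \<in> borel_measurable (borel \<Otimes>\<^sub>M borel)" using borel_measurable_diff[OF m mL] by (simp add: case_prod_beta' borel_prod)
  show "sq (%z. L (z + (0, r - h)) - L z)" for r by (rule sq_diff[OF sq_shift[OF L] L])
  show "N2 (%z. L (z + (0, r - h)) - L z) <= e" if "r \<in> {0..h}" for r unfolding d by (rule e) (use that in auto)
 qed (use h e0 in auto)
 have ae: "AE z in lborel. (1/h) *\<^sub>R B.avg z = back_avg h L z - L z" using A.AE_integrable
 proof eventually_elim
  case (elim z)
  have "B.avg z = (LBINT r. indicator {0..h} r * L (z + (0, r - h)) - indicator {0..h} r * L z)" by (simp add: B.avg_def right_diff_distrib)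
  also have "... = (LBINT r. indicator {0..h} r * L (z + (0, r - h))) - (LBINT r. indicator {0..h} r * L z)"
  proof (rule integral_diff)
   have "integrable lborel (ind {0..h})" by (rule integrable_real_indicator) (use h in auto)
   then show "integrable lborel (%r. ind {0..h} r * L z)" by simp
  qed (use elim in auto)
  finally show ?case using h by (simp add: back_avg_def diff_divide_distrib)
 qed
 have "N2 (%z. back_avg h L z - L z) = N2 (%z. (1/h) *\<^sub>R B.avg z)" by (rule N2_cong_AE[OF ae sq_scaleR[OF B.sq_avg] sq_measurable[OF sq_diff[OF sb L]], symmetric])
 also have "... = (1/h)^2 * N2 B.avg" by (rule N2_scaleR)
 also have "... <= (1/h)^2 * (h^2 * e)" by (rule mult_left_mono[OF B.N2_avg]) simp
 also have "... = e" using h by (simp add: power2_eq_square)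
 finally show "N2 (%z. back_avg h L z - L z) <= e" .
qed

lemma back_avg_LIMSEQ:
 assumes L: "sq L" and h: "!!n::nat. 0 < h n" "h ~~> 0"
 shows "(%n. N2 (%z. back_avg (h n) L z - L z)) ~~> 0"
proof (rule LIMSEQ_I)
 fix e :: real assume e: "e > 0"
 obtain \<eta> where \<eta>: "\<eta> > 0" "!!s. 0 <= s ==> s <= \<eta> ==> N2 (%z. L (z - s *\<^sub>R (0, 1)) - L z) <= e/2" using translation_continuous[OF L half_gt_zero[OF e], of "(0, 1)"] by blast
 from order_tendstoD(2)[OF h(2) \<eta>(1)] obtain n0 where n0: "!!n. n \<ge> n0 ==> h n < \<eta>" by (auto simp: eventually_sequentially)
 have "norm (N2 (%z. back_avg (h n) L z - L z) - 0) < e" if "n \<ge> n0" for n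
 proof -
  have "N2 (%z. back_avg (h n) L z - L z) <= e/2" by (rule N2_back_avg[OF L h(1)], rule \<eta>(2)) (use n0[OF that] in auto)
  then show ?thesis using e by simp
 qed
 then show "\<exists>no. \<forall>n\<ge>no. norm (N2 (%z. back_avg (h n) L z - L z) - 0) < e" by blast
qed

text \<open>A time weight that vanishes up to t0 and grows with slope at most 1; the slope is the
  price paid in \<open>ramp_gradient_bound\<close>.\<close>

definition ramp :: "real => real => real" where "ramp t0 t = min T (max 0 (t - t0))"

lemma ramp: "0 <= ramp t0 t" "ramp t0 t <= T" "\<bar>ramp t0 t\<bar> <= T" "t <= t0 ==> ramp t0 t = 0"
 "0 <= h ==> ramp t0 (t + h) <= ramp t0 t + h" using T_pos by (auto simp: ramp_def)

lemma ramp_borel[measurable]: "ramp t0 \<in> borelm" unfolding ramp_def[abs_def] by measurable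

text \<open>Discrete form of integrating t grad v . d_t grad v by parts in time. It rests on a . (a
  - b) >= (|a|^2 - |b|^2)/2 and on a shift by h, which raises the ramp by at most h.\<close>

lemma ramp_gradient_bound:
 fixes G :: "(real^'n) \<times> real => real^'n"
 assumes G: "sq G" and h: "0 <= h"
 shows "- (h / 2 * N2 G) <= (LBINT z. G z \<bullet> (ramp t0 (snd z) *\<^sub>R (G z - sh (- h) G z)))"
proof -
 let ?r = "%z::(real^'n)\<times>real. ramp t0 (snd z)"
 have [measurable]: "G \<in> borelm" using G by (rule sq_measurable)
 have mr: "?r \<in> borelm" by measurable
 have sG: "sq (sh (- h) G)" by (rule sq_sh[OF G])
 have i: "integrable lborel (%z. ?r z * (norm (g z))^2)" if "sq g" for g :: "_ => real^'n" using sq_integrable_inner[OF sq_scale_bounded(1)[OF that mr ramp(3)] that] by (simp add: power2_norm_eq_inner)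
 have "(LBINT z. ?r z * (norm (sh (- h) G z))^2) = (LBINT z. ?r (z + (0,h)) * (norm (sh (- h) G (z + (0,h))))^2)" by (rule integral_shift[symmetric, of "%z. ?r z * (norm (sh (- h) G z))^2"]) (use sq_measurable[OF sG] mr in measurable)
 also have "... <= (LBINT z. ?r z * (norm (G z))^2 + h * (norm (G z))^2)"
 proof (rule integral_mono)
  show "integrable lborel (%z. ?r (z + (0,h)) * (norm (sh (- h) G (z + (0,h))))^2)" by (rule integrable_shift[OF i[OF sG]])
  show "integrable lborel (%z. ?r z * (norm (G z))^2 + h * (norm (G z))^2)" using i[OF G] sq_integrable[OF G] by simp
  fix z :: "(real^'n)\<times>real"
  have "norm (sh (- h) G (z + (0,h))) <= norm (G z)" by (cases z) (auto simp: sh_def indicator_def)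
  then have "(norm (sh (- h) G (z + (0,h))))^2 <= (norm (G z))^2" by (rule power_mono) simp
  moreover have "?r (z + (0,h)) <= ?r z + h" using ramp(5)[OF h] by (cases z) simp
  ultimately have "?r (z + (0,h)) * (norm (sh (- h) G (z + (0,h))))^2 <= (?r z + h) * (norm (G z))^2" using ramp(1)[of t0 "snd z"] h by (intro mult_mono) auto
  then show "?r (z + (0,h)) * (norm (sh (- h) G (z + (0,h))))^2 <= ?r z * (norm (G z))^2 + h * (norm (G z))^2" by (simp add: distrib_right)
 qed
 also have "... = (LBINT z. ?r z * (norm (G z))^2) + h * N2 G" using i[OF G] sq_integrable[OF G] by (simp add: N2_def)
 finally have 1: "(LBINT z. ?r z * (norm (sh (- h) G z))^2) <= ..." .
 have "(LBINT z. ?r z * (norm (G z))^2 / 2 - ?r z * (norm (sh (- h) G z))^2 / 2) <= (LBINT z. G z \<bullet> (?r z *\<^sub>R (G z - sh (- h) G z)))"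
 proof (rule integral_mono)
  show "integrable lborel (%z. ?r z * (norm (G z))^2 / 2 - ?r z * (norm (sh (- h) G z))^2 / 2)" using i[OF G] i[OF sG] by simp
  show "integrable lborel (%z. G z \<bullet> (?r z *\<^sub>R (G z - sh (- h) G z)))" by (rule sq_integrable_inner[OF G sq_scale_bounded(1)[OF sq_diff[OF G sG] mr ramp(3)]])
  fix z
  have "(norm a)^2 / 2 - (norm b)^2 / 2 <= a \<bullet> (a - b)" for a b :: "real^'n"
  proof -
   have "0 <= (norm (a - b))^2 / 2" by simp
   also have "... = a \<bullet> (a - b) - ((norm a)^2 / 2 - (norm b)^2 / 2)" by (simp add: power2_norm_eq_inner inner_diff_left inner_diff_right inner_commute field_simps)
   finally show ?thesis by simp
  qed
  from mult_left_mono[OF this[of "G z" "sh (- h) G z"] ramp(1)[of t0 "snd z"]]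
  show "?r z * (norm (G z))^2 / 2 - ?r z * (norm (sh (- h) G z))^2 / 2 <= G z \<bullet> (?r z *\<^sub>R (G z - sh (- h) G z))" by (simp add: right_diff_distrib)
 qed
 moreover have "(LBINT z. ?r z * (norm (G z))^2 / 2 - ?r z * (norm (sh (- h) G z))^2 / 2)
   = (LBINT z. ?r z * (norm (G z))^2) / 2 - (LBINT z. ?r z * (norm (sh (- h) G z))^2) / 2" using i[OF G] i[OF sG] by simp
 ultimately show ?thesis using 1 by linarith
qed

text \<open>The natural test function t d_t v has no spatial gradient at hand, so the backward
  difference of v, weighted by the ramp, takes its place. Dividing by h, letting h tend to 0 and
  applying Young's inequality to the source gives the bound.\<close>

lemma estimate_time_ramp:
 assumes S: "is_sol \<beta> f ub v G w P" and \<beta>: "coef \<beta> c C" and f: "sq f" and t0: "0 < t0"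
 shows "(LBINT z. ramp t0 (snd z) * (1 / \<beta> (fst z)) * (late (t0/2) w z)^2) <= N2 G + T / c * N2 f"
proof -
 define U where "U z = \<beta> (fst z) * v z" for z
 have H: "H1 v G" and w: "wloc w" and P: "sq P" and rep: "time_rep U w P" using S by (auto simp: is_sol_def U_def[abs_def])
 have c: "0 < c" by (rule coefD(1)[OF \<beta>])
 let ?L = "late (t0/2) w"
 have L: "sq ?L" "off ?L" using wloc_late[OF w, of "t0/2"] t0 by auto
 define g where "g z = ramp t0 (snd z) * (1 / \<beta> (fst z))" for z :: "(real^'n) \<times> real"
 have mg: "g \<in> borelm"
 proof -
  have "(%z::(real^'n) \<times> real. 1 / \<beta> (fst z)) \<in> borelm" by (rule measurable_compose[OF fst_borel coefD(10)[OF \<beta>]])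
  then show ?thesis unfolding g_def[abs_def] by measurable
 qed
 have g0: "0 <= g z" for z unfolding g_def using coefD(6)[OF \<beta>, of "fst z"] ramp(1) by simp
 have gT: "g z <= T / c" for z
 proof -
  have "ramp t0 (snd z) * (1 / \<beta> (fst z)) <= T * (1 / c)" using order_trans[OF abs_ge_self coefD(8)[OF \<beta>]] ramp T_pos coefD(6)[OF \<beta>, of "fst z"] by (intro mult_mono) auto
  then show ?thesis by (simp add: g_def)
 qed
 have gb: "\<bar>g z\<bar> <= T / c" for z using g0[of z] gT[of z] by simp
 define k where "k z = g z * ?L z" for z
 define m where "m z = g z * (ind D z * f z)" for z
 have sk: "sq k" unfolding k_def[abs_def] by (rule sq_mult_bounded[OF L(1) mg gb])
 have sf: "sq (%z. ind D z * f z)" by (rule sq_indicator_mult[OF f D_borel])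
 have sm: "sq m" unfolding m_def[abs_def] by (rule sq_mult_bounded[OF sf mg gb])
 \<comment> \<open>For h < t0/2 the times reached by the shift stay after t0/2, where w is square
   integrable.\<close>
 have step: "(LBINT z. back_avg h ?L z * k z) <= N2 G / 2 + (LBINT z. back_avg h ?L z * m z)" if h: "0 < h" "h < t0/2" for h
 proof -
  define \<phi> where "\<phi> z = ramp t0 (snd z) * (v z - sh (- h) v z)" for z
  define G\<phi> where "G\<phi> z = ramp t0 (snd z) *\<^sub>R (G z - sh (- h) G z)" for z
  have H\<phi>: "H1 \<phi> G\<phi>" unfolding \<phi>_def[abs_def] G\<phi>_def[abs_def] by (rule H1_cut[OF H1_diff[OF H H1_sh[OF H]] ramp_borel ramp(3)])
  have "\<forall>z. snd z < t0 --> \<phi> z = 0" by (simp add: \<phi>_def ramp(4))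
  then have e: "(LBINT z. w z * \<phi> z) + (LBINT z. G z \<bullet> G\<phi> z) = (LBINT z. f z * \<phi> z)" using S H\<phi> t0 unfolding is_sol_def by blast
  \<comment> \<open>By \<open>tint_increment\<close>, \<beta> times the backward difference of v is
    the integral of w over the last time span of length h.\<close>
  have "AE z in lborel. \<phi> z = ind D z * (g z * (h * back_avg h ?L z))" using rep[unfolded time_rep_def] AE_shift[OF rep[unfolded time_rep_def], of "- (0, h)"] AE_lborel_fst[OF wloc_slices[OF w half_gt_zero[OF t0]]]
  proof eventually_elim
   case (elim z)
   obtain x t where z: "z = (x, t)" by fastforce
   show ?case
   proof (cases "z \<in> D & t0 < t")
    case True
    then have D: "(x, t) \<in> D" "(x, t - h) \<in> D" using h t0 by (auto simp: z)
    have 1: "U (x, t) = P x - tint w (x, t)" "U (x, t - h) = P x - tint w (x, t - h)" using elim(1,2) D by (simp_all add: z)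
    have "tint w (x, t - h) - tint w (x, (t - h) + h) = (LBINT r. indicator {0..h} r * ?L (x, (t - h) + r))" by (rule tint_increment) (use elim(3) t0 h True in \<open>auto simp: z\<close>)
    then have "tint w (x, t - h) - tint w (x, t) = h * back_avg h ?L z" using h by (simp add: back_avg_def z algebra_simps)
    then have "\<beta> x * (v (x, t) - v (x, t - h)) = h * back_avg h ?L z" using 1 by (simp add: U_def right_diff_distrib)
    then have "v (x, t) - v (x, t - h) = 1 / \<beta> x * (h * back_avg h ?L z)" using coefD(6)[OF \<beta>, of x] by (simp add: field_simps)
    moreover have "sh (- h) v z = v (x, t - h)" using True by (simp add: sh_def z)
    ultimately show ?thesis using True by (simp add: \<phi>_def g_def z)
   next
    case False
    then have "\<phi> z = 0 & (ind D z = 0 \<or> g z = 0)" using H1_outside(1)[OF H\<phi>, of z] by (auto simp: \<phi>_def g_def ramp(4) z)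
    then show ?thesis by auto
   qed
  qed note ae = this
  have [measurable]: "w \<in> borelm" "f \<in> borelm" "\<phi> \<in> borelm" "back_avg h ?L \<in> borelm" "k \<in> borelm" "m \<in> borelm" using w f H1_sq(1)[OF H\<phi>] sq_back_avg[OF L(1) h(1)] sk sm by (auto simp: wloc_def sq_measurable)
  have "(LBINT z. w z * \<phi> z) = (LBINT z. h * (back_avg h ?L z * k z))"
  proof (rule integral_cong_AE)
   show "AE z in lborel. w z * \<phi> z = h * (back_avg h ?L z * k z)" using ae
   proof eventually_elim
    case (elim z)
    have "g z * (ind D z * w z) = g z * ?L z"
    proof (cases "z \<in> D & t0/2 < snd z")
     case False
     then have "?L z = 0 & (ind D z = 0 \<or> g z = 0)" using offD[OF L(2), of z] t0 by (auto simp: late_def g_def ramp(4))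
     then show ?thesis by auto
    qed (simp add: late_def)
    moreover have "w z * \<phi> z = h * (back_avg h ?L z * (g z * (ind D z * w z)))" unfolding elim by (simp add: mult_ac)
    ultimately show ?case unfolding k_def by (simp only:)
   qed
  qed measurable
  moreover have "(LBINT z. f z * \<phi> z) = (LBINT z. h * (back_avg h ?L z * m z))"
  proof (rule integral_cong_AE)
   show "AE z in lborel. f z * \<phi> z = h * (back_avg h ?L z * m z)" using ae
   proof eventually_elim
    case (elim z)
    show ?case unfolding elim m_def by (simp add: mult_ac)
   qed
  qed measurable
  moreover have "- (h / 2 * N2 G) <= (LBINT z. G z \<bullet> G\<phi> z)" unfolding G\<phi>_def by (rule ramp_gradient_bound[OF H1_sq(2)[OF H]]) (use h in simp)
  ultimately have "h * (LBINT z. back_avg h ?L z * k z) <= h * (N2 G / 2 + (LBINT z. back_avg h ?L z * m z))" using e by (simp add: algebra_simps)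
  then show ?thesis using h by simp
 qed
 \<comment> \<open>The factor t0/4 keeps every step below t0/2.\<close>
 define hn where "hn n = t0 / 4 * inverse (real (Suc n))" for n
 have hn: "0 < hn n" "hn n < t0/2" for n
 proof -
  have "inverse (real (Suc n)) <= 1" by (simp add: inverse_le_1_iff)
  then have "t0 / 4 * inverse (real (Suc n)) <= t0 / 4 * 1" using t0 by (intro mult_left_mono) auto
  then show "0 < hn n" "hn n < t0/2" using t0 by (auto simp: hn_def)
 qed
 have "hn ~~> t0 / 4 * 0" unfolding hn_def[abs_def] by (intro tendsto_intros LIMSEQ_inverse_real_of_nat)
 then have hn0: "hn ~~> 0" by simp
 note lim = back_avg_LIMSEQ[OF L(1) hn(1) hn0]
 have "(LBINT z. ?L z * k z) <= N2 G / 2 + (LBINT z. ?L z * m z)" by (rule LIMSEQ_le[OF mult_integral_LIMSEQ[OF sq_back_avg[OF L(1) hn(1)] L(1) sk lim]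
     tendsto_add[OF tendsto_const mult_integral_LIMSEQ[OF sq_back_avg[OF L(1) hn(1)] L(1) sm lim]]])
   (use step[OF hn] in auto)
 also have "(LBINT z. ?L z * m z) <= (LBINT z. ?L z * k z / 2 + T / c * (f z)^2 / 2)"
 proof (rule integral_mono)
  show "integrable lborel (%z. ?L z * m z)" by (rule sq_integrable_mult[OF L(1) sm])
  show "integrable lborel (%z. ?L z * k z / 2 + T / c * (f z)^2 / 2)" using sq_integrable_mult[OF L(1) sk] sq_integrable[OF f] by simp
  fix z
  define a b where "a = ?L z" and "b = ind D z * f z"
  have "0 <= g z * (a - b)^2" using g0 by simp
  then have "g z * (a * b) * 2 <= g z * a^2 + g z * b^2" by (simp add: power2_diff algebra_simps)
  also have "g z * b^2 <= T / c * (f z)^2" using g0[of z] gT[of z] by (intro mult_mono) (auto simp: b_def indicator_def)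
  finally show "?L z * m z <= ?L z * k z / 2 + T / c * (f z)^2 / 2" by (simp add: m_def k_def a_def b_def power2_eq_square mult_ac)
 qed
 also have "... = (LBINT z. ?L z * k z) / 2 + T / c * N2 f / 2" using sq_integrable_mult[OF L(1) sk] sq_integrable[OF f] by (simp add: N2_def)
 finally have "(LBINT z. ?L z * k z) <= N2 G + T / c * N2 f" by simp
 then show ?thesis by (simp add: k_def g_def power2_eq_square mult_ac)
qed

text \<open>Let t0 tend to 0 in \<open>estimate_time_ramp\<close>: Fatou turns the weight sqrt(ramp)
  into sqrt(t), and 1 <= C/\<beta> removes the coefficient.\<close>

lemma estimate_time:
 assumes S: "is_sol \<beta> f ub v G w P" and \<beta>: "coef \<beta> c C" and f: "sq f"
 shows "sq (%z. sqrt (snd z) * w z)" "N2 (%z. sqrt (snd z) * w z) <= C * (N2 G + T / c * N2 f)"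
proof -
 have w: "wloc w" using S by (simp add: is_sol_def)
 have [measurable]: "w \<in> borelm" using w by (simp add: wloc_def)
 have C: "0 < C" by (rule coefD(7)[OF \<beta>])
 define tn where "tn n = inverse (real (Suc n))" for n
 have tn: "0 < tn n" for n by (simp add: tn_def)
 have tn0: "tn ~~> 0" unfolding tn_def[abs_def] by (rule LIMSEQ_inverse_real_of_nat)
 define hn where "hn n z = sqrt (ramp (tn n) (snd z)) * w z" for n and z :: "(real^'n) \<times> real"
 have heq: "hn n z = sqrt (ramp (tn n) (snd z)) * late (tn n / 2) w z" for n z using tn[of n] by (cases "tn n < snd z") (auto simp: hn_def late_def ramp(4))
 have sL: "sq (late (tn n / 2) w)" for n using wloc_late(1)[OF w, of "tn n / 2"] tn[of n] by simp
 have b: "sq (hn n) & N2 (hn n) <= C * (N2 G + T / c * N2 f)" for n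
 proof
  have mr: "(%z::(real^'n) \<times> real. sqrt (ramp (tn n) (snd z))) \<in> borelm" by measurable
  have "\<bar>sqrt (ramp (tn n) (snd z))\<bar> <= sqrt T" for z :: "(real^'n) \<times> real" using ramp(1,2) by simp
  from sq_mult_bounded[OF sL[of n] mr this] show s: "sq (hn n)" using heq by presburger
  let ?q = "%z. ramp (tn n) (snd z) * (1 / \<beta> (fst z)) * (late (tn n / 2) w z)^2"
  have mb: "(%z::(real^'n) \<times> real. 1 / \<beta> (fst z)) \<in> borelm" by (rule measurable_compose[OF fst_borel coefD(10)[OF \<beta>]])
  have iq: "integrable lborel ?q"
  proof (rule integrable_bound)
   show "integrable lborel (%z. (T * (1 / c)) * (norm (late (tn n / 2) w z))^2)" using sq_integrable[OF sL] by simp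
   show "?q \<in> borel_measurable lborel" using mb sq_measurable[OF sL[of n]] by measurable
   show "AE z in lborel. norm (?q z) <= norm ((T * (1 / c)) * (norm (late (tn n / 2) w z))^2)"
   proof (rule AE_I2)
    fix z :: "(real^'n) \<times> real"
    have "norm (?q z) = (\<bar>ramp (tn n) (snd z)\<bar> * \<bar>1 / \<beta> (fst z)\<bar>) * (late (tn n / 2) w z)^2" by (simp only: real_norm_def abs_mult abs_power2)
    also have "... <= (T * (1 / c)) * (late (tn n / 2) w z)^2" using T_pos by (intro mult_right_mono mult_mono ramp(3) coefD(8)[OF \<beta>]) auto
    also have "... <= norm ((T * (1 / c)) * (norm (late (tn n / 2) w z))^2)" using T_pos coefD(1)[OF \<beta>] by simp
    finally show "norm (?q z) <= norm ((T * (1 / c)) * (norm (late (tn n / 2) w z))^2)" .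
   qed
  qed
  have "N2 (hn n) <= (LBINT z. C * ?q z)" unfolding N2_def
  proof (rule integral_mono)
   show "integrable lborel (%z. (norm (hn n z))^2)" by (rule sq_integrable[OF s])
   show "integrable lborel (%z. C * ?q z)" by (rule integrable_mult_right) (rule iq)
   fix z :: "(real^'n) \<times> real"
   have "1 <= C * (1 / \<beta> (fst z))" using coefD(4,6)[OF \<beta>, of "fst z"] by simp
   then have "ramp (tn n) (snd z) * (late (tn n / 2) w z)^2 * 1 <= ramp (tn n) (snd z) * (late (tn n / 2) w z)^2 * (C * (1 / \<beta> (fst z)))" using ramp(1) by (intro mult_left_mono) auto
   then show "(norm (hn n z))^2 <= C * ?q z" unfolding heq using ramp(1) by (simp add: power_mult_distrib mult_ac)
  qed
  also have "... = C * (LBINT z. ?q z)" by (rule integral_mult_right_zero)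
  also have "... <= C * (N2 G + T / c * N2 f)" using C by (intro mult_left_mono estimate_time_ramp[OF S \<beta> f tn]) auto
  finally show "N2 (hn n) <= C * (N2 G + T / c * N2 f)" .
 qed
 have lim: "AE z in lborel. (%n. hn n z) ~~> sqrt (snd z) * w z"
 proof (rule AE_I2)
  fix z show "(%n. hn n z) ~~> sqrt (snd z) * w z"
  proof (cases "z \<in> D")
   case True
   have "(%n. hn n z) ~~> sqrt (min T (max 0 (snd z - 0))) * w z" unfolding hn_def ramp_def by (intro tendsto_intros tn0)
   with True show ?thesis by (auto simp: max_def min_def)
  next
   case False
   then have "w z = 0" using w offD[of w z] by (simp add: wloc_def)
   then show ?thesis by (simp add: hn_def)
  qed
 qed
 have m: "(%z. sqrt (snd z) * w z) \<in> borelm" by measurable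
 show "sq (%z. sqrt (snd z) * w z)" "N2 (%z. sqrt (snd z) * w z) <= C * (N2 G + T / c * N2 f)" using sq_Fatou[OF conjunct1[OF b] conjunct2[OF b] m lim] by auto
qed

end

subsection \<open>Averaging of oscillating coefficients\<close>

lemma wder_UNIV_translation:
 fixes v g :: "'a::euclidean_space => real"
 assumes v: "sq v" and g: "sq g" and wd: "wder UNIV d v g" and h: "0 <= h"
 shows "N2 (%z. v (z + h *\<^sub>R d) - v z) <= h^2 * N2 g"
proof -
 have [measurable]: "g \<in> borelm" using g by (rule sq_measurable)
 interpret J: param_avg "%z r. g (z + r *\<^sub>R d)" "{0..h}" h "N2 g"
 proof
  show "(%(z, r). g (z + r *\<^sub>R d)) \<in> borel_measurable (borel \<Otimes>\<^sub>M borel)" by measurable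
 qed (use h in \<open>auto simp: sq_shift[OF g] N2_shift[OF g]\<close>)
 have ae: "AE z in lborel. v (z + h *\<^sub>R d) - v z = J.avg z" using wder_translation(1)[OF v g wd open_UNIV h] by (simp add: J.avg_def)
 have "N2 (%z. v (z + h *\<^sub>R d) - v z) = N2 J.avg" by (rule N2_cong_AE[OF ae sq_diff[OF sq_shift[OF v] v] J.avg_measurable])
 with J.N2_avg show ?thesis by simp
qed

section \<open>Grid cells of a period\<close>

definition cell :: "nat => real^'n::finite => 'n => int" where
 "cell N y i = \<lfloor>real N * y $ i\<rfloor> mod int N"

definition cells :: "nat => ('n::finite => int) set" where
 "cells N = {j. \<forall>i. 0 <= j i & j i < int N}"

definition node :: "nat => ('n::finite => int) => real^'n" where
 "node N j = (\<chi> i. real_of_int (j i) / real N)"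

text \<open>Periodic with period 1 by the reduction modulo N in \<open>cell\<close>; evaluated at
  x/epsilon it marks one class of small cubes.\<close>

definition in_cell :: "nat => ('n::finite => int) => real^'n => real" where
 "in_cell N j y = (if cell N y = j then 1 else 0)"

lemma cells_PiE: "cells N = PiE UNIV (%_. {0..<int N})" by (auto simp: cells_def PiE_UNIV_domain)

lemma finite_cells: "finite (cells N :: ('n::finite => int) set)" unfolding cells_PiE by (rule finite_PiE) auto

lemma card_cells: "card (cells N :: ('n::finite => int) set) = N ^ CARD('n)" unfolding cells_PiE by (subst card_PiE) (auto simp: prod_constant)

lemma cell_in_cells: "N > 0 ==> cell N y \<in> cells N" by (simp add: cells_def cell_def)

lemma sum_in_cell:
 fixes y :: "real^'n::finite"
 assumes "N > 0" shows "(\<Sum>j\<in>cells N. a j * in_cell N j y) = a (cell N y)"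
proof -
 have "(\<Sum>j\<in>cells N. a j * in_cell N j y) = (\<Sum>j\<in>cells N. if cell N y = j then a j else 0)" by (rule sum.cong) (auto simp: in_cell_def)
 also have "... = a (cell N y)" using cell_in_cells[OF assms, of y] by (simp add: sum.delta'[OF finite_cells])
 finally show ?thesis .
qed

lemma cell_shift:
 assumes "N > 0" shows "cell N (y + node N i) k = (cell N y k + i k) mod int N"
proof -
 have "real N * (y + node N i) $ k = real N * y $ k + real_of_int (i k)" using assms by (simp add: node_def distrib_left)
 then have "\<lfloor>real N * (y + node N i) $ k\<rfloor> = \<lfloor>real N * y $ k\<rfloor> + i k" by simp
 then show ?thesis by (simp add: cell_def mod_simps)
qed

text \<open>Modulo N, the shifts by nodes move the cell of y to every cell exactly once. Hence the
  deviation of \<open>in_cell\<close> from its mean N^-n is an average of differences of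
  translates.\<close>

lemma sum_in_cell_shift:
 fixes y :: "real^'n::finite"
 assumes N: "N > 0" and j: "j \<in> cells N"
 shows "(\<Sum>i\<in>cells N. in_cell N j (y + node N i)) = 1"
proof -
 define i0 where "i0 k = (j k - cell N y k) mod int N" for k
 have i0: "i0 \<in> cells N" using N by (simp add: cells_def i0_def)
 have "(cell N (y + node N i) = j) = (i = i0)" if i: "i \<in> cells N" for i
 proof
  assume "i = i0"
  then have "cell N (y + node N i) k = j k" for k unfolding cell_shift[OF N] i0_def using j by (simp add: mod_simps cells_def)
  then show "cell N (y + node N i) = j" by (rule ext)
 next
  assume e: "cell N (y + node N i) = j"
  have "i k = i0 k" for k
  proof -
   have "j k = (cell N y k + i k) mod int N" using e cell_shift[OF N] by metis
   then have "i0 k = ((cell N y k + i k) mod int N - cell N y k) mod int N" by (simp add: i0_def)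
   also have "... = i k mod int N" by (simp add: mod_simps)
   also have "... = i k" using i by (simp add: cells_def)
   finally show ?thesis by simp
  qed
  then show "i = i0" by (rule ext)
 qed
 then have "(\<Sum>i\<in>cells N. in_cell N j (y + node N i)) = (\<Sum>i\<in>cells N. if i = i0 then 1 else 0)" by (intro sum.cong) (auto simp: in_cell_def)
 also have "... = 1" using i0 by (simp add: sum.delta[OF finite_cells])
 finally show ?thesis .
qed

lemma in_cell_bound: "0 <= in_cell N j y" "in_cell N j y <= 1" "\<bar>in_cell N j y\<bar> <= 1" by (auto simp: in_cell_def)

lemma in_cell_borel[measurable]: "in_cell N j \<in> borel_measurable (borel :: (real^'n::finite) measure)"
proof -
 have c: "(%y::real^'n. \<lfloor>real N * y $ i\<rfloor>) \<in> measurable borel (count_space UNIV)" for i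
 proof -
  have "(%y::real^'n. real N * y $ i) \<in> borelm" by (rule borel_measurable_continuous_onI) (intro continuous_intros)
  from measurable_compose[OF this measurable_real_floor] show ?thesis .
 qed
 have "in_cell N j = (%y. \<Prod>i\<in>UNIV. if cell N y i = j i then 1 else 0)"
 proof
  fix y show "in_cell N j y = (\<Prod>i\<in>UNIV. if cell N y i = j i then 1 else 0)" by (cases "cell N y = j") (auto simp: in_cell_def fun_eq_iff)
 qed
 moreover have "(%y::real^'n. if cell N y i = j i then 1 else (0::real)) \<in> borelm" for i unfolding cell_def using measurable_compose[OF c[of i], of "%k. if k mod int N = j i then 1 else (0::real)" borel] by simp
 ultimately show ?thesis by (simp add: borel_measurable_prod)
qed

context cylinder
begin

text \<open>Multiplication by a test function carries zt from the cylinder to the whole space, where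
  translations meet no boundary. The derivative is the product rule, obtained by using \<phi> p as
  test function.\<close>

lemma H1_test_product_wder:
 assumes H: "H1 zt G" and p: "test_fun D p"
 shows "wder UNIV (e, 0) (%z. p z * zt z) (%z. p z * (G z \<bullet> e) + frechet_derivative p (at z) (e, 0) * zt z)" unfolding wder_def
proof (intro allI impI)
 fix \<phi> :: "(real^'n) \<times> real => real" assume t: "test_fun UNIV \<phi>"
 have tp: "test_fun D (%z. \<phi> z * p z)" by (rule test_fun_mult[OF p test_fun_smooth[OF t]])
 let ?Dp = "%z v. frechet_derivative p (at z) v" and ?D\<phi> = "%z v. frechet_derivative \<phi> (at z) v"
 let ?Dq = "%z v. frechet_derivative (%z. \<phi> z * p z) (at z) v"
 have lin: "linear (?Dq z)" for z using smooth_funD[OF test_fun_smooth[OF tp]] has_derivative_linear by blast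
 have szt: "sq zt" and sG: "sq G" using H1_sq[OF H] .
 have sq: "sq (%z. \<phi> z * p z)" by (rule test_fun_sq[OF tp])
 have e: "(e, 0::real) = (\<Sum>i\<in>UNIV. e $ i *\<^sub>R (axis i 1, 0))" by (simp add: prod_eq_iff fst_sum snd_sum vec_eq_iff axis_def if_distrib[of "%x. _ * x"] sum.delta' cong: if_cong)
 have Dq: "?Dq z (e, 0) = (\<Sum>i\<in>UNIV. e $ i * dx i (%z. \<phi> z * p z) z)" for z unfolding e linear_sum[OF lin] linear_scale[OF lin] dx_def by simp
 have sDq: "sq (dx i (%z. \<phi> z * p z))" for i using test_fun_sq[OF test_fun_deriv[OF tp]] by (simp add: dx_def[abs_def])
 have "(LBINT z. zt z * ?Dq z (e, 0)) = (\<Sum>i\<in>UNIV. e $ i * (LBINT z. zt z * dx i (%z. \<phi> z * p z) z))"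
 proof -
  have "(%z. zt z * ?Dq z (e, 0)) = (%z. \<Sum>i\<in>UNIV. e $ i * (zt z * dx i (%z. \<phi> z * p z) z))" by (simp add: Dq sum_distrib_left mult.left_commute)
  then show ?thesis by (simp add: sq_integrable_mult[OF szt sDq])
 qed
 also have "... = (\<Sum>i\<in>UNIV. - (LBINT z. e $ i * (G z $ i * (\<phi> z * p z))))"
 proof (rule sum.cong[OF refl])
  fix i
  have "(LBINT z. zt z * dx i (%z. \<phi> z * p z) z) = - (LBINT z. G z $ i * (\<phi> z * p z))" using H tp unfolding H1_def by blast
  then show "e $ i * (LBINT z. zt z * dx i (%z. \<phi> z * p z) z) = - (LBINT z. e $ i * (G z $ i * (\<phi> z * p z)))" by simp
 qed
 also have "... = - (LBINT z. (\<Sum>i\<in>UNIV. e $ i * (G z $ i * (\<phi> z * p z))))" unfolding sum_negf by (subst integral_sum) (auto simp: sq_integrable_mult[OF sq_component[OF sG] sq])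
 also have "(%z. \<Sum>i\<in>UNIV. e $ i * (G z $ i * (\<phi> z * p z))) = (%z. (G z \<bullet> e) * (\<phi> z * p z))" by (simp add: inner_vec_def sum_distrib_right sum_distrib_left mult_ac)
 finally have 1: "(LBINT z. zt z * ?Dq z (e, 0)) = - (LBINT z. (G z \<bullet> e) * (\<phi> z * p z))" .
 have prodrule: "?Dq z (e, 0) = \<phi> z * ?Dp z (e, 0) + ?D\<phi> z (e, 0) * p z" for z by (rule frechet_derivative_mult_smooth[OF test_fun_smooth[OF p] test_fun_smooth[OF t]])
 have s1: "sq (%z. ?D\<phi> z (e, 0) * p z)" "sq (%z. \<phi> z * ?Dp z (e, 0))" by (rule test_fun_sq[OF test_fun_mult[OF p smooth_fun_deriv[OF test_fun_smooth[OF t]]]])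
    (rule test_fun_sq[OF test_fun_mult[OF test_fun_deriv[OF p] test_fun_smooth[OF t]]])
 have i1: "integrable lborel (%z. zt z * (\<phi> z * ?Dp z (e, 0)))" "integrable lborel (%z. zt z * (?D\<phi> z (e, 0) * p z))" by (rule sq_integrable_mult[OF szt]; rule s1)+
 have sGe: "sq (%z. G z \<bullet> e)"
 proof (rule sq_bound[OF sq_scaleR[OF sG, of "norm e"]])
  show "(%z. G z \<bullet> e) \<in> borelm" using sq_measurable[OF sG] by measurable
  show "AE z in lborel. norm (G z \<bullet> e) <= norm (norm e *\<^sub>R G z)" using Cauchy_Schwarz_ineq2[of "G _" e] by (intro AE_I2) (simp add: mult.commute[of "norm e"])
 qed
 have i2: "integrable lborel (%z. (G z \<bullet> e) * (\<phi> z * p z))" by (rule sq_integrable_mult[OF sGe sq])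
 have "(LBINT z. zt z * ?Dq z (e, 0)) = (LBINT z. zt z * (\<phi> z * ?Dp z (e, 0))) + (LBINT z. zt z * (?D\<phi> z (e, 0) * p z))" unfolding prodrule distrib_left by (rule integral_add[OF i1])
 then have "(LBINT z. p z * zt z * ?D\<phi> z (e, 0)) = - ((LBINT z. (G z \<bullet> e) * (\<phi> z * p z)) + (LBINT z. zt z * (\<phi> z * ?Dp z (e, 0))))" using 1 by (simp add: mult_ac)
 also have "(LBINT z. (G z \<bullet> e) * (\<phi> z * p z)) + (LBINT z. zt z * (\<phi> z * ?Dp z (e, 0))) = (LBINT z. (p z * (G z \<bullet> e) + ?Dp z (e, 0) * zt z) * \<phi> z)" by (subst integral_add[OF i2 i1(1), symmetric]) (simp add: algebra_simps)
 finally show "(LBINT z. p z * zt z * ?D\<phi> z (e, 0)) = - (LBINT z. (p z * (G z \<bullet> e) + ?Dp z (e, 0) * zt z) * \<phi> z)" .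
qed

text \<open>The product has a weak derivative on the whole space with squared norm at most K R.
  Since K depends on p and e only, the estimate is uniform over bounded sets of
  \<open>H1\<close>.\<close>

lemma H1_test_product_translation:
 assumes p: "test_fun D p"
 shows "\<exists>K\<ge>0. \<forall>zt G R h. H1 zt G --> N2 zt <= R --> N2 G <= R --> 0 <= h -->
   N2 (%z. p (z + h *\<^sub>R (e, 0)) * zt (z + h *\<^sub>R (e, 0)) - p z * zt z) <= h^2 * (K * R)"
proof -
 obtain M where M: "M > 0" "!!z. \<bar>p z\<bar> <= M" using test_fun_bounded[OF p] by blast
 obtain M' where M': "M' > 0" "!!z. \<bar>frechet_derivative p (at z) (e, 0)\<bar> <= M'" using test_fun_bounded[OF test_fun_deriv[OF p]] by blast
 define K where "K = 2 * (M^2 * (norm e)^2) + 2 * M'^2"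
 show ?thesis
 proof (intro exI[of _ K] conjI allI impI)
  show "K \<ge> 0" by (simp add: K_def)
  fix zt G and R h :: real assume H: "H1 zt G" and R: "N2 zt <= R" "N2 G <= R" and h: "0 <= h"
  have s: "sq zt" "sq G" using H1_sq[OF H] .
  let ?D = "%z. frechet_derivative p (at z) (e, 0)"
  have m: "p \<in> borelm" "?D \<in> borelm" by (rule sq_measurable[OF test_fun_sq[OF p]], rule sq_measurable[OF test_fun_sq[OF test_fun_deriv[OF p]]])
  have mG: "(%z. G z \<bullet> e) \<in> borelm" using sq_measurable[OF s(2)] by measurable
  have le: "AE z in lborel. norm (G z \<bullet> e) <= norm (norm e *\<^sub>R G z)" using Cauchy_Schwarz_ineq2[of "G _" e] by (intro AE_I2) (simp add: mult.commute[of "norm e"])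
  have sGe: "sq (%z. G z \<bullet> e)" "N2 (%z. G z \<bullet> e) <= (norm e)^2 * N2 G" using sq_bound[OF sq_scaleR[OF s(2)] mG le] N2_mono[OF sq_scaleR[OF s(2)] mG le] by (simp_all add: N2_scaleR)
  have a: "sq (%z. p z * (G z \<bullet> e))" "N2 (%z. p z * (G z \<bullet> e)) <= M^2 * N2 (%z. G z \<bullet> e)" by (rule sq_mult_bounded[OF sGe(1) m(1) M(2)], rule N2_mult_bounded[OF sGe(1) m(1) M(2)])
  have b: "sq (%z. ?D z * zt z)" "N2 (%z. ?D z * zt z) <= M'^2 * N2 zt" by (rule sq_mult_bounded[OF s(1) m(2) M'(2)], rule N2_mult_bounded[OF s(1) m(2) M'(2)])
  have "N2 (%z. p z * (G z \<bullet> e) + ?D z * zt z) <= 2 * (M^2 * ((norm e)^2 * R)) + 2 * (M'^2 * R)"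
  proof -
   have "M^2 * N2 (%z. G z \<bullet> e) <= M^2 * ((norm e)^2 * R)" by (intro mult_left_mono order_trans[OF sGe(2)] R) auto
   moreover have "M'^2 * N2 zt <= M'^2 * R" by (intro mult_left_mono R) auto
   ultimately show ?thesis using N2_add_le[OF a(1) b(1)] a(2) b(2) by linarith
  qed
  also have "... = K * R" by (simp add: K_def algebra_simps)
  finally have g: "N2 (%z. p z * (G z \<bullet> e) + ?D z * zt z) <= K * R" .
  have "N2 (%z. p (z + h *\<^sub>R (e, 0)) * zt (z + h *\<^sub>R (e, 0)) - p z * zt z) <= h^2 * N2 (%z. p z * (G z \<bullet> e) + ?D z * zt z)" by (rule wder_UNIV_translation[OF sq_mult_bounded[OF s(1) m(1) M(2)] sq_add[OF a(1) b(1)] H1_test_product_wder[OF H p] h])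
  also have "... <= h^2 * (K * R)" by (rule mult_left_mono[OF g]) simp
  finally show "N2 (%z. p (z + h *\<^sub>R (e, 0)) * zt (z + h *\<^sub>R (e, 0)) - p z * zt z) <= h^2 * (K * R)" .
 qed
qed

text \<open>Convergence to 0 with epsilon, uniformly on bounded sets of L^2(0,T;H^1). Uniformity
  matters because the functionals are evaluated at solutions that move with epsilon.\<close>

definition unif0 :: "(real => ((real^'n) \<times> real => real) => real) => bool" where
 "unif0 F \<longleftrightarrow> (\<forall>R>0. \<forall>e>0. \<exists>eps0>0. \<forall>eps zt G. 0 < eps --> eps < eps0 --> H1 zt G --> N2 zt <= R --> N2 G <= R --> \<bar>F eps zt\<bar> <= e)"

lemma unif0D:
 assumes "unif0 F" "R > 0" "e > 0"
 obtains eps0 where "eps0 > 0" "!!eps zt G. 0 < eps ==> eps < eps0 ==> H1 zt G ==> N2 zt <= R ==> N2 G <= R ==> \<bar>F eps zt\<bar> <= e" using assms unfolding unif0_def by metis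

text \<open>The approximating functional may depend on the bound R and the tolerance e, which is how
  discretizations enter.\<close>

lemma unif0_approx:
 assumes "!!R e. R > 0 ==> e > 0 ==> \<exists>F' eps0. unif0 F' & eps0 > 0 &
  (\<forall>eps zt G. 0 < eps --> eps < eps0 --> H1 zt G --> N2 zt <= R --> N2 G <= R --> \<bar>F eps zt - F' eps zt\<bar> <= e)"
 shows "unif0 F" unfolding unif0_def
proof (intro allI impI)
 fix R e :: real assume R: "R > 0" and e: "e > 0"
 obtain F' eps1 where F': "unif0 F'" "eps1 > 0" "!!eps zt G. 0 < eps ==> eps < eps1 ==> H1 zt G ==> N2 zt <= R ==> N2 G <= R ==> \<bar>F eps zt - F' eps zt\<bar> <= e/2" using assms[OF R half_gt_zero[OF e]] by blast
 obtain eps2 where eps2: "eps2 > 0" "!!eps zt G. 0 < eps ==> eps < eps2 ==> H1 zt G ==> N2 zt <= R ==> N2 G <= R ==> \<bar>F' eps zt\<bar> <= e/2" using unif0D[OF F'(1) R half_gt_zero[OF e]] by blast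
 have "\<bar>F eps zt\<bar> <= e" if "0 < eps" "eps < min eps1 eps2" "H1 zt G" "N2 zt <= R" "N2 G <= R" for eps zt G
 proof -
  have "\<bar>F eps zt - F' eps zt\<bar> <= e/2" "\<bar>F' eps zt\<bar> <= e/2" using F'(3)[of eps zt G] eps2(2)[of eps zt G] that by auto
  then show ?thesis by linarith
 qed
 then show "\<exists>eps0>0. \<forall>eps zt G. 0 < eps --> eps < eps0 --> H1 zt G --> N2 zt <= R --> N2 G <= R --> \<bar>F eps zt\<bar> <= e" using F'(2) eps2(1) by (intro exI[of _ "min eps1 eps2"]) auto
qed

lemma unif0_zero: "unif0 (%_ _. 0)" unfolding unif0_def by (auto intro: exI[of _ 1])

lemma unif0_add: assumes "unif0 F" "unif0 F'" shows "unif0 (%eps zt. F eps zt + F' eps zt)"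
proof (rule unif0_approx)
 fix R e :: real assume "R > 0" "e > 0"
 from unif0D[OF assms(2) this] obtain eps0 where "eps0 > 0" "!!eps zt G. 0 < eps ==> eps < eps0 ==> H1 zt G ==> N2 zt <= R ==> N2 G <= R ==> \<bar>F' eps zt\<bar> <= e" by blast
 then show "\<exists>F'' eps0. unif0 F'' & eps0 > 0 & (\<forall>eps zt G. 0 < eps --> eps < eps0 --> H1 zt G --> N2 zt <= R --> N2 G <= R --> \<bar>F eps zt + F' eps zt - F'' eps zt\<bar> <= e)" using assms(1) by (intro exI[of _ F] exI[of _ eps0]) auto
qed

lemma unif0_sum: "(!!j. j \<in> J ==> unif0 (F j)) ==> unif0 (%eps zt. \<Sum>j\<in>J. F j eps zt)" by (induction J rule: infinite_finite_induct) (auto intro: unif0_zero unif0_add)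

text \<open>The indicator of one class of small cubes minus its mean: N^-n is the fraction of a
  period that the class fills.\<close>

definition cell_fun :: "nat => ('n => int) => real => (real^'n) \<times> real => real" where
 "cell_fun N j eps z = in_cell N j ((1/eps) *\<^sub>R fst z) - 1 / real (N ^ CARD('n))"

lemma cell_fun_measurable[measurable]: "cell_fun N j eps \<in> borelm"
proof -
 have "(%z::(real^'n)\<times>real. (1/eps) *\<^sub>R fst z) \<in> borelm" by (rule borel_measurable_continuous_onI) (intro continuous_intros)
 from measurable_compose[OF this in_cell_borel] show ?thesis unfolding cell_fun_def[abs_def] by measurable
qed

lemma cell_fun_bound: assumes "N > 0" shows "\<bar>cell_fun N j eps z\<bar> <= 1"
proof -
 have "1 / real (N ^ CARD('n)) <= 1" using assms by simp
 moreover have "0 <= 1 / real (N ^ CARD('n))" by simp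
 ultimately show ?thesis using in_cell_bound[of N j "(1/eps) *\<^sub>R fst z"] unfolding cell_fun_def by linarith
qed

text \<open>Shifting by epsilon times a node moves the oscillating indicator to another class, and
  over all nodes the indicators sum to 1. The integral is thus an average of integrals against
  differences of p zt under shifts of size epsilon, each of order epsilon by
  \<open>H1_test_product_translation\<close>.\<close>

lemma unif0_cell_test:
 assumes N: "N > 0" and j: "j \<in> cells N" and p: "test_fun D p"
 shows "unif0 (%eps zt. \<integral>z. cell_fun N j eps z * (p z * zt z) \<partial>lborel)"
proof -
 \<comment> \<open>The minus sign arises because the shift is moved from the indicator to its
   cofactor.\<close>
 define e where "e i = - node N i" for i :: "'n => int"
 have "\<forall>i. \<exists>K\<ge>0. \<forall>zt G R h. H1 zt G --> N2 zt <= R --> N2 G <= R --> 0 <= h -->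
   N2 (%z. p (z + h *\<^sub>R (e i, 0)) * zt (z + h *\<^sub>R (e i, 0)) - p z * zt z) <= h^2 * (K * R)" by (intro allI H1_test_product_translation[OF p])
 from choice[OF this] obtain K where K': "\<forall>i. 0 <= K i & (\<forall>zt G R h. H1 zt G --> N2 zt <= R --> N2 G <= R --> 0 <= h -->
   N2 (%z. p (z + h *\<^sub>R (e i, 0)) * zt (z + h *\<^sub>R (e i, 0)) - p z * zt z) <= h^2 * (K i * R))" ..
 have K: "K i \<ge> 0" for i using K' by blast
 have K2: "N2 (%z. p (z + h *\<^sub>R (e i, 0)) * zt (z + h *\<^sub>R (e i, 0)) - p z * zt z) <= h^2 * (K i * R)"
  if "H1 zt G" "N2 zt <= R" "N2 G <= R" "0 <= h" for i zt G R h using K' that by blast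
 obtain r where r: "r > 0" "D \<subseteq> ball 0 r" using D_bounded bounded_subset_ballD[of D 0] by auto
 \<comment> \<open>A ball that contains every point which the shifts used below move into the
   cylinder; it gives the differences bounded support, as Cauchy-Schwarz against a bounded factor
   requires.\<close>
 define A where "A = ball (0::(real^'n)\<times>real) (r + (\<Sum>i\<in>cells N. norm (e i)))"
 have sA: "sq (ind A)" unfolding A_def by (rule sq_indicator) (use emeasure_bounded_finite[OF bounded_ball] in auto)
 have outA: "z \<notin> D & z + h *\<^sub>R (e i, 0) \<notin> D" if z: "z \<notin> A" and i: "i \<in> cells N" and h: "0 <= h" "h <= 1" for z i h
 proof -
  have "norm (e i) <= (\<Sum>i\<in>cells N. norm (e i))" using i finite_cells by (intro member_le_sum) auto
  moreover have "norm (h *\<^sub>R (e i, 0::real)) <= norm (e i)" using h by (simp add: norm_Pair mult_left_le_one_le)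
  ultimately have "r <= norm (z + h *\<^sub>R (e i, 0))" using z norm_diff_ineq[of z "h *\<^sub>R (e i, 0)"] by (simp add: A_def)
  moreover have "r <= norm z" using z sum_nonneg[of "cells N" "%i. norm (e i)"] by (simp add: A_def)
  moreover have "norm y < r" if "y \<in> D" for y using subsetD[OF r(2) that] by simp
  ultimately show ?thesis by (meson not_le)
 qed
 obtain M where M: "M > 0" "!!z. \<bar>p z\<bar> <= M" using test_fun_bounded[OF p] by blast
 have mp: "p \<in> borelm" by (rule sq_measurable[OF test_fun_sq[OF p]])
 define q where "q = 1 / real (N ^ CARD('n))"
 have q: "q * real (card (cells N :: ('n => int) set)) = 1" "0 <= q" using N by (simp_all add: q_def card_cells)
 define L where "L R = (\<Sum>i\<in>cells N. q * (sqrt (N2 (ind A)) * sqrt (K i * R)))" for R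
 have main: "\<bar>\<integral>z. cell_fun N j eps z * (p z * zt z) \<partial>lborel\<bar> <= eps * L R"
  if eps: "0 < eps" "eps <= 1" and H: "H1 zt G" and R: "N2 zt <= R" "N2 G <= R" for eps zt G R
 proof -
  define k where "k z = p z * zt z" for z
  define X where "X z = in_cell N j ((1/eps) *\<^sub>R fst z)" for z :: "(real^'n)\<times>real"
  have sk: "sq k" unfolding k_def[abs_def] by (rule sq_mult_bounded[OF H1_sq(1)[OF H] mp M(2)])
  have ok: "off k" unfolding off_def k_def using H1_outside(1)[OF H] by simp
  have ik: "integrable lborel k" by (rule integrable_on_D[OF sk ok])
  have mX: "X \<in> borelm"
  proof -
   have "(%z::(real^'n)\<times>real. (1/eps) *\<^sub>R fst z) \<in> borelm" by (rule borel_measurable_continuous_onI) (intro continuous_intros)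
   from measurable_compose[OF this in_cell_borel] show ?thesis unfolding X_def[abs_def] .
  qed
  have bX: "\<bar>X z\<bar> <= 1" for z unfolding X_def by (rule in_cell_bound)
  have Xi: "integrable lborel (%z. X (z + c) * f z)" if "integrable lborel f" for c and f :: "_ => real"
  proof (rule integrable_bound[OF that])
   show "(%z. X (z + c) * f z) \<in> borel_measurable lborel" using mX that by measurable
   show "AE z in lborel. norm (X (z + c) * f z) <= norm (f z)"
   proof (rule AE_I2)
    fix z
    have "\<bar>X (z + c)\<bar> * \<bar>f z\<bar> <= 1 * \<bar>f z\<bar>" by (rule mult_right_mono[OF bX]) simp
    then show "norm (X (z + c) * f z) <= norm (f z)" by (simp add: abs_mult)
   qed
  qed
  have Xi0: "integrable lborel (%z. X z * f z)" if "integrable lborel f" for f :: "_ => real" using Xi[OF that, of 0] by simp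
  have "(LBINT z. k z) = (LBINT z. (\<Sum>i\<in>cells N. X (z + (eps *\<^sub>R node N i, 0)) * k z))"
  proof (rule integral_cong[OF refl])
   fix z :: "(real^'n)\<times>real"
   have "(\<Sum>i\<in>cells N. X (z + (eps *\<^sub>R node N i, 0))) = (\<Sum>i\<in>cells N. in_cell N j ((1/eps) *\<^sub>R fst z + node N i))" using eps by (simp add: X_def scaleR_add_right)
   also have "... = 1" by (rule sum_in_cell_shift[OF N j])
   finally show "k z = (\<Sum>i\<in>cells N. X (z + (eps *\<^sub>R node N i, 0)) * k z)" by (simp add: sum_distrib_right[symmetric])
  qed
  also have "... = (\<Sum>i\<in>cells N. \<integral>z. X (z + (eps *\<^sub>R node N i, 0)) * k z \<partial>lborel)" by (rule integral_sum) (rule Xi[OF ik])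
  also have "... = (\<Sum>i\<in>cells N. \<integral>z. X z * k (z + eps *\<^sub>R (e i, 0)) \<partial>lborel)"
  proof (rule sum.cong[OF refl])
   fix i :: "'n => int"
   have "(LBINT z. X z * k (z + eps *\<^sub>R (e i, 0))) = (LBINT z. X (z + (eps *\<^sub>R node N i, 0)) * k (z + (eps *\<^sub>R node N i, 0) + eps *\<^sub>R (e i, 0)))" by (rule integral_shift[symmetric, of "%z. X z * k (z + eps *\<^sub>R (e i, 0))"]) (use mX sq_measurable[OF sk] in measurable)
   also have "... = (LBINT z. X (z + (eps *\<^sub>R node N i, 0)) * k z)" by (rule integral_cong[OF refl]) (simp add: e_def add.assoc flip: zero_prod_def)
   finally show "(LBINT z. X (z + (eps *\<^sub>R node N i, 0)) * k z) = (LBINT z. X z * k (z + eps *\<^sub>R (e i, 0)))" by simp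
  qed
  finally have kint: "(LBINT z. k z) = ..." .
  have "(LBINT z. cell_fun N j eps z * k z) = (LBINT z. X z * k z) - q * (LBINT z. k z)" using Xi0[OF ik] ik by (simp add: cell_fun_def X_def q_def left_diff_distrib)
  \<comment> \<open>Since q times the number of cells is 1, the term is written as an average and
    paired with the shifted terms one by one.\<close>
  also have "(LBINT z. X z * k z) = (\<Sum>i\<in>(cells N :: ('n => int) set). q * (LBINT z. X z * k z))" using q(1) by (simp add: mult.assoc[symmetric] mult.commute)
  also have "... - q * (LBINT z. k z) = (\<Sum>i\<in>cells N. - (q * (LBINT z. X z * (k (z + eps *\<^sub>R (e i, 0)) - k z))))" unfolding kint sum_distrib_left sum_subtractf[symmetric] by (rule sum.cong[OF refl]) (simp add: right_diff_distrib Xi0[OF ik] Xi0[OF integrable_shift[OF ik]])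
  also have "\<bar>...\<bar> <= (\<Sum>i\<in>cells N. q * (sqrt (N2 (ind A)) * (eps * sqrt (K i * R))))"
  proof (rule order_trans[OF sum_abs], rule sum_mono)
   fix i :: "'n => int" assume i: "i \<in> cells N"
   let ?d = "%z. k (z + eps *\<^sub>R (e i, 0)) - k z"
   have sd: "sq ?d" by (rule sq_diff[OF sq_shift[OF sk] sk])
   have sXd: "sq (%z. X z * ?d z)" by (rule sq_mult_bounded[OF sd mX bX])
   have "X z * ?d z = ind A z * (X z * ?d z)" for z using outA[of z i eps] eps i offD[OF ok, of z] offD[OF ok, of "z + eps *\<^sub>R (e i, 0)"] by (cases "z \<in> A") auto
   then have "\<bar>\<integral>z. X z * ?d z \<partial>lborel\<bar> = \<bar>\<integral>z. ind A z * (X z * ?d z) \<partial>lborel\<bar>" by presburger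
   also have "... <= sqrt (N2 (ind A)) * sqrt (N2 (%z. X z * ?d z))" by (rule Cauchy_Schwarz_mult[OF sA sXd])
   also have "... <= sqrt (N2 (ind A)) * (eps * sqrt (K i * R))"
   proof (intro mult_left_mono)
    have "N2 (%z. X z * ?d z) <= 1^2 * N2 ?d" by (rule N2_mult_bounded[OF sd mX bX])
    also have "... <= eps^2 * (K i * R)" using K2[OF H R, of eps i] eps by (simp add: k_def)
    finally have "sqrt (N2 (%z. X z * ?d z)) <= sqrt (eps^2 * (K i * R))" by simp
    then show "sqrt (N2 (%z. X z * ?d z)) <= eps * sqrt (K i * R)" using eps by (simp add: real_sqrt_mult)
   qed auto
   finally show "\<bar>- (q * (LBINT z. X z * ?d z))\<bar> <= q * (sqrt (N2 (ind A)) * (eps * sqrt (K i * R)))" using q(2) by (simp add: abs_mult mult_left_mono)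
  qed
  also have "... = eps * L R" by (simp add: L_def sum_distrib_left mult_ac)
  finally show ?thesis by (simp add: k_def)
 qed
 show ?thesis unfolding unif0_def
 proof (intro allI impI)
  fix R e' :: real assume R: "R > 0" and e': "e' > 0"
  have L0: "0 <= L R" unfolding L_def using q(2) K R by (intro sum_nonneg mult_nonneg_nonneg) auto
  define eps0 where "eps0 = min 1 (e' / (L R + 1))"
  have "eps0 > 0" using L0 e' by (simp add: eps0_def)
  moreover have "\<bar>\<integral>z. cell_fun N j eps z * (p z * zt z) \<partial>lborel\<bar> <= e'"
   if "0 < eps" "eps < eps0" "H1 zt G" "N2 zt <= R" "N2 G <= R" for eps zt G
  proof -
   have "eps * L R <= e' / (L R + 1) * L R" using that L0 by (intro mult_right_mono) (auto simp: eps0_def)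
   also have "... <= e'" using L0 e' by (simp add: field_simps)
   finally show ?thesis using main[of eps zt G R] that by (simp add: eps0_def)
  qed
  ultimately show "\<exists>eps0>0. \<forall>eps zt G. 0 < eps --> eps < eps0 --> H1 zt G --> N2 zt <= R --> N2 G <= R --> \<bar>\<integral>z. cell_fun N j eps z * (p z * zt z) \<partial>lborel\<bar> <= e'" by blast
 qed
qed

lemma integral_mult_bound:
 assumes a: "a \<in> borelm" "!!z. \<bar>a z\<bar> <= K" and p: "sq p" and zt: "sq zt"
 shows "\<bar>\<integral>z. a z * (p z * zt z) \<partial>lborel\<bar> <= K * (sqrt (N2 p) * sqrt (N2 zt))"
proof -
 have K: "0 <= K" using a(2)[of undefined] by simp
 have "\<bar>\<integral>z. a z * (p z * zt z) \<partial>lborel\<bar> = \<bar>\<integral>z. (a z * p z) * zt z \<partial>lborel\<bar>" by (simp add: mult.assoc)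
 also have "... <= sqrt (N2 (%z. a z * p z)) * sqrt (N2 zt)" by (rule Cauchy_Schwarz_mult[OF sq_mult_bounded[OF p a] zt])
 also have "... <= (K * sqrt (N2 p)) * sqrt (N2 zt)"
 proof (rule mult_right_mono)
  have "sqrt (N2 (%z. a z * p z)) <= sqrt (K^2 * N2 p)" using N2_mult_bounded[OF p a] by simp
  then show "sqrt (N2 (%z. a z * p z)) <= K * sqrt (N2 p)" using K by (simp add: real_sqrt_mult)
 qed simp
 finally show ?thesis by (simp add: mult.assoc)
qed

text \<open>The functional is continuous in p uniformly for zt in bounded sets, so it suffices to
  treat test functions p.\<close>

lemma unif0_density:
 assumes a: "!!eps. a eps \<in> borelm" "!!eps z. \<bar>a eps z\<bar> <= K" and K: "K > 0"
  and t: "!!p. test_fun D p ==> unif0 (%eps zt. \<integral>z. a eps z * (p z * zt z) \<partial>lborel)" and p: "sq p"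
 shows "unif0 (%eps zt. \<integral>z. a eps z * (p z * zt z) \<partial>lborel)"
proof (rule unif0_approx)
 fix R e :: real assume R: "R > 0" and e: "e > 0"
 \<comment> \<open>Chosen so that Cauchy-Schwarz with |a| <= K and the norm bound sqrt(R) gives
   exactly e.\<close>
 define d where "d = (e / (K * sqrt R))^2"
 have "d > 0" using R e K by (simp add: d_def)
 then obtain p' where p': "test_fun D p'" "N2 (%z. p' z - indicator D z * p z) < d" using test_dense[OF D_open p] unfolding test_dense_def by blast
 have sD: "sq (%z. ind D z * p z)" by (rule sq_indicator_mult[OF p D_borel])
 have s': "sq p'" by (rule test_fun_sq[OF p'(1)])
 have "\<bar>(LBINT z. a eps z * (p z * zt z)) - (LBINT z. a eps z * (p' z * zt z))\<bar> <= e"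
  if H: "H1 zt G" and R': "N2 zt <= R" for eps zt G
 proof -
  have s: "sq zt" by (rule H1_sq(1)[OF H])
  have i: "integrable lborel (%z. a eps z * (g z * zt z))" if "sq g" for g using sq_integrable_mult[OF sq_mult_bounded[OF that a(1) a(2)] s] by (simp add: mult.assoc)
  have "(LBINT z. a eps z * (p z * zt z)) = (LBINT z. a eps z * ((ind D z * p z) * zt z))"
  proof (rule integral_cong[OF refl])
   fix z show "a eps z * (p z * zt z) = a eps z * ((ind D z * p z) * zt z)" using H1_outside(1)[OF H, of z] by (cases "z \<in> D") auto
  qed
  then have "(LBINT z. a eps z * (p z * zt z)) - (LBINT z. a eps z * (p' z * zt z)) = - (LBINT z. a eps z * ((p' z - indicator D z * p z) * zt z))" using i[OF sD] i[OF s'] by (simp add: left_diff_distrib right_diff_distrib)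
  also have "\<bar>...\<bar> <= K * (sqrt (N2 (%z. p' z - indicator D z * p z)) * sqrt (N2 zt))" using integral_mult_bound[OF a(1) a(2) sq_diff[OF s' sD] s, of eps] by simp
  also have "... <= K * (e / (K * sqrt R) * sqrt R)"
  proof (intro mult_left_mono mult_mono)
   have "sqrt (N2 (%z. p' z - indicator D z * p z)) <= sqrt d" using p'(2) by simp
   then show "sqrt (N2 (%z. p' z - indicator D z * p z)) <= e / (K * sqrt R)" using e K R by (simp add: d_def)
  qed (use R' K R e in auto)
  also have "... = e" using K R by simp
  finally show ?thesis .
 qed
 then show "\<exists>F' eps0. unif0 F' & eps0 > 0 & (\<forall>eps zt G. 0 < eps --> eps < eps0 --> H1 zt G --> N2 zt <= R --> N2 G <= R -->
   \<bar>(LBINT z. a eps z * (p z * zt z)) - F' eps zt\<bar> <= e)" using t[OF p'(1)] by (intro exI[of _ "%eps zt. \<integral>z. a eps z * (p' z * zt z) \<partial>lborel"] exI[of _ 1]) auto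
qed

lemma unif0_cell:
 assumes N: "N > 0" and j: "j \<in> cells N" and p: "sq p"
 shows "unif0 (%eps zt. \<integral>z. cell_fun N j eps z * (p z * zt z) \<partial>lborel)" by (rule unif0_density[where K=1, OF cell_fun_measurable cell_fun_bound[OF N] _ unif0_cell_test[OF N j] p]) simp_all

end

subsection \<open>The averaged coefficient\<close>

text \<open>The grid point below y, without reduction modulo 1; it differs from the node of the cell
  of y by an integer vector, which periodic functions do not notice.\<close>

definition floor_node :: "nat => real^'n::finite => real^'n" where
 "floor_node N y = (\<chi> i. real_of_int \<lfloor>real N * y $ i\<rfloor> / real N)"

lemma floor_node_dist:
 assumes "N > 0" shows "dist y (floor_node N y :: real^'n::finite) <= real CARD('n) / real N"
proof -
 have "norm (y - floor_node N y) <= (\<Sum>i\<in>UNIV. \<bar>(y - floor_node N y) $ i\<bar>)" by (rule norm_le_l1_cart)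
 also have "... <= (\<Sum>i\<in>(UNIV :: 'n set). 1 / real N)"
 proof (rule sum_mono)
  fix i
  have "real_of_int \<lfloor>real N * y $ i\<rfloor> <= real N * y $ i" "real N * y $ i < real_of_int \<lfloor>real N * y $ i\<rfloor> + 1" by linarith+
  then have "\<bar>real N * y $ i - real_of_int \<lfloor>real N * y $ i\<rfloor>\<bar> <= 1" by linarith
  moreover have "(y - floor_node N y) $ i = (real N * y $ i - real_of_int \<lfloor>real N * y $ i\<rfloor>) / real N" using assms by (simp add: floor_node_def field_simps)
  ultimately show "\<bar>(y - floor_node N y) $ i\<bar> <= 1 / real N" using assms by (simp add: abs_divide divide_right_mono)
 qed
 finally show ?thesis by (simp add: dist_norm)
qed

lemma floor_node_cell:
 assumes "N > 0" obtains k where "int_vec k" "floor_node N y = node N (cell N y) + k"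
proof
 let ?k = "\<chi> i. real_of_int (\<lfloor>real N * y $ i\<rfloor> div int N)"
 show "int_vec ?k" by (simp add: int_vec_def)
 show "floor_node N y = node N (cell N y) + ?k"
 proof (simp add: floor_node_def node_def cell_def vec_eq_iff, rule allI)
  fix i
  have "real_of_int \<lfloor>real N * y $ i\<rfloor> = real_of_int (int N * (\<lfloor>real N * y $ i\<rfloor> div int N) + \<lfloor>real N * y $ i\<rfloor> mod int N)" by simp
  also have "... = real N * real_of_int (\<lfloor>real N * y $ i\<rfloor> div int N) + real_of_int (\<lfloor>real N * y $ i\<rfloor> mod int N)" by (simp only: of_int_add of_int_mult of_int_of_nat_eq)
  finally show "real_of_int \<lfloor>real N * y $ i\<rfloor> / real N = real_of_int (\<lfloor>real N * y $ i\<rfloor> mod int N) / real N + real_of_int (\<lfloor>real N * y $ i\<rfloor> div int N)" using assms by (simp add: add_divide_distrib)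
 qed
qed

lemma Ycell_box: "(Ycell :: (real^'n::finite) set) = box (\<chi> i. - 1/2) (\<chi> i. 1/2)" by (auto simp: Ycell_def mem_box_cart)

lemma measure_cart_box:
 fixes a b :: "real^'n::finite"
 assumes "!!i. b $ i - a $ i = d" "0 < d"
 shows "measure lborel (box a b) = d ^ CARD('n)" "measure lborel (cbox a b) = d ^ CARD('n)"
proof -
 have le: "a $ i <= b $ i" for i using assms(1)[of i] assms(2) by linarith
 then have ne: "cbox a b ~= {}" by (simp add: interval_ne_empty_cart)
 have "measure lborel (cbox a b) = (\<Prod>i\<in>UNIV. b $ i - a $ i)" by (rule content_cbox_cart[OF ne])
 then show 1: "measure lborel (cbox a b) = d ^ CARD('n)" using assms(1) by simp
 have "measure lborel (box a b) = measure lborel (cbox a b)" by (simp add: measure_lborel_box_eq measure_lborel_cbox_eq)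
 with 1 show "measure lborel (box a b) = d ^ CARD('n)" by simp
qed

text \<open>The period cell is centred at 0 while grid cells are numbered from the corner. For N = 2
  M its faces lie on grid planes, so each residue class meets it in a single cube of side 1/N, up to
  faces.\<close>

lemma measure_Ycell_cell:
 fixes j :: "'n::finite => int"
 assumes N: "N = 2 * M" "M > 0" and j: "j \<in> cells N"
 shows "measure lborel {y \<in> Ycell. cell N y = j} = 1 / real (N ^ CARD('n))"
  "{y \<in> Ycell. cell N y = j} \<in> sets borel"
proof -
 \<comment> \<open>The representative of the residue in the range from -M to M - 1, which matches
   coordinates between -1/2 and 1/2.\<close>
 define m where "m i = (if j i < int M then j i else j i - int N)" for i
 have N0: "real N > 0" "N > 0" using N by auto
 have j01: "0 <= j i" "j i < int N" for i using j by (auto simp: cells_def)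
 have m1: "- int M <= m i" "m i < int M" for i using j01[of i] N by (auto simp: m_def)
 have m2: "m i mod int N = j i" for i using j01[of i] by (simp add: m_def)
 have m3: "k = m i" if "- int M <= k" "k < int M" "k mod int N = j i" for k i
 proof -
  have "k = (if 0 <= k then k mod int N else k mod int N - int N)"
  proof (cases "0 <= k")
   case False
   have "(k + int N) mod int N = k + int N" using that(1) False N by (intro mod_pos_pos_trivial) auto
   then show ?thesis using False by simp
  qed (use that N in simp)
  then show ?thesis using that j01[of i] N by (auto simp: m_def split: if_splits)
 qed
 define a b where "a = (\<chi> i. real_of_int (m i) / real N)" and "b = (\<chi> i. (real_of_int (m i) + 1) / real N)"
 have sub1: "box a b \<subseteq> {y \<in> Ycell. cell N y = j}"
 proof
  fix y assume y: "y \<in> box a b"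
  have f: "\<lfloor>real N * y $ i\<rfloor> = m i" and Y: "- 1/2 < y $ i & y $ i < 1/2" for i
  proof -
   have l: "real_of_int (m i) < real N * y $ i" "real N * y $ i < real_of_int (m i) + 1" using y N0 by (auto simp: mem_box_cart a_def b_def field_simps)
   then show "\<lfloor>real N * y $ i\<rfloor> = m i" by linarith
   have "real_of_int (- int M) <= real_of_int (m i)" "real_of_int (m i) + 1 <= real_of_int (int M)" using m1[of i] by linarith+
   with l have "- real M < real N * y $ i" "real N * y $ i < real M" by simp_all
   then have "real M * (- 1) < real M * (2 * y $ i)" "real M * (2 * y $ i) < real M * 1" using N by (simp_all add: mult_ac)
   then have "- 1 < 2 * y $ i" "2 * y $ i < 1" using N(2) by (simp_all only: mult_less_cancel_left_pos of_nat_0_less_iff)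
   then show "- 1/2 < y $ i & y $ i < 1/2" by simp
  qed
  have "cell N y = j" using f m2 by (simp add: cell_def fun_eq_iff)
  then show "y \<in> {y \<in> Ycell. cell N y = j}" using Y by (simp add: Ycell_def)
 qed
 have sub2: "{y \<in> Ycell. cell N y = j} \<subseteq> cbox a b"
 proof
  fix y assume y: "y \<in> {y \<in> Ycell. cell N y = j}"
  have "real_of_int (m i) / real N <= y $ i & y $ i <= (real_of_int (m i) + 1) / real N" for i
  proof -
   have Y: "- 1/2 < y $ i" "y $ i < 1/2" using y by (auto simp: Ycell_def)
   then have "real M * (- 1) < real M * (2 * y $ i)" "real M * (2 * y $ i) < real M * 1" using N(2) by (simp_all only: mult_less_cancel_left_pos of_nat_0_less_iff)
   then have "- real M < real N * y $ i" "real N * y $ i < real M" using N(1) by (simp_all add: mult_ac)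
   then have "- int M <= \<lfloor>real N * y $ i\<rfloor>" "\<lfloor>real N * y $ i\<rfloor> < int M" by (simp_all add: le_floor_iff floor_less_iff)
   moreover have "\<lfloor>real N * y $ i\<rfloor> mod int N = j i" using y by (auto simp: cell_def)
   ultimately have "\<lfloor>real N * y $ i\<rfloor> = m i" by (rule m3)
   then have "real_of_int (m i) <= real N * y $ i" "real N * y $ i <= real_of_int (m i) + 1" by linarith+
   then show ?thesis using N0 by (simp add: field_simps)
  qed
  then show "y \<in> cbox a b" by (simp add: mem_box_cart a_def b_def)
 qed
 have "in_cell N j -` {1} \<inter> space borel \<in> sets (borel :: (real^'n) measure)" by (rule measurable_sets[OF in_cell_borel]) simp
 moreover have "in_cell N j -` {1} \<inter> space borel = {y. cell N y = j}" by (auto simp: in_cell_def split: if_splits)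
 ultimately have "{y. cell N y = j} \<in> sets borel" by simp
 moreover have "Ycell \<in> sets (borel :: (real^'n) measure)" unfolding Ycell_box by simp
 ultimately have "Ycell \<inter> {y. cell N y = j} \<in> sets borel" by (rule sets.Int[rotated])
 then show s: "{y \<in> Ycell. cell N y = j} \<in> sets borel" by (simp add: Int_def)
 have ab: "b $ i - a $ i = 1 / real N" for i by (simp add: a_def b_def diff_divide_distrib[symmetric])
 have p: "(1 / real N) ^ CARD('n) = 1 / real (N ^ CARD('n))" by (simp add: power_one_over)
 have fin: "emeasure lborel (cbox a b) < \<infinity>" by (rule emeasure_bounded_finite[OF bounded_cbox])
 have f2: "emeasure lborel {y \<in> Ycell. cell N y = j} < \<infinity>" by (rule le_less_trans[OF emeasure_mono[OF sub2] fin]) simp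
 have "measure lborel (box a b) <= measure lborel {y \<in> Ycell. cell N y = j}" by (rule measure_mono_fmeasurable[OF sub1]) (use s f2 in \<open>auto simp: fmeasurable_def\<close>)
 moreover have "measure lborel {y \<in> Ycell. cell N y = j} <= measure lborel (cbox a b)" by (rule measure_mono_fmeasurable[OF sub2]) (use s fin in \<open>auto simp: fmeasurable_def\<close>)
 ultimately show "measure lborel {y \<in> Ycell. cell N y = j} = 1 / real (N ^ CARD('n))" using measure_cart_box[OF ab] N0 p by simp
qed

text \<open>Caratheodory conditions, bounds and periodicity at every point rather than almost
  everywhere; bt stands for a Borel version of 1/b.\<close>

locale oscillating =
 fixes bt :: "real^'n::finite => real^'n => real" and c C :: real
 assumes bt_borel: "!!y. (%x. bt x y) \<in> borelm"
  and bt_cont: "!!x. continuous_on UNIV (bt x)"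
  and bt_per: "!!x y k. int_vec k ==> bt x (y + k) = bt x y"
  and bt_bounds: "!!x y. c <= bt x y" "!!x y. bt x y <= C" and c_pos: "0 < c"
begin

lemma C_pos: "0 < C" using bt_bounds[of undefined undefined] c_pos by linarith
lemma bt_abs: "\<bar>bt x y\<bar> <= C" using bt_bounds[of x y] c_pos by linarith

section \<open>The modulus of continuity in the fast variable\<close>

definition dense_pairs :: "((real^'n) \<times> (real^'n)) set" where
 "dense_pairs = (SOME S. countable S & (\<forall>X. open X --> X ~= {} --> (\<exists>d\<in>S. d \<in> X)))"

lemma dense_pairs: "countable dense_pairs" "open X ==> X ~= {} ==> \<exists>d\<in>dense_pairs. d \<in> X"
proof -
 obtain S :: "((real^'n) \<times> (real^'n)) set" where "countable S & (\<forall>X. open X --> X ~= {} --> (\<exists>d\<in>S. d \<in> X))" using countable_dense_exists by blast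
 then have "countable dense_pairs & (\<forall>X. open X --> X ~= {} --> (\<exists>d\<in>dense_pairs. d \<in> X))" unfolding dense_pairs_def by (rule someI)
 then show "countable dense_pairs" "open X ==> X ~= {} ==> \<exists>d\<in>dense_pairs. d \<in> X" by blast+
qed

text \<open>The modulus of continuity is a supremum over a countable set so that it is measurable in the slow variable.\<close>

definition near_pairs :: "nat => ((real^'n) \<times> (real^'n)) set" where
 "near_pairs N = dense_pairs \<inter> {d. dist (fst d) (snd d) < (real CARD('n) + 1) / real N}"

definition modulus :: "nat => real^'n => real" where
 "modulus N x = (SUP d\<in>near_pairs N. \<bar>bt x (fst d) - bt x (snd d)\<bar>)"

lemma open_near: "open {d::(real^'n) \<times> (real^'n). dist (fst d) (snd d) < r}" by (intro open_Collect_less continuous_intros)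

lemma near_pairs_ne: assumes "N > 0" shows "near_pairs N ~= {}"
proof -
 let ?X = "{d::(real^'n) \<times> (real^'n). dist (fst d) (snd d) < (real CARD('n) + 1) / real N}"
 have "(0, 0) \<in> ?X" using assms by simp
 then obtain d where "d \<in> dense_pairs" "d \<in> ?X" using dense_pairs(2)[OF open_near[of "(real CARD('n) + 1) / real N"]] by blast
 then show ?thesis unfolding near_pairs_def by blast
qed

lemma diff_bound: "\<bar>bt x y - bt x y'\<bar> <= C" using bt_bounds[of x y] bt_bounds[of x y'] c_pos by linarith

lemma modulus_bdd: "bdd_above ((%d. \<bar>bt x (fst d) - bt x (snd d)\<bar>) ` near_pairs N)" by (rule bdd_aboveI2[of _ _ C]) (rule diff_bound)

lemma modulus_bounds: assumes "N > 0" shows "0 <= modulus N x" "modulus N x <= C"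
proof -
 obtain d where "d \<in> near_pairs N" using near_pairs_ne[OF assms] by blast
 then have "\<bar>bt x (fst d) - bt x (snd d)\<bar> <= modulus N x" unfolding modulus_def by (rule cSUP_upper[OF _ modulus_bdd])
 then show "0 <= modulus N x" by linarith
 show "modulus N x <= C" unfolding modulus_def by (rule cSUP_least[OF near_pairs_ne[OF assms] diff_bound])
qed

lemma modulus_borel: "modulus N \<in> borelm"
proof -
 have "countable (near_pairs N)" unfolding near_pairs_def by (rule countable_Int1[OF dense_pairs(1)])
 then show ?thesis unfolding modulus_def[abs_def] by (rule borel_measurable_cSUP) (use bt_borel modulus_bdd in auto)
qed

lemma bt_pair_cont: "continuous_on UNIV (%d. \<bar>bt x (fst d) - bt x (snd d)\<bar>)"
proof -
 have "continuous_on UNIV (%d::(real^'n) \<times> (real^'n). bt x (fst d))" "continuous_on UNIV (%d::(real^'n) \<times> (real^'n). bt x (snd d))" by (rule continuous_on_compose2[OF bt_cont[of x]]; auto intro: continuous_intros)+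
 then show ?thesis by (intro continuous_intros)
qed

text \<open>A violating pair would have an open neighbourhood of violating pairs, since bt is
  continuous and the distance bound strict, and the dense set meets it.\<close>

lemma modulus_ge:
 assumes N: "N > 0" and d: "dist y y' < (real CARD('n) + 1) / real N"
 shows "\<bar>bt x y - bt x y'\<bar> <= modulus N x"
proof (rule ccontr)
 assume n: "\<not> ?thesis"
 let ?X = "{d::(real^'n) \<times> (real^'n). dist (fst d) (snd d) < (real CARD('n) + 1) / real N} \<inter> {d. modulus N x < \<bar>bt x (fst d) - bt x (snd d)\<bar>}"
 have "open ?X" by (intro open_Int open_near open_Collect_less bt_pair_cont continuous_intros)
 moreover have "(y, y') \<in> ?X" using n d by simp
 ultimately obtain q where q: "q \<in> dense_pairs" "q \<in> ?X" using dense_pairs(2) by blast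
 then have "q \<in> near_pairs N" by (simp add: near_pairs_def)
 then have "\<bar>bt x (fst q) - bt x (snd q)\<bar> <= modulus N x" unfolding modulus_def by (rule cSUP_upper[OF _ modulus_bdd])
 with q show False by simp
qed

text \<open>Uniform continuity on a compact cube, spread to the whole space by periodicity. The rate
  depends on x, so norms of the modulus are handled by dominated convergence. The grids are even so
  that their cells fit the centred period cell.\<close>

lemma modulus_tendsto_0: "(%N. modulus (2 * Suc N) x) ~~> 0"
proof (rule LIMSEQ_I)
 fix e :: real assume e: "e > 0"
 \<comment> \<open>After moving y into the unit cube, a point at distance less than 1 has
   coordinates between -1 and 2.\<close>
 let ?K = "cbox (\<chi> i. - 2) (\<chi> i. 2) :: (real^'n) set"
 have "uniformly_continuous_on ?K (bt x)" by (rule compact_uniformly_continuous[OF continuous_on_subset[OF bt_cont]]) auto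
 then obtain d where d: "d > 0" "!!y y'. y \<in> ?K ==> y' \<in> ?K ==> dist y' y < d ==> dist (bt x y') (bt x y) < e/2" unfolding uniformly_continuous_on_def using half_gt_zero[OF e] by metis
 have per: "\<bar>bt x y - bt x y'\<bar> <= e/2" if yy: "dist y y' < min d 1" for y y'
 proof -
  define k where "k = (\<chi> i. real_of_int \<lfloor>y $ i\<rfloor>)"
  have k: "int_vec (- k)" by (simp add: int_vec_def k_def)
  have c: "\<bar>y $ i - y' $ i\<bar> < 1" for i using component_le_norm_cart[of "y - y'" i] yy by (simp add: dist_norm)
  have "- 2 <= y $ i - real_of_int \<lfloor>y $ i\<rfloor> & y $ i - real_of_int \<lfloor>y $ i\<rfloor> <= 2 & - 2 <= y' $ i - real_of_int \<lfloor>y $ i\<rfloor> & y' $ i - real_of_int \<lfloor>y $ i\<rfloor> <= 2" for i using c[of i] by linarith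
  then have "y + - k \<in> ?K" "y' + - k \<in> ?K" by (auto simp: mem_box_cart k_def)
  then have "dist (bt x (y + - k)) (bt x (y' + - k)) < e/2" using yy by (intro d(2)) (auto simp: dist_norm norm_minus_commute)
  then show ?thesis unfolding bt_per[OF k] by (simp add: dist_real_def)
 qed
 obtain N0 where N0: "(real CARD('n) + 1) / min d 1 < real N0" using reals_Archimedean2 by blast
 have "norm (modulus (2 * Suc N) x - 0) < e" if "N \<ge> N0" for N
 proof -
  have m: "min d 1 > 0" using d(1) by simp
  have "real N0 < real (2 * Suc N)" using that by simp
  with N0 have h: "(real CARD('n) + 1) / min d 1 < real (2 * Suc N)" by (rule less_trans)
  have gen: "a / n < m'" if "a / m' < n" "m' > 0" "n > 0" for a n m' :: real using that by (simp add: pos_divide_less_eq mult.commute)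
  have h2: "(real CARD('n) + 1) / real (2 * Suc N) < min d 1" by (rule gen[OF h m]) simp
  have "modulus (2 * Suc N) x <= e/2" unfolding modulus_def
  proof (rule cSUP_least[OF near_pairs_ne])
   fix q :: "(real^'n) \<times> (real^'n)" assume "q \<in> near_pairs (2 * Suc N)"
   then have "dist (fst q) (snd q) < (real CARD('n) + 1) / real (2 * Suc N)" unfolding near_pairs_def by blast
   from per[OF less_trans[OF this h2]] show "\<bar>bt x (fst q) - bt x (snd q)\<bar> <= e/2" .
  qed simp
  then show ?thesis using e modulus_bounds(1)[of "2 * Suc N" x] by simp
 qed
 then show "\<exists>no. \<forall>N\<ge>no. norm (modulus (2 * Suc N) x - 0) < e" by blast
qed

lemma bt_node: assumes "N > 0" shows "bt x (floor_node N y) = bt x (node N (cell N y))" using floor_node_cell[OF assms, of y] bt_per by metis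

text \<open>The distance from y to its grid point is at most n/N, strictly below the radius (n +
  1)/N of \<open>near_pairs\<close>; periodicity then replaces the grid point by the node.\<close>

lemma bt_cell_approx: assumes "N > 0" shows "\<bar>bt x y - bt x (node N (cell N y))\<bar> <= modulus N x"
proof -
 have "dist y (floor_node N y) < (real CARD('n) + 1) / real N" using floor_node_dist[OF assms, of y] assms by (simp add: field_simps)
 from modulus_ge[OF assms this] show ?thesis by (simp add: bt_node[OF assms])
qed

section \<open>Means as limits of Riemann sums\<close>

definition mean :: "real^'n => real" where "mean x = (LBINT y. indicator Ycell y * bt x y)"

definition node_mean :: "nat => real^'n => real" where
 "node_mean N x = (\<Sum>j\<in>cells N. bt x (node N j) * (1 / real (N ^ CARD('n))))"

lemma measure_Ycell: "measure lborel (Ycell :: (real^'n) set) = 1" "(Ycell :: (real^'n) set) \<in> sets borel"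
 "emeasure lborel (Ycell :: (real^'n) set) < \<infinity>"
proof -
 show "measure lborel (Ycell :: (real^'n) set) = 1" unfolding Ycell_box by (rule trans[OF measure_cart_box(1)[where d=1]]) auto
 show "(Ycell :: (real^'n) set) \<in> sets borel" unfolding Ycell_box by simp
 show "emeasure lborel (Ycell :: (real^'n) set) < \<infinity>" unfolding Ycell_box by (rule emeasure_bounded_finite[OF bounded_box])
qed

lemma integrable_Ycell:
 fixes g :: "real^'n => real"
 assumes "g \<in> borelm" "!!y. \<bar>g y\<bar> <= K"
 shows "integrable lborel (%y. indicator Ycell y * g y)"
proof (rule integrable_bound[where f = "%y. K * indicator Ycell y"])
 show "integrable lborel (%y. K * ind (Ycell :: (real^'n) set) y)" using measure_Ycell by (intro integrable_mult_right integrable_real_indicator) auto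
 show "(%y. ind Ycell y * g y) \<in> borel_measurable lborel" using assms(1) measure_Ycell(2) by measurable
 show "AE y in lborel. norm (ind Ycell y * g y) <= norm (K * ind Ycell y)" using assms(2) by (intro AE_I2) (auto simp: indicator_def intro: order_trans[OF _ abs_ge_self])
qed

lemma bt_x_borel: "bt x \<in> borelm" by (rule borel_measurable_continuous_onI[OF bt_cont])

text \<open>Replacing bt by its value at the node of each cell costs at most the modulus and turns
  the integral over the period into a sum with equal weights.\<close>

lemma node_mean_approx:
 assumes N: "N = 2 * Suc M" shows "\<bar>mean x - node_mean N x\<bar> <= modulus N x"
proof -
 have N0: "N > 0" using N by simp
 define g where "g y = bt x (node N (cell N y))" for y
 have gs: "g y = (\<Sum>j\<in>cells N. bt x (node N j) * in_cell N j y)" for y unfolding g_def by (rule sum_in_cell[OF N0, symmetric])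
 have gm: "g \<in> borelm" unfolding gs[abs_def] by measurable
 have gC: "\<bar>g y\<bar> <= C" for y unfolding g_def by (rule bt_abs)
 have "(LBINT y. indicator Ycell y * g y) = (LBINT y. (\<Sum>j\<in>cells N. bt x (node N j) * ind {y \<in> Ycell. cell N y = j} y))" by (rule integral_cong[OF refl]) (auto simp: gs in_cell_def indicator_def intro!: sum.cong)
 also have "... = (\<Sum>j\<in>cells N. bt x (node N j) * measure lborel {y \<in> Ycell. cell N y = j})"
 proof (subst integral_sum)
  fix j :: "'n => int" assume j: "j \<in> cells N"
  have "emeasure lborel {y \<in> Ycell. cell N y = j} <= emeasure lborel (Ycell :: (real^'n) set)" by (rule emeasure_mono) (use measure_Ycell(2) in auto)
  then have "emeasure lborel {y \<in> Ycell. cell N y = j} < \<infinity>" using measure_Ycell(3) by (rule le_less_trans)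
  then show "integrable lborel (%y. bt x (node N j) * ind {y \<in> Ycell. cell N y = j} y)" using measure_Ycell_cell(2)[OF N _ j] by (intro integrable_mult_right integrable_real_indicator) auto
 qed simp
 also have "... = node_mean N x" unfolding node_mean_def by (rule sum.cong[OF refl]) (simp only: measure_Ycell_cell(1)[OF N zero_less_Suc])
 finally have 1: "(LBINT y. indicator Ycell y * g y) = node_mean N x" .
 have i: "integrable lborel (%y. indicator Ycell y * bt x y)" "integrable lborel (%y. indicator Ycell y * g y)" by (rule integrable_Ycell[OF bt_x_borel bt_abs], rule integrable_Ycell[OF gm gC])
 have "mean x - node_mean N x = (LBINT y. indicator Ycell y * bt x y - indicator Ycell y * g y)" unfolding mean_def 1[symmetric] by (rule integral_diff[OF i, symmetric])
 also have "\<bar>...\<bar> <= (LBINT y. \<bar>indicator Ycell y * bt x y - indicator Ycell y * g y\<bar>)" using integral_norm_bound[of lborel "%y. indicator Ycell y * bt x y - indicator Ycell y * g y"] by simp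
 also have "... <= (LBINT y. modulus N x * ind (Ycell :: (real^'n) set) y)"
 proof (rule integral_mono)
  show "integrable lborel (%y. \<bar>indicator Ycell y * bt x y - indicator Ycell y * g y\<bar>)" using i by simp
  show "integrable lborel (%y. modulus N x * ind (Ycell :: (real^'n) set) y)" using measure_Ycell by (intro integrable_mult_right integrable_real_indicator) auto
  show "\<bar>indicator Ycell y * bt x y - indicator Ycell y * g y\<bar> <= modulus N x * indicator Ycell y" for y using bt_cell_approx[OF N0, of x y] by (auto simp: indicator_def g_def)
 qed
 also have "... = modulus N x" by (simp add: measure_Ycell)
 finally show ?thesis .
qed

lemma mean_bounds: "c <= mean x" "mean x <= C"
proof -
 have ic: "integrable lborel (%y. K * ind (Ycell :: (real^'n) set) y)" for K using measure_Ycell by (intro integrable_mult_right integrable_real_indicator) auto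
 have "(LBINT y. c * ind Ycell (y::real^'n)) <= mean x" unfolding mean_def by (rule integral_mono[OF ic integrable_Ycell[OF bt_x_borel bt_abs]]) (use bt_bounds in \<open>auto simp: indicator_def\<close>)
 then show "c <= mean x" by (simp add: measure_Ycell)
 have "mean x <= (LBINT y. C * ind Ycell (y::real^'n))" unfolding mean_def by (rule integral_mono[OF integrable_Ycell[OF bt_x_borel bt_abs] ic]) (use bt_bounds in \<open>auto simp: indicator_def\<close>)
 then show "mean x <= C" by (simp add: measure_Ycell)
qed

lemma node_mean_borel: "node_mean N \<in> borelm" unfolding node_mean_def[abs_def] using bt_borel by measurable

lemma node_mean_LIMSEQ: "(%M. node_mean (2 * Suc M) x) ~~> mean x"
proof (rule LIM_zero_cancel, rule tendsto_rabs_zero_cancel, rule tendsto_sandwich[OF _ _ tendsto_const modulus_tendsto_0[of x]])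
 show "\<forall>\<^sub>F M in sequentially. \<bar>node_mean (2 * Suc M) x - mean x\<bar> <= modulus (2 * Suc M) x" using node_mean_approx[OF refl, of x] by (auto simp: abs_minus_commute)
qed auto

lemma mean_borel: "mean \<in> borelm" by (rule borel_measurable_LIMSEQ_metric[OF node_mean_borel node_mean_LIMSEQ])

definition node_fun :: "nat => real => real^'n => real" where
 "node_fun N eps x = bt x (node N (cell N ((1/eps) *\<^sub>R x)))"

lemma node_fun_sum: "N > 0 ==> node_fun N eps x = (\<Sum>j\<in>cells N. bt x (node N j) * in_cell N j ((1/eps) *\<^sub>R x))" unfolding node_fun_def by (rule sum_in_cell[symmetric])

lemma node_fun_borel: assumes "N > 0" shows "node_fun N eps \<in> borelm"
proof -
 have "(%x::real^'n. in_cell N j ((1/eps) *\<^sub>R x)) \<in> borelm" for j by (rule measurable_compose[OF _ in_cell_borel]) simp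
 then show ?thesis unfolding node_fun_sum[OF assms, abs_def] using bt_borel by measurable
qed

text \<open>A Caratheodory function along a moving argument is the limit of functions that are
  piecewise constant in the fast variable.\<close>

lemma bt_eps_borel: "(%x. bt x ((1/eps) *\<^sub>R x)) \<in> borelm"
proof (rule borel_measurable_LIMSEQ_metric)
 show "node_fun (2 * Suc M) eps \<in> borelm" for M by (rule node_fun_borel) simp
 show "(%M. node_fun (2 * Suc M) eps x) ~~> bt x ((1/eps) *\<^sub>R x)" for x
 proof (rule LIM_zero_cancel, rule tendsto_rabs_zero_cancel, rule tendsto_sandwich[OF _ _ tendsto_const modulus_tendsto_0[of x]])
  show "\<forall>\<^sub>F M in sequentially. \<bar>node_fun (2 * Suc M) eps x - bt x ((1/eps) *\<^sub>R x)\<bar> <= modulus (2 * Suc M) x" unfolding node_fun_def using bt_cell_approx[of "2 * Suc _" x "(1/eps) *\<^sub>R x"] by (auto simp: abs_minus_commute)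
 qed auto
qed

end

locale oscillating_cylinder = cylinder \<Omega> T + oscillating bt c C
 for \<Omega> :: "(real^'n::finite) set" and T :: real and bt :: "real^'n => real^'n => real" and c C :: real
begin

text \<open>Three reductions: p becomes a bounded test function, the fast variable is discretized at
  nodes, and the inclusions are dropped. What remains is a finite sum of slow factors times centred
  cell indicators, covered by \<open>unif0_cell\<close>.\<close>

lemma unif0_oscillation:
 fixes d :: real
 assumes A: "!!eps. A eps \<in> sets borel" "!!eps. emeasure lborel (A eps \<inter> \<Omega>) < \<infinity>" and A0: "((%eps. measure lborel (A eps \<inter> \<Omega>)) \<longlongrightarrow> 0) (at_right 0)"
  and p: "sq p"
 shows "unif0 (%eps zt. \<integral>z. ((1 + d * ind (A eps) (fst z)) * bt (fst z) ((1/eps) *\<^sub>R fst z) - mean (fst z)) * (p z * zt z) \<partial>lborel)"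
proof -
 define a where "a eps z = (1 + d * ind (A eps) (fst z)) * bt (fst z) ((1/eps) *\<^sub>R fst z) - mean (fst z)" for eps and z :: "(real^'n) \<times> real"
 have mA: "(%z::(real^'n) \<times> real. ind (A eps) (fst z)) \<in> borelm" for eps by (rule measurable_compose[OF fst_borel borel_measurable_indicator[OF A(1)]])
 have mb: "(%z::(real^'n) \<times> real. bt (fst z) ((1/eps) *\<^sub>R fst z)) \<in> borelm" for eps by (rule measurable_compose[OF fst_borel bt_eps_borel])
 have mm: "(%z::(real^'n) \<times> real. mean (fst z)) \<in> borelm" by (rule measurable_compose[OF fst_borel mean_borel])
 have ma: "a eps \<in> borelm" for eps unfolding a_def[abs_def] using mA mb mm by measurable
 have ba: "\<bar>a eps z\<bar> <= (1 + \<bar>d\<bar>) * C + C" for eps z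
 proof -
  have "\<bar>1 + d * ind (A eps) (fst z)\<bar> <= 1 + \<bar>d\<bar>" by (auto simp: indicator_def)
  then have "\<bar>(1 + d * ind (A eps) (fst z)) * bt (fst z) ((1/eps) *\<^sub>R fst z)\<bar> <= (1 + \<bar>d\<bar>) * C" unfolding abs_mult using bt_abs by (intro mult_mono) auto
  moreover have "\<bar>mean (fst z)\<bar> <= C" using mean_bounds[of "fst z"] c_pos by linarith
  ultimately show ?thesis unfolding a_def by linarith
 qed
 have "unif0 (%eps zt. \<integral>z. a eps z * (p z * zt z) \<partial>lborel)"
 proof (rule unif0_density[OF ma ba _ _ p])
  show "0 < (1 + \<bar>d\<bar>) * C + C" using C_pos by (intro add_nonneg_pos) auto
  fix q assume q: "test_fun D q"
  obtain M where M: "M > 0" "!!z. \<bar>q z\<bar> <= M" using test_fun_bounded[OF q] by blast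
  have sq_q: "sq q" by (rule test_fun_sq[OF q])
  show "unif0 (%eps zt. \<integral>z. a eps z * (q z * zt z) \<partial>lborel)"
  proof (rule unif0_approx)
   fix R e :: real assume R: "R > 0" and e: "e > 0"
   \<comment> \<open>The discretization error tends to 0 for each x without uniformity, so it is
     measured in L^2 over the cylinder.\<close>
   define om where "om N z = ind D z * modulus (2 * Suc N) (fst z)" for N and z :: "(real^'n) \<times> real"
   have mom: "om N \<in> borelm" for N
   proof -
    have "(%z::(real^'n) \<times> real. modulus (2 * Suc N) (fst z)) \<in> borelm" by (rule measurable_compose[OF fst_borel modulus_borel])
    then show ?thesis unfolding om_def[abs_def] by measurable
   qed
   have ob: "\<bar>om N z\<bar> <= C * ind D z" for N z using modulus_bounds[of "2 * Suc N" "fst z"] by (auto simp: om_def indicator_def)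
   have sCD: "sq (%z. C * ind D z)" using sq_scaleR[OF sq_D, of C] by simp
   have som: "sq (om N)" for N by (rule sq_bound[OF sCD mom]) (use ob C_pos in \<open>auto intro!: AE_I2\<close>)
   have "(%N. N2 (%z. om N z - 0)) ~~> 0"
   proof (rule N2_dominated_LIMSEQ[OF sCD mom])
    show "AE z in lborel. (%N. om N z) ~~> 0"
    proof (rule AE_I2)
     fix z :: "(real^'n) \<times> real"
     from tendsto_mult_right_zero[OF modulus_tendsto_0[of "fst z"], of "ind D z"]
     show "(%N. om N z) ~~> 0" by (simp add: om_def)
    qed
    show "AE z in lborel. norm (om N z - 0) <= norm (C * ind D z)" for N using ob C_pos by (auto intro!: AE_I2)
   qed simp
   then have "(%N. 2 * M * (sqrt (N2 (om N)) * sqrt R)) ~~> 2 * M * (sqrt 0 * sqrt R)" by (intro tendsto_intros) simp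
   then have "\<forall>\<^sub>F N in sequentially. 2 * M * (sqrt (N2 (om N)) * sqrt R) < e/2" by (rule order_tendstoD(2)) (use e in simp)
   then obtain N1 where N1: "2 * M * (sqrt (N2 (om N1)) * sqrt R) < e/2" by (auto simp: eventually_sequentially)
   define N where "N = 2 * Suc N1"
   have N0: "N > 0" by (simp add: N_def)
   \<comment> \<open>The discretized coefficient minus its mean, separated cell by cell into a
     factor in x, absorbed by the weight, and a centred indicator.\<close>
   define F' where "F' eps zt = (\<Sum>j\<in>cells N. \<integral>z. cell_fun N j eps z * ((bt (fst z) (node N j) * q z) * zt z) \<partial>lborel)" for eps :: real and zt :: "(real^'n) \<times> real => real"
   have sqj: "sq (%z. bt (fst z) (node N j) * q z)" for j by (rule sq_fst_mult[OF sq_q bt_borel bt_abs])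
   have F'0: "unif0 F'" unfolding F'_def[abs_def] by (rule unif0_sum) (rule unif0_cell[OF N0 _ sqj])
   define mu where "mu eps = measure lborel (A eps \<inter> \<Omega>)" for eps
   \<comment> \<open>Since q is bounded by M, the inclusions enter through the square root of their
     measure.\<close>
   have "((%eps. (\<bar>d\<bar> * C * M) * (sqrt (mu eps * T) * sqrt R)) \<longlongrightarrow> (\<bar>d\<bar> * C * M) * (sqrt (0 * T) * sqrt R)) (at_right 0)" unfolding mu_def by (intro tendsto_intros A0)
   then have "\<forall>\<^sub>F eps in at_right 0. (\<bar>d\<bar> * C * M) * (sqrt (mu eps * T) * sqrt R) < e/2" by (rule order_tendstoD(2)) (use e in simp)
   then obtain eps0 where eps0: "eps0 > 0" "!!eps. 0 < eps ==> eps < eps0 ==> (\<bar>d\<bar> * C * M) * (sqrt (mu eps * T) * sqrt R) < e/2" unfolding eventually_at_right_field by auto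
   have "\<bar>(LBINT z. a eps z * (q z * zt z)) - F' eps zt\<bar> <= e"
    if eps: "0 < eps" "eps < eps0" and H: "H1 zt G" and R': "N2 zt <= R" for eps zt G
   proof -
    have s: "sq zt" by (rule H1_sq(1)[OF H])
    have mzt: "zt \<in> borelm" and mq: "q \<in> borelm" using s sq_q by (auto simp: sq_measurable)
    have rR: "sqrt (N2 zt) <= sqrt R" using R' by simp
    let ?J = "%z::(real^'n) \<times> real. ind (A eps \<inter> \<Omega>) (fst z) * ind {0<..<T} (snd z)"
    have sJ: "sq ?J" "N2 ?J = mu eps * T"
    proof -
     have s1: "sq (ind (A eps \<inter> \<Omega>))" by (rule sq_indicator) (use A in auto)
     have s2: "sq (ind {0<..<T})" by (rule sq_indicator) (use T_pos in auto)
     show "sq ?J" by (rule sq_prod(1)[OF s1 s2])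
     have "N2 (ind (A eps \<inter> \<Omega>)) = mu eps" unfolding mu_def by (rule N2_indicator) (use A in auto)
     moreover have "N2 (ind {0<..<T}) = T" using T_pos by (subst N2_indicator) auto
     ultimately show "N2 ?J = mu eps * T" by (simp only: sq_prod(2)[OF s1 s2])
    qed
    have F'eq: "F' eps zt = (LBINT z. (node_fun N eps (fst z) - node_mean N (fst z)) * (q z * zt z))"
    proof -
     have i: "integrable lborel (%z. cell_fun N j eps z * ((bt (fst z) (node N j) * q z) * zt z))" for j using sq_integrable_mult[OF sq_mult_bounded[OF sqj cell_fun_measurable cell_fun_bound[OF N0]] s] by (simp add: mult.assoc)
     have "F' eps zt = (LBINT z. (\<Sum>j\<in>cells N. cell_fun N j eps z * ((bt (fst z) (node N j) * q z) * zt z)))" unfolding F'_def by (rule integral_sum[symmetric]) (rule i)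
     also have "... = (LBINT z. (node_fun N eps (fst z) - node_mean N (fst z)) * (q z * zt z))"
     proof (rule integral_cong[OF refl])
      fix z
      show "(\<Sum>j\<in>cells N. cell_fun N j eps z * ((bt (fst z) (node N j) * q z) * zt z)) = (node_fun N eps (fst z) - node_mean N (fst z)) * (q z * zt z)" unfolding node_fun_sum[OF N0] node_mean_def sum_subtractf[symmetric] sum_distrib_right by (rule sum.cong[OF refl]) (simp add: cell_fun_def algebra_simps)
     qed
     finally show ?thesis .
    qed
    have mn: "(%z::(real^'n) \<times> real. node_fun N eps (fst z)) \<in> borelm" "(%z::(real^'n) \<times> real. node_mean N (fst z)) \<in> borelm" by (rule measurable_compose[OF fst_borel node_fun_borel[OF N0]], rule measurable_compose[OF fst_borel node_mean_borel])
    define g where "g z = a eps z - (node_fun N eps (fst z) - node_mean N (fst z))" for z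
    have nb: "\<bar>node_fun N eps (fst z) - node_mean N (fst z)\<bar> <= C + (C + C)" for z :: "(real^'n) \<times> real"
    proof -
     have "\<bar>node_fun N eps (fst z)\<bar> <= C" unfolding node_fun_def by (rule bt_abs)
     moreover have "\<bar>mean (fst z) - node_mean N (fst z)\<bar> <= C" using node_mean_approx[OF N_def, of "fst z"] modulus_bounds(2)[OF N0, of "fst z"] by linarith
     ultimately show ?thesis using mean_bounds[of "fst z"] c_pos by linarith
    qed
    have mnn: "(%z::(real^'n) \<times> real. node_fun N eps (fst z) - node_mean N (fst z)) \<in> borelm" using mn by measurable
    have ia: "integrable lborel (%z. a eps z * (q z * zt z))" using sq_integrable_mult[OF sq_mult_bounded[OF sq_q ma ba] s] by (simp add: mult.assoc)
    have ic: "integrable lborel (%z. (node_fun N eps (fst z) - node_mean N (fst z)) * (q z * zt z))" using sq_integrable_mult[OF sq_mult_bounded[OF sq_q mnn nb] s] by (simp add: mult.assoc)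
    have "(LBINT z. a eps z * (q z * zt z)) - F' eps zt = (LBINT z. g z * (q z * zt z))" unfolding F'eq integral_diff[OF ia ic, symmetric] g_def by (simp add: left_diff_distrib)
    also have "\<bar>...\<bar> <= (LBINT z. \<bar>g z * (q z * zt z)\<bar>)" using integral_norm_bound[of lborel "%z. g z * (q z * zt z)"] by simp
    also have "... <= (LBINT z. (\<bar>d\<bar> * C * M) * (?J z * \<bar>zt z\<bar>) + 2 * M * (om N1 z * \<bar>zt z\<bar>))"
    proof (rule integral_mono)
     have "(%z. g z * (q z * zt z)) = (%z. a eps z * (q z * zt z) - (node_fun N eps (fst z) - node_mean N (fst z)) * (q z * zt z))" by (simp add: g_def left_diff_distrib)
     then show "integrable lborel (%z. \<bar>g z * (q z * zt z)\<bar>)" using ia ic by simp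
     have sa: "sq (%z. \<bar>zt z\<bar>)" using sq_norm[OF s] by simp
     show "integrable lborel (%z. (\<bar>d\<bar> * C * M) * (?J z * \<bar>zt z\<bar>) + 2 * M * (om N1 z * \<bar>zt z\<bar>))" by (intro integrable_add integrable_mult_right sq_integrable_mult sJ som sa)
     fix z :: "(real^'n) \<times> real"
     show "\<bar>g z * (q z * zt z)\<bar> <= (\<bar>d\<bar> * C * M) * (?J z * \<bar>zt z\<bar>) + 2 * M * (om N1 z * \<bar>zt z\<bar>)"
     proof (cases "z \<in> D")
      case True
      define y where "y = (1/eps) *\<^sub>R fst z"
      have J: "?J z = ind (A eps) (fst z)" using True by (auto simp: indicator_def)
      have o: "om N1 z = modulus N (fst z)" using True by (simp add: om_def N_def)
      have "g z = d * ind (A eps) (fst z) * bt (fst z) y + (bt (fst z) y - node_fun N eps (fst z)) - (mean (fst z) - node_mean N (fst z))" by (simp add: g_def a_def y_def algebra_simps)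
      moreover have "\<bar>d * ind (A eps) (fst z) * bt (fst z) y\<bar> <= \<bar>d\<bar> * C * ?J z" unfolding J using bt_abs[of "fst z" y] by (auto simp: indicator_def abs_mult mult_left_mono)
      moreover have "\<bar>bt (fst z) y - node_fun N eps (fst z)\<bar> <= om N1 z" unfolding o node_fun_def y_def by (rule bt_cell_approx[OF N0])
      moreover have "\<bar>mean (fst z) - node_mean N (fst z)\<bar> <= om N1 z" unfolding o by (rule node_mean_approx[OF N_def])
      ultimately have g1: "\<bar>g z\<bar> <= \<bar>d\<bar> * C * ?J z + 2 * om N1 z" by linarith
      have "\<bar>g z\<bar> * (\<bar>q z\<bar> * \<bar>zt z\<bar>) <= (\<bar>d\<bar> * C * ?J z + 2 * om N1 z) * (M * \<bar>zt z\<bar>)" using g1 M by (intro mult_mono) (auto intro: mult_right_mono order_trans[OF abs_ge_zero])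
      then show ?thesis by (simp add: abs_mult algebra_simps)
     next
      case False
      then have "zt z = 0" by (rule H1_outside(1)[OF H])
      then show ?thesis by simp
     qed
    qed
    also have "... = (\<bar>d\<bar> * C * M) * (LBINT z. ?J z * \<bar>zt z\<bar>) + 2 * M * (LBINT z. om N1 z * \<bar>zt z\<bar>)"
    proof -
     have sa: "sq (%z. \<bar>zt z\<bar>)" using sq_norm[OF s] by simp
     have i1: "integrable lborel (%z. (\<bar>d\<bar> * C * M) * (?J z * \<bar>zt z\<bar>))" "integrable lborel (%z. 2 * M * (om N1 z * \<bar>zt z\<bar>))" by (rule integrable_mult_right, rule sq_integrable_mult[OF sJ(1) sa], rule integrable_mult_right, rule sq_integrable_mult[OF som sa])
     show ?thesis unfolding integral_add[OF i1] integral_mult_right_zero ..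
    qed
    also have "... <= (\<bar>d\<bar> * C * M) * (sqrt (mu eps * T) * sqrt R) + 2 * M * (sqrt (N2 (om N1)) * sqrt R)"
    proof -
     have sa: "sq (%z. \<bar>zt z\<bar>)" using sq_norm[OF s] by simp
     have na: "N2 (%z. \<bar>zt z\<bar>) = N2 zt" using N2_norm[of zt] by simp
     have "(LBINT z. ?J z * \<bar>zt z\<bar>) <= sqrt (N2 ?J) * sqrt (N2 zt)" using Cauchy_Schwarz_mult[OF sJ(1) sa] unfolding na by linarith
     also have "... <= sqrt (mu eps * T) * sqrt R" unfolding sJ(2) using rR T_pos by (intro mult_left_mono) (auto simp: mu_def)
     finally have 1: "(LBINT z. ?J z * \<bar>zt z\<bar>) <= sqrt (mu eps * T) * sqrt R" .
     have "(LBINT z. om N1 z * \<bar>zt z\<bar>) <= sqrt (N2 (om N1)) * sqrt (N2 zt)" using Cauchy_Schwarz_mult[OF som[of N1] sa] unfolding na by linarith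
     also have "... <= sqrt (N2 (om N1)) * sqrt R" using rR by (intro mult_left_mono) auto
     finally have 2: "(LBINT z. om N1 z * \<bar>zt z\<bar>) <= sqrt (N2 (om N1)) * sqrt R" .
     show ?thesis using 1 2 M(1) C_pos by (intro add_mono mult_left_mono) auto
    qed
    also have "... <= e" using N1 eps0(2)[OF eps] by linarith
    finally show ?thesis .
   qed
   then show "\<exists>F' eps0. unif0 F' & eps0 > 0 & (\<forall>eps zt G. 0 < eps --> eps < eps0 --> H1 zt G --> N2 zt <= R --> N2 G <= R -->
     \<bar>(LBINT z. a eps z * (q z * zt z)) - F' eps zt\<bar> <= e)" using F'0 eps0(1) by blast
  qed
 qed
 then show ?thesis by (simp only: a_def)
qed

end

subsection \<open>Borel representatives\<close>

lemma lebesgue_ex_borel: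
 fixes f :: "'a::euclidean_space => 'b::euclidean_space"
 assumes "f \<in> borel_measurable lebesgue"
 shows "\<exists>g\<in>borelm. AE x in lborel. f x = g x"
proof -
 have "\<exists>g\<in>borel_measurable lborel. AE x in lborel. f x \<bullet> b = g x" for b using borel_measurable_inner[OF assms borel_measurable_const] by (intro completion_ex_borel_measurable_real) simp
 then obtain g where g: "!!b. g b \<in> borel_measurable lborel" "!!b. AE x in lborel. f x \<bullet> b = g b x" by metis
 have "AE x in lborel. \<forall>b\<in>Basis. f x \<bullet> b = g b x" using g(2) by (subst AE_ball_countable) (auto simp: countable_finite)
 then have "AE x in lborel. f x = (\<Sum>b\<in>Basis. g b x *\<^sub>R b)"
  by eventually_elim (subst euclidean_representation[symmetric], simp)
 moreover have "(%x. \<Sum>b\<in>Basis. g b x *\<^sub>R b) \<in> borelm" using g(1) by simp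
 ultimately show ?thesis by (rule bexI)
qed

text \<open>The bridge from Lebesgue integrals over a set, as in the notion of weak solution, to
  Borel functions on the whole space.\<close>

lemma set_integral_borel:
 fixes g :: "'a::euclidean_space => 'b::euclidean_space"
 assumes A: "A \<in> sets borel" and g: "g \<in> borelm" "!!z. z \<notin> A ==> g z = 0"
  and ae: "AE z in lborel. z \<in> A --> F z = g z"
 shows "sint A F = (LBINT z. g z)"
  "set_integrable lebesgue A F \<longleftrightarrow> integrable lborel g" "set_borel_measurable lebesgue A F"
proof -
 have g': "g \<in> borel_measurable lborel" using g(1) by simp
 have gl: "g \<in> borel_measurable lebesgue" by (rule measurable_completion[OF g'])
 have eq: "AE z in lebesgue. g z = indicator A z *\<^sub>R F z" by (rule AE_completion) (use ae in eventually_elim, use g(2) in \<open>auto simp: indicator_def\<close>)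
 have m: "(%z. indicator A z *\<^sub>R F z) \<in> borel_measurable lebesgue" by (rule borel_measurable_AE[OF gl eq])
 show "set_borel_measurable lebesgue A F" using m by (simp add: set_borel_measurable_def)
 show "sint A F = (LBINT z. g z)" unfolding set_lebesgue_integral_def integral_completion[OF g', symmetric] by (rule integral_cong_AE[OF m gl]) (use eq in \<open>auto elim: eventually_mono\<close>)
 show "set_integrable lebesgue A F \<longleftrightarrow> integrable lborel g" unfolding set_integrable_def integrable_completion[OF g', symmetric] by (rule integrable_cong_AE[OF m gl]) (use eq in \<open>auto elim: eventually_mono\<close>)
qed

lemma set_integral_mult_borel:
 fixes g \<phi> :: "'a::euclidean_space => real"
 assumes A: "A \<in> sets borel" and g: "g \<in> borelm" "!!z. z \<notin> A ==> g z = 0"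
  and ae: "AE z in lborel. z \<in> A --> f z = g z" and \<phi>: "\<phi> \<in> borelm"
 shows "sint A (%z. f z * \<phi> z) = (LBINT z. g z * \<phi> z)"
proof (rule set_integral_borel(1)[OF A])
 show "(%z. g z * \<phi> z) \<in> borelm" by (rule borel_measurable_times[OF g(1) \<phi>])
 show "AE z in lborel. z \<in> A --> f z * \<phi> z = g z * \<phi> z" using ae by eventually_elim auto
qed (simp add: g)

lemma ex_borel_rep:
 fixes f :: "'a::euclidean_space => 'b::euclidean_space"
 assumes A: "A \<in> sets borel" and f: "set_borel_measurable lebesgue A f"
 obtains g where "g \<in> borelm" "!!z. z \<notin> A ==> g z = 0" "AE z in lborel. z \<in> A --> f z = g z"
proof -
 obtain g where g: "g \<in> borelm" "AE x in lborel. ind A x *\<^sub>R f x = g x" using lebesgue_ex_borel f unfolding set_borel_measurable_def by blast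
 have "(%z. ind A z *\<^sub>R g z) \<in> borelm" using A g(1) by measurable
 moreover have "AE z in lborel. z \<in> A --> f z = ind A z *\<^sub>R g z" using g(2) by eventually_elim (auto simp: indicator_def)
 ultimately show thesis by (intro that[of "%z. ind A z *\<^sub>R g z"]) auto
qed

lemma L2v_integral:
 fixes f g :: "'a::euclidean_space => 'b::euclidean_space"
 assumes A: "A \<in> sets borel" and g: "g \<in> borelm" "!!z. z \<notin> A ==> g z = 0"
  and ae: "AE z in lborel. z \<in> A --> f z = g z"
 shows "L2v A f \<longleftrightarrow> sq g" "sint A (%z. (norm (f z))^2) = N2 g"
proof -
 have m: "(%z. (norm (g z))^2) \<in> borelm" using g(1) by measurable
 have "AE z in lborel. z \<in> A --> (norm (f z))^2 = (norm (g z))^2" using ae by eventually_elim auto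
 note s = set_integral_borel[OF A m _ this]
 show "L2v A f \<longleftrightarrow> sq g" unfolding L2v_def sq_def using s(2) set_integral_borel(3)[OF A g ae] g by auto
 show "sint A (%z. (norm (f z))^2) = N2 g" unfolding N2_def by (rule s(1)) (simp add: g)
qed

lemma L2_eq_L2v: "L2 A f = L2v A f" by (simp add: L2_def L2v_def)

lemma L2v_rep:
 fixes f :: "'a::euclidean_space => 'b::euclidean_space"
 assumes A: "A \<in> sets borel" and f: "L2v A f"
 obtains g where "sq g" "!!z. z \<notin> A ==> g z = 0" "AE z in lborel. z \<in> A --> f z = g z"
proof -
 obtain g where g: "g \<in> borelm" "!!z. z \<notin> A ==> g z = 0" "AE z in lborel. z \<in> A --> f z = g z" using ex_borel_rep[OF A] f unfolding L2v_def by blast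
 with L2v_integral(1)[OF A g] f that show thesis by blast
qed

context cylinder
begin

lemma spatial_grad_H1:
 assumes "spatial_grad \<Omega> T v G"
 obtains v' G' where "H1 v' G'" "AE z in lborel. z \<in> D --> v z = v' z" "AE z in lborel. z \<in> D --> G z = G' z"
proof -
 obtain v' where v': "sq v'" "!!z. z \<notin> D ==> v' z = 0" "AE z in lborel. z \<in> D --> v z = v' z" using assms L2v_rep[OF D_borel, of v] unfolding spatial_grad_def L2_eq_L2v by blast
 obtain G' where G': "sq G'" "!!z. z \<notin> D ==> G' z = 0" "AE z in lborel. z \<in> D --> G z = G' z" using assms L2v_rep[OF D_borel, of G] unfolding spatial_grad_def by blast
 have "H1 v' G'"
 proof (rule H1I)
  show "off v'" "off G'" by (rule offI; fact v' G')+
  fix \<phi> i assume t: "test_fun D \<phi>"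
  have m: "\<phi> \<in> borelm" "dx i \<phi> \<in> borelm" using test_fun_sq[OF t] test_fun_sq[OF test_fun_deriv[OF t]] by (auto simp: dx_def[abs_def] sq_measurable)
  have mG: "(%z. G' z $ i) \<in> borelm" by (rule sq_measurable[OF sq_component[OF G'(1)]])
  have e1: "sint D (%z. v z * dx i \<phi> z) = (LBINT z. v' z * dx i \<phi> z)" by (rule set_integral_mult_borel[OF D_borel sq_measurable[OF v'(1)] v'(2,3) m(2)])
  have "AE z in lborel. z \<in> D --> G z $ i = G' z $ i" using G'(3) by eventually_elim simp
  then have e2: "sint D (%z. (G z $ i) * \<phi> z) = (LBINT z. (G' z $ i) * \<phi> z)" by (intro set_integral_mult_borel[OF D_borel mG _ _ m(1)]) (simp_all add: G'(2))
  show "(LBINT z. v' z * dx i \<phi> z) = - (LBINT z. (G' z $ i) * \<phi> z)" unfolding e1[symmetric] e2[symmetric] using assms t unfolding spatial_grad_def by blast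
 qed (fact v'(1) G'(1))+
 with v' G' that show thesis by blast
qed

lemma H1_spatial_grad:
 assumes H: "H1 v' G'" and ae: "AE z in lborel. z \<in> D --> v z = v' z" "AE z in lborel. z \<in> D --> G z = G' z"
 shows "spatial_grad \<Omega> T v G" unfolding spatial_grad_def L2_eq_L2v
proof (intro conjI allI impI)
 note v' = sq_measurable[OF H1_sq(1)[OF H]] H1_outside(1)[OF H] and G' = sq_measurable[OF H1_sq(2)[OF H]] H1_outside(2)[OF H]
 show "L2v D v" using L2v_integral(1)[OF D_borel v' ae(1)] H1_sq(1)[OF H] by simp
 show "L2v D G" using L2v_integral(1)[OF D_borel G' ae(2)] H1_sq(2)[OF H] by simp
 fix \<phi> i assume t: "test_fun D \<phi>"
 have m: "\<phi> \<in> borelm" "dx i \<phi> \<in> borelm" using test_fun_sq[OF t] test_fun_sq[OF test_fun_deriv[OF t]] by (auto simp: dx_def[abs_def] sq_measurable)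
 have mG: "(%z. G' z $ i) \<in> borelm" by (rule sq_measurable[OF sq_component[OF H1_sq(2)[OF H]]])
 have e1: "sint D (%z. v z * dx i \<phi> z) = (LBINT z. v' z * dx i \<phi> z)" by (rule set_integral_mult_borel[OF D_borel v' ae(1) m(2)])
 have "AE z in lborel. z \<in> D --> G z $ i = G' z $ i" using ae(2) by eventually_elim simp
 then have e2: "sint D (%z. (G z $ i) * \<phi> z) = (LBINT z. (G' z $ i) * \<phi> z)" by (intro set_integral_mult_borel[OF D_borel mG _ _ m(1)]) (simp_all add: G'(2))
 show "sint D (%z. v z * dx i \<phi> z) = - sint D (%z. (G z $ i) * \<phi> z)" unfolding e1 e2 using H t unfolding H1_def by blast
qed

text \<open>Both gradients have the same pairings with all test functions of the cylinder, so the
  fundamental lemma applies to each component.\<close>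

lemma H1_gradient_unique:
 assumes "H1 v G" "H1 v' G'" "AE z in lborel. v z = v' z"
 shows "AE z in lborel. G z = G' z"
proof -
 have "AE z in lborel. z \<in> D --> G z $ i - G' z $ i = 0" for i
 proof (rule fundamental_lemma[OF D_open])
  have s: "sq (%z. G z $ i)" "sq (%z. G' z $ i)" using assms H1_sq(2) sq_component by blast+
  show "sq (%z. G z $ i - G' z $ i)" by (rule sq_diff[OF s])
  fix \<phi> assume t: "test_fun D \<phi>"
  have sD: "dx i \<phi> \<in> borelm" using test_fun_sq[OF test_fun_deriv[OF t]] by (simp add: dx_def[abs_def] sq_measurable)
  have "(LBINT z. v z * dx i \<phi> z) = (LBINT z. v' z * dx i \<phi> z)"
  proof (rule integral_cong_AE)
   show "(%z. v z * dx i \<phi> z) \<in> borel_measurable lborel" "(%z. v' z * dx i \<phi> z) \<in> borel_measurable lborel" using sD sq_measurable[OF H1_sq(1)[OF assms(1)]] sq_measurable[OF H1_sq(1)[OF assms(2)]] by measurable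
   show "AE z in lborel. v z * dx i \<phi> z = v' z * dx i \<phi> z" using assms(3) by eventually_elim simp
  qed
  then have "(LBINT z. (G z $ i) * \<phi> z) = (LBINT z. (G' z $ i) * \<phi> z)" using assms(1,2)[unfolded H1_def, THEN conjunct2, THEN conjunct2, THEN conjunct2, rule_format, OF t] by simp
  then show "(LBINT z. (G z $ i - G' z $ i) * \<phi> z) = 0" using sq_integrable_mult[OF s(1) test_fun_sq[OF t]] sq_integrable_mult[OF s(2) test_fun_sq[OF t]] by (simp add: left_diff_distrib)
 qed
 then have "AE z in lborel. \<forall>i. z \<in> D --> G z $ i - G' z $ i = 0" by (subst AE_all_countable) auto
 then show ?thesis
 proof eventually_elim
  case (elim z)
  then show ?case using H1_outside(2)[OF assms(1), of z] H1_outside(2)[OF assms(2), of z] by (cases "z \<in> D") (auto simp: vec_eq_iff)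
 qed
qed

text \<open>P may fail to be measurable, so the exceptional set is first enlarged to a Borel null
  set.\<close>

lemma AE_slices: "AE z in lborel. P (z :: (real^'n) \<times> real) ==> AE t in lborel. AE x in lborel. P (x, t)"
proof -
 assume "AE z in lborel. P z"
 then obtain N where N: "{z. \<not> P z} \<subseteq> N" "N \<in> null_sets lborel" unfolding eventually_ae_filter by auto
 have sN: "N \<in> sets borel" using N(2) by (auto simp: null_sets_def)
 have "AE z in lborel. z \<notin> N" by (rule AE_not_in[OF N(2)])
 then have "AE z in lborel \<Otimes>\<^sub>M lborel. z \<notin> N" unfolding lborel_prod .
 from lborel_pair.AE_pair[OF this] have "AE x in lborel. AE t in lborel. (x, t) \<notin> N" .
 then have "AE t in lborel. AE x in lborel. (x, t) \<notin> N"
 proof (subst lborel_pair.AE_commute[symmetric])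
  have "{x \<in> space (lborel \<Otimes>\<^sub>M lborel). (fst x, snd x) \<notin> N} = - N" by (auto simp: lborel_prod)
  then show "{x \<in> space (lborel \<Otimes>\<^sub>M lborel). (fst x, snd x) \<notin> N} \<in> sets (lborel \<Otimes>\<^sub>M lborel)" using sN unfolding lborel_prod by (simp add: borel_comp)
 qed
 then show ?thesis by (rule eventually_mono) (auto elim!: eventually_mono simp: subsetD[OF N(1)], use N(1) in blast)
qed

lemma tint_fst_mult: "tint (%z. g (fst z) * w z) z = g (fst z) * tint w z" for g :: "real^'n => real"
proof -
 have "(LBINT s. ind {snd z<..} s * (g (fst z) * w (fst z, s))) = g (fst z) * (LBINT s. ind {snd z<..} s * w (fst z, s))" unfolding integral_mult_right_zero[symmetric] by (simp add: mult.left_commute)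
 then show ?thesis by (simp add: tint_def)
qed

lemma tI_late_eq_tint: "0 < t ==> t < T ==> tI (late t w) x = tint w (x, t)" using tint_late_early[of "(x, t)" t w] tint_late[of t "(x, t)" w] by simp

end

context cylinder
begin

text \<open>With v = a u and \<beta> = \<mu>/a the equation becomes d_t (\<beta> v) - Laplace v = f.
  The same conversion serves the oscillating problem, with m = 1, and the limit problem, with a = 1
  and m the mean.\<close>

lemma weak_sol_is_sol:
 assumes W: "weak_sol \<Omega> T m a f u0 u" and \<beta>: "coef \<beta> c C" and \<mu>: "coef \<mu> c' C'"
  and m: "AE x in lborel. x \<in> \<Omega> --> m x = \<mu> x & \<beta> x * a x = \<mu> x"
  and f': "sq f'" "off f'" "AE z in lborel. z \<in> D --> f z = f' z"
  and ub: "sq ub" "!!x. x \<notin> \<Omega> ==> ub x = 0" "AE x in lborel. x \<in> \<Omega> --> \<mu> x * u0 x = ub x"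
 obtains v G w P where "is_sol \<beta> f' ub v G w P" "AE z in lborel. z \<in> D --> a (fst z) * u z = v z"
proof -
 obtain w0 G0 where td: "time_deriv_loc \<Omega> T u w0" and C0: "C0L2 \<Omega> T u" and ini: "AE x in lebesgue. x \<in> \<Omega> --> u (x, 0) = u0 x"
  and sg: "spatial_grad \<Omega> T (%z. a (fst z) * u z) G0"
  and eq: "!!\<phi> G\<phi> t0. spatial_grad \<Omega> T \<phi> G\<phi> ==> 0 < t0 ==> (\<forall>z\<in>D. snd z < t0 --> \<phi> z = 0) ==>
    sint D (%z. m (fst z) * w0 z * \<phi> z + G0 z \<bullet> G\<phi> z) = sint D (%z. f z * \<phi> z)" using W unfolding weak_sol_def by (elim exE conjE) blast
 obtain v G where H: "H1 v G" and v: "AE z in lborel. z \<in> D --> a (fst z) * u z = v z" and G: "AE z in lborel. z \<in> D --> G0 z = G z" by (rule spatial_grad_H1[OF sg])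
 have m2: "AE z in lborel. fst z \<in> \<Omega> --> m (fst z) = \<mu> (fst z) & \<beta> (fst z) * a (fst z) = \<mu> (fst z)" by (rule AE_lborel_fst[OF m])
 \<comment> \<open>A Borel version of u, recovered from v through \<beta> a = \<mu>.\<close>
 define u1 where "u1 z = \<beta> (fst z) * (1 / \<mu> (fst z) * v z)" for z
 have u1: "sq u1" "off u1" unfolding u1_def[abs_def] using sq_fst_mult[OF sq_fst_mult[OF H1_sq(1)[OF H] coefD(10,8)[OF \<mu>]] coefD(2,5)[OF \<beta>]] H1_outside(1)[OF H] by (auto simp: off_def)
 have u1_eq: "AE z in lborel. z \<in> D --> u z = u1 z" using v m2
 proof eventually_elim
  case (elim z)
  show ?case
  proof
   assume "z \<in> D"
   then have e: "v z = a (fst z) * u z" "\<beta> (fst z) * a (fst z) = \<mu> (fst z)" using elim by (auto simp: mem_Times_iff)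
   have "u1 z = (\<beta> (fst z) * a (fst z)) * u z / \<mu> (fst z)" unfolding u1_def e(1) by simp
   then show "u z = u1 z" using coefD(6)[OF \<mu>, of "fst z"] using e(2) by simp
  qed
 qed
 have wL: "L2v (\<Omega> \<times> {t0<..<T}) w0" if "0 < t0" "t0 < T" for t0 using td that unfolding time_deriv_loc_def L2_eq_L2v by blast
 have slice: "\<Omega> \<times> {t0<..<T} \<in> sets borel" for t0 using \<Omega>_open by (intro borel_open open_Times) auto
 \<comment> \<open>Measurability of w0 is available on late slabs only, and w0 on the cylinder is
   the pointwise limit of its restrictions. The starting times T/(n + 2) stay strictly below
   T.\<close>
 have wm: "set_borel_measurable lebesgue D w0" unfolding set_borel_measurable_def
 proof (rule borel_measurable_LIMSEQ_real)
  fix n show "(%z. ind (\<Omega> \<times> {T * inverse (real (Suc (Suc n)))<..<T}) z *\<^sub>R w0 z) \<in> borel_measurable lebesgue"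
  proof -
   have "inverse (real (Suc (Suc n))) < 1" by (simp add: inverse_less_1_iff)
   then have "T * inverse (real (Suc (Suc n))) < T * 1" using T_pos by (intro mult_strict_left_mono) auto
   then show ?thesis using wL[of "T * inverse (real (Suc (Suc n)))"] T_pos unfolding L2v_def set_borel_measurable_def by simp
  qed
 next
  fix z :: "(real^'n) \<times> real"
  show "(%n. ind (\<Omega> \<times> {T * inverse (real (Suc (Suc n)))<..<T}) z *\<^sub>R w0 z) ~~> ind D z *\<^sub>R w0 z"
  proof (cases "z \<in> D")
   case True
   have "(%n. T * inverse (real (Suc (Suc n)))) ~~> T * 0" by (intro tendsto_intros LIMSEQ_Suc[OF LIMSEQ_inverse_real_of_nat])
   moreover have "T * 0 < snd z" using True by auto
   ultimately have "\<forall>\<^sub>F n in sequentially. T * inverse (real (Suc (Suc n))) < snd z" by (rule order_tendstoD(2))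
   then have "\<forall>\<^sub>F n in sequentially. ind (\<Omega> \<times> {T * inverse (real (Suc (Suc n)))<..<T}) z *\<^sub>R w0 z = ind D z *\<^sub>R w0 z"
    by eventually_elim (use True in \<open>auto simp: indicator_def\<close>)
   then show ?thesis by (rule tendsto_eventually)
  next
   case False
   have "z \<notin> \<Omega> \<times> {T * inverse (real (Suc (Suc n)))<..<T}" for n
   proof
    assume "z \<in> \<Omega> \<times> {T * inverse (real (Suc (Suc n)))<..<T}"
    moreover have "0 < T * inverse (real (Suc (Suc n)))" using T_pos by simp
    ultimately show False using False by (auto simp: mem_Times_iff)
   qed
   with False show ?thesis by simp
  qed
 qed
 obtain w1 where w1: "w1 \<in> borelm" "!!z. z \<notin> D ==> w1 z = 0" "AE z in lborel. z \<in> D --> w0 z = w1 z" using ex_borel_rep[OF D_borel wm] by blast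
 have late0: "late t0 w z = 0" if "T <= t0" "off w" for t0 w z using offD[OF that(2), of z] that(1) by (cases "z \<in> D") (auto simp: late_def)
 have wl: "wloc w1" unfolding wloc_def
 proof (intro conjI allI impI)
  show "off w1" by (rule offI) (rule w1)
  fix t0 :: real assume t0: "0 < t0"
  have lm: "late t0 w1 \<in> borelm" unfolding late_def[abs_def] using w1(1) by measurable
  show "sq (late t0 w1)"
  proof (cases "t0 < T")
   case True
   show ?thesis
   proof (rule L2v_integral(1)[THEN iffD1, OF slice lm _ _ wL[OF t0 True]])
    show "late t0 w1 z = 0" if "z \<notin> \<Omega> \<times> {t0<..<T}" for z using that w1(2)[of z] t0 by (auto simp: late_def indicator_def mem_Times_iff)
    show "AE z in lborel. z \<in> \<Omega> \<times> {t0<..<T} --> w0 z = late t0 w1 z" using w1(3) by eventually_elim (use t0 in \<open>auto simp: late_def\<close>)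
   qed
  next
   case False
   then have "late t0 w1 = (%z. 0)" using late0[of t0 w1] w1(2) by (auto simp: off_def fun_eq_iff)
   then show ?thesis by simp
  qed
 qed (rule w1)
 have wd: "wder D (0, 1) u1 w1" unfolding wder_def
 proof (intro allI impI)
  fix \<phi> assume t: "test_fun D \<phi>"
  have mm: "\<phi> \<in> borelm" "dt \<phi> \<in> borelm" using test_fun_sq[OF t] test_fun_sq[OF test_fun_deriv[OF t]] by (auto simp: dt_def[abs_def] sq_measurable)
  have e1: "sint D (%z. u z * dt \<phi> z) = (LBINT z. u1 z * dt \<phi> z)" by (rule set_integral_mult_borel[OF D_borel sq_measurable[OF u1(1)] offD[OF u1(2)] u1_eq mm(2)])
  have e2: "sint D (%z. w0 z * \<phi> z) = (LBINT z. w1 z * \<phi> z)" by (rule set_integral_mult_borel[OF D_borel w1 mm(1)])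
  show "(LBINT z. u1 z * frechet_derivative \<phi> (at z) (0, 1)) = - (LBINT z. w1 z * \<phi> z)" unfolding dt_def[symmetric] e1[symmetric] e2[symmetric] using td t unfolding time_deriv_loc_def by blast
 qed
 obtain P0 where P0: "sq P0" "time_rep u1 w1 P0" using time_rep_exists[OF u1 wl wd] by blast
 define w2 where "w2 z = \<mu> (fst z) * w1 z" for z
 \<comment> \<open>The indicator makes P, and with it all traces, vanish off the domain.\<close>
 define P where "P x = \<mu> x * (ind \<Omega> x * P0 x)" for x
 have sP: "sq P" unfolding P_def[abs_def] by (rule sq_mult_bounded[OF sq_indicator_mult[OF P0(1) \<Omega>_borel] coefD(2,5)[OF \<mu>]])
 have w2m: "w2 \<in> borelm"
 proof -
  have "(%z::(real^'n) \<times> real. \<mu> (fst z)) \<in> borelm" by (rule measurable_compose[OF fst_borel coefD(2)[OF \<mu>]])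
  then show ?thesis unfolding w2_def[abs_def] using w1(1) by measurable
 qed
 have l2: "late t0 w2 = (%z. \<mu> (fst z) * late t0 w1 z)" for t0 by (auto simp: late_def w2_def)
 have wl2: "wloc w2" unfolding wloc_def l2 using wl w2m sq_fst_mult[OF _ coefD(2,5)[OF \<mu>]] by (auto simp: wloc_def off_def w2_def)
 have rep: "time_rep (%z. \<beta> (fst z) * v z) w2 P" unfolding time_rep_def using P0(2)[unfolded time_rep_def]
 proof eventually_elim
  case (elim z)
  show ?case
  proof
   assume z: "z \<in> D"
   have "\<beta> (fst z) * v z = \<mu> (fst z) * u1 z" using coefD(6)[OF \<mu>, of "fst z"] by (simp add: u1_def)
   then show "\<beta> (fst z) * v z = P (fst z) - tint w2 z" using elim z unfolding w2_def[abs_def] tint_fst_mult by (simp add: P_def mem_Times_iff right_diff_distrib)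
  qed
 qed
 have init: "\<exists>tk. (\<forall>k::nat. 0 < tk k) & tk ~~> 0 & (%k. N2 (%x. Ut w2 P (tk k) x - ub x)) ~~> 0"
 proof -
  have "AE z in lborel. z \<in> D --> u z = P0 (fst z) - tint w1 z" using u1_eq P0(2)[unfolded time_rep_def] by eventually_elim auto
  from AE_slices[OF this] have good: "AE t in lborel. AE x in lborel. (x, t) \<in> D --> u (x, t) = P0 x - tint w1 (x, t)" by simp
  \<comment> \<open>The representation holds at almost every time, hence at some time in every
    interval of positive length next to 0. There the trace agrees with u, and the continuity of u at
    time 0 gives the datum.\<close>
  have "\<exists>t. 0 < t & t < min T (inverse (real (Suc k))) & (AE x in lborel. (x, t) \<in> D --> u (x, t) = P0 x - tint w1 (x, t))" for k
  proof (rule ccontr)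
   assume "\<not> ?thesis"
   with good have "AE t in lborel. t \<notin> {0<..<min T (inverse (real (Suc k)))}" by (auto elim!: eventually_mono)
   then have "{0<..<min T (inverse (real (Suc k)))} \<in> null_sets lborel" by (subst AE_iff_null_sets) auto
   moreover have "emeasure lborel {0<..<min T (inverse (real (Suc k)))} = ennreal (min T (inverse (real (Suc k))) - 0)" by (rule emeasure_lborel_Ioo) (use T_pos in simp)
   moreover have "0 < min T (inverse (real (Suc k)))" using T_pos by simp
   ultimately show False by (simp add: null_sets_def)
  qed
  then have "\<exists>tk. \<forall>k. 0 < tk k & tk k < min T (inverse (real (Suc k))) & (AE x in lborel. (x, tk k) \<in> D --> u (x, tk k) = P0 x - tint w1 (x, tk k))" by (intro choice allI)
  then obtain tk where tk': "!!k. 0 < tk k & tk k < min T (inverse (real (Suc k))) & (AE x in lborel. (x, tk k) \<in> D --> u (x, tk k) = P0 x - tint w1 (x, tk k))" by (elim exE) (rule that, erule spec)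
  note tk = tk'[THEN conjunct1] tk'[THEN conjunct2, THEN conjunct1] tk'[THEN conjunct2, THEN conjunct2]
  have tk0: "tk ~~> 0" by (rule tendsto_sandwich[OF _ _ tendsto_const LIMSEQ_inverse_real_of_nat]) (use tk(1,2) less_imp_le in \<open>auto intro!: always_eventually less_imp_le\<close>)
  have ini': "AE x in lborel. x \<in> \<Omega> --> u (x, 0) = u0 x" using ini by (simp add: AE_completion_iff)
  have bound: "N2 (%x. Ut w2 P (tk k) x - ub x) <= C'^2 * sint \<Omega> (%x. (u (x, tk k) - u (x, 0))^2)" for k
  proof -
   have tkT: "tk k < T" using tk(2)[of k] by simp
   let ?g = "%x. ind \<Omega> x * (1 / \<mu> x * (Ut w2 P (tk k) x - ub x))"
   have sU: "sq (%x. Ut w2 P (tk k) x - ub x)" by (rule sq_diff[OF sq_Ut[OF wl2 sP tk(1)] ub(1)])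
   have sg: "sq ?g" by (rule sq_indicator_mult[OF sq_mult_bounded[OF sU coefD(10,8)[OF \<mu>]] \<Omega>_borel])
   have e: "AE x in lborel. x \<in> \<Omega> --> u (x, tk k) - u (x, 0) = ?g x" using tk(3)[of k] ini' ub(3)
   proof eventually_elim
    case (elim x)
    show ?case
    proof
     assume x: "x \<in> \<Omega>"
     then have "u (x, tk k) = P0 x - tint w1 (x, tk k)" using elim(1) tk(1)[of k] tkT by simp
     moreover have "Ut w2 P (tk k) x = \<mu> x * (P0 x - tint w1 (x, tk k))" unfolding Ut_def tI_late_eq_tint[OF tk(1) tkT] using x tint_fst_mult[of \<mu> w1 "(x, tk k)"] by (simp add: w2_def[abs_def] P_def right_diff_distrib)
     ultimately have "Ut w2 P (tk k) x - ub x = \<mu> x * (u (x, tk k) - u (x, 0))" using elim(2,3) x by (simp add: right_diff_distrib)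
     then show "u (x, tk k) - u (x, 0) = ?g x" using x coefD(6)[OF \<mu>, of x] by simp
    qed
   qed
   have "sint \<Omega> (%x. (norm (u (x, tk k) - u (x, 0)))^2) = N2 ?g" by (rule L2v_integral(2)[OF \<Omega>_borel sq_measurable[OF sg] _ e]) simp
   moreover have "N2 (%x. \<mu> x * ?g x) <= C'^2 * N2 ?g" by (rule N2_mult_bounded[OF sg coefD(2,5)[OF \<mu>]])
   moreover have "\<mu> x * ?g x = Ut w2 P (tk k) x - ub x" for x
   proof (cases "x \<in> \<Omega>")
    case False
    then have "P x = 0" "tI (late (tk k) w2) x = 0" using offD[OF wloc_late(2)[OF wl2, of "tk k"], of "(x, _)"] by (auto simp: P_def tI_def)
    then show ?thesis using False ub(2)[of x] by (simp add: Ut_def)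
   qed (use coefD(6)[OF \<mu>, of x] in simp)
   ultimately show ?thesis by simp
  qed
  have z0: "((%s. sint \<Omega> (%x. (u (x, s) - u (x, 0))^2)) \<longlongrightarrow> 0) (at 0 within {0..T})" using C0 T_pos unfolding C0L2_def by auto
  have "filterlim tk (at 0 within {0..T}) sequentially" unfolding filterlim_at using tk0 tk(1,2) by (auto intro!: always_eventually simp: less_imp_le order.strict_implies_not_eq[symmetric])
  from filterlim_compose[OF z0 this]
  have "(%k. C'^2 * sint \<Omega> (%x. (u (x, tk k) - u (x, 0))^2)) ~~> C'^2 * 0" by (intro tendsto_intros)
  then have "(%k. C'^2 * sint \<Omega> (%x. (u (x, tk k) - u (x, 0))^2)) ~~> 0" by simp
  then have "(%k. N2 (%x. Ut w2 P (tk k) x - ub x)) ~~> 0" by (rule tendsto_sandwich[OF _ _ tendsto_const, rotated 2]) (use bound in auto)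
  with tk(1) tk0 show ?thesis by blast
 qed
 have "(LBINT z. w2 z * \<phi> z) + (LBINT z. G z \<bullet> G\<phi> z) = (LBINT z. f' z * \<phi> z)"
  if H\<phi>: "H1 \<phi> G\<phi>" and t0: "0 < t0" "\<forall>z. snd z < t0 --> \<phi> z = 0" for \<phi> G\<phi> t0
 proof -
  have s: "sq \<phi>" "sq G\<phi>" by (rule H1_sq[OF H\<phi>])+
  \<comment> \<open>As \<open>\<phi>\<close> vanishes before t0, only the square integrable part of
    \<open>w2\<close> after t0/2 matters.\<close>
  have "w2 z * \<phi> z = late (t0/2) w2 z * \<phi> z" for z using t0(1) spec[OF t0(2), of z] by (cases "snd z < t0") (auto simp: late_def simp del: split_paired_All)
  then have wz: "(%z. w2 z * \<phi> z) = (%z. late (t0/2) w2 z * \<phi> z)" by (rule ext)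
  have i1: "integrable lborel (%z. w2 z * \<phi> z)" unfolding wz by (rule sq_integrable_mult[OF wloc_late(1)[OF wl2] s(1)]) (use t0(1) in simp)
  have i2: "integrable lborel (%z. G z \<bullet> G\<phi> z)" by (rule sq_integrable_inner[OF H1_sq(2)[OF H] s(2)])
  have "sint D (%z. m (fst z) * w0 z * \<phi> z + G0 z \<bullet> G\<phi> z) = (LBINT z. w2 z * \<phi> z + G z \<bullet> G\<phi> z)"
  proof (rule set_integral_borel(1)[OF D_borel])
   show "(%z. w2 z * \<phi> z + G z \<bullet> G\<phi> z) \<in> borelm" using w2m sq_measurable[OF s(1)] sq_measurable[OF s(2)] sq_measurable[OF H1_sq(2)[OF H]] by measurable
   show "AE z in lborel. z \<in> D --> m (fst z) * w0 z * \<phi> z + G0 z \<bullet> G\<phi> z = w2 z * \<phi> z + G z \<bullet> G\<phi> z" using m2 w1(3) G by eventually_elim (auto simp: w2_def)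
  qed (simp add: H1_outside[OF H\<phi>])
  moreover have "sint D (%z. f z * \<phi> z) = (LBINT z. f' z * \<phi> z)"
  proof (rule set_integral_borel(1)[OF D_borel])
   show "(%z. f' z * \<phi> z) \<in> borelm" using sq_measurable[OF f'(1)] sq_measurable[OF s(1)] by measurable
   show "AE z in lborel. z \<in> D --> f z * \<phi> z = f' z * \<phi> z" using f'(3) by eventually_elim auto
  qed (simp add: H1_outside[OF H\<phi>])
  moreover have "spatial_grad \<Omega> T \<phi> G\<phi>" by (rule H1_spatial_grad[OF H\<phi>]) auto
  ultimately have "(LBINT z. w2 z * \<phi> z + G z \<bullet> G\<phi> z) = (LBINT z. f' z * \<phi> z)" using eq[of \<phi> G\<phi> t0] t0 by simp
  then show ?thesis using i1 i2 by simp
 qed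
 then have "is_sol \<beta> f' ub v G w2 P" unfolding is_sol_def using H wl2 sP rep init by blast
 with v that show thesis by blast
qed

end

subsection \<open>The inclusions\<close>

lemma cell_image:
 fixes \<xi> :: "real^'n::finite"
 assumes "eps > 0"
 shows "(%y. eps *\<^sub>R (\<xi> + y)) ` Ycell = box (\<chi> i. eps * (\<xi> $ i - 1/2)) (\<chi> i. eps * (\<xi> $ i + 1/2))"
proof (intro set_eqI iffI)
 fix x assume "x \<in> (%y. eps *\<^sub>R (\<xi> + y)) ` Ycell"
 then show "x \<in> box (\<chi> i. eps * (\<xi> $ i - 1/2)) (\<chi> i. eps * (\<xi> $ i + 1/2))" using assms by (auto simp: Ycell_def mem_box_cart)
next
 fix x assume x: "x \<in> box (\<chi> i. eps * (\<xi> $ i - 1/2)) (\<chi> i. eps * (\<xi> $ i + 1/2))"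
 have "- 1/2 < x $ i / eps - \<xi> $ i & x $ i / eps - \<xi> $ i < 1/2" for i using x assms spec[of _ i] by (auto simp: mem_box_cart field_simps)
 then have "(1/eps) *\<^sub>R x - \<xi> \<in> Ycell" by (auto simp: Ycell_def)
 moreover have "x = eps *\<^sub>R (\<xi> + ((1/eps) *\<^sub>R x - \<xi>))" using assms by simp
 ultimately show "x \<in> (%y. eps *\<^sub>R (\<xi> + y)) ` Ycell" by blast
qed

text \<open>Coordinates in the open cell are below 1/2 in modulus, so the integer vectors of a
  common point would differ by less than 1 in each coordinate.\<close>

lemma cells_disjoint:
 fixes \<xi> \<xi>' :: "real^'n::finite"
 assumes "eps > 0" "int_vec \<xi>" "int_vec \<xi>'" "\<xi> ~= \<xi>'"
 shows "(%y. eps *\<^sub>R (\<xi> + y)) ` Ycell \<inter> (%y. eps *\<^sub>R (\<xi>' + y)) ` Ycell = {}"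
proof (rule ccontr)
 assume "\<not> ?thesis"
 then obtain x where "x \<in> (%y. eps *\<^sub>R (\<xi> + y)) ` Ycell" "x \<in> (%y. eps *\<^sub>R (\<xi>' + y)) ` Ycell" by blast
 then obtain y y' where y: "y \<in> Ycell" "y' \<in> Ycell" "eps *\<^sub>R (\<xi> + y) = eps *\<^sub>R (\<xi>' + y')" by (elim imageE) metis
 then have e: "\<xi> + y = \<xi>' + y'" using assms(1) by simp
 have "\<xi> $ i = \<xi>' $ i" for i
 proof -
  obtain a b where ab: "\<xi> $ i = of_int a" "\<xi>' $ i = of_int b" using assms(2,3) unfolding int_vec_def Ints_def by blast
  have "of_int a + y $ i = of_int b + y' $ i" using arg_cong[OF e, of "%v. v $ i"] ab by simp
  moreover have "-1/2 < y $ i" "y $ i < 1/2" "-1/2 < y' $ i" "y' $ i < 1/2" using y(1,2) by (auto simp: Ycell_def)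
  ultimately have "\<bar>of_int (a - b) :: real\<bar> < 1" by (simp add: abs_less_iff)
  then have "a = b" by linarith
  then show ?thesis using ab by simp
 qed
 then show False using assms(4) by (simp add: vec_eq_iff)
qed

lemma emeasure_bounded: "bounded A ==> emeasure lborel A < \<infinity>" for A :: "'a::euclidean_space set" by (rule emeasure_bounded_finite)

text \<open>Volume counting: the cells indexed by \<open>Xi\<close> are disjoint, lie in the domain
  and have volume epsilon^n each.\<close>

lemma card_Xi:
 fixes \<Omega> :: "(real^'n::finite) set"
 assumes "open \<Omega>" "bounded \<Omega>" "eps > 0"
 shows "finite (Xi \<Omega> eps)" "real (card (Xi \<Omega> eps)) * eps ^ CARD('n) <= measure lborel \<Omega>"
proof -
 let ?b = "%\<xi>::real^'n. (%y. eps *\<^sub>R (\<xi> + y)) ` Ycell"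
 have bound: "real (card F) * eps ^ CARD('n) <= measure lborel \<Omega>" if F: "finite F" "F \<subseteq> Xi \<Omega> eps" for F
 proof -
  have m: "measure lborel (?b \<xi>) = eps ^ CARD('n)" for \<xi> unfolding cell_image[OF assms(3)] by (rule measure_cart_box(1)) (use assms(3) in \<open>auto simp: algebra_simps\<close>)
  have s: "?b \<xi> \<in> sets lborel" "emeasure lborel (?b \<xi>) ~= \<infinity>" for \<xi> unfolding cell_image[OF assms(3)] using emeasure_bounded[OF bounded_box] by (auto simp: less_top[symmetric])
  have "?b \<xi> \<inter> ?b \<xi>' = {}" if "\<xi> \<in> F" "\<xi>' \<in> F" "\<xi> ~= \<xi>'" for \<xi> \<xi>' using cells_disjoint[OF assms(3), of \<xi> \<xi>'] that F(2) unfolding Xi_def by blast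
  then have dj: "disjoint_family_on ?b F" unfolding disjoint_family_on_def by blast
  have "(\<Sum>\<xi>\<in>F. measure lborel (?b \<xi>)) = measure lborel (\<Union>\<xi>\<in>F. ?b \<xi>)" by (rule measure_finite_Union[symmetric, OF F(1) _ dj s(2)]) (use s(1) in blast)
  also have "... <= measure lborel \<Omega>"
  proof (rule measure_mono_fmeasurable)
   show "(\<Union>\<xi>\<in>F. ?b \<xi>) \<subseteq> \<Omega>" using F(2) by (auto simp: Xi_def)
   show "(\<Union>\<xi>\<in>F. ?b \<xi>) \<in> sets lborel" using F(1) s(1) by (intro sets.finite_UN) auto
   show "\<Omega> \<in> fmeasurable lborel" using assms(1) emeasure_bounded[OF assms(2)] by (intro fmeasurableI) auto
  qed
  finally show ?thesis by (simp add: m)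
 qed
 show fin: "finite (Xi \<Omega> eps)"
 proof (rule finite_if_finite_subsets_card_bdd[THEN conjunct1])
  fix F assume "F \<subseteq> Xi \<Omega> eps" "finite F"
  from bound[OF this(2,1)] have "real (card F) <= measure lborel \<Omega> / eps ^ CARD('n)" using assms(3) by (simp add: field_simps)
  then show "card F <= nat \<lceil>measure lborel \<Omega> / eps ^ CARD('n)\<rceil>" by linarith
 qed
 show "real (card (Xi \<Omega> eps)) * eps ^ CARD('n) <= measure lborel \<Omega>" by (rule bound[OF fin subset_refl])
qed

lemma Omega1_open:
 fixes B :: "(real^'n::finite) set"
 assumes "open B" "\<eta> > 0" "eps > 0"
 shows "open (Omega1 \<Omega> B \<eta> eps)" unfolding Omega1_def
proof (rule open_UN, rule ballI)
 fix \<xi> :: "real^'n"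
 have "(%y. eps *\<^sub>R (\<xi> + \<eta> *\<^sub>R y)) ` B = (%y. eps *\<^sub>R \<xi> + y) ` ((%y. (eps * \<eta>) *\<^sub>R y) ` B)" by (auto simp: image_image scaleR_add_right)
 moreover have "open ..." using assms by (intro open_translation open_scaling) auto
 ultimately show "open ((%y. eps *\<^sub>R (\<xi> + \<eta> *\<^sub>R y)) ` B)" by simp
qed

text \<open>Each inclusion fits in a cube of side epsilon times \<eta>, and \<open>card_Xi\<close>
  bounds their number.\<close>

lemma measure_Omega1:
 fixes \<Omega> :: "(real^'n::finite) set"
 assumes \<Omega>: "open \<Omega>" "bounded \<Omega>" and B: "open B" "B \<subseteq> Ycell" and p: "\<eta> > 0" "eps > 0"
 shows "measure lborel (Omega1 \<Omega> B \<eta> eps) <= \<eta> ^ CARD('n) * measure lborel \<Omega>" "bounded (Omega1 \<Omega> B \<eta> eps)"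
proof -
 note X = card_Xi[OF \<Omega> p(2)]
 let ?c = "%\<xi>::real^'n. cbox (\<chi> i. eps * \<xi> $ i - eps * \<eta> / 2) (\<chi> i. eps * \<xi> $ i + eps * \<eta> / 2)"
 have sub: "Omega1 \<Omega> B \<eta> eps \<subseteq> (\<Union>\<xi>\<in>Xi \<Omega> eps. ?c \<xi>)" unfolding Omega1_def
 proof (rule UN_mono[OF subset_refl], rule image_subsetI)
  fix \<xi> y :: "real^'n" assume "y \<in> B"
  then have y: "- 1/2 < y $ i" "y $ i < 1/2" for i using B(2) by (auto simp: Ycell_def)
  have "eps * \<eta> * (- 1/2) <= eps * \<eta> * y $ i" "eps * \<eta> * y $ i <= eps * \<eta> * (1/2)" for i by (rule mult_left_mono; use y[of i] p in simp)+
  then have "eps * \<xi> $ i - eps * \<eta> / 2 <= eps * (\<xi> $ i + \<eta> * y $ i)" "eps * (\<xi> $ i + \<eta> * y $ i) <= eps * \<xi> $ i + eps * \<eta> / 2" for i by (simp_all add: distrib_left mult.assoc[symmetric])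
  then show "eps *\<^sub>R (\<xi> + \<eta> *\<^sub>R y) \<in> ?c \<xi>" by (simp add: mem_box_cart)
 qed
 have bU: "bounded (\<Union>\<xi>\<in>Xi \<Omega> eps. ?c \<xi>)" using X(1) by (intro bounded_UN) auto
 show "bounded (Omega1 \<Omega> B \<eta> eps)" by (rule bounded_subset[OF bU sub])
 have "measure lborel (Omega1 \<Omega> B \<eta> eps) <= measure lborel (\<Union>\<xi>\<in>Xi \<Omega> eps. ?c \<xi>)" by (rule measure_mono_fmeasurable[OF sub])
   (use Omega1_open[OF B(1) p] emeasure_bounded[OF bU] X(1) in \<open>auto intro!: fmeasurableI\<close>)
 also have "... <= (\<Sum>\<xi>\<in>Xi \<Omega> eps. measure lborel (?c \<xi>))" by (rule measure_UNION_le[OF X(1)]) simp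
 also have "... = (\<Sum>\<xi>\<in>Xi \<Omega> eps. (eps * \<eta>) ^ CARD('n))" by (rule sum.cong[OF refl], rule measure_cart_box(2)) (use p in \<open>auto simp: field_simps\<close>)
 also have "... = \<eta> ^ CARD('n) * (real (card (Xi \<Omega> eps)) * eps ^ CARD('n))" by (simp add: power_mult_distrib)
 also have "... <= \<eta> ^ CARD('n) * measure lborel \<Omega>" using X(2) p by (intro mult_left_mono) auto
 finally show "measure lborel (Omega1 \<Omega> B \<eta> eps) <= \<eta> ^ CARD('n) * measure lborel \<Omega>" .
qed

subsection \<open>Borel version of the coefficient\<close>

lemma AE_lebesgue_Borel_null:
 fixes P :: "'a::euclidean_space => bool"
 assumes "AE x in lebesgue. P x"
 obtains Z where "Z \<in> null_sets lborel" "!!x. x \<notin> Z ==> P x"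
proof -
 have "AE x in lborel. P x" using assms by (simp add: AE_completion_iff)
 then obtain N where "{x \<in> space lborel. \<not> P x} \<subseteq> N" "N \<in> null_sets lborel" unfolding eventually_ae_filter by blast
 then show thesis using that[of N] by auto
qed

lemma dense_sequence_limit:
 fixes y :: "'a::euclidean_space"
 assumes S: "\<forall>U. open U --> U ~= {} --> (\<exists>d\<in>S. d \<in> U)"
 obtains s where "!!n::nat. s n \<in> S" "s ~~> y"
proof -
 have "\<exists>d\<in>S. d \<in> ball y (inverse (real (Suc n)))" for n by (rule S[rule_format]) auto
 then have "\<exists>s. \<forall>n. s n \<in> S & dist y (s n) < inverse (real (Suc n))" by (intro choice allI) (auto simp: mem_ball)
 then obtain s where s: "!!n. s n \<in> S" "!!n. dist y (s n) < inverse (real (Suc n))" by blast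
 have "(%n. dist (s n) y) ~~> 0" by (rule tendsto_sandwich[OF _ _ tendsto_const LIMSEQ_inverse_real_of_nat])
   (use s(2) in \<open>auto intro!: always_eventually less_imp_le simp: dist_commute\<close>)
 then have "s ~~> y" by (rule iffD2[OF tendsto_dist_iff])
 with s(1) that show thesis by blast
qed

text \<open>Measurability of b is given for each y separately, with null sets that depend on y.
  Borel versions at a countable dense set of y share one null set; off the good set b is replaced by
  a constant, and continuity in y extends measurability to all y.\<close>

lemma admissible_oscillating:
 fixes \<Omega> :: "(real^'n::finite) set"
 assumes b: "admissible_coeff \<Omega> b" and \<Omega>: "\<Omega> \<in> sets borel"
 obtains bt c C where "oscillating bt c C" "AE x in lborel. x \<in> \<Omega> --> (\<forall>y. 0 < b x y & bt x y = 1 / b x y)"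
proof -
 obtain M where M: "AE x in lebesgue. x \<in> \<Omega> --> (\<forall>y. \<bar>b x y\<bar> <= M)" using b unfolding admissible_coeff_def by blast
 obtain C where C: "C > 0" "AE x in lebesgue. x \<in> \<Omega> --> (\<forall>y. C <= b x y)" using b unfolding admissible_coeff_def by blast
 obtain S0 :: "(real^'n) set" where S0: "countable S0" "\<forall>U. open U --> U ~= {} --> (\<exists>d\<in>S0. d \<in> U)" by (rule countable_dense_setE) blast
 have bm: "set_borel_measurable lebesgue \<Omega> (%x. b x y)" for y using b unfolding admissible_coeff_def by blast
 have "\<exists>g. g \<in> borelm & (AE x in lborel. x \<in> \<Omega> --> b x y = g x)" for y using ex_borel_rep[OF \<Omega> bm, of y] by blast
 then have "\<exists>g. \<forall>y. g y \<in> borelm & (AE x in lborel. x \<in> \<Omega> --> b x y = g y x)" by (intro choice allI)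
 then obtain g where g: "!!y. g y \<in> borelm" "!!y. AE x in lborel. x \<in> \<Omega> --> b x y = g y x" by blast
 have gS: "AE x in lborel. \<forall>y\<in>S0. x \<in> \<Omega> --> b x y = g y x" by (subst AE_ball_countable[OF S0(1)]) (use g(2) in blast)
 define good where "good x \<longleftrightarrow> (\<forall>y\<in>S0. b x y = g y x) & continuous_on UNIV (b x) & (\<forall>y. \<bar>b x y\<bar> <= M) &
   (\<forall>y k. int_vec k --> b x (y + k) = b x y) & (\<forall>y. C <= b x y)" for x
 have "AE x in lebesgue. x \<in> \<Omega> --> good x" using AE_completion[OF gS] M C(2) b[unfolded admissible_coeff_def, THEN conjunct2, THEN conjunct1]
   b[unfolded admissible_coeff_def, THEN conjunct2, THEN conjunct2, THEN conjunct2, THEN conjunct1]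
  by eventually_elim (auto simp: good_def)
 then obtain Z where Z: "Z \<in> null_sets lborel" "!!x. x \<notin> Z ==> x \<in> \<Omega> --> good x" by (rule AE_lebesgue_Borel_null) blast
 have Zs: "Z \<in> sets borel" using Z(1) by (auto simp: null_sets_def)
 define A where "A = \<Omega> - Z"
 have A: "A \<in> sets borel" "!!x. x \<in> A ==> good x" using \<Omega> Zs Z(2) by (auto simp: A_def)
 define M' where "M' = max M C"
 define b' where "b' x y = (if x \<in> A then b x y else C)" for x y
 have b': "continuous_on UNIV (b' x)" "C <= b' x y" "b' x y <= M'" "int_vec k ==> b' x (y + k) = b' x y" for x y k
 proof -
  have "continuous_on UNIV (b' x) & C <= b' x y & b' x y <= M' & (int_vec k --> b' x (y + k) = b' x y)"
  proof (cases "x \<in> A")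
   case True
   from A(2)[OF True] have "continuous_on UNIV (b x)" "\<bar>b x y\<bar> <= M" "C <= b x y" "int_vec k --> b x (y + k) = b x y" unfolding good_def by blast+
   moreover have "b' x = b x" using True by (auto simp: b'_def)
   ultimately show ?thesis by (auto simp: M'_def)
  next
   case False
   then have "b' x = (%_. C)" by (auto simp: b'_def)
   then show ?thesis by (simp add: M'_def)
  qed
  then show "continuous_on UNIV (b' x)" "C <= b' x y" "b' x y <= M'" "int_vec k ==> b' x (y + k) = b' x y" by blast+
 qed
 have b'm: "(%x. b' x y) \<in> borelm" for y
 proof -
  obtain s where s: "!!n::nat. s n \<in> S0" "s ~~> y" by (rule dense_sequence_limit[where y = y, OF S0(2)]) blast
  show ?thesis
  proof (rule borel_measurable_LIMSEQ_real)
   fix n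
   have "(%x. b' x (s n)) = (%x. if x \<in> A then g (s n) x else C)" using A(2) s(1) by (auto simp: b'_def good_def)
   moreover have "(%x. if x \<in> A then g (s n) x else C) \<in> borelm" using g(1)[of "s n"] A(1) by (intro measurable_If_set) auto
   ultimately show "(%x. b' x (s n)) \<in> borelm" by simp
  next
   fix x
   show "(%n. b' x (s n)) ~~> b' x y" by (rule continuous_on_tendsto_compose[OF b'(1) s(2)]) auto
  qed
 qed
 have "oscillating (%x y. 1 / b' x y) (1 / M') (1 / C)"
 proof
  have M': "M' > 0" using C(1) by (simp add: M'_def)
  then show "0 < 1 / M'" by simp
  fix x y k :: "real^'n"
  have p: "0 < b' x y" for x y using b'(2)[of x y] C(1) by linarith
  show "(%x. 1 / b' x y) \<in> borelm" using b'm[of y] by measurable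
  show "continuous_on UNIV (%y. 1 / b' x y)" using p[of x] by (intro continuous_intros b'(1)) (auto simp: less_imp_neq[THEN not_sym])
  show "1 / M' <= 1 / b' x y" "1 / b' x y <= 1 / C" using b'(2,3)[of x y] p C(1) M' by (auto intro!: divide_left_mono)
  show "1 / b' x (y + k) = 1 / b' x y" if "int_vec k" using b'(4)[OF that] by simp
 qed
 moreover have "AE x in lborel. x \<in> \<Omega> --> (\<forall>y. 0 < b x y & 1 / b' x y = 1 / b x y)" using AE_not_in[OF Z(1)]
 proof eventually_elim
  case (elim x)
  show ?case
  proof (intro impI allI)
   fix y assume "x \<in> \<Omega>"
   then have "x \<in> A" using elim by (simp add: A_def)
   moreover have "C <= b x y" using A(2)[OF \<open>x \<in> A\<close>] unfolding good_def by blast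
   ultimately show "0 < b x y & 1 / b' x y = 1 / b x y" using C(1) by (simp add: b'_def)
  qed
 qed
 ultimately show thesis by (rule that)
qed

lemma (in oscillating) MY_inv_eq_mean:
 assumes "!!y. bt x y = 1 / b x y" shows "MY_inv b x = mean x"
proof -
 have m: "(%y. ind Ycell y * bt x y) \<in> borelm" using borel_measurable_times[OF borel_measurable_indicator[OF measure_Ycell(2)] bt_x_borel] by simp
 have "MY_inv b x = (LBINT y. ind Ycell y * bt x y)" unfolding MY_inv_def by (rule set_integral_borel(1)[OF measure_Ycell(2) m]) (simp_all add: assms)
 then show ?thesis by (simp add: mean_def)
qed

subsection \<open>Passing to the limit\<close>

lemma sq_Pair:
 assumes f: "sq f" and g: "sq g" shows "sq (%x. (f x, g x))" "N2 (%x. (f x, g x)) = N2 f + N2 g"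
proof -
 have e: "(norm (f x, g x))^2 = (norm (f x))^2 + (norm (g x))^2" for x by (simp add: norm_Pair)
 have m: "(%x. (f x, g x)) \<in> borelm" using sq_measurable[OF f] sq_measurable[OF g] by measurable
 show "sq (%x. (f x, g x))" unfolding sq_def e using m sq_integrable[OF f] sq_integrable[OF g] by simp
 show "N2 (%x. (f x, g x)) = N2 f + N2 g" unfolding N2_def e using sq_integrable[OF f] sq_integrable[OF g] by simp
qed

lemma sq_fst_snd:
 assumes "sq f" shows "sq (%x. fst (f x))" "sq (%x. snd (f x))"
proof -
 have m: "f \<in> borelm" by (rule sq_measurable[OF assms])
 show "sq (%x. fst (f x))" by (rule sq_bound[OF assms borel_measurable_continuous_on[OF continuous_on_fst[OF continuous_on_id] m]]) (rule AE_I2, metis norm_fst_le prod.collapse)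
 show "sq (%x. snd (f x))" by (rule sq_bound[OF assms borel_measurable_continuous_on[OF continuous_on_snd[OF continuous_on_id] m]]) (rule AE_I2, metis norm_snd_le prod.collapse)
qed

text \<open>A linear functional takes the same convex combinations of its values, and those keep
  their limit because the weights move into the tail.\<close>

lemma Mazur_limit:
 fixes a :: "nat => 'a::euclidean_space => 'b::euclidean_space"
 assumes c: "!!k. convex_weights k (c k) (m k)" and a: "!!n. sq (a n)" "sq a0" and p: "sq p"
  and lim: "(%k. N2 (%z. (\<Sum>i<m k. c k i *\<^sub>R a i z) - a0 z)) ~~> 0"
  and l: "(%n. \<integral>z. a n z \<bullet> p z \<partial>lborel) ~~> l"
 shows "(LBINT z. a0 z \<bullet> p z) = l"
proof (rule LIMSEQ_unique)
 have s: "sq (%z. \<Sum>i<m k. c k i *\<^sub>R a i z)" for k by (intro sq_sum sq_scaleR a(1))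
 show "(%k. \<integral>z. (\<Sum>i<m k. c k i *\<^sub>R a i z) \<bullet> p z \<partial>lborel) ~~> (LBINT z. a0 z \<bullet> p z)" by (rule inner_integral_LIMSEQ[OF s a(2) p lim])
 have "(LBINT z. (\<Sum>i<m k. c k i *\<^sub>R a i z) \<bullet> p z) = (\<Sum>i<m k. c k i * (LBINT z. a i z \<bullet> p z))" for k using sq_integrable_inner[OF a(1) p] by (simp add: inner_sum_left)
 then show "(%k. \<integral>z. (\<Sum>i<m k. c k i *\<^sub>R a i z) \<bullet> p z \<partial>lborel) ~~> l" using convex_weights_LIMSEQ[OF l c] by simp
qed

context cylinder
begin

lemma test_fun_time_support:
 assumes "test_fun D \<phi>"
 obtains t0 where "0 < t0" "!!z. snd z < t0 ==> \<phi> z = 0"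
proof -
 obtain K where K: "compact K" "K \<subseteq> D" "!!z. z \<notin> K ==> \<phi> z = 0" using test_fun_support[OF assms] by blast
 show thesis
 proof (cases "K = {}")
  case True
  with K(3) show thesis by (intro that[of 1]) auto
 next
  case False
  have "compact (snd ` K)" by (rule compact_continuous_image[OF _ K(1)]) (intro continuous_intros)
  then obtain m where m: "m \<in> snd ` K" "!!y. y \<in> snd ` K ==> m <= y" using compact_attains_inf[of "snd ` K"] False by blast
  have "m > 0" using m(1) K(2) by auto
  moreover have "\<phi> z = 0" if "snd z < m" for z using m(2)[of "snd z"] K(3)[of z] that by force
  ultimately show thesis by (rule that)
 qed
qed

text \<open>Undoes the weight sqrt(t): pairing sqrt(t) w with \<phi>/sqrt(t) recovers the pairing of
  w with \<phi> when \<phi> vanishes before t0, and from t0 on the factor is bounded.\<close>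

definition root_late :: "real => real => real" where
 "root_late t0 t = (if t0 <= t then 1 / sqrt t else 0)"

lemma root_late: "root_late t0 \<in> borelm" "0 < t0 ==> \<bar>root_late t0 t\<bar> <= 1 / sqrt t0"
proof -
 show "root_late t0 \<in> borelm" unfolding root_late_def[abs_def] by measurable
 show "\<bar>root_late t0 t\<bar> <= 1 / sqrt t0" if "0 < t0" using that by (auto simp: root_late_def intro!: divide_left_mono)
qed

lemma sq_root_late:
 assumes "sq (v :: (real^'n) \<times> real => real)" "0 < t0" shows "sq (%z. root_late t0 (snd z) * v z)" by (rule sq_mult_bounded[OF assms(1) measurable_compose[OF snd_borel root_late(1)] root_late(2)[OF assms(2)]])

text \<open>Mazur's lemma is applied to the triples of solution, gradient and \<open>\<surd>t \<partial>\<^sub>t(\<beta>v)\<close>, so that one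
 strongly convergent sequence of convex combinations carries all linear relations to the limit.\<close>

lemma limit_solution:
 assumes S: "!!n::nat. is_sol (\<beta> n) f ub (v n) (G n) (w n) (P n)" and \<beta>: "!!n. coef (\<beta> n) c C" and m: "coef m c C"
  and f: "sq f" and ub: "sq ub"
  and osc: "!!p. sq p ==> (%n. \<integral>z. (\<beta> n (fst z) - m (fst z)) * (p z * v n z) \<partial>lborel) ~~> 0"
 obtains v0 G0 \<omega> P0 where "H1 v0 G0" "wloc \<omega>" "sq P0" "time_rep (%z. m (fst z) * v0 z) \<omega> P0"
  "!!\<phi> G\<phi> t0. H1 \<phi> G\<phi> ==> 0 < t0 ==> \<forall>z. snd z < t0 --> \<phi> z = 0 ==>
    (LBINT z. \<omega> z * \<phi> z) + (LBINT z. G0 z \<bullet> G\<phi> z) = (LBINT z. f z * \<phi> z)"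
  "!!\<Phi> G\<Phi>. H1 \<Phi> G\<Phi> ==> (LBINT z. m (fst z) * v0 z * \<Phi> z) + (LBINT z. G0 z \<bullet> tint G\<Phi> z) =
    (LBINT z. f z * tint \<Phi> z) + (LBINT x. ub x * tI \<Phi> x)"
proof -
 have H: "H1 (v n) (G n)" and wl: "wloc (w n)" and sP: "sq (P n)" and rep: "time_rep (%z. \<beta> n (fst z) * v n z) (w n) (P n)"
  and eq: "H1 \<phi> G\<phi> ==> 0 < t0 ==> \<forall>z. snd z < t0 --> \<phi> z = 0 ==>
    (LBINT z. w n z * \<phi> z) + (LBINT z. G n z \<bullet> G\<phi> z) = (LBINT z. f z * \<phi> z)" for n \<phi> G\<phi> t0 using S[of n] unfolding is_sol_def by blast+
 have sv: "sq (v n)" "sq (G n)" for n by (rule H1_sq[OF H])+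
 define s where "s n z = sqrt (snd z) * w n z" for n and z :: "(real^'n) \<times> real"
 have ss: "sq (s n)" for n unfolding s_def[abs_def] by (rule estimate_time(1)[OF S \<beta> f])
 define x where "x n z = (v n z, G n z, s n z)" for n z
 have sx: "sq (x n)" for n unfolding x_def[abs_def] by (intro sq_Pair sv ss)
 define K where "K = (T * sqrt (N2 f) + sqrt T * sqrt (N2 ub)) / c"
 define K' where "K' = sqrt (N2 f) * K + N2 ub / (2 * c)"
 have bv: "sqrt (N2 (v n)) <= K" for n unfolding K_def by (rule estimate_v[OF S \<beta> f ub])
 have bG: "N2 (G n) <= K'" for n using estimate_gradient[OF S \<beta> f ub, of n] mult_left_mono[OF bv[of n], of "sqrt (N2 f)"] unfolding K'_def by simp
 have bs: "N2 (s n) <= C * (K' + T / c * N2 f)" for n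
 proof -
  have "C * (N2 (G n) + T / c * N2 f) <= C * (K' + T / c * N2 f)" using bG[of n] coefD(7)[OF m] by (intro mult_left_mono add_right_mono) auto
  then show ?thesis using estimate_time(2)[OF S \<beta> f, of n] unfolding s_def[abs_def] by linarith
 qed
 have bx: "N2 (x n) <= K^2 + (K' + C * (K' + T / c * N2 f))" for n
 proof -
  have "N2 (v n) <= K^2" using power_mono[OF bv[of n], of 2] by simp
  moreover have "N2 (x n) = N2 (v n) + (N2 (G n) + N2 (s n))" unfolding x_def[abs_def] by (simp add: sq_Pair(2) sq_Pair(1) sv ss)
  ultimately show ?thesis using bG[of n] bs[of n] by linarith
 qed
 obtain cw mk y where M: "!!k. convex_weights k (cw k) (mk k)" "sq y"
  "(%k. N2 (%z. (\<Sum>i<mk k. cw k i *\<^sub>R x i z) - y z)) ~~> 0" by (rule Mazur[OF sx bx]) (rule that; assumption)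
 have xo: "x n z = 0" if "z \<notin> D" for n z using H1_outside[OF H that, of n] offD[OF _ that, of "w n"] wl[of n] by (simp add: x_def s_def wloc_def zero_prod_def)
 \<comment> \<open>All combinations vanish off the cylinder, so cutting the limit to zero there does
   not increase the error.\<close>
 define y0 where "y0 z = ind D z *\<^sub>R y z" for z
 have sy: "sq y0" unfolding y0_def[abs_def] by (rule sq_indicator_scale[OF M(2) D_borel])
 have lim: "(%k. N2 (%z. (\<Sum>i<mk k. cw k i *\<^sub>R x i z) - y0 z)) ~~> 0"
 proof (rule tendsto_sandwich[OF _ _ tendsto_const M(3)])
  show "\<forall>\<^sub>F k in sequentially. N2 (%z. (\<Sum>i<mk k. cw k i *\<^sub>R x i z) - y0 z) <= N2 (%z. (\<Sum>i<mk k. cw k i *\<^sub>R x i z) - y z)"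
  proof (intro always_eventually allI)
   fix k
   have sS: "sq (%z. \<Sum>i<mk k. cw k i *\<^sub>R x i z)" by (intro sq_sum sq_scaleR sx)
   show "N2 (%z. (\<Sum>i<mk k. cw k i *\<^sub>R x i z) - y0 z) <= N2 (%z. (\<Sum>i<mk k. cw k i *\<^sub>R x i z) - y z)"
   proof (rule N2_mono[OF sq_diff[OF sS M(2)] sq_measurable[OF sq_diff[OF sS sy]]], rule AE_I2)
    fix z show "norm ((\<Sum>i<mk k. cw k i *\<^sub>R x i z) - y0 z) <= norm ((\<Sum>i<mk k. cw k i *\<^sub>R x i z) - y z)" by (cases "z \<in> D") (simp_all add: y0_def xo)
   qed
  qed
 qed simp
 define v0 where "v0 z = fst (y0 z)" for z
 define G0 where "G0 z = fst (snd (y0 z))" for z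
 define s0 where "s0 z = snd (snd (y0 z))" for z
 have sv0: "sq v0" "sq G0" "sq s0" unfolding v0_def[abs_def] G0_def[abs_def] s0_def[abs_def] by (intro sq_fst_snd sy)+
 have ov0: "off v0" "off G0" "off s0" by (auto simp: off_def v0_def G0_def s0_def y0_def)
 \<comment> \<open>Every linear expression in v, its gradient and the weighted time derivative that
   converges along the sequence has the same limit at the limiting triple.\<close>
 have key: "(LBINT z. v0 z * p z) + ((LBINT z. G0 z \<bullet> q z) + (LBINT z. s0 z * r z)) = l"
  if p: "sq p" and q: "sq q" and r: "sq r"
   and l: "(%n. (LBINT z. v n z * p z) + ((LBINT z. G n z \<bullet> q z) + (LBINT z. s n z * r z))) ~~> l" for p q r l
 proof -
  have split: "(LBINT z. (a z, b z, d z) \<bullet> (p z, q z, r z)) = (LBINT z. a z * p z) + ((LBINT z. b z \<bullet> q z) + (LBINT z. d z * r z))"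
   if "sq a" "sq b" "sq d" for a d :: "(real^'n) \<times> real => real" and b :: "(real^'n) \<times> real => real^'n" using sq_integrable_mult[OF that(1) p] sq_integrable_inner[OF that(2) q] sq_integrable_mult[OF that(3) r] by simp
  have "(LBINT z. y0 z \<bullet> (p z, q z, r z)) = l"
  proof (rule Mazur_limit[OF M(1) sx sy _ lim])
   show "sq (%z. (p z, q z, r z))" by (intro sq_Pair p q r)
   show "(%n. \<integral>z. x n z \<bullet> (p z, q z, r z) \<partial>lborel) ~~> l" unfolding x_def split[OF sv ss] by (rule l)
  qed
  moreover have "y0 z = (v0 z, G0 z, s0 z)" for z by (simp add: v0_def G0_def s0_def)
  ultimately show ?thesis using split[OF sv0] by simp
 qed
 \<comment> \<open>Off the cylinder \<open>s0\<close> is zero, so division by the root of a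
   nonpositive time does no harm.\<close>
 define \<omega> where "\<omega> z = s0 z / sqrt (snd z)" for z
 have \<omega>m: "\<omega> \<in> borelm" unfolding \<omega>_def[abs_def] using sq_measurable[OF sv0(3)] snd_borel by measurable
 have w\<omega>: "wloc \<omega>" unfolding wloc_def
 proof (intro conjI allI impI)
  show "off \<omega>" using ov0(3) by (auto simp: off_def \<omega>_def)
  fix t0 :: real assume t0: "0 < t0"
  have "late t0 \<omega> = late t0 (%z. root_late t0 (snd z) * s0 z)" by (auto simp: late_def \<omega>_def root_late_def fun_eq_iff indicator_def)
  moreover have "sq (late t0 (%z. root_late t0 (snd z) * s0 z))" by (rule sq_late[OF sq_root_late[OF sv0(3) t0]])
  ultimately show "sq (late t0 \<omega>)" by simp
 qed (rule \<omega>m)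
 have root: "s n z * (root_late t0 (snd z) * \<phi> z) = w n z * \<phi> z" "s0 z * (root_late t0 (snd z) * \<phi> z) = \<omega> z * \<phi> z"
  if "0 < t0" "\<forall>z. snd z < t0 --> \<phi> z = 0" for n z t0 \<phi> using that(1) spec[OF that(2), of z] by (cases "snd z < t0"; simp add: s_def \<omega>_def root_late_def)+
 have H0: "H1 v0 G0"
 proof (rule H1I[OF sv0(1,2) ov0(1,2)])
  fix \<phi> i assume t: "test_fun D \<phi>"
  have sp: "sq \<phi>" "sq (dx i \<phi>)" using test_fun_sq[OF t] test_fun_sq[OF test_fun_deriv[OF t]] by (auto simp: dx_def[abs_def])
  have sa: "sq (%z. \<phi> z *\<^sub>R axis i (1::real) :: real^'n)" by (rule sq_bound[OF sp(1)]) (use sq_measurable[OF sp(1)] in auto)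
  have "(LBINT z. v n z * dx i \<phi> z) = - (LBINT z. (G n z $ i) * \<phi> z)" for n using H[of n] t unfolding H1_def by blast
  then have "(LBINT z. v0 z * dx i \<phi> z) + ((LBINT z. G0 z \<bullet> (\<phi> z *\<^sub>R axis i 1)) + (LBINT z. s0 z * 0)) = 0" by (intro key[OF sp(2) sa]) (simp_all add: inner_axis mult.commute)
  then show "(LBINT z. v0 z * dx i \<phi> z) = - (LBINT z. (G0 z $ i) * \<phi> z)" by (simp add: inner_axis mult.commute)
 qed
 have eq0: "(LBINT z. \<omega> z * \<phi> z) + (LBINT z. G0 z \<bullet> G\<phi> z) = (LBINT z. f z * \<phi> z)"
  if H\<phi>: "H1 \<phi> G\<phi>" and t0: "0 < t0" "\<forall>z. snd z < t0 --> \<phi> z = 0" for \<phi> G\<phi> t0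
 proof -
  have "(LBINT z. v0 z * 0) + ((LBINT z. G0 z \<bullet> G\<phi> z) + (LBINT z. s0 z * (root_late t0 (snd z) * \<phi> z))) = (LBINT z. f z * \<phi> z)" by (rule key[OF sq_zero H1_sq(2)[OF H\<phi>] sq_root_late[OF H1_sq(1)[OF H\<phi>] t0(1)]])
    (simp add: root(1)[OF t0] eq[OF H\<phi> t0] add.commute)
  then show ?thesis by (simp add: root(2)[OF t0])
 qed
 \<comment> \<open>Relations that involve \<beta> v are not of the form treated in
   \<open>key\<close>, since \<beta> moves with n; exchanging \<beta> for m costs a term that
   vanishes by \<open>osc\<close>.\<close>
 have m_split: "(LBINT z. v n z * (m (fst z) * p z)) = (LBINT z. \<beta> n (fst z) * v n z * p z) - (LBINT z. (\<beta> n (fst z) - m (fst z)) * (p z * v n z))"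
  if p: "sq p" for n p
 proof -
  have i: "integrable lborel (%z. \<beta> n (fst z) * v n z * p z)" "integrable lborel (%z. m (fst z) * v n z * p z)" using sq_integrable_mult[OF sq_fst_mult[OF sv(1) coefD(2,5)[OF \<beta>]] p]
    sq_integrable_mult[OF sq_fst_mult[OF sv(1) coefD(2,5)[OF m]] p] by blast+
  have "(LBINT z. (\<beta> n (fst z) - m (fst z)) * (p z * v n z)) = (LBINT z. \<beta> n (fst z) * v n z * p z - m (fst z) * v n z * p z)" by (simp add: algebra_simps)
  also have "... = (LBINT z. \<beta> n (fst z) * v n z * p z) - (LBINT z. m (fst z) * v n z * p z)" by (rule integral_diff[OF i])
  also have "(LBINT z. m (fst z) * v n z * p z) = (LBINT z. v n z * (m (fst z) * p z))" by (simp add: mult_ac)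
  finally show ?thesis by simp
 qed
 have sm: "sq (%z. m (fst z) * p z)" if "sq p" for p :: "(real^'n) \<times> real => real" by (rule sq_fst_mult[OF that coefD(2,5)[OF m]])
 have wd0: "wder D (0, 1) (%z. m (fst z) * v0 z) \<omega>" unfolding wder_def
 proof (intro allI impI)
  fix \<phi> assume t: "test_fun D \<phi>"
  let ?d = "%z. frechet_derivative \<phi> (at z) (0, 1)"
  obtain t0 where t0: "0 < t0" "\<forall>z. snd z < t0 --> \<phi> z = 0" using test_fun_time_support[OF t] by metis
  have sp: "sq \<phi>" "sq ?d" using test_fun_sq[OF t] test_fun_sq[OF test_fun_deriv[OF t]] by auto
  have e: "(LBINT z. \<beta> n (fst z) * v n z * ?d z) = - (LBINT z. w n z * \<phi> z)" for n using time_rep_wder[OF wl[of n] sP[of n] rep[of n] sq_measurable[OF sq_fst_mult[OF sv(1)[of n] coefD(2,5)[OF \<beta>[of n]]]]] t unfolding wder_def by blast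
  have "(LBINT z. v0 z * (m (fst z) * ?d z)) + ((LBINT z. G0 z \<bullet> 0) + (LBINT z. s0 z * (root_late t0 (snd z) * \<phi> z))) = 0" by (rule key[OF sm[OF sp(2)] sq_zero sq_root_late[OF sp(1) t0(1)]])
    (use tendsto_minus[OF osc[OF sp(2)]] in \<open>simp add: root(1)[OF t0] m_split[OF sp(2)] e\<close>)
  then have "(LBINT z. v0 z * (m (fst z) * ?d z)) = - (LBINT z. \<omega> z * \<phi> z)" unfolding root(2)[OF t0] by simp
  then show "(LBINT z. m (fst z) * v0 z * ?d z) = - (LBINT z. \<omega> z * \<phi> z)" by (simp add: mult.assoc mult.left_commute)
 qed
 have om: "off (%z. m (fst z) * v0 z)" using ov0(1) by (auto simp: off_def)
 obtain P0 where P0: "sq P0" "time_rep (%z. m (fst z) * v0 z) \<omega> P0" by (rule time_rep_exists[OF sm[OF sv0(1)] om w\<omega> wd0])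
 have duh: "(LBINT z. m (fst z) * v0 z * \<Phi> z) + (LBINT z. G0 z \<bullet> tint G\<Phi> z) = (LBINT z. f z * tint \<Phi> z) + (LBINT x. ub x * tI \<Phi> x)"
  if H\<Phi>: "H1 \<Phi> G\<Phi>" for \<Phi> G\<Phi>
 proof -
  let ?l = "(LBINT z. f z * tint \<Phi> z) + (LBINT x. ub x * tI \<Phi> x)"
  note s\<Phi> = H1_sq(1)[OF H\<Phi>]
  have "(LBINT z. v n z * (m (fst z) * \<Phi> z)) + ((LBINT z. G n z \<bullet> tint G\<Phi> z) + (LBINT z. s n z * 0))
    = ?l - (LBINT z. (\<beta> n (fst z) - m (fst z)) * (\<Phi> z * v n z))" for n using weak_duhamel[OF S \<beta> f ub H\<Phi>, of n] m_split[OF s\<Phi>, of n] by simp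
  moreover have "(%n. ?l - (LBINT z. (\<beta> n (fst z) - m (fst z)) * (\<Phi> z * v n z))) ~~> ?l - 0" by (intro tendsto_diff tendsto_const osc[OF s\<Phi>])
  ultimately have "(LBINT z. v0 z * (m (fst z) * \<Phi> z)) + ((LBINT z. G0 z \<bullet> tint G\<Phi> z) + (LBINT z. s0 z * 0)) = ?l" by (intro key[OF sm[OF s\<Phi>] H1_sq(2)[OF H1_tint[OF H\<Phi>]] sq_zero]) simp
  then show ?thesis by (simp add: mult_ac)
 qed
 show thesis by (rule that[OF H0 w\<omega> P0 eq0 duh])
qed

end

subsection \<open>The initial value of the limit\<close>

text \<open>Integrating translates of the derivative along a unit segment gives \<phi> minus a
  translate of \<phi>, whose integral is 0, while all translates have the same integral. The
  indicator of a large ball serves as a square integrable substitute for the constant 1.\<close>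

lemma integral_frechet_derivative_zero:
 assumes t: "test_fun U \<phi>" shows "(LBINT z. frechet_derivative \<phi> (at z) d) = 0"
proof -
 let ?D = "%z. frechet_derivative \<phi> (at z) d"
 obtain K where K: "compact K" "!!z. z \<notin> K ==> \<phi> z = 0" "!!z. z \<notin> K ==> ?D z = 0" using t by (elim test_funE) metis
 obtain R where R: "!!z. z \<in> K ==> norm z <= R" using compact_imp_bounded[OF K(1)] unfolding bounded_iff by blast
 have sD: "sq ?D" by (rule test_fun_sq[OF test_fun_deriv[OF t]])
 have s\<phi>: "sq \<phi>" by (rule test_fun_sq[OF t])
 have [measurable]: "?D \<in> borelm" "\<phi> \<in> borelm" using sD s\<phi> by (auto simp: sq_measurable)
 interpret K: param_avg "%z r. ?D (z - r *\<^sub>R d)" "{0..1}" 1 "N2 ?D"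
 proof
  show "(%(z, r). ?D (z - r *\<^sub>R d)) \<in> borel_measurable (borel \<Otimes>\<^sub>M borel)" by measurable
  show "sq (%z. ?D (z - r *\<^sub>R d))" for r using sq_shift[OF sD, of "- (r *\<^sub>R d)"] by simp
  show "N2 (%z. ?D (z - r *\<^sub>R d)) <= N2 ?D" for r using N2_shift[OF sD, of "- (r *\<^sub>R d)"] by simp
 qed auto
 let ?g = "ind (cball 0 (R + norm d))"
 have sg: "sq ?g" by (rule sq_indicator[OF _ emeasure_bounded[OF bounded_cball]]) simp
 have inK: "norm z <= R + norm d" if "z - r *\<^sub>R d \<in> K" "r \<in> {0..1}" for z r
 proof -
  have "norm z <= norm (z - r *\<^sub>R d) + norm (r *\<^sub>R d)" by (metis diff_add_cancel norm_triangle_ineq)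
  moreover have "norm (r *\<^sub>R d) <= norm d" using that(2) by (simp add: mult_left_le_one_le)
  ultimately show ?thesis using R[OF that(1)] by linarith
 qed
 have "(LBINT z. K.avg z \<bullet> ?g z) = (LBINT r. indicator {0..1} r * (LBINT z. ?D (z - r *\<^sub>R d) \<bullet> ?g z))" by (rule K.inner_avg[OF sg])
 also have "... = (LBINT r. indicator {0..1::real} r * (LBINT z. ?D z))"
 proof (rule integral_cong[OF refl])
  fix r :: real
  show "indicator {0..1} r * (LBINT z. ?D (z - r *\<^sub>R d) \<bullet> ?g z) = indicator {0..1} r * (LBINT z. ?D z)"
  proof (cases "r \<in> {0..1}")
   case True
   have "?D (z - r *\<^sub>R d) \<bullet> ?g z = ?D (z + - (r *\<^sub>R d))" for z using inK[of z r] True K(3)[of "z - r *\<^sub>R d"] by (cases "z - r *\<^sub>R d \<in> K") (auto simp: indicator_def)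
   then have "(LBINT z. ?D (z - r *\<^sub>R d) \<bullet> ?g z) = (LBINT z. ?D (z + - (r *\<^sub>R d)))" by (intro integral_cong refl)
   then show ?thesis by (simp only: integral_shift[of ?D "- (r *\<^sub>R d)"] \<open>?D \<in> borelm\<close>)
  qed simp
 qed
 also have "... = (LBINT z. ?D z)" by simp
 finally have 1: "(LBINT z. ?D z) = (LBINT z. K.avg z \<bullet> ?g z)" by simp
 have "K.avg z \<bullet> ?g z = \<phi> z - \<phi> (z + - d)" for z
 proof -
  have "K.avg z = \<phi> z - \<phi> (z + - d)" unfolding K.avg_def using smooth_fun_line_integral[OF test_fun_smooth[OF t], of 1 z d] by simp
  moreover have "\<phi> z = 0 & \<phi> (z + - d) = 0" if "\<not> norm z <= R + norm d" using inK[of z 0] inK[of z 1] K(2)[of z] K(2)[of "z - d"] that by auto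
  ultimately show ?thesis by (cases "norm z <= R + norm d") (simp_all add: indicator_def)
 qed
 then have "(LBINT z. K.avg z \<bullet> ?g z) = (LBINT z. \<phi> z - \<phi> (z + - d))" by (intro integral_cong refl)
 also have "... = 0"
 proof -
  have g1: "\<phi> z = \<phi> z * ?g z" for z using R[of z] K(2)[of z] by (cases "z \<in> K") (auto simp: indicator_def intro: add_increasing2)
  have "integrable lborel (%z. \<phi> z * ?g z)" by (rule sq_integrable_mult[OF s\<phi> sg])
  then have i: "integrable lborel \<phi>" unfolding g1[symmetric] .
  show ?thesis using integral_diff[OF i integrable_shift[OF i, of "- d"]] integral_shift[of \<phi> "- d"] by simp
 qed
 finally show ?thesis using 1 by simp
qed

lemma sq_vec:
 fixes g :: "'a::euclidean_space => real^'n::finite"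
 assumes "!!i. sq (%z. g z $ i)" shows "sq g"
proof -
 have "g z = (\<Sum>i\<in>UNIV. (g z $ i) *\<^sub>R axis i 1)" for z by (simp add: vec_eq_iff axis_def if_distrib sum.delta cong: if_cong)
 then have e: "g = (%z. \<Sum>i\<in>UNIV. (g z $ i) *\<^sub>R axis i 1)" by (rule ext)
 have "sq (%z. (g z $ i) *\<^sub>R axis i (1::real) :: real^'n)" for i by (rule sq_bound[OF assms[of i]]) (use sq_measurable[OF assms[of i]] in auto)
 then show ?thesis by (subst e) (rule sq_sum)
qed

context cylinder
begin

text \<open>Constant in time on the cylinder, so that a smooth function of x can be subtracted from
  a solution.\<close>

definition ext :: "(real^'n => real) => (real^'n) \<times> real => real" where
 "ext \<psi> z = ind D z * \<psi> (fst z)"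

definition grad_ext :: "(real^'n => real) => (real^'n) \<times> real => real^'n" where
 "grad_ext \<psi> z = ind D z *\<^sub>R (\<chi> i. frechet_derivative \<psi> (at (fst z)) (axis i 1))"

text \<open>The derivative of the product of \<psi> with a test function has integral 0; the product
  rule turns this into the weak gradient identity.\<close>

lemma H1_ext:
 assumes t: "test_fun \<Omega> \<psi>" shows "H1 (ext \<psi>) (grad_ext \<psi>)"
proof (rule H1I)
 have sI: "sq (ind {0<..<T})" by (rule sq_indicator) (simp_all add: emeasure_lborel_Ioo less_imp_le[OF T_pos])
 have e: "ind D z * g (fst z) = g (fst z) * ind {0<..<T} (snd z)" if "!!x. x \<notin> \<Omega> ==> g x = 0" for g :: "real^'n => real" and z using that[of "fst z"] by (cases "fst z \<in> \<Omega>") (auto simp: indicator_def mem_Times_iff)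
 show "sq (ext \<psi>)"
 proof -
  have "ext \<psi> = (%z. \<psi> (fst z) * ind {0<..<T} (snd z))" unfolding ext_def[abs_def] by (rule HOL.ext, rule e, rule test_fun_outside[OF t])
  then show ?thesis using sq_prod(1)[OF test_fun_sq[OF t] sI] by simp
 qed
 show "sq (grad_ext \<psi>)"
 proof (rule sq_vec)
  fix i
  have "(%z. grad_ext \<psi> z $ i) = (%z. frechet_derivative \<psi> (at (fst z)) (axis i 1) * ind {0<..<T} (snd z))" using e[of "%x. frechet_derivative \<psi> (at x) (axis i 1)"] test_fun_deriv_outside[OF t] by (auto simp: grad_ext_def)
  then show "sq (%z. grad_ext \<psi> z $ i)" using sq_prod(1)[OF test_fun_sq[OF test_fun_deriv[OF t]] sI] by simp
 qed
 show "off (ext \<psi>)" "off (grad_ext \<psi>)" by (auto simp: off_def ext_def grad_ext_def)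
 fix \<phi> i assume \<phi>: "test_fun D \<phi>"
 let ?p = "%z::(real^'n) \<times> real. \<psi> (fst z)" and ?e = "(axis i 1, 0) :: (real^'n) \<times> real"
 have sm: "smooth_fun UNIV ?p" using smooth_fun_affine[OF bounded_linear_fst test_fun_smooth[OF t], of 0] by simp
 have d: "frechet_derivative ?p (at z) ?e = frechet_derivative \<psi> (at (fst z)) (axis i 1)" for z
 proof -
  have 1: "((%z::(real^'n)\<times>real. fst z) has_derivative fst) (at z)" by (rule bounded_linear_imp_has_derivative[OF bounded_linear_fst])
  have "(?p has_derivative (%w. frechet_derivative \<psi> (at (fst z)) (fst w))) (at z)" by (rule has_derivative_compose[OF 1 smooth_funD[OF test_fun_smooth[OF t]]])
  from frechet_derivative_at[OF this, symmetric] show ?thesis by simp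
 qed
 have sp: "sq (dx i \<phi>)" using test_fun_sq[OF test_fun_deriv[OF \<phi>]] by (simp add: dx_def[abs_def])
 have i1: "integrable lborel (%z. ext \<psi> z * dx i \<phi> z)" by (rule sq_integrable_mult[OF \<open>sq (ext \<psi>)\<close> sp])
 have i2: "integrable lborel (%z. (grad_ext \<psi> z $ i) * \<phi> z)" by (rule sq_integrable_mult[OF sq_component[OF \<open>sq (grad_ext \<psi>)\<close>] test_fun_sq[OF \<phi>]])
 have "0 = (LBINT z. frechet_derivative (%z. ?p z * \<phi> z) (at z) ?e)" by (rule integral_frechet_derivative_zero[OF test_fun_mult[OF \<phi> sm], symmetric])
 also have "... = (LBINT z. ext \<psi> z * dx i \<phi> z + (grad_ext \<psi> z $ i) * \<phi> z)"
 proof (rule integral_cong[OF refl])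
  fix z :: "(real^'n) \<times> real"
  have "frechet_derivative (%z. ?p z * \<phi> z) (at z) ?e = ?p z * dx i \<phi> z + frechet_derivative \<psi> (at (fst z)) (axis i 1) * \<phi> z" unfolding frechet_derivative_mult_smooth[OF test_fun_smooth[OF \<phi>] sm] d dx_def ..
  then show "frechet_derivative (%z. ?p z * \<phi> z) (at z) ?e = ext \<psi> z * dx i \<phi> z + (grad_ext \<psi> z $ i) * \<phi> z" using test_fun_outside[OF \<phi>, of z] test_fun_deriv_outside[OF \<phi>, of z ?e] by (cases "z \<in> D") (simp_all add: ext_def grad_ext_def dx_def)
 qed
 also have "... = (LBINT z. ext \<psi> z * dx i \<phi> z) + (LBINT z. (grad_ext \<psi> z $ i) * \<phi> z)" by (rule integral_add[OF i1 i2])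
 finally show "(LBINT z. ext \<psi> z * dx i \<phi> z) = - (LBINT z. (grad_ext \<psi> z $ i) * \<phi> z)" by simp
qed

section \<open>Estimates on short initial time spans\<close>

lemma early_small:
 fixes h :: "(real^'n) \<times> real => real"
 assumes h: "integrable lborel h" "off h" and A: "!!t. A t \<in> sets borel" "!!t. A t \<subseteq> {..t}"
 shows "((%t. \<integral>z. ind (A t) (snd z) * h z \<partial>lborel) \<longlongrightarrow> 0) (at_right 0)"
proof (rule tendsto_at_right_sequentially[OF T_pos])
 fix S :: "nat => real" assume S: "!!n. 0 < S n" "S ~~> 0"
 have hm: "h \<in> borelm" using h(1) by auto
 have "(%n. \<integral>z. ind (A (S n)) (snd z) * h z \<partial>lborel) ~~> (\<integral>z. 0 \<partial>(lborel :: ((real^'n) \<times> real) measure))"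
 proof (rule integral_dominated_convergence[where w = "%z. norm (h z)"])
  show "(%z. ind (A (S n)) (snd z) * h z) \<in> borel_measurable lborel" for n using borel_measurable_times[OF ind_snd_borel[OF A(1)] hm] by simp
  show "AE z in lborel. (%n. ind (A (S n)) (snd z) * h z) ~~> 0"
  proof (rule AE_I2)
   fix z show "(%n. ind (A (S n)) (snd z) * h z) ~~> 0"
   proof (cases "z \<in> D")
    case True
    then have "0 < snd z" by auto
    from order_tendstoD(2)[OF S(2) this] have "\<forall>\<^sub>F n in sequentially. ind (A (S n)) (snd z) * h z = 0"
     by eventually_elim (use A(2) in \<open>fastforce simp: indicator_def\<close>)
    then show ?thesis by (rule tendsto_eventually)
   qed (simp add: offD[OF h(2)])
  qed
  show "AE z in lborel. norm (ind (A (S n)) (snd z) * h z) <= norm (h z)" for n by (rule AE_I2) (simp add: indicator_def)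
 qed (use h(1) hm in simp_all)
 then show "(%n. \<integral>z. ind (A (S n)) (snd z) * h z \<partial>lborel) ~~> 0" by simp
qed

definition early :: "real => ((real^'n) \<times> real => 'b::real_normed_vector) => (real^'n) \<times> real => 'b" where
 "early t v z = ind {..<t} (snd z) *\<^sub>R v z"

lemma N2_early_small:
 fixes v :: "(real^'n) \<times> real => 'b::euclidean_space"
 assumes v: "sq v" "off v" shows "((%t. N2 (early t v)) \<longlongrightarrow> 0) (at_right 0)"
proof -
 have e: "N2 (early t v) = (LBINT z. ind {..<t} (snd z) * (norm (v z))^2)" for t unfolding N2_def by (rule integral_cong[OF refl]) (simp add: early_def indicator_def)
 show ?thesis unfolding e by (rule early_small[OF sq_integrable[OF v(1)] offI]) (auto simp: offD[OF v(2)] simp del: mem_Sigma_iff)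
qed

lemma H1_early:
 assumes "H1 v G" shows "H1 (early t v) (early t G)"
proof -
 have "H1 (%z. ind {..<t} (snd z) * v z) (%z. ind {..<t} (snd z) *\<^sub>R G z)" by (rule H1_cut[OF assms, where C = 1]) (auto simp: indicator_def)
 then show ?thesis by (simp add: early_def[abs_def])
qed

text \<open>Reinterpreting the cylinder with height t improves the factor T in the bound for
  backward integrals to t, the power that \<open>early_estimate\<close> needs.\<close>

lemma tint_early:
 fixes v :: "(real^'n) \<times> real => 'b::euclidean_space"
 assumes v: "sq v" "off v" and t: "0 < t" "t <= T"
 shows "t <= snd z ==> tint (early t v) z = 0" "sqrt (N2 (tint (early t v))) <= t * sqrt (N2 (early t v))"
proof -
 interpret E: cylinder \<Omega> t using \<Omega>_open \<Omega>_bounded t(1) by unfold_locales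
 show z: "tint (early t v) z = 0" if "t <= snd z" for z
 proof -
  have "(LBINT s. ind {snd z<..} s *\<^sub>R early t v (fst z, s)) = (\<integral>s. 0 \<partial>(lborel :: real measure))" by (rule integral_cong[OF refl]) (use that in \<open>simp add: early_def indicator_def\<close>)
  then show ?thesis by (simp add: tint_def)
 qed
 have e: "tint (early t v) = E.tint (early t v)"
 proof
  fix z show "tint (early t v) z = E.tint (early t v) z" using z[of z] t by (cases "t <= snd z") (simp_all add: tint_def E.tint_def indicator_def)
 qed
 have s: "sq (early t v)" unfolding early_def[abs_def] by (rule sq_scale_bounded(1)[OF v(1) ind_snd_borel, where C = 1]) (auto simp: indicator_def)
 have o: "E.off (early t v)" unfolding E.off_def using offD[OF v(2)] t by (auto simp: early_def indicator_def)
 have "N2 (tint (early t v)) <= t^2 * N2 (early t v)" unfolding e by (rule E.sq_tint(2)[OF s o])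
 then have "sqrt (N2 (tint (early t v))) <= sqrt (t^2 * N2 (early t v))" by (rule real_sqrt_le_mono)
 then show "sqrt (N2 (tint (early t v))) <= t * sqrt (N2 (early t v))" using t(1) by (simp add: real_sqrt_mult)
qed

text \<open>The Duhamel identity \<open>duh\<close> is tested with v - \<psi> restricted to times
  before t. Every term on the right carries a factor t, so the time average over (0, t) is
  controlled by the distance of \<psi> from the initial value of v plus terms that vanish with
  t.\<close>

lemma early_estimate:
 assumes H: "H1 v G" and m: "coef m c C" and f: "sq f" and ub: "sq ub" and \<psi>: "test_fun \<Omega> \<psi>" and t: "0 < t" "t <= T"
  and duh: "!!\<Phi> G\<Phi>. H1 \<Phi> G\<Phi> ==> (LBINT z. m (fst z) * v z * \<Phi> z) + (LBINT z. G z \<bullet> tint G\<Phi> z) =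
    (LBINT z. f z * tint \<Phi> z) + (LBINT x. ub x * tI \<Phi> x)"
 defines "\<Phi> \<equiv> early t (%z. v z - ext \<psi> z)" and "F \<equiv> early t (%z. G z - grad_ext \<psi> z)"
 shows "(LBINT z. m (fst z) * (\<Phi> z)^2) <= t * (C * N2 (%x. ub x / m x - \<psi> x) +
  2 * (sqrt (N2 f) * sqrt (N2 \<Phi>) + sqrt (N2 (grad_ext \<psi>)) * sqrt (N2 F)))"
proof -
 \<comment> \<open>The prospective initial value of v is ub/m, because \<open>ub\<close> is that of
   m v.\<close>
 define r where "r x = 1 / m x * ub x - \<psi> x" for x
 note HE = H1_ext[OF \<psi>] and Hz = H1_diff[OF H H1_ext[OF \<psi>]]
 note sz = H1_sq[OF Hz] H1_off[OF Hz]
 have H\<Phi>: "H1 \<Phi> F" unfolding \<Phi>_def F_def by (rule H1_early[OF Hz])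
 note s\<Phi> = H1_sq[OF H\<Phi>] H1_off[OF H\<Phi>]
 have sr: "sq r" unfolding r_def[abs_def] by (rule sq_diff[OF sq_mult_bounded[OF ub coefD(10,8)[OF m]] test_fun_sq[OF \<psi>]])
 define \<rho> where "\<rho> z = r (fst z) * ind {0<..<t} (snd z)" for z :: "(real^'n) \<times> real"
 have sI: "sq (ind {0<..<t})" by (rule sq_indicator) (simp_all add: emeasure_lborel_Ioo less_imp_le[OF t(1)])
 have "N2 (ind {0<..<t}) = t" using N2_indicator[of "{0<..<t}"] t by simp
 then have s\<rho>: "sq \<rho>" "N2 \<rho> = N2 r * t" unfolding \<rho>_def[abs_def] using sq_prod[OF sr sI] by simp_all
 have mb: "sq (%z. m (fst z) * p z)" if "sq p" for p :: "(real^'n) \<times> real => real" by (rule sq_fst_mult[OF that coefD(2,5)[OF m]])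
 define I where "I = (LBINT z. m (fst z) * (\<Phi> z)^2)"
 have iI: "integrable lborel (%z. m (fst z) * (p z)^2)" if "sq p" for p :: "(real^'n) \<times> real => real" using sq_integrable_mult[OF mb[OF that] that] by (simp add: power2_eq_square mult.assoc)
 have z0: "\<Phi> z = 0" if "z \<notin> D \<or> t <= snd z" for z using that offD[OF sz(3), of z] by (auto simp: \<Phi>_def early_def indicator_def)
 have A: "(LBINT z. m (fst z) * v z * \<Phi> z) = I + (LBINT x. m x * \<psi> x * tI \<Phi> x)"
 proof -
  have sm: "sq (%x. m x * \<psi> x)" by (rule sq_mult_bounded[OF test_fun_sq[OF \<psi>] coefD(2,5)[OF m]])
  note k = integral_fst_mult[OF sm s\<Phi>(1,3)]
  have "m (fst z) * v z * \<Phi> z = m (fst z) * (\<Phi> z)^2 + m (fst z) * \<psi> (fst z) * \<Phi> z" for z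
  proof (cases "z \<in> D & snd z < t")
   case True
   then have "v z = \<Phi> z + \<psi> (fst z)" by (simp add: \<Phi>_def early_def ext_def)
   then show ?thesis by (simp add: algebra_simps power2_eq_square)
  next
   case False
   then have "\<Phi> z = 0" using z0[of z] by force
   then show ?thesis by simp
  qed
  then have "(LBINT z. m (fst z) * v z * \<Phi> z) = (LBINT z. m (fst z) * (\<Phi> z)^2 + m (fst z) * \<psi> (fst z) * \<Phi> z)" by (intro integral_cong refl)
  also have "... = I + (LBINT z. m (fst z) * \<psi> (fst z) * \<Phi> z)" unfolding I_def by (rule integral_add[OF iI[OF s\<Phi>(1)] k(2)])
  finally show ?thesis by (simp add: k(1))
 qed
 have B: "(LBINT x. ub x * tI \<Phi> x) - (LBINT x. m x * \<psi> x * tI \<Phi> x) = (LBINT z. m (fst z) * \<rho> z * \<Phi> z)"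
 proof -
  have sm: "sq (%x. m x * r x)" by (rule sq_mult_bounded[OF sr coefD(2,5)[OF m]])
  have sm': "sq (%x. m x * \<psi> x)" by (rule sq_mult_bounded[OF test_fun_sq[OF \<psi>] coefD(2,5)[OF m]])
  have stI: "sq (tI \<Phi>)" by (rule sq_tI[OF s\<Phi>(1,3)])
  have "(LBINT x. ub x * tI \<Phi> x) - (LBINT x. m x * \<psi> x * tI \<Phi> x) = (LBINT x. ub x * tI \<Phi> x - m x * \<psi> x * tI \<Phi> x)" by (rule integral_diff[symmetric, OF sq_integrable_mult[OF ub stI] sq_integrable_mult[OF sm' stI]])
  also have "... = (LBINT x. m x * r x * tI \<Phi> x)"
  proof (rule integral_cong[OF refl])
   fix x show "ub x * tI \<Phi> x - m x * \<psi> x * tI \<Phi> x = m x * r x * tI \<Phi> x" using coefD(6)[OF m, of x] by (simp add: r_def algebra_simps)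
  qed
  also have "... = (LBINT z. m (fst z) * r (fst z) * \<Phi> z)" by (rule integral_fst_mult(1)[OF sm s\<Phi>(1,3), symmetric])
  also have "... = (LBINT z. m (fst z) * \<rho> z * \<Phi> z)"
  proof (rule integral_cong[OF refl])
   fix z show "m (fst z) * r (fst z) * \<Phi> z = m (fst z) * \<rho> z * \<Phi> z" using z0[of z] by (cases "z \<in> D & snd z < t") (auto simp: \<rho>_def)
  qed
  finally show ?thesis .
 qed
 \<comment> \<open>Young's inequality; the copy of \<open>I\<close> that it produces is absorbed by
   the left-hand side at the end.\<close>
 have "2 * (LBINT z. m (fst z) * \<rho> z * \<Phi> z) <= (LBINT z. m (fst z) * (\<rho> z)^2) + I"
 proof -
  have "(LBINT z. 2 * (m (fst z) * \<rho> z * \<Phi> z)) <= (LBINT z. m (fst z) * (\<rho> z)^2 + m (fst z) * (\<Phi> z)^2)"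
  proof (rule integral_mono)
   show "integrable lborel (%z. 2 * (m (fst z) * \<rho> z * \<Phi> z))" using sq_integrable_mult[OF mb[OF s\<rho>(1)] s\<Phi>(1)] by simp
   show "integrable lborel (%z. m (fst z) * (\<rho> z)^2 + m (fst z) * (\<Phi> z)^2)" by (rule integrable_add[OF iI[OF s\<rho>(1)] iI[OF s\<Phi>(1)]])
   fix z show "2 * (m (fst z) * \<rho> z * \<Phi> z) <= m (fst z) * (\<rho> z)^2 + m (fst z) * (\<Phi> z)^2" using mult_nonneg_nonneg[OF less_imp_le[OF coefD(6)[OF m, of "fst z"]] zero_le_power2[of "\<rho> z - \<Phi> z"]] by (simp add: power2_diff algebra_simps)
  qed
  then show ?thesis unfolding I_def by (simp add: integral_add[OF iI[OF s\<rho>(1)] iI[OF s\<Phi>(1)]])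
 qed
 moreover have "(LBINT z. m (fst z) * (\<rho> z)^2) <= C * (N2 r * t)"
 proof -
  have "(LBINT z. m (fst z) * (\<rho> z)^2) <= (LBINT z. C * (norm (\<rho> z))^2)"
  proof (rule integral_mono[OF iI[OF s\<rho>(1)] integrable_mult_right[OF sq_integrable[OF s\<rho>(1)]]])
   fix z show "m (fst z) * (\<rho> z)^2 <= C * (norm (\<rho> z))^2" using coefD(4)[OF m, of "fst z"] by (simp add: mult_right_mono)
  qed
  then show ?thesis unfolding integral_mult_right_zero N2_def[symmetric] s\<rho>(2) .
 qed
 moreover have "(LBINT z. f z * tint \<Phi> z) <= t * (sqrt (N2 f) * sqrt (N2 \<Phi>))"
 proof -
  have "(LBINT z. f z * tint \<Phi> z) <= sqrt (N2 f) * sqrt (N2 (tint \<Phi>))" using Cauchy_Schwarz_mult[OF f H1_sq(1)[OF H1_tint[OF H\<Phi>]]] by linarith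
  also have "... <= sqrt (N2 f) * (t * sqrt (N2 \<Phi>))" unfolding \<Phi>_def by (rule mult_left_mono[OF tint_early(2)[OF sz(1,3) t]]) simp
  finally show ?thesis by (simp add: mult_ac)
 qed
 moreover have "- (LBINT z. G z \<bullet> tint F z) <= t * (sqrt (N2 (grad_ext \<psi>)) * sqrt (N2 F))"
 proof -
  note sF = H1_sq(2)[OF H1_tint[OF H\<Phi>]] and sE = H1_sq(2)[OF HE]
  have "G z \<bullet> tint F z = F z \<bullet> tint F z + grad_ext \<psi> z \<bullet> tint F z" for z
  proof (cases "snd z < t")
   case True
   then have "G z = F z + grad_ext \<psi> z" by (simp add: F_def early_def)
   then show ?thesis by (simp add: inner_add_left)
  next
   case False
   then show ?thesis using tint_early(1)[OF sz(2,4) t, of z] unfolding F_def by simp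
  qed
  then have "(LBINT z. G z \<bullet> tint F z) = (LBINT z. F z \<bullet> tint F z) + (LBINT z. grad_ext \<psi> z \<bullet> tint F z)" using sq_integrable_inner[OF s\<Phi>(2) sF] sq_integrable_inner[OF sE sF] by simp
  moreover have "0 <= (LBINT z. F z \<bullet> tint F z)" by (rule tint_inner_nonneg[OF s\<Phi>(2,4)])
  moreover have "- (LBINT z. grad_ext \<psi> z \<bullet> tint F z) <= sqrt (N2 (grad_ext \<psi>)) * sqrt (N2 (tint F))" using Cauchy_Schwarz_inner[OF sE sF] by linarith
  moreover have "sqrt (N2 (grad_ext \<psi>)) * sqrt (N2 (tint F)) <= sqrt (N2 (grad_ext \<psi>)) * (t * sqrt (N2 F))" unfolding F_def by (rule mult_left_mono[OF tint_early(2)[OF sz(2,4) t]]) simp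
  ultimately show ?thesis by (simp add: mult_ac)
 qed
 moreover have "I + (LBINT z. G z \<bullet> tint F z) = (LBINT z. f z * tint \<Phi> z) + (LBINT z. m (fst z) * \<rho> z * \<Phi> z)" using duh[OF H\<Phi>] A B by linarith
 ultimately have "I <= C * (N2 r * t) + 2 * (t * (sqrt (N2 f) * sqrt (N2 \<Phi>))) + 2 * (t * (sqrt (N2 (grad_ext \<psi>)) * sqrt (N2 F)))"
  by linarith
 moreover have "r = (%x. ub x / m x - \<psi> x)" by (auto simp: r_def)
 ultimately show ?thesis unfolding I_def by (simp add: algebra_simps)
qed

text \<open>Fubini; it turns a bound on a time average into a bound at a single time once an energy
  inequality relates the times.\<close>

lemma time_slices_lower:
 fixes g :: "(real^'n) \<times> real => real"
 assumes g: "integrable lborel g" and t: "0 < t" and z: "!!x s. s \<notin> {0<..<t} ==> g (x, s) = 0"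
  and le: "AE s in lborel. s \<in> {0<..<t} --> e <= (LBINT x. g (x, s))"
 shows "t * e <= (LBINT z. g z)"
proof -
 have i: "integrable (lborel \<Otimes>\<^sub>M lborel) (case_prod (%x s. g (x, s)))" using g by (simp add: lborel_prod)
 have "t * e = (LBINT s. ind {0<..<t} s * e)" using t by simp
 also have "... <= (LBINT s. (LBINT x. g (x, s)))"
 proof (rule integral_mono_AE)
  show "integrable lborel (%s. ind {0<..<t} s * e)" using t by (intro integrable_mult_left) (simp add: emeasure_lborel_Ioo)
  show "integrable lborel (%s. \<integral>x. g (x, s) \<partial>lborel)" by (rule lborel_pair.integrable_snd[OF i])
  show "AE s in lborel. ind {0<..<t} s * e <= (LBINT x. g (x, s))" using le
  proof eventually_elim
   case (elim s)
   then show ?case using z[of s] by (cases "s \<in> {0<..<t}") simp_all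
  qed
 qed
 also have "... = (LBINT z. g z)" using lborel_pair.integral_snd[OF i] by (simp add: lborel_prod)
 finally show ?thesis .
qed

lemma time_rep_diff_ext:
 assumes rep: "time_rep (%z. m (fst z) * v z) w P"
 shows "time_rep (%z. m (fst z) * (v z - ext \<psi> z)) w (%x. P x - m x * \<psi> x)" using rep unfolding time_rep_def by eventually_elim (simp add: ext_def right_diff_distrib)

text \<open>Test with v - \<psi> between the times s and t. The weighted chain rule yields the
  difference of the energies at both times, and the remaining terms are collected in one integral
  over early times, which is small for small t.\<close>

lemma energy_step:
 assumes H: "H1 v G" and w: "wloc w" and P: "sq P" and rep: "time_rep (%z. m (fst z) * v z) w P" and m: "coef m c C"
  and f: "sq f" and \<psi>: "test_fun \<Omega> \<psi>" and st: "0 < s" "s < t"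
  and eq: "!!\<phi> G\<phi> t0. H1 \<phi> G\<phi> ==> 0 < t0 ==> \<forall>z. snd z < t0 --> \<phi> z = 0 ==>
    (LBINT z. w z * \<phi> z) + (LBINT z. G z \<bullet> G\<phi> z) = (LBINT z. f z * \<phi> z)"
 defines "W \<equiv> Ut w (%x. P x - m x * \<psi> x)"
 shows "(LBINT x. 1 / m x * (W t x)^2) <= (LBINT x. 1 / m x * (W s x)^2)
  + 2 * (LBINT z. ind {..t} (snd z) * \<bar>f z * (v z - ext \<psi> z) - G z \<bullet> (G z - grad_ext \<psi> z)\<bar>)"
proof -
 define P' where "P' x = P x - m x * \<psi> x" for x
 define zt where "zt z = v z - ext \<psi> z" for z
 define F where "F z = G z - grad_ext \<psi> z" for z
 have Hz: "H1 zt F" unfolding zt_def[abs_def] F_def[abs_def] by (rule H1_diff[OF H H1_ext[OF \<psi>]])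
 have sP: "sq P'" unfolding P'_def[abs_def] by (rule sq_diff[OF P sq_mult_bounded[OF test_fun_sq[OF \<psi>] coefD(2,5)[OF m]]])
 have rep': "time_rep (%z. m (fst z) * zt z) w P'" unfolding zt_def P'_def[abs_def] by (rule time_rep_diff_ext[OF rep])
 have W: "W = Ut w P'" unfolding W_def P'_def[abs_def] ..
 have i: "integrable lborel (%x. 1 / m x * (Y x)^2)" if "sq Y" for Y using sq_integrable_mult[OF sq_mult_bounded[OF that coefD(10,8)[OF m]] that] by (simp add: power2_eq_square)
 have chain: "(LBINT z. late t0 w z * zt z) = ((LBINT x. 1 / m x * (P' x)^2) - (LBINT x. 1 / m x * (W t0 x)^2)) / 2"
  if t0: "0 < t0" for t0
 proof -
  have "(LBINT z. late t0 w z * (1 / m (fst z) * (m (fst z) * zt z))) = (LBINT x. 1 / m x * ((P' x)^2 - (W t0 x)^2) / 2)" unfolding W by (rule weighted_chain_rule[OF w sP rep' t0 sq_measurable[OF sq_fst_mult[OF H1_sq(1)[OF Hz] coefD(2,5)[OF m]]] coefD(10,8)[OF m]])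
  also have "... = (LBINT x. (1 / m x * (P' x)^2 - 1 / m x * (W t0 x)^2) / 2)" by (simp add: right_diff_distrib diff_divide_distrib)
  also have "... = ((LBINT x. 1 / m x * (P' x)^2) - (LBINT x. 1 / m x * (W t0 x)^2)) / 2" unfolding W integral_divide_zero using integral_diff[OF i[OF sP] i[OF sq_Ut[OF w sP t0]]] by simp
  finally show ?thesis using coefD(6)[OF m] by (simp add: less_imp_neq[THEN not_sym])
 qed
 define \<phi> where "\<phi> z = ind {s<..t} (snd z) * zt z" for z
 define K where "K z = ind {s<..t} (snd z) *\<^sub>R F z" for z
 have H\<phi>: "H1 \<phi> K" unfolding \<phi>_def[abs_def] K_def[abs_def] by (rule H1_cut[OF Hz, where C = 1]) (auto simp: indicator_def)
 have "(LBINT z. w z * \<phi> z) = (LBINT z. late s w z * zt z - late t w z * zt z)" by (rule integral_cong[OF refl]) (use st in \<open>auto simp: \<phi>_def late_def indicator_def\<close>)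
 also have "... = (LBINT z. late s w z * zt z) - (LBINT z. late t w z * zt z)" by (rule integral_diff) (use st in \<open>auto intro!: sq_integrable_mult[OF wloc_late(1)[OF w] H1_sq(1)[OF Hz]]\<close>)
 also have "... = ((LBINT x. 1 / m x * (W t x)^2) - (LBINT x. 1 / m x * (W s x)^2)) / 2" using st by (simp add: chain diff_divide_distrib)
 finally have 1: "(LBINT z. w z * \<phi> z) = ((LBINT x. 1 / m x * (W t x)^2) - (LBINT x. 1 / m x * (W s x)^2)) / 2" .
 have 2: "(LBINT z. w z * \<phi> z) + (LBINT z. G z \<bullet> K z) = (LBINT z. f z * \<phi> z)" by (rule eq[OF H\<phi> st(1)]) (auto simp: \<phi>_def)
 have j: "integrable lborel (%z. f z * zt z - G z \<bullet> F z)" by (intro integrable_diff sq_integrable_mult sq_integrable_inner f H1_sq[OF Hz] H1_sq(2)[OF H])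
 have ja: "integrable lborel (%z. ind {..t} (snd z) * \<bar>f z * zt z - G z \<bullet> F z\<bar>)"
 proof (rule integrable_bound[OF j])
  show "(%z. ind {..t} (snd z) * \<bar>f z * zt z - G z \<bullet> F z\<bar>) \<in> borel_measurable lborel" using borel_measurable_integrable[OF j] by simp
 qed (rule AE_I2, simp add: indicator_def)
 have "(LBINT z. f z * \<phi> z) - (LBINT z. G z \<bullet> K z) = (LBINT z. f z * \<phi> z - G z \<bullet> K z)" by (rule integral_diff[symmetric, OF sq_integrable_mult[OF f H1_sq(1)[OF H\<phi>]] sq_integrable_inner[OF H1_sq(2)[OF H] H1_sq(2)[OF H\<phi>]]])
 also have "... <= (LBINT z. ind {..t} (snd z) * \<bar>f z * zt z - G z \<bullet> F z\<bar>)"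
 proof (rule integral_mono)
  show "integrable lborel (%z. f z * \<phi> z - G z \<bullet> K z)" by (intro integrable_diff sq_integrable_mult sq_integrable_inner f H1_sq[OF H\<phi>] H1_sq(2)[OF H])
  fix z show "f z * \<phi> z - G z \<bullet> K z <= ind {..t} (snd z) * \<bar>f z * zt z - G z \<bullet> F z\<bar>" by (auto simp: \<phi>_def K_def indicator_def)
 qed (rule ja)
 finally show ?thesis using 1 2 unfolding zt_def F_def by simp
qed

text \<open>Testing with \<open>v - \<psi>\<close>, where the smooth \<open>\<psi>\<close> is close to the prospective initial value of \<open>v\<close>,
 bounds the time average of \<open>v - \<psi>\<close> near \<open>t = 0\<close>; the energy identity turns the average into a bound at every time.\<close>

lemma initial_value:
 assumes H: "H1 v G" and w: "wloc w" and P: "sq P" "!!x. x \<notin> \<Omega> ==> P x = 0" and rep: "time_rep (%z. m (fst z) * v z) w P" and m: "coef m c C"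
  and f: "sq f" and ub: "sq ub" "!!x. x \<notin> \<Omega> ==> ub x = 0"
  and eq: "!!\<phi> G\<phi> t0. H1 \<phi> G\<phi> ==> 0 < t0 ==> \<forall>z. snd z < t0 --> \<phi> z = 0 ==>
    (LBINT z. w z * \<phi> z) + (LBINT z. G z \<bullet> G\<phi> z) = (LBINT z. f z * \<phi> z)"
  and duh: "!!\<Phi> G\<Phi>. H1 \<Phi> G\<Phi> ==> (LBINT z. m (fst z) * v z * \<Phi> z) + (LBINT z. G z \<bullet> tint G\<Phi> z) =
    (LBINT z. f z * tint \<Phi> z) + (LBINT x. ub x * tI \<Phi> x)"
 shows "((%t. N2 (%x. Ut w P t x - ub x)) \<longlongrightarrow> 0) (at_right 0)"
proof (rule order_tendstoI)
 fix a :: real assume "a < 0"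
 then show "\<forall>\<^sub>F t in at_right 0. a < N2 (%x. Ut w P t x - ub x)" by (intro always_eventually allI less_le_trans[OF _ N2_nonneg])
next
 fix a :: real assume a: "0 < a"
 have C: "0 < C" by (rule coefD(7)[OF m])
 define q where "q x = 1 / m x * ub x" for x
 have sq_q: "sq q" unfolding q_def[abs_def] by (rule sq_mult_bounded[OF ub(1) coefD(10,8)[OF m]])
 \<comment> \<open>The tolerance becomes a/2 under the factor 4 C^2 of the final estimate; the other
   a/2 comes from \<open>err\<close>, kept below a/(4 C) against the factor 2 C.\<close>
 obtain \<psi> where \<psi>: "test_fun \<Omega> \<psi>" "N2 (%x. \<psi> x - indicator \<Omega> x * q x) < a / (8 * C^2)"
 proof -
  have "0 < a / (8 * C^2)" using a C by simp
  then show thesis using test_dense[OF \<Omega>_open sq_q, unfolded test_dense_def] that by blast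
 qed
 define r where "r x = ub x / m x - \<psi> x" for x
 have sr: "sq r" using sq_diff[OF sq_q test_fun_sq[OF \<psi>(1)]] by (simp add: r_def[abs_def] q_def)
 have "indicator \<Omega> x * q x = ub x / m x" for x using ub(2)[of x] by (cases "x \<in> \<Omega>") (auto simp: q_def)
 then have Nr: "N2 r < a / (8 * C^2)" using \<psi>(2) by (simp add: r_def[abs_def] N2_minus_commute)
 define zt where "zt z = v z - ext \<psi> z" for z
 define F where "F z = G z - grad_ext \<psi> z" for z
 have Hz: "H1 zt F" unfolding zt_def[abs_def] F_def[abs_def] by (rule H1_diff[OF H H1_ext[OF \<psi>(1)]])
 define h where "h z = \<bar>f z * zt z - G z \<bullet> F z\<bar>" for z
 have h: "integrable lborel h" "off h" unfolding h_def[abs_def] using integrable_diff[OF sq_integrable_mult[OF f H1_sq(1)[OF Hz]] sq_integrable_inner[OF H1_sq(2)[OF H] H1_sq(2)[OF Hz]]]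
   H1_outside[OF Hz] by (auto simp: off_def simp del: mem_Sigma_iff)
 define err where "err t = 2 * (LBINT z. ind {..t} (snd z) * h z)
  + 2 * (sqrt (N2 f) * sqrt (N2 (early t zt)) + sqrt (N2 (grad_ext \<psi>)) * sqrt (N2 (early t F)))" for t
 have "(err \<longlongrightarrow> 2 * 0 + 2 * (sqrt (N2 f) * sqrt 0 + sqrt (N2 (grad_ext \<psi>)) * sqrt 0)) (at_right 0)" unfolding err_def[abs_def] by (intro tendsto_add tendsto_mult tendsto_const tendsto_real_sqrt early_small[OF h] N2_early_small H1_sq[OF Hz] H1_off[OF Hz]) auto
 then have "\<forall>\<^sub>F t in at_right 0. err t < a / (4 * C)" by (rule order_tendstoD) (use a C in simp)
 moreover have "\<forall>\<^sub>F t in at_right 0. t \<in> {0<..<T}" by (rule eventually_at_right_real[OF T_pos])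
 ultimately show "\<forall>\<^sub>F t in at_right 0. N2 (%x. Ut w P t x - ub x) < a"
 proof eventually_elim
  case (elim t)
  then have t: "0 < t" "t <= T" "t < T" by auto
  define P' where "P' x = P x - m x * \<psi> x" for x
  have sP: "sq P'" unfolding P'_def[abs_def] by (rule sq_diff[OF P(1) sq_mult_bounded[OF test_fun_sq[OF \<psi>(1)] coefD(2,5)[OF m]]])
  define E where "E s = (LBINT x. 1 / m x * (Ut w P' s x)^2)" for s
  define H0 where "H0 = (LBINT z. ind {..t} (snd z) * h z)"
  \<comment> \<open>The energy at t exceeds that at any earlier time by a small error at most, so a
    bound on the average over (0, t) bounds the energy at t itself.\<close>
  have step: "E t - 2 * H0 <= E s" if "0 < s" "s < t" for s
  proof -
   have "E t <= E s + 2 * H0" unfolding E_def H0_def h_def zt_def F_def P'_def[abs_def] by (rule energy_step[OF H w P(1) rep m f \<psi>(1) that eq])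
   then show ?thesis by simp
  qed
  let ?g = "%z. m (fst z) * (early t zt z)^2"
  have He: "H1 (early t zt) (early t F)" by (rule H1_early[OF Hz])
  have gi: "integrable lborel ?g" using sq_integrable_mult[OF sq_fst_mult[OF H1_sq(1)[OF He] coefD(2,5)[OF m]] H1_sq(1)[OF He]] by (simp add: power2_eq_square mult.assoc)
  have "time_rep (%z. m (fst z) * zt z) w P'" unfolding zt_def P'_def[abs_def] by (rule time_rep_diff_ext[OF rep])
  from AE_slices[OF this[unfolded time_rep_def]]
  have sl: "AE s in lborel. AE x in lborel. (x, s) \<in> D --> m x * zt (x, s) = P' x - tint w (x, s)" by simp
  have "t * (E t - 2 * H0) <= (LBINT z. ?g z)"
  proof (rule time_slices_lower[OF gi t(1)])
   fix x s assume "s \<notin> {0<..<t}"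
   then show "m (fst (x, s)) * (early t zt (x, s))^2 = 0" using H1_outside(1)[OF Hz, of "(x, s)"] by (auto simp: early_def indicator_def)
  next
   show "AE s in lborel. s \<in> {0<..<t} --> E t - 2 * H0 <= (LBINT x. m (fst (x, s)) * (early t zt (x, s))^2)" using sl
   proof eventually_elim
    case (elim s)
    show ?case
    proof
     assume s: "s \<in> {0<..<t}"
     have pm: "(%x::real^'n. (x, s)) \<in> borelm" by (intro borel_measurable_continuous_onI continuous_intros)
     have "(LBINT x. m (fst (x, s)) * (early t zt (x, s))^2) = E s" unfolding E_def
     proof (rule integral_cong_AE)
      show "(%x. m (fst (x, s)) * (early t zt (x, s))^2) \<in> borel_measurable lborel" using measurable_compose[OF pm borel_measurable_integrable[OF gi, simplified]] by simp
      show "(%x. 1 / m x * (Ut w P' s x)^2) \<in> borel_measurable lborel" using borel_measurable_times[OF coefD(10)[OF m] borel_measurable_power[OF sq_measurable[OF sq_Ut[OF w sP]], of s 2]] s by simp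
      show "AE x in lborel. m (fst (x, s)) * (early t zt (x, s))^2 = 1 / m x * (Ut w P' s x)^2" using elim
      proof eventually_elim
       case (elim x)
       show ?case
       proof (cases "x \<in> \<Omega>")
        case True
        then have e: "Ut w P' s x = m x * zt (x, s)" using elim s t unfolding Ut_def by (simp add: tI_late_eq_tint)
        have "early t zt (x, s) = zt (x, s)" using s by (simp add: early_def)
        then show ?thesis unfolding e using coefD(6)[OF m, of x] by (simp add: power2_eq_square)
       next
        case False
        then have "P' x = 0" "tI (late s w) x = 0" "zt (x, s) = 0" using P(2) test_fun_outside[OF \<psi>(1)] offD[OF wloc_late(2)[OF w, of s], of "(x, _)"] H1_outside(1)[OF Hz, of "(x, s)"] by (auto simp: P'_def tI_def)
        then show ?thesis by (simp add: Ut_def early_def)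
       qed
      qed
     qed
     then show "E t - 2 * H0 <= (LBINT x. m (fst (x, s)) * (early t zt (x, s))^2)" using step[of s] s by simp
    qed
   qed
  qed
  also have "... <= t * (C * N2 r + 2 * (sqrt (N2 f) * sqrt (N2 (early t zt)) + sqrt (N2 (grad_ext \<psi>)) * sqrt (N2 (early t F))))" unfolding zt_def[abs_def] F_def[abs_def] r_def[abs_def] by (rule early_estimate[OF H m f ub(1) \<psi>(1) t(1,2) duh])
  finally have "E t - 2 * H0 <= C * N2 r + 2 * (sqrt (N2 f) * sqrt (N2 (early t zt)) + sqrt (N2 (grad_ext \<psi>)) * sqrt (N2 (early t F)))" using t(1) by simp
  then have Et: "E t <= C * N2 r + err t" unfolding err_def H0_def by linarith
  have sU: "sq (Ut w P' t)" by (rule sq_Ut[OF w sP t(1)])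
  have "N2 (Ut w P' t) <= C * E t"
  proof -
   have "integrable lborel (%x. 1 / m x * (Ut w P' t x)^2)" using sq_integrable_mult[OF sq_mult_bounded[OF sU coefD(10,8)[OF m]] sU] by (simp add: power2_eq_square)
   note i = integrable_mult_right[OF this, of C]
   have "N2 (Ut w P' t) <= (LBINT x. C * (1 / m x * (Ut w P' t x)^2))" unfolding N2_def
   proof (rule integral_mono[OF sq_integrable[OF sU] i])
    fix x
    have "1 <= C * (1 / m x)" using coefD(4,6)[OF m, of x] by (simp add: field_simps)
    from mult_right_mono[OF this, of "(Ut w P' t x)^2"] show "(norm (Ut w P' t x))^2 <= C * (1 / m x * (Ut w P' t x)^2)" by simp
   qed
   then show ?thesis unfolding E_def integral_mult_right_zero .
  qed
  moreover have "N2 (%x. m x * r x) <= C^2 * N2 r" by (rule N2_mult_bounded[OF sr coefD(2,5)[OF m]])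
  moreover have "N2 (%x. Ut w P t x - ub x) <= 2 * N2 (Ut w P' t) + 2 * N2 (%x. m x * r x)"
  proof -
   have "Ut w P t x - ub x = Ut w P' t x - m x * r x" for x using coefD(6)[OF m, of x] by (simp add: Ut_def P'_def r_def right_diff_distrib)
   then show ?thesis using N2_diff_le[OF sU sq_mult_bounded[OF sr coefD(2,5)[OF m]]] by simp
  qed
  ultimately have "N2 (%x. Ut w P t x - ub x) <= 2 * (C * E t) + 2 * (C^2 * N2 r)" by linarith
  also have "... <= 2 * (C * (C * N2 r + err t)) + 2 * (C^2 * N2 r)" using mult_left_mono[OF Et, of C] C by simp
  also have "... = 4 * C^2 * N2 r + 2 * C * err t" by (simp add: algebra_simps power2_eq_square)
  also have "... < a"
  proof -
   have "4 * C^2 * N2 r < 4 * C^2 * (a / (8 * C^2))" using Nr C by (intro mult_strict_left_mono) auto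
   moreover have "2 * C * err t < 2 * C * (a / (4 * C))" using elim(1) C by (intro mult_strict_left_mono) auto
   ultimately show ?thesis using C by (simp add: field_simps power2_eq_square)
  qed
  finally show ?case .
 qed
qed

end

subsection \<open>Weak solutions with values at every time\<close>

context cylinder
begin

lemma AE_snd_neq: "AE z in lborel. snd (z :: (real^'n) \<times> real) ~= t"
proof -
 let ?H = "{z :: (real^'n) \<times> real. (0, 1) \<bullet> z = t}"
 have "negligible ?H" by (rule negligible_hyperplane) (simp add: zero_prod_def)
 then have "AE z in lebesgue. z \<notin> ?H" by (intro AE_not_in) (simp add: negligible_iff_null_sets)
 then have "AE z in lborel. z \<notin> ?H" by (simp add: AE_completion_iff)
 then show ?thesis by eventually_elim (simp add: inner_prod_def)
qed

lemma Ut_outside: "wloc w ==> x \<notin> \<Omega> ==> P x = 0 ==> Ut w P t x = 0" using offD[OF wloc_late(2), of w "(x, _)" t] by (simp add: Ut_def tI_def)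

lemma Ut_diff:
 assumes w: "wloc w" and P: "sq P" and t: "0 < s" "0 < t"
 shows "N2 (%x. Ut w P s x - Ut w P t x) <= T * N2 (%z. late s w z - late t w z)"
proof -
 have sd: "sq (%z. late t w z - late s w z)" by (rule sq_diff[OF wloc_late(1)[OF w t(2)] wloc_late(1)[OF w t(1)]])
 have od: "off (%z. late t w z - late s w z)" by (rule offI) (simp add: offD[OF wloc_late(2)[OF w]] del: mem_Sigma_iff)
 have "AE x in lborel. tI (%z. late t w z - late s w z) x = Ut w P s x - Ut w P t x" using wloc_slices[OF w t(1)] wloc_slices[OF w t(2)] by eventually_elim (simp add: Ut_def tI_def)
 from N2_cong_AE[OF this sq_tI(1)[OF sd od] sq_measurable[OF sq_diff[OF sq_Ut[OF w P t(1)] sq_Ut[OF w P t(2)]]]]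
 have "N2 (%x. Ut w P s x - Ut w P t x) = N2 (tI (%z. late t w z - late s w z))" by simp
 also have "... <= T * N2 (%z. late t w z - late s w z)" by (rule sq_tI(2)[OF sd od])
 also have "N2 (%z. late t w z - late s w z) = N2 (%z. late s w z - late t w z)" by (rule N2_minus_commute)
 finally show ?thesis .
qed

text \<open>Two traces differ by a time integral of w between the two times, so dominated
  convergence for the cut functions suffices. First w is cut at t/2, which makes it square
  integrable.\<close>

lemma Ut_continuous:
 assumes w: "wloc w" and P: "sq P" and t: "0 < t"
 shows "((%s. N2 (%x. Ut w P s x - Ut w P t x)) \<longlongrightarrow> 0) (at t within A)" unfolding tendsto_at_iff_sequentially comp_def
proof (intro allI impI)
 fix X :: "nat => real" assume X: "X ~~> t"
 have t2: "0 < t/2" "t/2 < t" using t by auto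
 note ev = order_tendstoD(1)[OF X t2(2)]
 have "(%k. N2 (%z. late (X k) (late (t/2) w) z - late t (late (t/2) w) z)) ~~> 0"
 proof (rule N2_dominated_LIMSEQ[OF wloc_late(1)[OF w t2(1)]])
  show "late (X k) (late (t/2) w) \<in> borelm" "late t (late (t/2) w) \<in> borelm" for k by (rule sq_measurable[OF sq_late[OF wloc_late(1)[OF w t2(1)]]])+
  show "AE z in lborel. (%k. late (X k) (late (t/2) w) z) ~~> late t (late (t/2) w) z" using AE_snd_neq[of t]
  proof eventually_elim
   case (elim z)
   have "\<forall>\<^sub>F k in sequentially. late (X k) (late (t/2) w) z = late t (late (t/2) w) z"
   proof (cases "t < snd z")
    case True
    from order_tendstoD(2)[OF X this] show ?thesis by eventually_elim (use True in \<open>simp add: late_def\<close>)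
   next
    case False
    with elim have "snd z < t" by simp
    from order_tendstoD(1)[OF X this] show ?thesis by eventually_elim (use False in \<open>simp add: late_def\<close>)
   qed
   then show ?case by (rule tendsto_eventually)
  qed
  show "AE z in lborel. norm (late (X k) (late (t/2) w) z - late t (late (t/2) w) z) <= norm (late (t/2) w z)" for k by (rule AE_I2) (simp add: late_def indicator_def)
 qed
 then have lim: "(%k. T * N2 (%z. late (X k) (late (t/2) w) z - late t (late (t/2) w) z)) ~~> 0" by (rule tendsto_mult_right_zero)
 have "\<forall>\<^sub>F k in sequentially. N2 (%x. Ut w P (X k) x - Ut w P t x) <= T * N2 (%z. late (X k) (late (t/2) w) z - late t (late (t/2) w) z)" using ev
 proof eventually_elim
  case (elim k)
  have "late s (late (t/2) w) = late s w" if "t/2 < s" for s using that by (auto simp: late_def indicator_def fun_eq_iff)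
  then show ?case using Ut_diff[OF w P, of "X k" t] elim t2 by simp
 qed
 then show "(%k. N2 (%x. Ut w P (X k) x - Ut w P t x)) ~~> 0" by (intro tendsto_sandwich[OF _ _ tendsto_const lim]) auto
qed

text \<open>A weak solution needs values at every time, while v is determined almost everywhere. The
  traces \<open>Ut\<close>, divided by m, provide them for t > 0 and the datum does so at t = 0,
  where continuity is \<open>init\<close>.\<close>

lemma is_sol_weak_sol:
 assumes H: "H1 v G" and w: "wloc w" and P: "sq P" "!!x. x \<notin> \<Omega> ==> P x = 0" and rep: "time_rep (%z. m (fst z) * v z) w P" and m: "coef m c C"
  and f: "sq f" "AE z in lborel. z \<in> D --> f0 z = f z" and ub: "sq ub" "!!x. x \<notin> \<Omega> ==> ub x = 0"
  and eq: "!!\<phi> G\<phi> t0. H1 \<phi> G\<phi> ==> 0 < t0 ==> \<forall>z. snd z < t0 --> \<phi> z = 0 ==>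
    (LBINT z. w z * \<phi> z) + (LBINT z. G z \<bullet> G\<phi> z) = (LBINT z. f z * \<phi> z)"
  and init: "((%t. N2 (%x. Ut w P t x - ub x)) \<longlongrightarrow> 0) (at_right 0)"
  and M: "AE x in lborel. x \<in> \<Omega> --> M x = m x" and u0: "AE x in lborel. x \<in> \<Omega> --> m x * u0 x = ub x"
 obtains v0 where "weak_sol \<Omega> T M (%_. 1) f0 u0 v0" "AE z in lborel. z \<in> D --> v0 z = v z"
proof -
 define U where "U t x = (if 0 < t then Ut w P t x else ub x)" for t x
 define V where "V t x = 1 / m x * U t x" for t x
 define v0 where "v0 z = V (snd z) (fst z)" for z
 have sU: "sq (U t)" for t by (cases "0 < t") (simp_all add: U_def[abs_def] sq_Ut[OF w P(1)] ub)
 have sV: "sq (V t)" for t unfolding V_def[abs_def] by (rule sq_mult_bounded[OF sU coefD(10,8)[OF m]])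
 have V0: "V t x = 0" if "x \<notin> \<Omega>" for t x using Ut_outside[where P = P, OF w that P(2)[OF that]] ub(2)[OF that] by (simp add: V_def U_def)
 have v: "AE z in lborel. z \<in> D --> v0 z = v z" using rep[unfolded time_rep_def]
 proof eventually_elim
  case (elim z)
  show ?case
  proof
   assume z: "z \<in> D"
   then have "Ut w P (snd z) (fst z) = P (fst z) - tint w z" by (auto simp: Ut_def tI_late_eq_tint)
   then have "Ut w P (snd z) (fst z) = m (fst z) * v z" using elim z by simp
   then show "v0 z = v z" using z coefD(6)[OF m, of "fst z"] by (auto simp: v0_def V_def U_def)
  qed
 qed
 define w' where "w' z = 1 / m (fst z) * w z" for z
 have l': "late t0 w' = (%z. 1 / m (fst z) * late t0 w z)" for t0 by (auto simp: late_def w'_def)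
 have m1: "(%z::(real^'n) \<times> real. 1 / m (fst z)) \<in> borelm" by (rule measurable_compose[OF fst_borel coefD(10)[OF m]])
 have wm: "w \<in> borelm" "w' \<in> borelm" using w borel_measurable_times[OF m1, of w] unfolding wloc_def w'_def[abs_def] by auto
 have w': "wloc w'" unfolding wloc_def
 proof (intro conjI allI impI)
  show "off w'" using w by (auto simp: wloc_def off_def w'_def)
  show "sq (late t0 w')" if "0 < t0" for t0 unfolding l' by (rule sq_fst_mult[OF wloc_late(1)[OF w that] coefD(10,8)[OF m]])
 qed (rule wm)
 have P': "sq (%x. 1 / m x * P x)" by (rule sq_mult_bounded[OF P(1) coefD(10,8)[OF m]])
 have rep': "time_rep v w' (%x. 1 / m x * P x)" unfolding time_rep_def using rep[unfolded time_rep_def]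
 proof eventually_elim
  case (elim z)
  show ?case
  proof
   assume "z \<in> D"
   with elim have "1 / m (fst z) * (m (fst z) * v z) = 1 / m (fst z) * (P (fst z) - tint w z)" by simp
   then show "v z = 1 / m (fst z) * P (fst z) - tint w' z" using coefD(6)[OF m, of "fst z"] tint_fst_mult[of "%x. 1 / m x" w z] by (simp add: w'_def[abs_def] right_diff_distrib)
  qed
 qed
 note sv = H1_sq[OF H]
 have w'o: "off w'" using w' by (simp add: wloc_def)
 have slice: "\<Omega> \<times> {t0<..<T} \<in> sets borel" for t0 using \<Omega>_open by (intro borel_open open_Times) auto
 have L2_late: "L2 (\<Omega> \<times> {t0<..<T}) g" if "0 < t0" "sq (late t0 g')" "off g'" "AE z in lborel. z \<in> D --> g z = g' z" for t0 g g' unfolding L2_eq_L2v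
 proof (rule L2v_integral(1)[THEN iffD2, OF slice sq_measurable[OF that(2)] _ _ that(2)])
  show "late t0 g' z = 0" if "z \<notin> \<Omega> \<times> {t0<..<T}" for z using that offD[OF \<open>off g'\<close>, of z] \<open>0 < t0\<close> by (auto simp: late_def indicator_def mem_Times_iff)
  show "AE z in lborel. z \<in> \<Omega> \<times> {t0<..<T} --> g z = late t0 g' z" using that(4) by eventually_elim (use that(1) in \<open>auto simp: late_def mem_Times_iff\<close>)
 qed
 have td: "time_deriv_loc \<Omega> T v0 w'" unfolding time_deriv_loc_def
 proof (intro conjI allI impI)
  fix t0 assume t0: "0 < t0 & t0 < T"
  show "L2 (\<Omega> \<times> {t0<..<T}) v0" by (rule L2_late[OF _ sq_late[OF sv(1)] H1_off(1)[OF H] v]) (use t0 in simp)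
  show "L2 (\<Omega> \<times> {t0<..<T}) w'" by (rule L2_late[OF _ wloc_late(1)[OF w']]) (use t0 w' in \<open>auto simp: wloc_def\<close>)
 next
  fix \<phi> assume t: "test_fun D \<phi>"
  have mm: "\<phi> \<in> borelm" "dt \<phi> \<in> borelm" using test_fun_sq[OF t] test_fun_sq[OF test_fun_deriv[OF t]] by (auto simp: dt_def[abs_def] sq_measurable)
  have e1: "sint D (%z. v0 z * dt \<phi> z) = (LBINT z. v z * dt \<phi> z)" by (rule set_integral_mult_borel[OF D_borel sq_measurable[OF sv(1)] H1_outside(1)[OF H] v mm(2)])
  have e2: "sint D (%z. w' z * \<phi> z) = (LBINT z. w' z * \<phi> z)" by (rule set_integral_mult_borel[OF D_borel wm(2) offD[OF w'o] _ mm(1)]) (assumption, rule AE_I2, simp)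
  show "sint D (%z. v0 z * dt \<phi> z) = - sint D (%z. w' z * \<phi> z)" unfolding e1 e2 unfolding dt_def using time_rep_wder[OF w' P' rep' sq_measurable[OF sv(1)]] t unfolding wder_def by blast
 qed
 have Veq: "sint \<Omega> (%x. (v0 (x, s) - v0 (x, t))^2) = N2 (%x. V s x - V t x)" for s t
 proof -
  have "sint \<Omega> (%x. (norm (v0 (x, s) - v0 (x, t)))^2) = N2 (%x. V s x - V t x)" by (rule L2v_integral(2)[OF \<Omega>_borel sq_measurable[OF sq_diff[OF sV sV]]]) (simp_all add: V0 v0_def)
  then show ?thesis by simp
 qed
 have C0: "C0L2 \<Omega> T v0" unfolding C0L2_def Veq
 proof (intro conjI ballI)
  fix t assume t: "t \<in> {0..T}"
  show "L2 \<Omega> (%x. v0 (x, t))" unfolding L2_eq_L2v by (rule L2v_integral(1)[THEN iffD2, OF \<Omega>_borel sq_measurable[OF sV[of t]] _ _ sV[of t]]) (simp_all add: V0 v0_def)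
  have "((%s. N2 (%x. U s x - U t x)) \<longlongrightarrow> 0) (at t within {0..T})"
  proof (cases "0 < t")
   case True
   have "\<forall>\<^sub>F s in at t within {0..T}. 0 < s" by (rule order_tendstoD(1)[OF tendsto_ident_at True])
   then have "\<forall>\<^sub>F s in at t within {0..T}. N2 (%x. Ut w P s x - Ut w P t x) = N2 (%x. U s x - U t x)"
    by eventually_elim (simp add: U_def True)
   then show ?thesis by (rule Lim_transform_eventually[OF Ut_continuous[OF w P(1) True]])
  next
   case False
   with t have "t = 0" by simp
   have "\<forall>\<^sub>F s in at_right 0. N2 (%x. Ut w P s x - ub x) = N2 (%x. U s x - U t x)" using eventually_at_right_less[of "0::real"] by eventually_elim (simp add: U_def \<open>t = 0\<close>)
   from Lim_transform_eventually[OF init this] show ?thesis unfolding \<open>t = 0\<close> at_within_Icc_at_right[OF T_pos] .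
  qed
  then have lim: "((%s. (1 / c)^2 * N2 (%x. U s x - U t x)) \<longlongrightarrow> 0) (at t within {0..T})" by (rule tendsto_mult_right_zero)
  have "N2 (%x. V s x - V t x) <= (1 / c)^2 * N2 (%x. U s x - U t x)" for s using N2_mult_bounded[OF sq_diff[OF sU[of s] sU[of t]] coefD(10,8)[OF m]] by (simp add: V_def right_diff_distrib)
  then show "((%s. N2 (%x. V s x - V t x)) \<longlongrightarrow> 0) (at t within {0..T})" by (intro tendsto_sandwich[OF _ _ tendsto_const lim]) (auto intro!: always_eventually)
 qed
 have "AE x in lborel. x \<in> \<Omega> --> v0 (x, 0) = u0 x" using u0
 proof eventually_elim
  case (elim x)
  then show ?case using coefD(6)[OF m, of x] by (auto simp: v0_def V_def U_def field_simps)
 qed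
 then have ini: "AE x in lebesgue. x \<in> \<Omega> --> v0 (x, 0) = u0 x" by (rule AE_completion)
 have sg: "spatial_grad \<Omega> T (%z. 1 * v0 z) G" by (rule H1_spatial_grad[OF H]) (use v in simp, rule AE_I2, simp)
 have "sint D (%z. M (fst z) * w' z * \<phi> z + G z \<bullet> G\<phi> z) = sint D (%z. f0 z * \<phi> z)"
  if s\<phi>: "spatial_grad \<Omega> T \<phi> G\<phi>" and t0: "0 < t0" and z0: "\<forall>z\<in>D. snd z < t0 --> \<phi> z = 0" for \<phi> G\<phi> t0
 proof -
  obtain \<phi>1 G1 where H1: "H1 \<phi>1 G1" and a1: "AE z in lborel. z \<in> D --> \<phi> z = \<phi>1 z" "AE z in lborel. z \<in> D --> G\<phi> z = G1 z" by (rule spatial_grad_H1[OF s\<phi>])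
  \<comment> \<open>A Borel version of the test function vanishes before t0 only almost everywhere;
    the cut restores this at every point, as \<open>eq\<close> demands.\<close>
  define \<phi>2 where "\<phi>2 z = ind {t0..} (snd z) * \<phi>1 z" for z
  define G2 where "G2 z = ind {t0..} (snd z) *\<^sub>R G1 z" for z
  have H2: "H1 \<phi>2 G2" unfolding \<phi>2_def[abs_def] G2_def[abs_def] by (rule H1_cut[OF H1, where C = 1]) (auto simp: indicator_def)
  have \<phi>12: "AE z in lborel. \<phi>1 z = \<phi>2 z" using a1(1)
  proof eventually_elim
   case (elim z)
   then show ?case using z0 H1_outside(1)[OF H1, of z] by (cases "z \<in> D"; cases "snd z < t0") (auto simp: \<phi>2_def simp del: mem_Sigma_iff)
  qed
  note G12 = H1_gradient_unique[OF H1 H2 \<phi>12]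
  have \<phi>20: "\<forall>z. snd z < t0 --> \<phi>2 z = 0" by (simp add: \<phi>2_def)
  note s2 = H1_sq[OF H2]
  have wz: "(%z. w z * \<phi>2 z) = (%z. late (t0/2) w z * \<phi>2 z)" using t0 by (auto simp: late_def \<phi>2_def indicator_def fun_eq_iff)
  have i1: "integrable lborel (%z. w z * \<phi>2 z)" unfolding wz by (rule sq_integrable_mult[OF wloc_late(1)[OF w] s2(1)]) (use t0 in simp)
  have i2: "integrable lborel (%z. G z \<bullet> G2 z)" by (rule sq_integrable_inner[OF sv(2) s2(2)])
  have "sint D (%z. M (fst z) * w' z * \<phi> z + G z \<bullet> G\<phi> z) = (LBINT z. w z * \<phi>2 z + G z \<bullet> G2 z)"
  proof (rule set_integral_borel(1)[OF D_borel])
   show "(%z. w z * \<phi>2 z + G z \<bullet> G2 z) \<in> borelm" using borel_measurable_integrable[OF integrable_add[OF i1 i2]] by simp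
   show "AE z in lborel. z \<in> D --> M (fst z) * w' z * \<phi> z + G z \<bullet> G\<phi> z = w z * \<phi>2 z + G z \<bullet> G2 z" using AE_lborel_fst[OF M, where 'b = real] a1 \<phi>12 G12
   proof eventually_elim
    case (elim z)
    then show ?case using coefD(6)[OF m, of "fst z"] by (auto simp: w'_def mem_Times_iff)
   qed
  qed (simp add: H1_outside[OF H2] del: mem_Sigma_iff)
  moreover have "sint D (%z. f0 z * \<phi> z) = (LBINT z. f z * \<phi>2 z)"
  proof (rule set_integral_borel(1)[OF D_borel])
   show "(%z. f z * \<phi>2 z) \<in> borelm" using sq_measurable[OF f(1)] sq_measurable[OF s2(1)] by simp
   show "AE z in lborel. z \<in> D --> f0 z * \<phi> z = f z * \<phi>2 z" using f(2) a1(1) \<phi>12 by eventually_elim simp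
  qed (simp add: H1_outside[OF H2] del: mem_Sigma_iff)
  ultimately show ?thesis using eq[OF H2 t0 \<phi>20] i1 i2 by simp
 qed
 with td C0 ini sg have "weak_sol \<Omega> T M (%_. 1) f0 u0 v0" unfolding weak_sol_def by blast
 with v that show thesis by blast
qed

end

subsection \<open>Convergence\<close>

context cylinder
begin

text \<open>Against test functions the derivative can be moved away from \<open>Z\<close>, whose
  norm tends to 0; the bound R and density extend this to every square integrable g.\<close>

lemma weak_gradient_LIMIT:
 fixes Z :: "real => (real^'n) \<times> real => real"
 assumes H: "!!eps. 0 < eps ==> H1 (Z eps) (Y eps)" and Z: "((%eps. N2 (Z eps)) \<longlongrightarrow> 0) (at_right 0)"
  and Y: "!!eps. 0 < eps ==> N2 (Y eps) <= R" and g: "sq g"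
 shows "((%eps. \<integral>z. (Y eps z $ i) * g z \<partial>lborel) \<longlongrightarrow> 0) (at_right 0)"
proof (rule tendstoI)
 fix e :: real assume e: "0 < e"
 have R: "0 <= R" using order_trans[OF N2_nonneg Y[of 1]] by simp
 \<comment> \<open>R + 1 avoids a zero denominator; Cauchy-Schwarz then leaves at most e/2.\<close>
 have "0 < (e / 2)^2 / (R + 1)" using e R by simp
 then obtain \<phi> where \<phi>: "test_fun D \<phi>" "N2 (%z. \<phi> z - indicator D z * g z) < (e / 2)^2 / (R + 1)" using test_dense[OF D_open g, unfolded test_dense_def] by blast
 define k where "k z = \<phi> z - indicator D z * g z" for z
 have sk: "sq k" unfolding k_def[abs_def] by (rule sq_diff[OF test_fun_sq[OF \<phi>(1)] sq_indicator_mult[OF g D_borel]])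
 have sd: "sq (dx i \<phi>)" using test_fun_sq[OF test_fun_deriv[OF \<phi>(1)]] by (simp add: dx_def[abs_def])
 have "((%eps. sqrt (N2 (Z eps)) * sqrt (N2 (dx i \<phi>))) \<longlongrightarrow> sqrt 0 * sqrt (N2 (dx i \<phi>))) (at_right 0)" by (intro tendsto_mult tendsto_real_sqrt Z tendsto_const)
 then have "\<forall>\<^sub>F eps in at_right 0. sqrt (N2 (Z eps)) * sqrt (N2 (dx i \<phi>)) < e / 2" by (rule order_tendstoD) (use e in simp)
 then show "\<forall>\<^sub>F eps in at_right 0. dist (LBINT z. (Y eps z $ i) * g z) 0 < e" using eventually_at_right_less[of "0::real"]
 proof eventually_elim
  case (elim eps)
  note Heps = H[OF elim(2)]
  have sY: "sq (%z. Y eps z $ i)" by (rule sq_component[OF H1_sq(2)[OF Heps]])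
  have "(Y eps z $ i) * g z = (Y eps z $ i) * \<phi> z - (Y eps z $ i) * k z" for z using H1_outside(2)[OF Heps, of z] by (cases "z \<in> D") (simp_all add: k_def algebra_simps del: mem_Sigma_iff)
  then have "(LBINT z. (Y eps z $ i) * g z) = (LBINT z. (Y eps z $ i) * \<phi> z - (Y eps z $ i) * k z)" by (intro integral_cong refl)
  also have "... = (LBINT z. (Y eps z $ i) * \<phi> z) - (LBINT z. (Y eps z $ i) * k z)" by (rule integral_diff[OF sq_integrable_mult[OF sY test_fun_sq[OF \<phi>(1)]] sq_integrable_mult[OF sY sk]])
  also have "(LBINT z. (Y eps z $ i) * \<phi> z) = - (LBINT z. Z eps z * dx i \<phi> z)" using Heps \<phi>(1) unfolding H1_def by simp
  finally have "\<bar>\<integral>z. (Y eps z $ i) * g z \<partial>lborel\<bar> <= \<bar>\<integral>z. Z eps z * dx i \<phi> z \<partial>lborel\<bar> + \<bar>\<integral>z. (Y eps z $ i) * k z \<partial>lborel\<bar>" by simp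
  also have "... <= sqrt (N2 (Z eps)) * sqrt (N2 (dx i \<phi>)) + sqrt (N2 (%z. Y eps z $ i)) * sqrt (N2 k)" by (intro add_mono Cauchy_Schwarz_mult H1_sq(1)[OF Heps] sd sY sk)
  also have "... < e / 2 + e / 2"
  proof (rule add_less_le_mono[OF elim(1)])
   have "N2 (%z. Y eps z $ i) <= N2 (Y eps)" by (rule N2_mono[OF H1_sq(2)[OF Heps] sq_measurable[OF sY]]) (rule AE_I2, simp add: component_le_norm_cart)
   then have "N2 (%z. Y eps z $ i) <= R + 1" using Y[OF elim(2)] by simp
   then have "N2 (%z. Y eps z $ i) * N2 k <= (R + 1) * ((e / 2)^2 / (R + 1))" using \<phi>(2) R by (intro mult_mono) (auto simp: k_def[abs_def])
   then have "sqrt (N2 (%z. Y eps z $ i) * N2 k) <= sqrt ((e / 2)^2)" using R by (intro real_sqrt_le_mono) simp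
   then show "sqrt (N2 (%z. Y eps z $ i)) * sqrt (N2 k) <= e / 2" using e by (simp add: real_sqrt_mult)
  qed
  finally show ?case by simp
 qed
qed

lemma coef_N2_le:
 assumes \<beta>: "coef \<beta> c C" and v: "sq (v :: (real^'n) \<times> real => real)"
 shows "c * N2 v <= (LBINT z. \<beta> (fst z) * (v z)^2)"
proof -
 have i: "integrable lborel (%z. \<beta> (fst z) * (v z)^2)" using sq_integrable_mult[OF sq_fst_mult[OF v coefD(2,5)[OF \<beta>]] v] by (simp add: power2_eq_square mult.assoc)
 have "c * N2 v = (LBINT z. c * (norm (v z))^2)" by (simp add: N2_def)
 also have "... <= (LBINT z. \<beta> (fst z) * (v z)^2)"
 proof (rule integral_mono[OF integrable_mult_right[OF sq_integrable[OF v]] i])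
  fix z show "c * (norm (v z))^2 <= \<beta> (fst z) * (v z)^2" using coefD(3)[OF \<beta>, of "fst z"] by (simp add: mult_right_mono)
 qed
 finally show ?thesis .
qed

lemma is_sol_unique:
 assumes "is_sol \<beta> f ub v1 G1 w1 P1" "is_sol \<beta> f ub v2 G2 w2 P2" and \<beta>: "coef \<beta> c C" and "sq f" "sq ub"
 shows "AE z in lborel. v1 z = v2 z"
proof -
 have H: "H1 v1 G1" "H1 v2 G2" using assms(1,2) by (auto simp: is_sol_def)
 have s: "sq (%z. v1 z - v2 z)" by (rule sq_diff[OF H1_sq(1)[OF H(1)] H1_sq(1)[OF H(2)]])
 have "(LBINT z. \<beta> (fst z) * (v1 z - v2 z)^2) <= 0" using comparison[OF assms(1,2) \<beta> \<beta> assms(4,5)] by simp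
 with coef_N2_le[OF \<beta> s] have "c * N2 (%z. v1 z - v2 z) <= 0" by linarith
 then have "N2 (%z. v1 z - v2 z) = 0" using coefD(1)[OF \<beta>] N2_nonneg[of "%z. v1 z - v2 z"] by (simp add: mult_le_0_iff)
 then have "AE z in lborel. v1 z - v2 z = 0" using N2_eq_0_iff[OF s] by simp
 then show ?thesis by eventually_elim simp
qed

end

context oscillating_cylinder
begin

lemma coef_oscillation:
 assumes A: "A \<in> sets borel" and d: "0 <= d"
 shows "coef (%x. (1 + d * ind A x) * bt x ((1/eps) *\<^sub>R x)) c ((1 + d) * C)" unfolding coef_def
proof (intro conjI allI)
 show "(%x. (1 + d * ind A x) * bt x ((1/eps) *\<^sub>R x)) \<in> borelm" by (intro borel_measurable_times borel_measurable_add borel_measurable_const borel_measurable_indicator A bt_eps_borel)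
 fix x
 have b: "c <= bt x ((1/eps) *\<^sub>R x)" "bt x ((1/eps) *\<^sub>R x) <= C" by (rule bt_bounds)+
 have a: "1 <= 1 + d * ind A x" "1 + d * ind A x <= 1 + d" using d by (auto simp: indicator_def)
 show "c <= (1 + d * ind A x) * bt x ((1/eps) *\<^sub>R x)" using mult_mono[OF a(1) b(1)] a b c_pos by simp
 show "(1 + d * ind A x) * bt x ((1/eps) *\<^sub>R x) <= (1 + d) * C" using a b c_pos d by (intro mult_mono) auto
qed (rule c_pos)

text \<open>Mazur's lemma needs a sequence, so the limit is built along epsilon = 1/(n + 1).
  Comparing every solution with that limit then gives convergence of the whole family.\<close>

lemma convergence:
 fixes A :: "real => (real^'n) set"
 assumes A: "!!eps. A eps \<in> sets borel" "!!eps. emeasure lborel (A eps \<inter> \<Omega>) < \<infinity>" and A0: "((%eps. measure lborel (A eps \<inter> \<Omega>)) \<longlongrightarrow> 0) (at_right 0)"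
  and d: "0 <= d" and f: "sq f" and ub: "sq ub" "!!x. x \<notin> \<Omega> ==> ub x = 0"
  and S: "!!eps. 0 < eps ==> is_sol (%x. (1 + d * ind (A eps) x) * bt x ((1/eps) *\<^sub>R x)) f ub (v eps) (G eps) (w eps) (P eps)"
 obtains v0 G0 w0 P0 where "is_sol mean f ub v0 G0 w0 P0" "!!x. x \<notin> \<Omega> ==> P0 x = 0"
  "((%t. N2 (%x. Ut w0 P0 t x - ub x)) \<longlongrightarrow> 0) (at_right 0)"
  "((%eps. N2 (%z. v eps z - v0 z)) \<longlongrightarrow> 0) (at_right 0)"
  "!!\<psi>. sq \<psi> ==> ((%eps. \<integral>z. G eps z \<bullet> \<psi> z \<partial>lborel) \<longlongrightarrow> (LBINT z. G0 z \<bullet> \<psi> z)) (at_right 0)"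
proof -
 define \<beta> where "\<beta> eps x = (1 + d * ind (A eps) x) * bt x ((1/eps) *\<^sub>R x)" for eps x
 have S: "is_sol (\<beta> eps) f ub (v eps) (G eps) (w eps) (P eps)" if "0 < eps" for eps using S[OF that] by (simp add: \<beta>_def[abs_def])
 have coef: "coef (\<beta> eps) c ((1 + d) * C)" for eps unfolding \<beta>_def[abs_def] by (rule coef_oscillation[OF A(1) d])
 \<comment> \<open>The upper bound is widened to (1 + d) C so that the mean and \<beta> share their
   bounds, as \<open>comparison\<close> requires.\<close>
 have cm: "coef mean c ((1 + d) * C)"
 proof -
  have "C <= (1 + d) * C" using mult_right_mono[of 1 "1 + d" C] C_pos d by simp
  then show ?thesis unfolding coef_def using c_pos mean_borel mean_bounds by (blast intro: order_trans)
 qed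
 have H: "H1 (v eps) (G eps)" if "0 < eps" for eps using S[OF that] by (simp add: is_sol_def)
 define K where "K = (T * sqrt (N2 f) + sqrt T * sqrt (N2 ub)) / c"
 \<comment> \<open>A common bound for the squared norms of solutions and gradients, independent of
   epsilon.\<close>
 define R where "R = K^2 + (sqrt (N2 f) * K + N2 ub / (2 * c)) + 1"
 have K0: "0 <= K" unfolding K_def using T_pos c_pos by simp
 have bR: "N2 (v eps) <= R" "N2 (G eps) <= R" if e: "0 < eps" for eps
 proof -
  have 1: "sqrt (N2 (v eps)) <= K" unfolding K_def by (rule estimate_v[OF S[OF e] coef f ub(1)])
  have 2: "N2 (v eps) <= K^2" using power_mono[OF 1, of 2] by simp
  have 3: "N2 (G eps) <= sqrt (N2 f) * K + N2 ub / (2 * c)" using estimate_gradient[OF S[OF e] coef f ub(1)] mult_left_mono[OF 1, of "sqrt (N2 f)"] by simp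
  show "N2 (v eps) <= R" using 2 order_trans[OF N2_nonneg 3] unfolding R_def by simp
  show "N2 (G eps) <= R" using 3 zero_le_power2[of K] unfolding R_def by linarith
 qed
 \<comment> \<open>Stated for arbitrary bounded families in \<open>H1\<close>, since it is applied
   both to the solutions and to their differences from the limit.\<close>
 have osc: "((%eps. \<integral>z. (\<beta> eps (fst z) - mean (fst z)) * (p z * zt eps z) \<partial>lborel) \<longlongrightarrow> 0) (at_right 0)"
  if p: "sq p" and zt: "!!eps. 0 < eps ==> H1 (zt eps) (Y eps)" "!!eps. 0 < eps ==> N2 (zt eps) <= R'" "!!eps. 0 < eps ==> N2 (Y eps) <= R'" for p zt Y R'
 proof (rule tendstoI)
  fix e :: real assume e: "0 < e"
  have "0 <= R'" using order_trans[OF N2_nonneg zt(2)[of 1]] by simp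
  then have "0 < R' + 1" "0 < e / 2" using e by auto
  from unif0D[OF unif0_oscillation[OF A A0 p, of d] this]
  obtain eps0 where eps0: "0 < eps0" "!!eps zt G. 0 < eps ==> eps < eps0 ==> H1 zt G ==> N2 zt <= R' + 1 ==> N2 G <= R' + 1 ==>
   \<bar>\<integral>z. ((1 + d * ind (A eps) (fst z)) * bt (fst z) ((1/eps) *\<^sub>R fst z) - mean (fst z)) * (p z * zt z) \<partial>lborel\<bar> <= e / 2" by blast
  have "\<forall>\<^sub>F eps in at_right 0. eps \<in> {0<..<eps0}" by (rule eventually_at_right_real[OF eps0(1)])
  then show "\<forall>\<^sub>F eps in at_right 0. dist (LBINT z. (\<beta> eps (fst z) - mean (fst z)) * (p z * zt eps z)) 0 < e"
  proof eventually_elim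
   case (elim eps)
   then have "0 < eps" "eps < eps0" by auto
   from eps0(2)[OF this zt(1)[OF this(1)]] zt(2,3)[OF this(1)] show ?case using e unfolding \<beta>_def by (simp add: dist_real_def)
  qed
 qed
 define epss where "epss n = inverse (real (Suc n))" for n
 have epss: "0 < epss n" for n by (simp add: epss_def)
 have epss0: "epss ~~> 0" unfolding epss_def[abs_def] by (rule LIMSEQ_inverse_real_of_nat)
 have epsslim: "filterlim epss (at_right 0) sequentially" by (rule tendsto_imp_filterlim_at_right[OF epss0]) (simp add: epss)
 have oscs: "(%n. \<integral>z. (\<beta> (epss n) (fst z) - mean (fst z)) * (p z * v (epss n) z) \<partial>lborel) ~~> 0" if "sq p" for p by (rule filterlim_compose[OF osc[OF that H bR] epsslim])
 obtain v0 G0 w0 P1 where L: "H1 v0 G0" "wloc w0" "sq P1" "time_rep (%z. mean (fst z) * v0 z) w0 P1"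
  "!!\<phi> G\<phi> t0. H1 \<phi> G\<phi> ==> 0 < t0 ==> \<forall>z. snd z < t0 --> \<phi> z = 0 ==>
    (LBINT z. w0 z * \<phi> z) + (LBINT z. G0 z \<bullet> G\<phi> z) = (LBINT z. f z * \<phi> z)"
  "!!\<Phi> G\<Phi>. H1 \<Phi> G\<Phi> ==> (LBINT z. mean (fst z) * v0 z * \<Phi> z) + (LBINT z. G0 z \<bullet> tint G\<Phi> z) =
    (LBINT z. f z * tint \<Phi> z) + (LBINT x. ub x * tI \<Phi> x)" by (rule limit_solution[OF S[OF epss] coef cm f ub(1) oscs]) (assumption, rule that)
 define P0 where "P0 x = ind \<Omega> x * P1 x" for x
 have sP: "sq P0" unfolding P0_def[abs_def] by (rule sq_indicator_mult[OF L(3) \<Omega>_borel])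
 have P0: "P0 x = 0" if "x \<notin> \<Omega>" for x using that by (simp add: P0_def)
 have rep: "time_rep (%z. mean (fst z) * v0 z) w0 P0" using L(4) unfolding time_rep_def by eventually_elim (auto simp: P0_def mem_Times_iff)
 have init: "((%t. N2 (%x. Ut w0 P0 t x - ub x)) \<longlongrightarrow> 0) (at_right 0)" by (rule initial_value[OF L(1,2) sP P0 rep cm f ub L(5,6)])
 have S0: "is_sol mean f ub v0 G0 w0 P0" unfolding is_sol_def
 proof (intro conjI allI impI)
  show "\<exists>tk. (\<forall>k::nat. 0 < tk k) & tk ~~> 0 & (%k. N2 (%x. Ut w0 P0 (tk k) x - ub x)) ~~> 0" using epss epss0 filterlim_compose[OF init epsslim] by blast
 qed (rule L(1) L(2) sP rep L(5); assumption)+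
 define Z where "Z eps z = v eps z - v0 z" for eps z
 define Y where "Y eps z = G eps z - G0 z" for eps z
 define R' where "R' = 2 * R + 2 * N2 v0 + 2 * N2 G0"
 have HZ: "H1 (Z eps) (Y eps)" if "0 < eps" for eps unfolding Z_def[abs_def] Y_def[abs_def] by (rule H1_diff[OF H[OF that] L(1)])
 have ZR: "N2 (Z eps) <= R'" "N2 (Y eps) <= R'" if "0 < eps" for eps using N2_diff_le[OF H1_sq(1)[OF H[OF that]] H1_sq(1)[OF L(1)]] N2_diff_le[OF H1_sq(2)[OF H[OF that]] H1_sq(2)[OF L(1)]]
   bR[OF that] N2_nonneg[of v0] N2_nonneg[of G0] unfolding R'_def Z_def[abs_def] Y_def[abs_def] by linarith+
 have oZ: "((%eps. \<integral>z. (\<beta> eps (fst z) - mean (fst z)) * (v0 z * Z eps z) \<partial>lborel) \<longlongrightarrow> 0) (at_right 0)" by (rule osc[OF H1_sq(1)[OF L(1)] HZ ZR])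
 have lim0: "((%eps. - (LBINT z. (\<beta> eps (fst z) - mean (fst z)) * (v0 z * Z eps z)) / c) \<longlongrightarrow> 0) (at_right 0)" using tendsto_divide[OF tendsto_minus[OF oZ] tendsto_const[of c]] c_pos by simp
 have le: "N2 (Z eps) <= - (LBINT z. (\<beta> eps (fst z) - mean (fst z)) * (v0 z * Z eps z)) / c" if "0 < eps" for eps
 proof -
  have "c * N2 (Z eps) <= (LBINT z. \<beta> eps (fst z) * (Z eps z)^2)" by (rule coef_N2_le[OF coef H1_sq(1)[OF HZ[OF that]]])
  also have "... <= (LBINT z. (mean (fst z) - \<beta> eps (fst z)) * v0 z * Z eps z)" using comparison[OF S[OF that] S0 coef cm f ub(1)] unfolding Z_def .
  also have "... = (LBINT z. - ((\<beta> eps (fst z) - mean (fst z)) * (v0 z * Z eps z)))" by (rule integral_cong[OF refl]) (simp add: algebra_simps)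
  also have "... = - (LBINT z. (\<beta> eps (fst z) - mean (fst z)) * (v0 z * Z eps z))" by (rule integral_minus)
  finally show ?thesis unfolding pos_le_divide_eq[OF c_pos] mult.commute[of "N2 (Z eps)" c] .
 qed
 have Zlim: "((%eps. N2 (Z eps)) \<longlongrightarrow> 0) (at_right 0)" by (rule tendsto_sandwich[OF _ _ tendsto_const lim0])
   (use eventually_at_right_less[of "0::real"] le in \<open>auto elim: eventually_mono\<close>)
 have Glim: "((%eps. \<integral>z. G eps z \<bullet> \<psi> z \<partial>lborel) \<longlongrightarrow> (LBINT z. G0 z \<bullet> \<psi> z)) (at_right 0)" if \<psi>: "sq \<psi>" for \<psi>
 proof -
  have "((%eps. \<Sum>i\<in>UNIV. \<integral>z. (Y eps z $ i) * (\<psi> z $ i) \<partial>lborel) \<longlongrightarrow> (\<Sum>i\<in>(UNIV :: 'n set). 0)) (at_right 0)" by (intro tendsto_sum weak_gradient_LIMIT[OF HZ Zlim ZR(2) sq_component[OF \<psi>]])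
  then have s: "((%eps. (\<Sum>i\<in>UNIV. \<integral>z. (Y eps z $ i) * (\<psi> z $ i) \<partial>lborel) + (LBINT z. G0 z \<bullet> \<psi> z)) \<longlongrightarrow> 0 + (LBINT z. G0 z \<bullet> \<psi> z)) (at_right 0)" by (intro tendsto_add tendsto_const) simp
  have "(\<Sum>i\<in>UNIV. \<integral>z. (Y eps z $ i) * (\<psi> z $ i) \<partial>lborel) + (LBINT z. G0 z \<bullet> \<psi> z) = (LBINT z. G eps z \<bullet> \<psi> z)" if e: "0 < eps" for eps
  proof -
   have "(\<Sum>i\<in>UNIV. \<integral>z. (Y eps z $ i) * (\<psi> z $ i) \<partial>lborel) = (LBINT z. (\<Sum>i\<in>UNIV. (Y eps z $ i) * (\<psi> z $ i)))" by (rule integral_sum[symmetric])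
     (rule sq_integrable_mult[OF sq_component[OF H1_sq(2)[OF HZ[OF e]]] sq_component[OF \<psi>]])
   also have "... = (LBINT z. G eps z \<bullet> \<psi> z - G0 z \<bullet> \<psi> z)" by (rule integral_cong[OF refl]) (simp add: Y_def inner_vec_def left_diff_distrib sum_subtractf)
   also have "... = (LBINT z. G eps z \<bullet> \<psi> z) - (LBINT z. G0 z \<bullet> \<psi> z)" by (rule integral_diff[OF sq_integrable_inner[OF H1_sq(2)[OF H[OF e]] \<psi>] sq_integrable_inner[OF H1_sq(2)[OF L(1)] \<psi>]])
   finally show ?thesis by simp
  qed
  then have "\<forall>\<^sub>F eps in at_right 0. (\<Sum>i\<in>UNIV. \<integral>z. (Y eps z $ i) * (\<psi> z $ i) \<partial>lborel) + (LBINT z. G0 z \<bullet> \<psi> z) = (LBINT z. G eps z \<bullet> \<psi> z)" using eventually_at_right_less[of "0::real"] by (auto elim: eventually_mono)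
  from Lim_transform_eventually[OF s this] show ?thesis by simp
 qed
 show thesis by (rule that[OF S0 P0 init Zlim[unfolded Z_def] Glim])
qed

end

theorem mainTheorem13:
  fixes \<Omega> :: "(real^'n::finite) set" and T \<delta> :: real
    and B :: "(real^'n) set" and \<eta> :: "real \<Rightarrow> real"
    and b :: "real^'n \<Rightarrow> real^'n \<Rightarrow> real"
    and f :: "(real^'n) \<times> real \<Rightarrow> real" and ubar :: "real^'n \<Rightarrow> real"
    and u :: "real \<Rightarrow> (real^'n) \<times> real \<Rightarrow> real"
  assumes n2: "CARD('n) \<ge> 2"
    and dom: "smooth_domain \<Omega>" and T: "T > 0"
    and B: "open B" "connected B" "B \<noteq> {}" "smooth_domain B" "closure B \<subseteq> Ycell"
    and eta: "\<forall>\<epsilon>>0. 0 < \<eta> \<epsilon> \<and> \<eta> \<epsilon> \<le> 1" "(\<eta> \<longlongrightarrow> 0) (at_right 0)"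
    and dom2: "\<forall>\<epsilon>>0. smooth_domain (Omega2 \<Omega> B (\<eta> \<epsilon>) \<epsilon>)"
    and b: "admissible_coeff \<Omega> b"
    and f: "L2 (OmT \<Omega> T) f" and ubar: "L2 \<Omega> ubar"
    and delta: "0 < \<delta>" "\<delta> \<le> 1"
    and u: "\<forall>\<epsilon>>0. weak_sol \<Omega> T (\<lambda>_. 1) (b_eps_delta b \<Omega> B (\<eta> \<epsilon>) \<epsilon> \<delta>) f ubar (u \<epsilon>)"
  shows "\<exists>v0. weak_sol \<Omega> T (MY_inv b) (\<lambda>_. 1) f (\<lambda>x. ubar x / MY_inv b x) v0 \<and>
      (\<forall>v. weak_sol \<Omega> T (MY_inv b) (\<lambda>_. 1) f (\<lambda>x. ubar x / MY_inv b x) v \<longrightarrow>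
           (AE z in lebesgue. z \<in> OmT \<Omega> T \<longrightarrow> v z = v0 z)) \<and>
      ((\<lambda>\<epsilon>. set_lebesgue_integral lebesgue (OmT \<Omega> T)
           (\<lambda>z. (b_eps_delta b \<Omega> B (\<eta> \<epsilon>) \<epsilon> \<delta> (fst z) * u \<epsilon> z - v0 z)^2)) \<longlongrightarrow> 0) (at_right 0) \<and>
      (\<forall>G G0. (\<forall>\<epsilon>>0. spatial_grad \<Omega> T (\<lambda>z. b_eps_delta b \<Omega> B (\<eta> \<epsilon>) \<epsilon> \<delta> (fst z) * u \<epsilon> z) (G \<epsilon>)) \<and>
              spatial_grad \<Omega> T v0 G0 \<longrightarrow>
         (\<forall>\<psi>. L2v (OmT \<Omega> T) \<psi> \<longrightarrow>
            ((\<lambda>\<epsilon>. set_lebesgue_integral lebesgue (OmT \<Omega> T) (\<lambda>z. G \<epsilon> z \<bullet> \<psi> z)) \<longlongrightarrow>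
               set_lebesgue_integral lebesgue (OmT \<Omega> T) (\<lambda>z. G0 z \<bullet> \<psi> z)) (at_right 0)))"
proof -
 have \<Omega>: "open \<Omega>" "bounded \<Omega>" using dom by (auto simp: smooth_domain_def)
 interpret cylinder \<Omega> T using \<Omega> T by unfold_locales
 obtain bt c C where bt: "oscillating bt c C" "AE x in lborel. x \<in> \<Omega> --> (\<forall>y. 0 < b x y & bt x y = 1 / b x y)" by (rule admissible_oscillating[OF b \<Omega>_borel])
 interpret oscillating bt c C by (rule bt(1))
 interpret oscillating_cylinder \<Omega> T bt c C by unfold_locales
 \<comment> \<open>On the inclusions 1/(\<delta> b) = (1 + d)/b.\<close>
 define d where "d = 1 / \<delta> - 1"
 have d: "0 <= d" "(1 + d) * \<delta> = 1" using delta by (auto simp: d_def)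
 \<comment> \<open>The empty set for epsilon <= 0 makes A Borel and bounded for every real
   epsilon.\<close>
 define A where "A eps = (if 0 < eps then Omega1 \<Omega> B (\<eta> eps) eps else {})" for eps
 have BY: "B \<subseteq> Ycell" using B(5) closure_subset by blast
 have \<eta>p: "0 < \<eta> eps" if "0 < eps" for eps using eta(1) that by blast
 have Ab: "A eps \<in> sets borel" "bounded (A eps)" for eps using Omega1_open[OF B(1) \<eta>p] measure_Omega1(2)[OF \<Omega> B(1) BY \<eta>p] by (auto simp: A_def)
 have Af: "emeasure lborel (A eps \<inter> \<Omega>) < \<infinity>" for eps by (rule emeasure_bounded[OF bounded_subset[OF \<Omega>(2)]]) simp
 have A0: "((%eps. measure lborel (A eps \<inter> \<Omega>)) \<longlongrightarrow> 0) (at_right 0)"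
 proof (rule tendsto_sandwich[OF _ _ tendsto_const])
  have "((%eps. \<eta> eps ^ CARD('n) * measure lborel \<Omega>) \<longlongrightarrow> 0 ^ CARD('n) * measure lborel \<Omega>) (at_right 0)" by (intro tendsto_mult tendsto_power eta(2) tendsto_const)
  then show "((%eps. \<eta> eps ^ CARD('n) * measure lborel \<Omega>) \<longlongrightarrow> 0) (at_right 0)" by (simp add: zero_power)
  show "\<forall>\<^sub>F eps in at_right 0. measure lborel (A eps \<inter> \<Omega>) <= \<eta> eps ^ CARD('n) * measure lborel \<Omega>" using eventually_at_right_less[of "0::real"]
  proof eventually_elim
   case (elim eps)
   have "measure lborel (A eps \<inter> \<Omega>) <= measure lborel (A eps)" using Ab[of eps] emeasure_bounded[OF Ab(2)[of eps]] by (intro measure_mono_fmeasurable fmeasurableI) auto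
   also have "... <= \<eta> eps ^ CARD('n) * measure lborel \<Omega>" using measure_Omega1(1)[OF \<Omega> B(1) BY \<eta>p[OF elim] elim] elim by (simp add: A_def)
   finally show ?case .
  qed
 qed simp
 obtain f1 where f1: "sq f1" "!!z. z \<notin> D ==> f1 z = 0" "AE z in lborel. z \<in> D --> f z = f1 z" by (rule L2v_rep[OF D_borel f[unfolded L2_eq_L2v]]) (rule that; assumption)
 obtain ub where ub: "sq ub" "!!x. x \<notin> \<Omega> ==> ub x = 0" "AE x in lborel. x \<in> \<Omega> --> ubar x = ub x" by (rule L2v_rep[OF \<Omega>_borel ubar[unfolded L2_eq_L2v]]) (rule that; assumption)
 have of1: "off f1" by (rule offI) (rule f1(2))
 define \<beta> where "\<beta> eps x = (1 + d * ind (A eps) x) * bt x ((1/eps) *\<^sub>R x)" for eps x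
 have coef: "coef (\<beta> eps) c ((1 + d) * C)" for eps unfolding \<beta>_def[abs_def] by (rule coef_oscillation[OF Ab(1) d(1)])
 have cm: "coef mean c C" unfolding coef_def using c_pos mean_borel mean_bounds by blast
 let ?a = "%eps. b_eps_delta b \<Omega> B (\<eta> eps) eps \<delta>"
 \<comment> \<open>The four components are packed into one tuple so that a single choice over
   epsilon yields them together.\<close>
 have "\<exists>q. is_sol (\<beta> eps) f1 ub (fst q) (fst (snd q)) (fst (snd (snd q))) (snd (snd (snd q))) &
   (AE z in lborel. z \<in> D --> ?a eps (fst z) * u eps z = fst q z)" if e: "0 < eps" for eps
 proof -
  have c1: "coef (%x::real^'n. 1) 1 1" by (simp add: coef_def)
  have a: "AE x in lborel. x \<in> \<Omega> --> 1 = (1::real) & \<beta> eps x * ?a eps x = 1" using bt(2)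
  proof eventually_elim
   case (elim x)
   show ?case
   proof
    assume "x \<in> \<Omega>"
    with elim have "0 < b x ((1/eps) *\<^sub>R x)" "bt x ((1/eps) *\<^sub>R x) = 1 / b x ((1/eps) *\<^sub>R x)" by blast+
    then show "1 = (1::real) & \<beta> eps x * ?a eps x = 1" using d(2) e by (simp add: \<beta>_def A_def b_eps_delta_def b_eps_def)
   qed
  qed
  have "AE x in lborel. x \<in> \<Omega> --> 1 * ubar x = ub x" using ub(3) by simp
  from weak_sol_is_sol[OF u[rule_format, OF e] coef[of eps] c1 a f1(1) of1 f1(3) ub(1,2) this]
  obtain v G w P where "is_sol (\<beta> eps) f1 ub v G w P" "AE z in lborel. z \<in> D --> ?a eps (fst z) * u eps z = v z" by blast
  then show ?thesis by (intro exI[of _ "(v, G, w, P)"]) simp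
 qed
 then have "\<forall>eps. \<exists>q. 0 < eps --> is_sol (\<beta> eps) f1 ub (fst q) (fst (snd q)) (fst (snd (snd q))) (snd (snd (snd q))) &
   (AE z in lborel. z \<in> D --> ?a eps (fst z) * u eps z = fst q z)" by blast
 from choice[OF this] obtain q where "\<forall>eps. 0 < eps --> is_sol (\<beta> eps) f1 ub (fst (q eps)) (fst (snd (q eps))) (fst (snd (snd (q eps)))) (snd (snd (snd (q eps)))) &
   (AE z in lborel. z \<in> D --> ?a eps (fst z) * u eps z = fst (q eps) z)" by (elim exE)
 then have S': "!!eps. 0 < eps ==> is_sol (\<beta> eps) f1 ub (fst (q eps)) (fst (snd (q eps))) (fst (snd (snd (q eps)))) (snd (snd (snd (q eps))))"
  and v: "!!eps. 0 < eps ==> AE z in lborel. z \<in> D --> ?a eps (fst z) * u eps z = fst (q eps) z" by blast+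
 obtain v1 G1 w1 P1 where L: "is_sol mean f1 ub v1 G1 w1 P1" "!!x. x \<notin> \<Omega> ==> P1 x = 0"
  "((%t. N2 (%x. Ut w1 P1 t x - ub x)) \<longlongrightarrow> 0) (at_right 0)"
  "((%eps. N2 (%z. fst (q eps) z - v1 z)) \<longlongrightarrow> 0) (at_right 0)"
  "!!\<psi>. sq \<psi> ==> ((%eps. \<integral>z. fst (snd (q eps)) z \<bullet> \<psi> z \<partial>lborel) \<longlongrightarrow> (LBINT z. G1 z \<bullet> \<psi> z)) (at_right 0)" by (rule convergence[OF Ab(1) Af A0 d(1) f1(1) ub(1,2) S'[unfolded \<beta>_def[abs_def]]]) (assumption, assumption, rule that, assumption+)
 have HL: "H1 v1 G1" using L(1) by (simp add: is_sol_def)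
 have Hq: "H1 (fst (q eps)) (fst (snd (q eps)))" if "0 < eps" for eps using S'[OF that] by (simp add: is_sol_def)
 have M: "AE x in lborel. x \<in> \<Omega> --> MY_inv b x = mean x" using bt(2)
 proof eventually_elim
  case (elim x)
  then show ?case using MY_inv_eq_mean[of x b] by blast
 qed
 have u0: "AE x in lborel. x \<in> \<Omega> --> mean x * (ubar x / MY_inv b x) = ub x" using M ub(3)
 proof eventually_elim
  case (elim x)
  then show ?case using coefD(6)[OF cm, of x] by auto
 qed
 obtain v0 where v0: "weak_sol \<Omega> T (MY_inv b) (%_. 1) f (%x. ubar x / MY_inv b x) v0" "AE z in lborel. z \<in> D --> v0 z = v1 z"
 proof (rule is_sol_weak_sol[OF HL _ _ L(2) _ cm f1(1,3) ub(1,2) _ L(3) M u0])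
  show "wloc w1" "sq P1" "time_rep (%z. mean (fst z) * v1 z) w1 P1" using L(1) by (auto simp: is_sol_def)
  show "(LBINT z. w1 z * \<phi> z) + (LBINT z. G1 z \<bullet> G\<phi> z) = (LBINT z. f1 z * \<phi> z)"
   if "H1 \<phi> G\<phi>" "0 < t0" "\<forall>z. snd z < t0 --> \<phi> z = 0" for \<phi> G\<phi> t0 using L(1) that unfolding is_sol_def by blast
 qed (assumption, assumption, rule that)
 show ?thesis
 proof (intro exI[of _ v0] conjI allI impI)
  show "weak_sol \<Omega> T (MY_inv b) (%_. 1) f (%x. ubar x / MY_inv b x) v0" by (rule v0(1))
 next
  fix v assume W: "weak_sol \<Omega> T (MY_inv b) (%_. 1) f (%x. ubar x / MY_inv b x) v"
  have "AE x in lborel. x \<in> \<Omega> --> MY_inv b x = mean x & mean x * 1 = mean x" using M by simp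
  from weak_sol_is_sol[OF W cm cm this f1(1) of1 f1(3) ub(1,2) u0]
  obtain v2 G2 w2 P2 where "is_sol mean f1 ub v2 G2 w2 P2" and v2: "AE z in lborel. z \<in> D --> 1 * v z = v2 z" by blast
  from is_sol_unique[OF this(1) L(1) cm f1(1) ub(1)] have "AE z in lborel. v2 z = v1 z" .
  then have "AE z in lborel. z \<in> D --> v z = v0 z" using v2 v0(2) by eventually_elim simp
  then show "AE z in lebesgue. z \<in> D --> v z = v0 z" by (rule AE_completion)
 next
  have "N2 (%z. fst (q eps) z - v1 z) = sint D (%z. (?a eps (fst z) * u eps z - v0 z)^2)" if e: "0 < eps" for eps
  proof -
   have s: "sq (%z. fst (q eps) z - v1 z)" by (rule sq_diff[OF H1_sq(1)[OF Hq[OF e]] H1_sq(1)[OF HL]])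
   have "sint D (%z. (norm (?a eps (fst z) * u eps z - v0 z))^2) = N2 (%z. fst (q eps) z - v1 z)"
   proof (rule L2v_integral(2)[OF D_borel sq_measurable[OF s]])
    show "AE z in lborel. z \<in> D --> ?a eps (fst z) * u eps z - v0 z = fst (q eps) z - v1 z" using v[OF e] v0(2) by eventually_elim simp
   qed (simp add: H1_outside[OF Hq[OF e]] H1_outside[OF HL] del: mem_Sigma_iff)
   then show ?thesis by simp
  qed
  then have "\<forall>\<^sub>F eps in at_right 0. N2 (%z. fst (q eps) z - v1 z) = sint D (%z. (?a eps (fst z) * u eps z - v0 z)^2)" by (rule eventually_mono[OF eventually_at_right_less[of "0::real"]])
  then show "((%eps. sint D (%z. (?a eps (fst z) * u eps z - v0 z)^2)) \<longlongrightarrow> 0) (at_right 0)" by (rule Lim_transform_eventually[OF L(4)])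
 next
  fix G :: "real => (real^'n) \<times> real => real^'n" and G0 \<psi> :: "(real^'n) \<times> real => real^'n"
  assume gr: "(\<forall>eps>0. spatial_grad \<Omega> T (%z. ?a eps (fst z) * u eps z) (G eps)) & spatial_grad \<Omega> T v0 G0" and \<psi>: "L2v D \<psi>"
  obtain \<psi>1 where \<psi>1: "sq \<psi>1" "!!z. z \<notin> D ==> \<psi>1 z = 0" "AE z in lborel. z \<in> D --> \<psi> z = \<psi>1 z" by (rule L2v_rep[OF D_borel \<psi>]) (rule that; assumption)
  \<comment> \<open>The gradients in the statement are arbitrary weak gradients; by uniqueness they
    agree almost everywhere with the constructed ones.\<close>
  have gi: "(LBINT z. F z \<bullet> \<psi>1 z) = sint D (%z. G' z \<bullet> \<psi> z)"
   if sg: "spatial_grad \<Omega> T g G'" and H: "H1 h F" and ae: "AE z in lborel. z \<in> D --> g z = h z" for g G' h F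
  proof -
   obtain g2 F2 where g2: "H1 g2 F2" "AE z in lborel. z \<in> D --> g z = g2 z" "AE z in lborel. z \<in> D --> G' z = F2 z" by (rule spatial_grad_H1[OF sg])
   have "AE z in lborel. g2 z = h z" using ae g2(2)
   proof eventually_elim
    case (elim z)
    then show ?case using H1_outside(1)[OF g2(1), of z] H1_outside(1)[OF H, of z] by (cases "z \<in> D") (simp_all del: mem_Sigma_iff)
   qed
   note F2 = H1_gradient_unique[OF g2(1) H this]
   show ?thesis
   proof (rule set_integral_borel(1)[OF D_borel, symmetric])
    show "(%z. F z \<bullet> \<psi>1 z) \<in> borelm" by (rule borel_measurable_inner[OF sq_measurable[OF H1_sq(2)[OF H]] sq_measurable[OF \<psi>1(1)]])
    show "AE z in lborel. z \<in> D --> G' z \<bullet> \<psi> z = F z \<bullet> \<psi>1 z" using g2(3) F2 \<psi>1(3) by eventually_elim simp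
   qed (simp add: \<psi>1(2) del: mem_Sigma_iff)
  qed
  have "\<forall>\<^sub>F eps in at_right 0. (LBINT z. fst (snd (q eps)) z \<bullet> \<psi>1 z) = sint D (%z. G eps z \<bullet> \<psi> z)" using eventually_at_right_less[of "0::real"]
  proof eventually_elim
   case (elim eps)
   show ?case by (rule gi[OF conjunct1[OF gr, rule_format, OF elim] Hq[OF elim] v[OF elim]])
  qed
  from Lim_transform_eventually[OF L(5)[OF \<psi>1(1)] this]
  show "((%eps. sint D (%z. G eps z \<bullet> \<psi> z)) \<longlongrightarrow> sint D (%z. G0 z \<bullet> \<psi> z)) (at_right 0)" unfolding gi[OF conjunct2[OF gr] HL v0(2)] .
 qed
qed

end
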